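(* Let $f:X\to X$ be a homeomorphism of a compact metric space preserving a probability measure $\mu$ of full support. Let $A_{\theta,s}\in C^0(X,\mathrm{SL}(2,\mathbb{R}))$, $\theta\in\mathbb{R}/\mathbb{Z}$, $s$ a one-dimensional real parameter (in an open interval), be monotonic in $\theta$ and $C^{2r+1+\epsilon}$ (with $r$ an integer, $1\le r<\infty$, and $\epsilon>0$), respectively $C^\infty$, respectively $C^\omega$, in $(\theta,s)$. Then $$s\mapsto\int_{\mathbb{R}/\mathbb{Z}}L(A_{\theta,s})\,d\theta$$ is $C^r$, respectively $C^\infty$, respectively $C^\omega$.
   Context: For $A\in C^0(X,\mathrm{SL}(2,\mathbb{R}))$ put $A_n(x)=A(f^{n-1}(x))\cdots A(x)$, $n\ge1$, and $L(A)=\lim_{n\to\infty}\frac1n\int_X\ln\|A_n(x)\|\,d\mu(x)$. The family is $C^k$ in $(\theta,s)$ if there is a fixed compact set of $C^k$ functions of $(\theta,s)$ with values in $\mathrm{SL}(2,\mathbb{R})$ (compact-open topology) containing $(\theta,s)\mapsto A_{\theta,s}(x)$ for every $x\in X$. $C^\omega$ means real-analytic. A continuous real function $g$ on an interval is $\epsilon_0$-monotonic if $|g(t')-g(t)|/|t'-t|\ge\epsilon_0$ for all $t\ne t'$; the notion extends to functions on or into $\mathbb{R}/\mathbb{Z}$ via lifts and into the unit circle via $x\mapsto e^{2\pi i x}$. A family $A_\theta\in C^0(X,\mathrm{SL}(2,\mathbb{R}))$ is $\epsilon_0$-monotonic (increasing or decreasing) if for every $x\in X$ and every $w\in\mathbb{R}^2\setminus\{0\}$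 the function $\theta\mapsto A_\theta(x)w/\|A_\theta(x)w\|$ is $\epsilon_0$-monotonic (increasing for all $x,w$, or decreasing for all $x,w$); it is monotonic if it is $\epsilon_0$-monotonic for some $\epsilon_0>0$. "$A_{\theta,s}$ monotonic in $\theta$" means that $\theta\mapsto A_{\theta,s}$ is monotonic for each $s$. *)

theory Defs
  imports "HOL-Probability.Probability"
begin

definition SL2 :: "(real^2^2) set" where
  "SL2 = {M. det M = 1}"


subsection \<open>Cocycles and the Lyapunov exponent\<close>

primrec cocycle :: "('x \<Rightarrow> 'x) \<Rightarrow> ('x \<Rightarrow> real^2^2) \<Rightarrow> nat \<Rightarrow> 'x \<Rightarrow> real^2^2" where
  "cocycle f A 0 x = mat 1"
| "cocycle f A (Suc n) x = A ((f ^^ n) x) ** cocycle f A n x"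

definition lyapunov :: "('x \<Rightarrow> 'x) \<Rightarrow> 'x measure \<Rightarrow> ('x \<Rightarrow> real^2^2) \<Rightarrow> real" where
  "lyapunov f \<mu> A =
     lim (\<lambda>n. (1 / real n) * (LINT x|\<mu>. ln (onorm (\<lambda>v. cocycle f A n x *v v))))"


subsection \<open>Monotonicity\<close>

definition eps_monotonic_on :: "real set \<Rightarrow> real \<Rightarrow> (real \<Rightarrow> real) \<Rightarrow> bool" where
  "eps_monotonic_on T e g \<longleftrightarrow>
     continuous_on T g \<and> (\<forall>t\<in>T. \<forall>t'\<in>T. t \<noteq> t' \<longrightarrow> \<bar>g t' - g t\<bar> / \<bar>t' - t\<bar> \<ge> e)"

text \<open>
  Functions on \<open>\<real>/\<int>\<close> are represented by 1-periodic functions on the real line.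
  \<open>\<phi>\<close> is a lift of the circle-valued map \<open>g\<close> with respect to \<open>x \<mapsto> exp (2 \<pi> i x)\<close>; it is
  unique up to an additive integer constant.
\<close>

definition circle_lift :: "(real \<Rightarrow> real^2) \<Rightarrow> (real \<Rightarrow> real) \<Rightarrow> bool" where
  "circle_lift g \<phi> \<longleftrightarrow> continuous_on UNIV \<phi> \<and>
     (\<forall>t. g t = vector [cos (2 * pi * \<phi> t), sin (2 * pi * \<phi> t)])"

definition circle_eps_increasing :: "real \<Rightarrow> (real \<Rightarrow> real^2) \<Rightarrow> bool" where
  "circle_eps_increasing e g \<longleftrightarrow> (\<exists>\<phi>. circle_lift g \<phi> \<and> eps_monotonic_on UNIV e \<phi> \<and> mono \<phi>)"

definition circle_eps_decreasing :: "real \<Rightarrow> (real \<Rightarrow> real^2) \<Rightarrow> bool" where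
  "circle_eps_decreasing e g \<longleftrightarrow> (\<exists>\<phi>. circle_lift g \<phi> \<and> eps_monotonic_on UNIV e \<phi> \<and> antimono \<phi>)"

definition eps_monotonic_family :: "real \<Rightarrow> (real \<Rightarrow> 'x \<Rightarrow> real^2^2) \<Rightarrow> bool" where
  "eps_monotonic_family e A \<longleftrightarrow>
     (\<forall>x w. w \<noteq> 0 \<longrightarrow> circle_eps_increasing e (\<lambda>\<theta>. (A \<theta> x *v w) /\<^sub>R norm (A \<theta> x *v w))) \<or>
     (\<forall>x w. w \<noteq> 0 \<longrightarrow> circle_eps_decreasing e (\<lambda>\<theta>. (A \<theta> x *v w) /\<^sub>R norm (A \<theta> x *v w)))"

definition monotonic_family :: "(real \<Rightarrow> 'x \<Rightarrow> real^2^2) \<Rightarrow> bool" where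
  "monotonic_family A \<longleftrightarrow> (\<exists>e>0. eps_monotonic_family e A)"


subsection \<open>Regularity classes on open subsets of a Euclidean space\<close>

text \<open>
  Iterated partial derivatives along a word of basis vectors. On an open set \<open>U\<close> the values
  depend only on the restriction of the function to \<open>U\<close>.
\<close>

definition iter_deriv ::
    "'a::euclidean_space list \<Rightarrow> ('a \<Rightarrow> 'b::real_normed_vector) \<Rightarrow> 'a \<Rightarrow> 'b" where
  "iter_deriv bs F = foldr (\<lambda>b G z. frechet_derivative G (at z) b) bs F"

definition C_nat_on :: "nat \<Rightarrow> 'a::euclidean_space set \<Rightarrow> ('a \<Rightarrow> 'b::real_normed_vector) \<Rightarrow> bool" where
  "C_nat_on n U F \<longleftrightarrow>
     (\<forall>bs\<in>lists Basis. length bs < n \<longrightarrow> (\<forall>z\<in>U. iter_deriv bs F differentiable (at z))) \<and>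
     (\<forall>bs\<in>lists Basis. length bs \<le> n \<longrightarrow> continuous_on U (iter_deriv bs F))"

text \<open>
  In the next definition the diagonal terms vanish because \<open>0 / 0 = 0\<close>. For \<open>a = 0\<close> this is
  an oscillation, hence automatically finite and dominated by \<open>sup_seminorm\<close> when the derivative
  is continuous and \<open>K\<close> is compact.
\<close>

definition holder_seminorm ::
    "real \<Rightarrow> 'a::euclidean_space list \<Rightarrow> 'a set \<Rightarrow> ('a \<Rightarrow> 'b::real_normed_vector) \<Rightarrow> ennreal" where
  "holder_seminorm a bs K F =
     (SUP (y, z)\<in>K \<times> K. ennreal (norm (iter_deriv bs F y - iter_deriv bs F z) / dist y z powr a))"

definition sup_seminorm ::
    "'a::euclidean_space list \<Rightarrow> 'a set \<Rightarrow> ('a \<Rightarrow> 'b::real_normed_vector) \<Rightarrow> ennreal" where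
  "sup_seminorm bs K F = (SUP z\<in>K. ennreal (norm (iter_deriv bs F z)))"

text \<open>
  Seminorms for the usual topology of the space of real-analytic functions on \<open>U\<close> (the projective
  limit, over compact \<open>K \<subseteq> U\<close>, of the spaces of germs of analytic functions at \<open>K\<close>), where \<open>d\<close>
  ranges over the nonnegative sequences with \<open>d n powr (1/n) \<longlonglongrightarrow> 0\<close>; see Vogt, ``A fundamental
  system of seminorms for A(K)''. A set of analytic functions is bounded for them iff for each
  compact \<open>K\<close> there are \<open>C\<close>, \<open>R\<close> such that all its members satisfy
  \<open>norm (iter_deriv bs F z) \<le> C * R ^ n * fact n\<close>, \<open>n = length bs\<close>, on \<open>K\<close>, that is, iff near
  each compact set they have uniformly bounded holomorphic extensions to a common complex
  neighbourhood.
\<close>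

definition analytic_seminorm ::
    "(nat \<Rightarrow> real) \<Rightarrow> 'a::euclidean_space set \<Rightarrow> ('a \<Rightarrow> 'b::real_normed_vector) \<Rightarrow> ennreal" where
  "analytic_seminorm d K F =
     (SUP bs\<in>lists Basis. SUP z\<in>K.
        ennreal (d (length bs) * norm (iter_deriv bs F z) / fact (length bs)))"

text \<open>Convergent multivariate power series; the exponents are functions \<open>Basis \<rightarrow> nat\<close>.\<close>

definition real_analytic_on :: "'a::euclidean_space set \<Rightarrow> ('a \<Rightarrow> 'b::real_normed_vector) \<Rightarrow> bool" where
  "real_analytic_on U F \<longleftrightarrow>
     (\<forall>z0\<in>U. \<exists>\<rho>>0. \<exists>c. \<forall>z\<in>ball z0 \<rho>.
        ((\<lambda>\<alpha>. (\<Prod>b\<in>Basis. ((z - z0) \<bullet> b) ^ \<alpha> b) *\<^sub>R c \<alpha>) has_sum F z)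
          (Basis \<rightarrow>\<^sub>E (UNIV :: nat set)))"

datatype regularity = C_real real | C_inf | C_omega

text \<open>
  \<open>C\<^sup>k\<close> for real \<open>k = m + a\<close>, \<open>m = \<lfloor>k\<rfloor>\<close>, \<open>0 \<le> a < 1\<close>: all derivatives up to order \<open>m\<close> exist and are
  continuous, and those of order \<open>m\<close> are locally \<open>a\<close>-Hoelder.
\<close>

fun class_on :: "regularity \<Rightarrow> 'a::euclidean_space set \<Rightarrow> ('a \<Rightarrow> 'b::real_normed_vector) \<Rightarrow> bool" where
  "class_on (C_real k) U F \<longleftrightarrow> C_nat_on (nat \<lfloor>k\<rfloor>) U F \<and>
     (\<forall>K bs. compact K \<and> K \<subseteq> U \<and> bs \<in> lists Basis \<and> length bs = nat \<lfloor>k\<rfloor>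
        \<longrightarrow> holder_seminorm (frac k) bs K F < \<infinity>)"
| "class_on C_inf U F \<longleftrightarrow> (\<forall>n. C_nat_on n U F)"
| "class_on C_omega U F \<longleftrightarrow> real_analytic_on U F"

fun class_seminorms ::
    "regularity \<Rightarrow> 'a::euclidean_space set \<Rightarrow> (('a \<Rightarrow> 'b::real_normed_vector) \<Rightarrow> ennreal) set" where
  "class_seminorms (C_real k) U =
     {sup_seminorm bs K | bs K. compact K \<and> K \<subseteq> U \<and> bs \<in> lists Basis \<and> length bs \<le> nat \<lfloor>k\<rfloor>} \<union>
     {holder_seminorm (frac k) bs K | bs K.
        compact K \<and> K \<subseteq> U \<and> bs \<in> lists Basis \<and> length bs = nat \<lfloor>k\<rfloor>}"
| "class_seminorms C_inf U =
     {sup_seminorm bs K | bs K. compact K \<and> K \<subseteq> U \<and> bs \<in> lists Basis}"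
| "class_seminorms C_omega U =
     {analytic_seminorm d K | d K. compact K \<and> K \<subseteq> U \<and>
        (\<forall>n. 0 \<le> d n) \<and> (\<lambda>n. root n (d n)) \<longlonglongrightarrow> 0}"

text \<open>The topology on a set \<open>S\<close> of functions generated by the open balls of a family of seminorms.\<close>

definition seminorm_topology ::
    "(('a \<Rightarrow> 'b::real_normed_vector) \<Rightarrow> ennreal) set \<Rightarrow> ('a \<Rightarrow> 'b) set \<Rightarrow> ('a \<Rightarrow> 'b) topology" where
  "seminorm_topology P S =
     topology_generated_by
       {{G\<in>S. p (\<lambda>z. G z - F z) < ennreal e} | p F e. p \<in> P \<and> F \<in> S \<and> 0 < e}"


subsection \<open>Regular families of cocycles\<close>

text \<open>
  \<open>SL(2,\<real>)\<close>-valued functions of \<open>(\<theta>, s)\<close>, \<open>\<theta> \<in> \<real>/\<int>\<close>, \<open>s \<in> I\<close>. Values at \<open>s \<notin> I\<close> are irrelevant: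
  functions agreeing on \<open>UNIV \<times> I\<close> are topologically indistinguishable below.
\<close>

definition SL2_functions :: "regularity \<Rightarrow> real set \<Rightarrow> (real \<times> real \<Rightarrow> real^2^2) set" where
  "SL2_functions c I = {F. class_on c (UNIV \<times> I) F \<and>
     (\<forall>\<theta>. \<forall>s\<in>I. F (\<theta>, s) \<in> SL2 \<and> F (\<theta> + 1, s) = F (\<theta>, s))}"

definition regular_family ::
    "regularity \<Rightarrow> real set \<Rightarrow> (real \<Rightarrow> real \<Rightarrow> 'x \<Rightarrow> real^2^2) \<Rightarrow> bool" where
  "regular_family c I A \<longleftrightarrow>
     (\<exists>\<K>. compactin (seminorm_topology (class_seminorms c (UNIV \<times> I)) (SL2_functions c I)) \<K> \<and>
          (\<forall>x. (\<lambda>(\<theta>, s). A \<theta> s x) \<in> \<K>))"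

end

theory Submission
  imports Defs "HOL-Complex_Analysis.Complex_Analysis"
begin

text \<open>
  The phase \<open>th\<close> is made complex. Write \<open>A'\<close> for the derivative of \<open>A\<close> in \<open>th\<close>. Monotonicity says that
  \<open>si * area (A w) (A' w)\<close> is bounded below by a multiple of \<open>|w|^2\<close>, with a sign \<open>si\<close> that does not depend
  on \<open>w\<close> or on the point. Hence a matrix close to \<open>A + i si y A'\<close> with small \<open>y > 0\<close> preserves the cone of
  complex vectors \<open>x\<close> with \<open>Im (cnj (x 1) * x 2) \<ge> 0\<close> (\<open>good_perturbation\<close>). A product of \<open>n\<close> such matrices,
  applied to \<open>(1, i)\<close> and paired with \<open>(1, - i)\<close>, is a number \<open>D\<close> which cannot vanish, and
  \<open>(1/n) ln |D|\<close> is bounded independently of \<open>n\<close> (\<open>Dn_good\<close>). For real matrices of determinant one, \<open>|D|\<close> is the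
  operator norm of the product up to a factor two (\<open>onorm_Dn\<close>), so \<open>(1/n) ln |D|\<close> computes the Lyapunov exponent.

  If the family extends holomorphically, \<open>D\<close> is holomorphic and periodic in \<open>th\<close> and has no zeros at the
  heights \<open>0 \<le> si y \<le> 2 t\<close>. The mean of \<open>ln |D|\<close> over a horizontal circle is then affine in the height, so the
  mean on the real circle is determined by those at the heights \<open>t\<close> and \<open>2 t\<close> (\<open>mean_log_affine\<close>,
  \<open>HH_reflection\<close>). At these heights there is room to make \<open>s\<close> complex as well, in a disc of radius comparable
  to \<open>t\<close>, and bounded zero-free holomorphic functions have logarithms with controlled power series
  (\<open>log_norm_anl\<close>). All bounds are independent of \<open>n\<close>, and letting \<open>n\<close> tend to infinity settles the analytic case,
  where \<open>t\<close> can be fixed (\<open>mean_exponent_anl\<close>).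

  A family that is only differentiable is replaced by holomorphic periodic families
  at the scale \<open>1/N\<close>, which match its jets of order below \<open>K = r + 2\<close> up to an error of order \<open>N^-K\<close> within distance \<open>1/N\<close> of the
  real points (\<open>smooth_approximates_jet\<close>). They can be treated as above with \<open>t\<close> comparable to \<open>1/N\<close>. For two
  successive scales \<open>N\<close> and \<open>2 N\<close> one interpolates linearly with a complex parameter \<open>om\<close>; the cone is still
  preserved for \<open>|om|\<close> up to a multiple of \<open>N^(K-1)\<close> (\<open>mix_good\<close>), so by Cauchy's estimate in \<open>om\<close> the two means differ by
  \<open>O(N^-(r+1))\<close> on discs of radius comparable to \<open>1/N\<close> in \<open>s\<close> (\<open>HH_difference_anl\<close>). Their difference has \<open>r\<close>-th
  derivative with Hoelder-1/2 norm \<open>O(N^-(1/2))\<close>, which is summable along \<open>N = 2^j N0\<close>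
  (\<open>HH_uniformly_regular\<close>). Such Hoelder bounds survive the pointwise limits in \<open>j\<close> and then in \<open>n\<close>.

  What remains is to pass from the topologies on spaces of functions to bounds that are uniform over the base:
  a compact set is bounded for each seminorm (\<open>compactin_seminorm_bounded\<close>), and for analytic functions
  boundedness for the whole system of seminorms gives factorial bounds with common constants
  (\<open>analytic_seminorm_uniform\<close>).
\<close>

no_notation fps_nth (infixl "$" 75)

section \<open>Matrices preserving a complex cone\<close>

text \<open>For \<open>x = p + i q\<close> with real \<open>p\<close>, \<open>q\<close> this is the oriented area spanned by \<open>p\<close> and \<open>q\<close>. A real matrix multiplies it by its
determinant, so the cone where it is nonnegative is invariant under real matrices of positive determinant, and the
tilts by a monotone direction push that cone inwards.\<close>

definition crossE :: "complex^2 => real" where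
 "crossE x = Im (cnj (x $ 1) * x $ 2)"

text \<open>A functional without zeros on the cone \<open>crossE x \<ge> 0\<close>, apart from the origin: \<open>lfun x = 0\<close> forces \<open>x\<close> to be a multiple
of \<open>(1, - i)\<close>, whose area is negative.\<close>

definition lfun :: "complex^2 => complex" where
 "lfun x = x $ 1 - \<i> * x $ 2"

definition x0 :: "complex^2" where
 "x0 = vector [1, \<i>]"

definition cmat :: "real^2^2 => complex^2^2" where
 "cmat M = (\<chi> i j. complex_of_real (M $ i $ j))"

definition area :: "real^2 => real^2 => real" where
 "area v w = v $ 1 * w $ 2 - v $ 2 * w $ 1"

text \<open>The three requirements are stable under composition, which is why a product of good matrices can be handled
factor by factor.\<close>

definition good :: "real => complex^2^2 => bool" where
 "good C M \<longleftrightarrow> (ALL x. norm (M *v x) <= C * norm x & norm x <= C * norm (M *v x)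
  & (crossE x \<ge> 0 --> crossE (M *v x) \<ge> 0))"

lemma norm_vec2_sq: "(norm (x :: ('a::real_normed_vector)^2))\<^sup>2 = (norm (x$1))\<^sup>2 + (norm (x$2))\<^sup>2"
 by (simp add: norm_vec_def L2_set_def sum_2)

lemma mat2_vec: "(M *v x) $ i = M $ i $ 1 * x $ 1 + M $ i $ 2 * x $ 2"
 for M :: "'a::comm_ring_1^2^2"
 by (simp add: matrix_vector_mult_def sum_2)

lemma norm_mat_vec: "norm (M *v x) <= norm M * norm x"
 for M :: "'a::real_normed_field^2^2"
proof -
 have *: "(norm ((M *v x) $ i))\<^sup>2 <= (norm (M $ i))\<^sup>2 * (norm x)\<^sup>2" for i
 proof -
  have "norm ((M *v x) $ i) <= norm (M$i$1) * norm (x$1) + norm (M$i$2) * norm (x$2)"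
  unfolding mat2_vec by (metis norm_mult norm_triangle_ineq)
  then have "(norm ((M *v x) $ i))\<^sup>2 <= (norm (M$i$1) * norm (x$1) + norm (M$i$2) * norm (x$2))\<^sup>2"
  by (simp add: power_mono)
  also have "... <= ((norm (M$i$1))\<^sup>2 + (norm (M$i$2))\<^sup>2) * ((norm (x$1))\<^sup>2 + (norm (x$2))\<^sup>2)"
  using zero_le_power2[of "norm (M$i$1) * norm (x$2) - norm (M$i$2) * norm (x$1)"]
  by (simp add: power2_eq_square algebra_simps)
  finally show ?thesis by (simp add: norm_vec2_sq)
 qed
 have "(norm (M *v x))\<^sup>2 <= (norm M * norm x)\<^sup>2"
  using *[of 1] *[of 2] by (simp add: norm_vec2_sq[of "M *v x"] norm_vec2_sq[of M] power_mult_distrib algebra_simps)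
 then show ?thesis
  by (meson abs_ge_zero mult_nonneg_nonneg norm_ge_zero power2_le_imp_le)
qed

lemma norm_mat_vec_le: "norm M <= b ==> norm (M *v x) <= b * norm x"
 for M :: "'a::real_normed_field^2^2"
 by (meson norm_mat_vec mult_right_mono norm_ge_zero order_trans)

lemma norm_cmat [simp]: "norm (cmat M) = norm M"
proof -
 have "(norm (cmat M))\<^sup>2 = (norm M)\<^sup>2"
  by (simp add: norm_vec2_sq cmat_def)
 then show ?thesis by simp
qed

lemma cmat_add: "cmat (A + B) = cmat A + cmat B"
 by (simp add: cmat_def vec_eq_iff)

lemma norm_lfun_sq: "(norm (lfun x))\<^sup>2 = (norm x)\<^sup>2 + 2 * crossE x"
 unfolding norm_vec2_sq lfun_def crossE_def cmod_power2
 by (simp add: power2_eq_square algebra_simps)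

lemma abs_crossE: "2 * \<bar>crossE x\<bar> <= (norm x)\<^sup>2"
proof -
 have "\<bar>crossE x\<bar> <= norm (x$1) * norm (x$2)"
  unfolding crossE_def using abs_Im_le_cmod[of "cnj (x $ 1) * x $ 2"] by (simp add: norm_mult)
 moreover have "2 * (norm (x$1) * norm (x$2)) <= (norm x)\<^sup>2"
  unfolding norm_vec2_sq using zero_le_power2[of "norm (x$1) - norm (x$2)"]
  by (simp add: power2_eq_square algebra_simps)
 ultimately show ?thesis by linarith
qed

lemma lfun_ge_norm: "crossE x \<ge> 0 ==> norm x <= norm (lfun x)"
 using norm_lfun_sq[of x] by (smt (verit) norm_ge_zero power2_le_imp_le)

lemma lfun_le_norm: "norm (lfun x) <= 2 * norm x"
proof (rule power2_le_imp_le)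
 show "(norm (lfun x))\<^sup>2 <= (2 * norm x)\<^sup>2"
  using norm_lfun_sq[of x] abs_crossE[of x] by (simp add: power_mult_distrib)
qed simp

lemma crossE_add: "crossE (y + e) \<ge> crossE y - norm y * norm e - (norm e)\<^sup>2"
proof -
 have 1: "crossE (y + e) = crossE y + (Im (cnj (y $ 1) * e $ 2) + Im (cnj (e $ 1) * y $ 2)) + crossE e"
  by (simp add: crossE_def algebra_simps)
 have "\<bar>Im (cnj (y $ 1) * e $ 2) + Im (cnj (e $ 1) * y $ 2)\<bar> <= norm (y$1) * norm (e$2) + norm (e$1) * norm (y$2)"
  using abs_Im_le_cmod[of "cnj (y $ 1) * e $ 2"] abs_Im_le_cmod[of "cnj (e $ 1) * y $ 2"] by (simp add: norm_mult)
 also have "... <= norm y * norm e"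
 proof (rule power2_le_imp_le)
  show "(norm (y$1) * norm (e$2) + norm (e$1) * norm (y$2))\<^sup>2 <= (norm y * norm e)\<^sup>2"
  unfolding power_mult_distrib norm_vec2_sq
  using zero_le_power2[of "norm (y$1) * norm (e$1) - norm (y$2) * norm (e$2)"]
  by (simp add: power2_eq_square algebra_simps)
 qed simp
 finally show ?thesis using 1 abs_crossE[of e] by (smt (verit) zero_le_power2)
qed

lemma det2: "det (M :: real^2^2) = M$1$1 * M$2$2 - M$1$2 * M$2$1"
 by (rule det_2)

lemma crossE_cmat: "crossE (cmat M *v x) = det M * crossE x"
 by (simp add: crossE_def mat2_vec cmat_def det2 algebra_simps)

lemma crossE_tilt:
 fixes P A' :: "real^2^2" and x :: "complex^2" and u :: real
 defines "p \<equiv> (\<chi> i. Re (x $ i)) :: real^2" and "q \<equiv> (\<chi> i. Im (x $ i)) :: real^2"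
 shows "crossE ((\<chi> i j. complex_of_real (P $ i $ j) + \<i> * complex_of_real (u * A' $ i $ j)) *v x)
  = det P * crossE x + u * (area (P *v p) (A' *v p) + area (P *v q) (A' *v q)) + u\<^sup>2 * det A' * crossE x"
 unfolding p_def q_def area_def
 by (simp add: crossE_def mat2_vec det2 power2_eq_square algebra_simps)

lemma norm_real_imag_parts: 
 fixes x :: "complex^2"
 shows "(norm ((\<chi> i. Re (x $ i)) :: real^2))\<^sup>2 + (norm ((\<chi> i. Im (x $ i)) :: real^2))\<^sup>2 = (norm x)\<^sup>2"
 by (simp add: norm_vec2_sq cmod_power2)

lemma area_bound: "\<bar>area v w\<bar> <= norm v * norm w"
proof (rule power2_le_imp_le)
 show "\<bar>area v w\<bar>\<^sup>2 <= (norm v * norm w)\<^sup>2"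
  unfolding power_mult_distrib norm_vec2_sq area_def power2_abs real_norm_def
  using zero_le_power2[of "v$1 * w$1 + v$2 * w$2"]
  by (simp add: power2_eq_square algebra_simps)
qed simp

lemma area_add_left: "area (v + v') w = area v w + area v' w"
 by (simp add: area_def algebra_simps)

lemma det_bound: "2 * \<bar>det (M::real^2^2)\<bar> <= (norm M)\<^sup>2"
 unfolding norm_vec2_sq det2 real_norm_def power2_abs
 using zero_le_power2[of "\<bar>M$1$1\<bar> - \<bar>M$2$2\<bar>"] zero_le_power2[of "\<bar>M$1$2\<bar> - \<bar>M$2$1\<bar>"]
  abs_triangle_ineq4[of "M$1$1 * M$2$2" "M$1$2 * M$2$1"]
 by (simp add: power2_eq_square algebra_simps abs_mult)

lemma det_add_lower: "det (A + R) \<ge> det A - norm A * norm R - (norm R)\<^sup>2" for A R :: "real^2^2"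
proof -
 have 1: "det (A + R) = det A + (A$1$1 * R$2$2 - A$1$2 * R$2$1 + (R$1$1 * A$2$2 - R$1$2 * A$2$1)) + det R"
  by (simp add: det2 algebra_simps)
 have a: "\<bar>A$1$1 * R$2$2 - A$1$2 * R$2$1\<bar> <= norm (A$1) * norm (R$2)"
  "\<bar>R$1$1 * A$2$2 - R$1$2 * A$2$1\<bar> <= norm (R$1) * norm (A$2)"
  using area_bound[of "A$1" "R$2"] area_bound[of "R$1" "A$2"] by (simp_all add: area_def)
 have "norm (A$1) * norm (R$2) + norm (R$1) * norm (A$2) <= norm A * norm R"
 proof (rule power2_le_imp_le)
  show "(norm (A$1) * norm (R$2) + norm (R$1) * norm (A$2))\<^sup>2 <= (norm A * norm R)\<^sup>2"
  unfolding power_mult_distrib norm_vec2_sq[of A] norm_vec2_sq[of R]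
  using zero_le_power2[of "norm (A$1) * norm (R$1) - norm (A$2) * norm (R$2)"]
  by (simp add: power2_eq_square algebra_simps)
 qed simp
 then show ?thesis using 1 a det_bound[of R] by (smt (verit) zero_le_power2)
qed

lemma SL2_lower:
 fixes A :: "real^2^2"
 assumes "det A = 1"
 shows "norm x <= norm A * norm (cmat A *v x)"
proof -
 let ?J = "vector [vector [A$2$2, - A$1$2], vector [- A$2$1, A$1$1]] :: real^2^2"
 have "(norm ?J)\<^sup>2 = (norm A)\<^sup>2" by (simp add: norm_vec2_sq)
 then have nJ: "norm ?J = norm A" by simp
 let ?d = "complex_of_real (A$1$1) * complex_of_real (A$2$2) - complex_of_real (A$1$2) * complex_of_real (A$2$1)"
 have d: "?d = 1"
  using assms unfolding det2 by (metis of_real_1 of_real_diff of_real_mult)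
 have "(cmat ?J *v (cmat A *v x)) $ 1 = ?d * x $ 1" "(cmat ?J *v (cmat A *v x)) $ 2 = ?d * x $ 2"
  by (simp_all add: mat2_vec cmat_def algebra_simps)
 then have "cmat ?J *v (cmat A *v x) = x"
  by (simp add: vec_eq_iff forall_2 d)
 then show ?thesis
  using norm_mat_vec[of "cmat ?J" "cmat A *v x"] nJ by simp
qed
definition tilt :: "real^2^2 => real => real^2^2 => complex^2^2" where
 "tilt P u A' = (\<chi> i j. complex_of_real (P $ i $ j) + \<i> * complex_of_real (u * A' $ i $ j))"

lemma norm_tilt_vec: "norm (tilt P u A' *v x - cmat P *v x) <= \<bar>u\<bar> * norm A' * norm x"
proof -
 have "tilt P u A' *v x - cmat P *v x = (\<i> * complex_of_real u) *s (cmat A' *v x)"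
  by (simp add: vec_eq_iff mat2_vec tilt_def cmat_def algebra_simps)
 also have "norm ... = \<bar>u\<bar> * norm (cmat A' *v x)"
 proof -
  have "(norm ((\<i> * complex_of_real u) *s (cmat A' *v x)))\<^sup>2 = (\<bar>u\<bar> * norm (cmat A' *v x))\<^sup>2"
  unfolding power_mult_distrib norm_vec2_sq
  by (simp add: norm_mult power_mult_distrib algebra_simps)
  then show ?thesis by simp
 qed
 also have "... <= \<bar>u\<bar> * (norm A' * norm x)"
  using norm_mat_vec[of "cmat A'" x] by (simp add: mult_left_mono)
 finally show ?thesis by (simp add: mult.assoc)
qed

text \<open>The area of the image of \<open>x = p + i q\<close> under the tilted matrix is \<open>det * crossE x\<close> plus \<open>t\<close> times the areas of the real and
imaginary parts under the monotone direction, which are at least \<open>c t |x|^2\<close>. The remaining terms, quadratic in \<open>t\<close> or coming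
from \<open>Er\<close>, are dominated by this gain. The real perturbation \<open>R\<close> need not be of order \<open>t\<close>, since real matrices with positive
determinant preserve the cone by themselves.\<close>

lemma good_perturbation:
 fixes A A' R :: "real^2^2" and Er :: "complex^2^2"
 assumes B: "norm A <= B" "norm A' <= B" "1 <= B" and det: "det A = 1" and si: "\<bar>si\<bar> = 1"
  and mono: "!!w. si * area (A *v w) (A' *v w) \<ge> c * (norm w)\<^sup>2" and c: "0 < c" "c <= 1"
  and R: "norm R <= c / (32 * B\<^sup>2)" and t: "0 <= t" "t <= c / (32 * B\<^sup>2)"
  and Er: "norm Er <= c / (16 * B) * t"
 shows "good (4 * B) (tilt (A + R) (si * t) A' + Er)"
proof -
 define de where "de = c / (32 * B\<^sup>2)"
 have B2: "B <= B\<^sup>2" "1 <= B\<^sup>2" using B(3) mult_mono[of 1 B 1 B] mult_right_mono[of 1 B B] by (simp_all add: power2_eq_square)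
 have de: "0 < de" "de * B\<^sup>2 = c / 32"
  using c B(3) by (simp_all add: de_def)
 have deB: "de * B <= c / 32" using de mult_left_mono[OF B2(1), of de] by linarith
 have de1: "de <= c / 32" using de mult_left_mono[OF B2(2), of de] by linarith
 have R': "norm R <= de" and t': "t <= de" using R t by (simp_all add: de_def)
 have kt: "c / (16 * B) * t <= t / 16" "c / (16*B) * t \<ge> 0"
 proof -
  have "c / (16 * B) <= 1/16" using c B(3) by (simp add: field_simps)
  then show "c / (16 * B) * t <= t / 16" using t(1) mult_right_mono by fastforce
 qed (use c B(3) t in simp)
 have Er1: "norm Er <= t / 16" using Er kt by linarith
 let ?P = "A + R"
 have detP: "det ?P \<ge> 1/2"
 proof -
  have "norm A * norm R <= B * de" using B(1,3) R' by (intro mult_mono) auto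
  moreover have "(norm R)\<^sup>2 <= de\<^sup>2" using R' by (simp add: power_mono)
  moreover have "de\<^sup>2 <= 1/4" using de1 de(1) c(2) power_mono[of de "1/2" 2] by (simp add: power2_eq_square)
  ultimately show ?thesis using det_add_lower[of A R] det deB c(2) by (simp add: mult.commute)
 qed
 have monoP: "si * area (?P *v w) (A' *v w) \<ge> c/2 * (norm w)\<^sup>2" for w
 proof -
  have "\<bar>si * area (R *v w) (A' *v w)\<bar> <= norm (R *v w) * norm (A' *v w)"
  using area_bound[of "R *v w" "A' *v w"] si by (simp add: abs_mult)
  also have "... <= (de * norm w) * (B * norm w)"
  using norm_mat_vec_le[OF R'] norm_mat_vec_le[OF B(2)] de(1) by (intro mult_mono) auto
  also have "... = (de * B) * (norm w)\<^sup>2" by (simp add: power2_eq_square)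
  also have "... <= (c/32) * (norm w)\<^sup>2" using deB by (intro mult_right_mono) auto
  finally have "si * area (R *v w) (A' *v w) \<ge> - (c/32 * (norm w)\<^sup>2)" by linarith
  moreover have "si * area (?P *v w) (A' *v w) = si * area (A *v w) (A' *v w) + si * area (R *v w) (A' *v w)"
  by (simp add: matrix_vector_mult_add_rdistrib area_add_left algebra_simps)
  moreover have "c * (norm w)\<^sup>2 - c/32 * (norm w)\<^sup>2 \<ge> c/2 * (norm w)\<^sup>2"
  using c by (simp add: algebra_simps)
  ultimately show ?thesis using mono[of w] by linarith
 qed
 show ?thesis unfolding good_def
 proof (intro allI conjI impI)
  fix x
  let ?y0 = "tilt ?P (si * t) A' *v x" and ?e = "Er *v x"
  have M: "(tilt ?P (si * t) A' + Er) *v x = ?y0 + ?e"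
  by (simp add: matrix_vector_mult_add_rdistrib)
  have e: "norm ?e <= c / (16 * B) * t * norm x"
  by (rule norm_mat_vec_le[OF Er])
  have e1: "norm ?e <= t / 16 * norm x"
  by (rule norm_mat_vec_le[OF Er1])
  have d: "norm (?y0 - cmat A *v x) <= (de + t * B) * norm x"
  proof -
  have eq: "?y0 - cmat A *v x = (?y0 - cmat ?P *v x) + cmat R *v x"
  by (simp add: cmat_add matrix_vector_mult_add_rdistrib)
  have f1: "norm (?y0 - cmat ?P *v x) <= t * B * norm x"
  proof -
  have "\<bar>si * t\<bar> * norm A' * norm x <= t * B * norm x"
  using si t(1) B(2) by (intro mult_right_mono) (auto simp: abs_mult intro: mult_left_mono)
  then show ?thesis using norm_tilt_vec[of ?P "si * t" A' x] by linarith
  qed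
  have f2: "norm (cmat R *v x) <= de * norm x"
  using R' by (intro norm_mat_vec_le) simp
  show ?thesis
  using norm_triangle_ineq[of "?y0 - cmat ?P *v x" "cmat R *v x"] f1 f2 unfolding eq distrib_right by linarith
  qed
  have Ax: "norm (cmat A *v x) <= B * norm x"
  using B(1) by (intro norm_mat_vec_le) simp
  have tB: "t * B <= c/32" using mult_right_mono[OF t', of B] deB B(3) by linarith
  have small: "de + t * B <= 1/16" using de1 tB c(2) by linarith
  have dd: "norm (?y0 + ?e - cmat A *v x) <= (de + t * B + t/16) * norm x"
  proof -
  have eq: "?y0 + ?e - cmat A *v x = (?y0 - cmat A *v x) + ?e" by simp
  show ?thesis
  using d e1 norm_triangle_ineq[of "?y0 - cmat A *v x" ?e] unfolding eq distrib_right by linarith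
  qed
  have tl: "t <= 1/32" using t' de1 c(2) by linarith
  have nx: "0 <= norm x" by simp
  have "(de + t * B + t/16) * norm x <= 1/8 * norm x"
  using small tl by (intro mult_right_mono) auto
  moreover have "norm x <= B * norm x" using B(3) nx by (simp add: mult_le_cancel_right1)
  ultimately show "norm ((tilt ?P (si * t) A' + Er) *v x) <= 4 * B * norm x"
  using dd Ax norm_triangle_ineq2[of "?y0 + ?e" "cmat A *v x"] nx unfolding M by linarith
  show "norm x <= 4 * B * norm ((tilt ?P (si * t) A' + Er) *v x)"
  proof -
  have l: "norm x <= B * norm (cmat A *v x)"
  using SL2_lower[OF det, of x] B(1) by (meson mult_right_mono norm_ge_zero order_trans)
  have "norm (cmat A *v x) <= norm (?y0 + ?e) + (de + t * B + t/16) * norm x"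
  using dd norm_triangle_ineq3[of "cmat A *v x" "?y0 + ?e"] by (simp add: norm_minus_commute)
  then have "B * norm (cmat A *v x) <= B * norm (?y0 + ?e) + B * ((de + t * B + t/16) * norm x)"
  using B(3) by (simp add: distrib_left[symmetric])
  moreover have "B * ((de + t * B + t/16) * norm x) <= 1/2 * norm x"
  proof -
  have "B * (t * B) <= c / 32" using mult_right_mono[OF t', of "B\<^sup>2"] de(2) B2 by (simp add: power2_eq_square mult_ac)
  then have "B * (de + t * B + t/16) <= 1/2"
  using deB tB c(2) by (simp add: algebra_simps)
  from mult_right_mono[OF this nx] show ?thesis by (simp add: mult.assoc)
  qed
  ultimately have "norm x <= B * norm (?y0 + ?e) + 1/2 * norm x" using l by linarith
  moreover have "0 <= B * norm (?y0 + ?e)" using B(3) by simp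
  ultimately show ?thesis unfolding M by linarith
  qed
  show "crossE ((tilt ?P (si * t) A' + Er) *v x) \<ge> 0" if x: "crossE x \<ge> 0"
  proof -
  define N where "N = (norm x)\<^sup>2"
  have N0: "N \<ge> 0" by (simp add: N_def)
  let ?p = "(\<chi> i. Re (x $ i)) :: real^2" and ?q = "(\<chi> i. Im (x $ i)) :: real^2"
  have 1: "crossE ?y0 = det ?P * crossE x + t * (si * area (?P *v ?p) (A' *v ?p) + si * area (?P *v ?q) (A' *v ?q))
  + (si * t)\<^sup>2 * det A' * crossE x"
  unfolding tilt_def crossE_tilt by (simp add: algebra_simps)
  have 2: "si * area (?P *v ?p) (A' *v ?p) + si * area (?P *v ?q) (A' *v ?q) \<ge> c/2 * N"
  proof -
  have "c/2 * N = c/2 * (norm ?p)\<^sup>2 + c/2 * (norm ?q)\<^sup>2"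
  unfolding N_def norm_real_imag_parts[symmetric] by (rule distrib_left)
  then show ?thesis using monoP[of ?p] monoP[of ?q] by linarith
  qed
  have 3: "\<bar>(si * t)\<^sup>2 * det A' * crossE x\<bar> <= t * (c/32 * N)"
  proof -
  have "si\<^sup>2 = 1" using si by (metis power2_abs one_power2)
  then have "\<bar>(si * t)\<^sup>2 * det A' * crossE x\<bar> = t * (t * \<bar>det A'\<bar> * \<bar>crossE x\<bar>)"
  using t(1) by (simp add: power_mult_distrib abs_mult power2_eq_square)
  also have "... <= t * (c / 32 * N)"
  proof (intro mult_left_mono mult_mono)
  have "\<bar>det A'\<bar> <= B\<^sup>2" using det_bound[of A'] B(2) power_mono[of "norm A'" B 2]
  by (smt (verit) norm_ge_zero zero_le_power2)
  then have "t * \<bar>det A'\<bar> <= de * B\<^sup>2" using t t' de by (intro mult_mono) auto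
  then show "t * \<bar>det A'\<bar> <= c / 32" using de(2) by simp
  show "\<bar>crossE x\<bar> <= N" using abs_crossE[of x] unfolding N_def by (smt (verit) zero_le_power2)
  qed (use c t in auto)
  finally show ?thesis .
  qed
  have 4: "norm ?y0 <= 2 * B * norm x"
  proof -
  have "norm ?y0 <= norm (cmat A *v x) + (de + t * B) * norm x"
  using d norm_triangle_ineq2[of ?y0 "cmat A *v x"] by linarith
  also have "... <= B * norm x + 1 * norm x"
  using Ax small by (intro add_mono mult_right_mono) auto
  also have "... <= 2 * B * norm x" using \<open>norm x <= B * norm x\<close> by simp
  finally show ?thesis .
  qed
  have 5: "norm ?y0 * norm ?e <= t * (c/8 * N)"
  proof -
  have "norm ?y0 * norm ?e <= (2 * B * norm x) * (c / (16 * B) * t * norm x)"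
  using 4 e B(3) by (intro mult_mono) auto
  also have "... = t * (c/8 * N)" using B(3) by (simp add: N_def power2_eq_square field_simps)
  finally show ?thesis .
  qed
  have 6: "(norm ?e)\<^sup>2 <= t * (c/16 * N)"
  proof -
  have "norm ?e * norm ?e <= (t/16 * norm x) * (c / (16 * B) * t * norm x)"
  using e e1 t by (intro mult_mono) auto
  also have "... = t * (c / 16 * N) * (t / (16 * B))" by (simp add: N_def power2_eq_square field_simps)
  also have "... <= t * (c / 16 * N) * 1"
  using tl t(1) c(1) B(3) N0 by (intro mult_left_mono) (auto simp: divide_le_eq intro!: mult_nonneg_nonneg)
  finally show ?thesis by (simp add: power2_eq_square)
  qed
  have "crossE ?y0 \<ge> t * (c/2 * N) - t * (c/32 * N)"
  proof -
  have "det ?P * crossE x \<ge> 0" using detP x by simp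
  moreover have "t * (si * area (?P *v ?p) (A' *v ?p) + si * area (?P *v ?q) (A' *v ?q)) \<ge> t * (c/2 * N)"
  using 2 t(1) by (rule mult_left_mono)
  ultimately show ?thesis using 1 3 by linarith
  qed
  moreover have "t * (c/2 * N) - t * (c/32 * N) - t * (c/8 * N) - t * (c/16 * N) \<ge> 0"
  proof -
  have "t * (c/2 * N) - t * (c/32 * N) - t * (c/8 * N) - t * (c/16 * N) = t * c * N * (9/32)"
  by (simp add: algebra_simps)
  then show ?thesis using t(1) c(1) N0 by simp
  qed
  ultimately show ?thesis unfolding M using crossE_add[of ?y0 ?e] 5 6 by linarith
  qed
 qed
qed

primrec orbit :: "(nat => complex^2^2) => nat => complex^2" where
 "orbit M 0 = x0"
| "orbit M (Suc n) = M n *v orbit M n"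

text \<open>The scalar whose logarithm replaces that of the norm of the product. It depends holomorphically on the matrices.\<close>

definition Dn :: "(nat => complex^2^2) => nat => complex" where
 "Dn M n = lfun (orbit M n)"

lemma norm_x0: "(norm x0)\<^sup>2 = 2" "crossE x0 = 1"
 by (simp_all add: norm_vec2_sq x0_def crossE_def)

lemma good_orbit:
 assumes "!!k. k < n ==> good C (M k)" and C: "C \<ge> 0"
 shows "crossE (orbit M n) \<ge> 0 & norm (orbit M n) <= C ^ n * norm x0 & norm x0 <= C ^ n * norm (orbit M n)"
 using assms(1)
proof (induction n)
 case 0 then show ?case by (simp add: norm_x0)
next
 case (Suc n)
 then have IH: "crossE (orbit M n) \<ge> 0" "norm (orbit M n) <= C ^ n * norm x0" "norm x0 <= C ^ n * norm (orbit M n)"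
  and g: "good C (M n)" by auto
 have "norm (orbit M (Suc n)) <= C * norm (orbit M n)" using g by (simp add: good_def)
 also have "... <= C * (C ^ n * norm x0)" using IH(2) C by (rule mult_left_mono)
 finally have 1: "norm (orbit M (Suc n)) <= C ^ Suc n * norm x0" by (simp add: algebra_simps)
 have "norm (orbit M n) <= C * norm (orbit M (Suc n))" using g by (simp add: good_def)
 then have "C ^ n * norm (orbit M n) <= C ^ n * (C * norm (orbit M (Suc n)))" using C by (simp add: mult_left_mono)
 then have 2: "norm x0 <= C ^ Suc n * norm (orbit M (Suc n))" using IH(3) by (simp add: algebra_simps)
 show ?case using 1 2 g IH(1) by (auto simp: good_def)
qed

lemma Dn_good:
 assumes "!!k. k < n ==> good C (M k)" and C: "C \<ge> 1"
 shows "Dn M n ~= 0" and "\<bar>ln (norm (Dn M n))\<bar> <= real n * ln C + ln 4"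
proof -
 note o = good_orbit[of n C M, OF assms(1)]
 have x: "1 <= norm x0" "norm x0 <= 2" using norm_x0(1) 
  by (auto intro!: power2_le_imp_le[of 1 "norm x0"] power2_le_imp_le[of "norm x0" 2])
 have o': "crossE (orbit M n) \<ge> 0" "norm (orbit M n) <= C ^ n * norm x0" "norm x0 <= C ^ n * norm (orbit M n)"
  using o C by auto
 have n0: "norm (orbit M n) > 0" "C ^ n > 0"
 proof -
  show "C ^ n > 0" using C by simp
  have "norm (orbit M n) ~= 0" using o'(3) x(1) by force
  then show "norm (orbit M n) > 0" by simp
 qed
 have D1: "norm (orbit M n) <= norm (Dn M n)" unfolding Dn_def using o'(1) by (rule lfun_ge_norm)
 then show D0: "Dn M n ~= 0" using n0 by auto
 have "norm (orbit M n) <= C ^ n * norm x0" by (rule o')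
 also have "... <= C ^ n * 2" using x n0 by (intro mult_left_mono) auto
 finally have D2: "norm (Dn M n) <= 4 * C ^ n"
  using lfun_le_norm[of "orbit M n"] unfolding Dn_def by linarith
 have "1 <= C ^ n * norm (Dn M n)" using o'(3) x(1) mult_left_mono[OF D1, of "C ^ n"] n0(2) by linarith
 then have "ln 1 <= ln (C ^ n * norm (Dn M n))" by (subst ln_le_cancel_iff) auto
 then have l: "0 <= real n * ln C + ln (norm (Dn M n))" 
  using n0 D0 C by (simp add: ln_mult ln_realpow)
 have "ln (norm (Dn M n)) <= ln (4 * C ^ n)" using D2 n0 D1 by (subst ln_le_cancel_iff) auto
 then have u: "ln (norm (Dn M n)) <= ln 4 + real n * ln C" using C by (simp add: ln_mult ln_realpow)
 have "ln 4 \<ge> (0::real)" by simp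
 then show "\<bar>ln (norm (Dn M n))\<bar> <= real n * ln C + ln 4" using l u by linarith
qed

lemma Dn_holomorphic:
 assumes "!!k i j. (%w. M w k $ i $ j) holomorphic_on S"
 shows "(%w. Dn (M w) n) holomorphic_on S"
proof -
 have "(%w. orbit (M w) n $ i) holomorphic_on S" for i
 proof (induction n arbitrary: i)
  case 0 then show ?case by simp
 next
  case (Suc n) then show ?case by (auto simp: mat2_vec intro!: holomorphic_intros assms)
 qed
 then show ?thesis unfolding Dn_def lfun_def by (intro holomorphic_intros)
qed

text \<open>The complex line through two matrices. Moving far along it without leaving the good matrices makes the two ends
indistinguishable for \<open>ln |D|\<close>.\<close>

definition mix :: "complex => complex^2^2 => complex^2^2 => complex^2^2" where
 "mix om M0 M1 = (\<chi> i j. M0 $ i $ j + om * (M1 $ i $ j - M0 $ i $ j))"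

lemma mix_0 [simp]: "mix 0 M0 M1 = M0" and mix_1 [simp]: "mix 1 M0 M1 = M1"
 by (simp_all add: mix_def vec_eq_iff)

lemma norm_mix: "norm (mix om M0 M1 - M0) = norm om * norm (M1 - M0)"
proof -
 have e: "(mix om M0 M1 - M0) $ i $ j = om * ((M1 - M0) $ i $ j)" for i j
  unfolding mix_def by simp
 have "(norm (mix om M0 M1 - M0))\<^sup>2 = (norm om * norm (M1 - M0))\<^sup>2"
  unfolding power_mult_distrib norm_vec2_sq e norm_mult by (simp only: distrib_left)
 then show ?thesis by simp
qed

section \<open>Logarithms of zero-free functions and their power series\<close>

text \<open>An expansion at \<open>s\<close> whose coefficients obey Cauchy bounds with radius \<open>rh\<close>. Unlike a bound on a holomorphic extension, this passes
directly to averages and to pointwise limits.\<close>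

definition anl :: "real => real => (real => real) => real => bool" where
 "anl rh M u s \<longleftrightarrow> (EX a. (ALL i. \<bar>a i\<bar> * rh ^ i <= M) & (ALL v. \<bar>v\<bar> < rh --> (%i. a i * v ^ i) sums u (s + v)))"

lemma bounded_log_increment:
 fixes D :: "complex => complex"
 assumes hol: "D holomorphic_on ball z0 rh" and nz: "!!w. w : ball z0 rh ==> D w ~= 0"
  and bd: "!!w. w : ball z0 rh ==> \<bar>ln (norm (D w))\<bar> <= M" and "rh > 0" "M > 0"
 obtains g where "g holomorphic_on ball z0 rh" "!!w. w : ball z0 rh ==> Re (g w) = ln (norm (D w))"
  "!!w. norm (w - z0) <= rh / 2 ==> norm (g w - g z0) <= 16 * M * norm (w - z0) / rh"
proof -
 obtain g where g: "g holomorphic_on ball z0 rh" "!!w. w : ball z0 rh ==> exp (g w) = D w"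
  using holomorphic_logarithm_exists[of "ball z0 rh" D z0] hol nz \<open>rh > 0\<close> by (metis centre_in_ball convex_ball open_ball)
 have Re: "Re (g w) = ln (norm (D w))" if "w : ball z0 rh" for w
  using g(2)[OF that] by (metis ln_exp norm_exp_eq_Re)
 define G where "G = (%\<zeta>. g (z0 + of_real rh * \<zeta>) - g z0)"
 define ph where "ph = (%\<zeta>. G \<zeta> / (of_real (8 * M) - G \<zeta>))"
 have in_ball: "z0 + of_real rh * \<zeta> : ball z0 rh" if "norm \<zeta> < 1" for \<zeta>
  using that \<open>rh > 0\<close> by (simp add: dist_norm norm_mult)
 have ReG: "Re (G \<zeta>) < 4 * M" if "norm \<zeta> < 1" for \<zeta>
  using Re[OF in_ball[OF that]] Re[of z0] bd[OF in_ball[OF that]] bd[of z0] \<open>rh > 0\<close> \<open>M > 0\<close>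
  by (simp add: G_def)
 have lt: "norm (G \<zeta>) < norm (of_real (8 * M) - G \<zeta>)" if "norm \<zeta> < 1" for \<zeta>
 proof (rule power2_less_imp_less)
  have "(norm (of_real (8 * M) - G \<zeta>))\<^sup>2 = (norm (G \<zeta>))\<^sup>2 + 16 * M * (4 * M - Re (G \<zeta>))"
  unfolding cmod_power2 by (simp add: power2_eq_square algebra_simps)
  moreover have "16 * M * (4 * M - Re (G \<zeta>)) > 0" using ReG[OF that] \<open>M > 0\<close> by simp
  ultimately show "(norm (G \<zeta>))\<^sup>2 < (norm (of_real (8 * M) - G \<zeta>))\<^sup>2" by linarith
 qed simp
 have "(%\<zeta>. z0 + of_real rh * \<zeta>) holomorphic_on ball 0 1" by (intro holomorphic_intros)
 moreover have "(%\<zeta>. z0 + of_real rh * \<zeta>) ` ball 0 1 <= ball z0 rh" using in_ball by auto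
 ultimately have "(g \<circ> (%\<zeta>. z0 + of_real rh * \<zeta>)) holomorphic_on ball 0 1"
  using g(1) holomorphic_on_compose_gen by blast
 then have holG: "G holomorphic_on ball 0 1"
  unfolding G_def o_def by (intro holomorphic_on_diff holomorphic_on_const)
 have nz8: "of_real (8 * M) - G \<zeta> ~= 0" if "norm \<zeta> < 1" for \<zeta>
  using lt[OF that] by (metis norm_not_less_zero norm_zero)
 have hol\<phi>: "ph holomorphic_on ball 0 1" unfolding ph_def
  by (intro holomorphic_intros holG) (use nz8 in auto)
 have ph0: "ph 0 = 0" by (simp add: ph_def G_def)
 have ph1: "norm (ph \<zeta>) < 1" if "norm \<zeta> < 1" for \<zeta>
  using lt[OF that] by (simp add: ph_def norm_divide divide_less_eq)
 have key: "norm (G \<zeta>) <= 16 * M * norm \<zeta>" if "norm \<zeta> <= 1/2" for \<zeta>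
 proof -
  have l1: "norm \<zeta> < 1" using that by linarith
  have "norm (ph \<zeta>) <= norm \<zeta>" using Schwarz_Lemma(1)[OF hol\<phi> ph0 ph1 l1] .
  then have "norm (G \<zeta>) <= norm \<zeta> * norm (of_real (8 * M) - G \<zeta>)"
  using nz8[OF l1] by (simp add: ph_def norm_divide divide_le_eq)
  also have "... <= norm \<zeta> * (8 * M + norm (G \<zeta>))"
  using norm_triangle_ineq4[of "of_real (8 * M)" "G \<zeta>"] \<open>M > 0\<close>
  by (intro mult_left_mono) (auto simp: norm_mult)
  finally have 1: "norm (G \<zeta>) <= 8 * M * norm \<zeta> + norm \<zeta> * norm (G \<zeta>)" by (simp add: algebra_simps)
  have "norm \<zeta> * norm (G \<zeta>) <= 1/2 * norm (G \<zeta>)" using that by (intro mult_right_mono) auto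
  then show ?thesis using 1 by linarith
 qed
 show ?thesis
 proof (rule that[OF g(1) Re])
  fix w assume w: "norm (w - z0) <= rh / 2"
  let ?\<zeta> = "(w - z0) / of_real rh"
  have "norm ?\<zeta> <= 1/2" using w \<open>rh > 0\<close> by (simp add: norm_divide field_simps)
  from key[OF this] show "norm (g w - g z0) <= 16 * M * norm (w - z0) / rh"
  using \<open>rh > 0\<close> by (simp add: G_def norm_divide)
 qed
qed

text \<open>On a disc, a zero-free holomorphic function is \<open>exp g\<close>. The real part of \<open>g\<close> is bounded by \<open>M\<close>, which bounds the
increments of \<open>g\<close>, and its Taylor coefficients obey Cauchy's inequality. On the real axis \<open>ln |D|\<close> is the real
part of that series.\<close>

lemma log_norm_anl:
 fixes D :: "complex => complex"
 assumes "D holomorphic_on ball (of_real s) rh" and "!!w. w : ball (of_real s) rh ==> D w ~= 0"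
  and bd: "!!w. w : ball (of_real s) rh ==> \<bar>ln (norm (D w))\<bar> <= M" and "rh > 0" "M > 0"
 shows "anl (rh / 2) (9 * M) (%v. ln (norm (D (of_real v)))) s"
proof -
 obtain g where g: "g holomorphic_on ball (of_real s) rh"
  "!!w. w : ball (of_real s) rh ==> Re (g w) = ln (norm (D w))"
  "!!w. norm (w - of_real s) <= rh / 2 ==> norm (g w - g (of_real s)) <= 16 * M * norm (w - of_real s) / rh"
  using bounded_log_increment[OF assms] by metis
 define h where "h = (%w. g w - \<i> * of_real (Im (g (of_real s))))"
 have holh: "h holomorphic_on ball (of_real s) rh" unfolding h_def by (intro holomorphic_intros g)
 have sub: "cball (complex_of_real s) (rh/2) <= ball (of_real s) rh" using \<open>rh > 0\<close> by auto
 have bh: "norm (h w) <= 9 * M" if "norm (w - of_real s) <= rh / 2" for w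
 proof -
  have "h w = (g w - g (of_real s)) + of_real (Re (g (of_real s)))"
  unfolding h_def using complex_eq[of "g (of_real s)"] by (simp add: algebra_simps)
  moreover have "norm (g w - g (of_real s)) <= 8 * M"
  proof -
  have "16 * M * norm (w - of_real s) / rh <= 16 * M * (rh/2) / rh"
  using that \<open>M > 0\<close> \<open>rh > 0\<close> by (intro divide_right_mono mult_left_mono) auto
  then show ?thesis using g(3)[OF that] \<open>rh > 0\<close> by simp
  qed
  moreover have "norm (complex_of_real (Re (g (of_real s)))) <= M"
  using g(2)[of "of_real s"] bd[of "of_real s"] \<open>rh > 0\<close> by simp
  ultimately show ?thesis by (smt (verit) norm_triangle_ineq)
 qed
 define c where "c = (%n. (deriv ^^ n) h (of_real s) / fact n)"
 have c: "norm (c n) * (rh/2)^n <= 9 * M" for n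
 proof -
  have "norm ((deriv ^^ n) h (of_real s)) <= fact n * (9 * M) / (rh/2)^n"
  proof (rule Cauchy_inequality)
  show "h holomorphic_on ball (complex_of_real s) (rh/2)"
  using holh sub ball_subset_cball by (meson holomorphic_on_subset subset_trans)
  show "continuous_on (cball (complex_of_real s) (rh/2)) h"
  using holh sub by (meson holomorphic_on_imp_continuous_on holomorphic_on_subset)
  qed (use bh \<open>rh > 0\<close> in \<open>auto simp: norm_minus_commute\<close>)
  then show ?thesis using \<open>rh > 0\<close> by (simp add: c_def norm_divide field_simps)
 qed
 have "\<bar>Re (c n)\<bar> * (rh/2)^n <= 9 * M" for n
 proof -
  have "\<bar>Re (c n)\<bar> * (rh/2)^n <= norm (c n) * (rh/2)^n"
  using \<open>rh > 0\<close> by (intro mult_right_mono abs_Re_le_cmod) auto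
  then show ?thesis using c[of n] by linarith
 qed
 moreover have "(%n. Re (c n) * v ^ n) sums ln (norm (D (of_real (s + v))))" if "\<bar>v\<bar> < rh/2" for v
 proof -
  have w: "of_real (s + v) : ball (complex_of_real s) rh" using that \<open>rh > 0\<close> by (simp add: dist_norm)
  from holomorphic_power_series[OF holh this]
  have "(%n. c n * of_real v ^ n) sums h (of_real (s + v))" by (simp add: c_def)
  then have "(%n. Re (c n * of_real v ^ n)) sums Re (h (of_real (s + v)))" by (rule sums_Re)
  moreover have "Re (c n * of_real v ^ n) = Re (c n) * v ^ n" for n
  by (simp flip: of_real_power)
  ultimately show ?thesis using g(2)[OF w] by (simp add: h_def)
 qed
 ultimately show ?thesis unfolding anl_def by (intro exI[of _ "%n. Re (c n)"]) blast
qed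

text \<open>Going from 0 to 1 uses only a fraction \<open>1/R\<close> of the disc, and bounded increments of a holomorphic logarithm are Lipschitz.\<close>

lemma log_norm_compare:
 fixes D :: "complex => complex"
 assumes "D holomorphic_on ball 0 R" and "!!w. w : ball 0 R ==> D w ~= 0"
  and "!!w. w : ball 0 R ==> \<bar>ln (norm (D w))\<bar> <= M" and R: "R \<ge> 2" and "M > 0"
 shows "\<bar>ln (norm (D 1)) - ln (norm (D 0))\<bar> <= 16 * M / R"
proof -
 have R0: "R > 0" using R by simp
 obtain g where g: "!!w. w : ball 0 R ==> Re (g w) = ln (norm (D w))"
  "!!w. norm (w - 0) <= R / 2 ==> norm (g w - g 0) <= 16 * M * norm (w - 0) / R"
  using bounded_log_increment[OF assms(1-3) R0 \<open>M > 0\<close>] by metis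
 have "\<bar>Re (g 1 - g 0)\<bar> <= 16 * M / R"
  using g(2)[of 1] R abs_Re_le_cmod[of "g 1 - g 0"] by simp
 then show ?thesis using g(1)[of 0] g(1)[of 1] R by simp
qed

lemma anl_lincomb:
 assumes "anl rh M u s" "anl rh M' u' s"
 shows "anl rh (\<bar>c\<bar> * M + \<bar>c'\<bar> * M') (%v. c * u v + c' * u' v) s"
proof -
 obtain a a' where a: "!!i. \<bar>a i\<bar> * rh ^ i <= M" "!!v. \<bar>v\<bar> < rh ==> (%i. a i * v ^ i) sums u (s + v)"
  and a': "!!i. \<bar>a' i\<bar> * rh ^ i <= M'" "!!v. \<bar>v\<bar> < rh ==> (%i. a' i * v ^ i) sums u' (s + v)"
  using assms unfolding anl_def by blast
 show ?thesis
 proof (cases "rh \<ge> 0")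
  case False
  have "\<bar>c\<bar> * M + \<bar>c'\<bar> * M' \<ge> 0" using a(1)[of 0] a'(1)[of 0] by simp
  then show ?thesis using False unfolding anl_def by (intro exI[of _ "%_. 0"]) auto
 next
  case True
  have "\<bar>c * a i + c' * a' i\<bar> * rh ^ i <= \<bar>c\<bar> * M + \<bar>c'\<bar> * M'" for i
  proof -
  have "\<bar>c * a i + c' * a' i\<bar> * rh ^ i <= (\<bar>c\<bar> * \<bar>a i\<bar> + \<bar>c'\<bar> * \<bar>a' i\<bar>) * rh ^ i"
  using True abs_triangle_ineq[of "c * a i" "c' * a' i"] by (intro mult_right_mono) (auto simp: abs_mult)
  also have "... = \<bar>c\<bar> * (\<bar>a i\<bar> * rh ^ i) + \<bar>c'\<bar> * (\<bar>a' i\<bar> * rh ^ i)" by (simp add: algebra_simps)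
  also have "... <= \<bar>c\<bar> * M + \<bar>c'\<bar> * M'" using a(1) a'(1) by (intro add_mono mult_left_mono) auto
  finally show ?thesis .
  qed
  moreover have "(%i. (c * a i + c' * a' i) * v ^ i) sums (c * u (s + v) + c' * u' (s + v))" if "\<bar>v\<bar> < rh" for v
  using sums_add[OF sums_mult[OF a(2)[OF that], of c] sums_mult[OF a'(2)[OF that], of c']]
  by (simp add: algebra_simps)
  ultimately show ?thesis unfolding anl_def by (intro exI[of _ "%i. c * a i + c' * a' i"]) auto
 qed
qed

lemma anl_mono: "anl rh M u s ==> M <= M' ==> anl rh M' u s"
 unfolding anl_def by (meson order_trans)

lemma geometric_dominated:
 fixes a :: "nat => real"
 assumes "!!i. \<bar>a i\<bar> * rh ^ i <= M" "\<bar>v\<bar> < rh"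
 shows "\<bar>a i * v ^ i\<bar> <= M * (\<bar>v\<bar> / rh) ^ i" "summable (%i. M * (\<bar>v\<bar> / rh) ^ i)"
proof -
 have rh: "rh > 0" using assms(2) by linarith
 have "\<bar>a i * v ^ i\<bar> = (\<bar>a i\<bar> * rh ^ i) * (\<bar>v\<bar> / rh) ^ i"
  using rh by (simp add: abs_mult power_abs power_divide)
 also have "... <= M * (\<bar>v\<bar> / rh) ^ i" using assms rh by (intro mult_right_mono) auto
 finally show "\<bar>a i * v ^ i\<bar> <= M * (\<bar>v\<bar> / rh) ^ i" .
 show "summable (%i. M * (\<bar>v\<bar> / rh) ^ i)"
  using rh assms(2) by (intro summable_mult summable_geometric) (auto simp: field_simps)
qed


lemma power_series_remainder:
 fixes a :: "nat => real"
 assumes b: "!!i. \<bar>a i\<bar> * rh ^ i <= M" and v: "0 < v" "v <= rh / 2" and s: "(%i. a i * v ^ i) sums U"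
 shows "\<bar>(U - (\<Sum>j<i. a j * v ^ j)) / v ^ i - a i\<bar> <= 2 * M / rh ^ Suc i * v"
proof -
 have rh: "rh > 0" using v by linarith
 have M: "M \<ge> 0" using b[of 0] by simp
 have "(%k. a (k + i) * v ^ (k + i)) sums (U - (\<Sum>j<i. a j * v ^ j))"
  using s by (rule sums_split_initial_segment)
 from sums_divide[OF this, of "v ^ i"]
 have "(%k. a (k + i) * v ^ k) sums ((U - (\<Sum>j<i. a j * v ^ j)) / v ^ i)"
  using v by (simp add: power_add)
 from sums_split_initial_segment[OF this, of 1]
 have S: "(%k. a (Suc (k + i)) * v ^ Suc k) sums ((U - (\<Sum>j<i. a j * v ^ j)) / v ^ i - a i)" by simp
 have bound: "\<bar>a (Suc (k + i)) * v ^ Suc k\<bar> <= M / rh ^ Suc i * v * (1/2) ^ k" for k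
 proof -
  have "\<bar>a (Suc (k + i)) * v ^ Suc k\<bar> = (\<bar>a (Suc (k+i))\<bar> * rh ^ Suc (k + i)) * (v * (v/rh) ^ k) / rh ^ Suc i"
  using rh v by (simp add: abs_mult power_add power_divide)
  also have "... <= M * (v * (1/2) ^ k) / rh ^ Suc i"
  proof (intro divide_right_mono mult_mono b)
  show "(v/rh) ^ k <= (1/2) ^ k" using rh v by (intro power_mono) (auto simp: field_simps)
  qed (use rh v M in auto)
  finally show ?thesis by (simp add: algebra_simps)
 qed
 have geo: "(%k. M / rh ^ Suc i * v * (1/2) ^ k) sums (M / rh ^ Suc i * v * 2)"
  using sums_mult[OF geometric_sums[of "1/2::real"], of "M / rh ^ Suc i * v"] by simp
 have "\<bar>(U - (\<Sum>j<i. a j * v ^ j)) / v ^ i - a i\<bar> <= M / rh ^ Suc i * v * 2"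
  using norm_suminf_le[OF _ sums_summable[OF geo], of "%k. a (Suc (k + i)) * v ^ Suc k"] bound
  sums_unique[OF S] sums_unique[OF geo] by (simp add: mult.assoc)
 then show ?thesis by (simp add: algebra_simps)
qed

text \<open>Each coefficient is recovered from the values at nearby points, so it depends measurably on the
parameter; the coefficients are then integrated.\<close>

lemma anl_average:
 fixes U :: "'w => real => real"
 assumes "prob_space P" and anl: "!!om. anl rh M (U om) s" and meas: "!!v. \<bar>v - s\<bar> < rh ==> (%om. U om v) : borel_measurable P"
  and "rh > 0"
 shows "anl rh M (%v. \<integral>om. U om v \<partial>P) s"
proof -
 interpret prob_space P by fact
 obtain a where b: "!!om i. \<bar>a om i\<bar> * rh ^ i <= M" and S: "!!om v. \<bar>v\<bar> < rh ==> (%i. a om i * v ^ i) sums U om (s + v)"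
  using anl unfolding anl_def by metis
 define w where "w = (%l::nat. rh / real (l + 2))"
 have w: "0 < w l" "w l <= rh / 2" "w l < rh" for l
 proof -
  show "0 < w l" and *: "w l <= rh / 2"
  unfolding w_def using \<open>rh > 0\<close> divide_left_mono[of 2 "real (l + 2)" rh] by simp_all
  then show "w l < rh" using \<open>rh > 0\<close> by linarith
 qed
 have w0: "w \<longlonglongrightarrow> 0" unfolding w_def by real_asymp
 have am: "(%om. a om i) : borel_measurable P" for i
 proof (induction i rule: less_induct)
  case (less i)
  show ?case
  proof (rule borel_measurable_LIMSEQ_real)
  fix om
  have "(%l. 2 * M / rh ^ Suc i * w l) \<longlonglongrightarrow> 2 * M / rh ^ Suc i * 0" by (intro tendsto_intros w0)
  then have z: "(%l. 2 * M / rh ^ Suc i * w l) \<longlonglongrightarrow> 0" by simp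
  have "(%l. (U om (s + w l) - (\<Sum>j<i. a om j * w l ^ j)) / w l ^ i - a om i) \<longlonglongrightarrow> 0"
  proof (rule Lim_null_comparison[OF always_eventually z], intro allI)
  fix l show "norm ((U om (s + w l) - (\<Sum>j<i. a om j * w l ^ j)) / w l ^ i - a om i) <= 2 * M / rh ^ Suc i * w l"
  using power_series_remainder[OF b w(1,2) S, of l om] w[of l] by simp
  qed
  then show "(%l. (U om (s + w l) - (\<Sum>j<i. a om j * w l ^ j)) / w l ^ i) \<longlonglongrightarrow> a om i"
  by (rule LIM_zero_cancel)
  next
  fix l
  have "(%om. U om (s + w l)) : borel_measurable P" using w[of l] by (intro meas) auto
  then show "(%om. (U om (s + w l) - (\<Sum>j<i. a om j * w l ^ j)) / w l ^ i) : borel_measurable P"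
  by (intro borel_measurable_divide borel_measurable_diff borel_measurable_sum borel_measurable_times)
  (use less in auto)
  qed
 qed
 have ab: "\<bar>a om i\<bar> <= M / rh ^ i" for om i using b[of om i] \<open>rh > 0\<close> by (simp add: field_simps)
 have int: "integrable P (%om. a om i)" for i
  using ab am by (intro integrable_const_bound[of _ "M / rh ^ i"]) auto
 have "\<bar>\<integral>om. a om i \<partial>P\<bar> * rh ^ i <= M" for i
 proof -
  have "\<bar>\<integral>om. a om i \<partial>P\<bar> <= (\<integral>om. \<bar>a om i\<bar> \<partial>P)" using integral_norm_bound[of P "%om. a om i"] by simp
  also have "... <= (\<integral>om. M / rh ^ i \<partial>P)" using ab int by (intro integral_mono) auto
  also have "... = M / rh ^ i" by (simp add: prob_space)
  finally show ?thesis using \<open>rh > 0\<close> by (simp add: field_simps)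
 qed
 moreover have "(%i. (\<integral>om. a om i \<partial>P) * v ^ i) sums (\<integral>om. U om (s + v) \<partial>P)" if v: "\<bar>v\<bar> < rh" for v
 proof -
  have "(%i. \<integral>om. a om i * v ^ i \<partial>P) sums (\<integral>om. (\<Sum>i. a om i * v ^ i) \<partial>P)"
  proof (rule sums_integral)
  show "integrable P (%om. a om i * v ^ i)" for i using int by simp
  show "AE om in P. summable (%i. norm (a om i * v ^ i))"
  proof (intro AE_I2)
  fix om
  show "summable (%i. norm (a om i * v ^ i))"
  by (rule summable_comparison_test'[OF geometric_dominated(2)[OF b[of om] v]])
  (simp only: real_norm_def abs_abs geometric_dominated(1)[OF b[of om] v])
  qed
  show "summable (%i. \<integral>om. norm (a om i * v ^ i) \<partial>P)"
  proof (rule summable_comparison_test'[OF geometric_dominated(2)[OF b[of undefined] v]])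
  fix i
  have "(\<integral>om. norm (a om i * v ^ i) \<partial>P) <= (\<integral>om. M * (\<bar>v\<bar> / rh) ^ i \<partial>P)"
  using geometric_dominated(1)[OF b v] int by (intro integral_mono) (auto simp: abs_mult)
  then show "norm (\<integral>om. norm (a om i * v ^ i) \<partial>P) <= M * (\<bar>v\<bar> / rh) ^ i" by (simp add: prob_space)
  qed
  qed
  moreover have "(\<Sum>i. a om i * v ^ i) = U om (s + v)" for om using S[OF v] by (simp add: sums_iff)
  ultimately show ?thesis by simp
 qed
 ultimately show ?thesis unfolding anl_def by (intro exI[of _ "%i. \<integral>om. a om i \<partial>P"]) blast
qed

text \<open>By induction on the index, each coefficient of the limit is recovered from values at nearby points up to an error that is uniform in \<open>n\<close>,
so coefficients of a pointwise convergent sequence converge.\<close>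

lemma anl_limit:
 fixes U :: "nat => real => real"
 assumes anl: "!!n. anl rh M (U n) s" and lim: "!!v. \<bar>v - s\<bar> < rh ==> (%n. U n v) \<longlonglongrightarrow> u v" and "rh > 0"
 shows "anl rh M u s"
proof -
 obtain a where b: "!!n i. \<bar>a n i\<bar> * rh ^ i <= M" and S: "!!n v. \<bar>v\<bar> < rh ==> (%i. a n i * v ^ i) sums U n (s + v)"
  using anl unfolding anl_def by metis
 have M: "M \<ge> 0" using b[of 0 0] by simp
 have "convergent (%n. a n i)" for i
 proof (induction i rule: less_induct)
  case (less i)
  have "Cauchy (%n. a n i)"
  proof (rule metric_CauchyI)
  fix e :: real assume "e > 0"
  define K where "K = 2 * M / rh ^ Suc i + 1"
  have K: "K > 0" "2 * M / rh ^ Suc i <= K" using M \<open>rh > 0\<close> by (auto simp: K_def add_nonneg_pos)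
  define v where "v = min (rh/2) (e / (4 * K))"
  have v: "0 < v" "v <= rh/2" "v < rh" "K * v <= e / 4"
  using \<open>rh > 0\<close> \<open>e > 0\<close> K by (auto simp: v_def min_def field_simps)
  define q where "q = (%n. (U n (s + v) - (\<Sum>j<i. a n j * v ^ j)) / v ^ i)"
  have q: "\<bar>q n - a n i\<bar> <= e/4" for n
  proof -
  have "\<bar>q n - a n i\<bar> <= 2 * M / rh ^ Suc i * v"
  unfolding q_def using power_series_remainder[OF b v(1,2) S] v by simp
  also have "... <= K * v" using K v by (intro mult_right_mono) auto
  finally show ?thesis using v by linarith
  qed
  have "convergent (%n. a n j)" if "j < i" for j using less that by blast
  then have "!!j. j < i ==> (%n. a n j) \<longlonglongrightarrow> lim (%n. a n j)" by (simp add: convergent_LIMSEQ_iff)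
  then have "q \<longlonglongrightarrow> (u (s + v) - (\<Sum>j<i. lim (%n. a n j) * v ^ j)) / v ^ i"
  unfolding q_def using v by (intro tendsto_intros lim) auto
  then have "Cauchy q" by (simp add: LIMSEQ_imp_Cauchy)
  then obtain N where N: "!!m n. m \<ge> N ==> n \<ge> N ==> dist (q m) (q n) < e/4"
  using \<open>e > 0\<close> metric_CauchyD by (metis zero_less_divide_iff zero_less_numeral)
  have "dist (a m i) (a n i) < e" if "m \<ge> N" "n \<ge> N" for m n
  using N[OF that] q[of m] q[of n] \<open>e > 0\<close> unfolding dist_real_def by linarith
  then show "EX N. \<forall>m\<ge>N. \<forall>n\<ge>N. dist (a m i) (a n i) < e" by blast
  qed
  then show ?case by (simp add: Cauchy_convergent_iff)
 qed
 then obtain c where c: "!!i. (%n. a n i) \<longlonglongrightarrow> c i" unfolding convergent_def by metis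
 have "\<bar>c i\<bar> * rh ^ i <= M" for i
  by (rule LIMSEQ_le_const2[of "%n. \<bar>a n i\<bar> * rh ^ i"]) (use b c in \<open>auto intro!: tendsto_intros\<close>)
 moreover have "(%i. c i * v ^ i) sums u (s + v)" if v: "\<bar>v\<bar> < rh" for v
 proof -
  have tan: "(%n. \<Sum>i. a n i * v ^ i) \<longlonglongrightarrow> (\<Sum>i. c i * v ^ i)" "summable (%i. norm (c i * v ^ i))"
  proof -
  have "eventually (%n. summable (%k. norm (a n k * v ^ k))) sequentially \<and>
  summable (%k. norm (c k * v ^ k)) & ((%n. \<Sum>k. a n k * v ^ k) \<longlongrightarrow> (\<Sum>k. c k * v ^ k)) sequentially"
  proof (rule tannerys_theorem)
  show "(%n. a n k * v ^ k) \<longlonglongrightarrow> c k * v ^ k" for k by (intro tendsto_intros c)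
  show "\<forall>\<^sub>F (k, n) in sequentially \<times>\<^sub>F sequentially. norm (a n k * v ^ k) <= M * (\<bar>v\<bar> / rh) ^ k"
  using geometric_dominated(1)[OF b v] by (intro always_eventually) (auto simp del: abs_mult)
  show "summable (%i. M * (\<bar>v\<bar> / rh) ^ i)" by (rule geometric_dominated(2)[OF b[of 0] v])
  qed auto
  then show "(%n. \<Sum>i. a n i * v ^ i) \<longlonglongrightarrow> (\<Sum>i. c i * v ^ i)" "summable (%i. norm (c i * v ^ i))" by auto
  qed
  have "(%n. U n (s + v)) \<longlonglongrightarrow> (\<Sum>i. c i * v ^ i)"
  using tan S[OF v] by (simp add: sums_iff)
  then have "(\<Sum>i. c i * v ^ i) = u (s + v)" using lim[of "s + v"] v LIMSEQ_unique by auto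
  then show ?thesis using tan summable_norm_cancel by (metis summable_sums)
 qed
 ultimately show ?thesis unfolding anl_def by (intro exI[of _ c]) blast
qed
lemma Re_of_real_has_derivative:
 assumes "f holomorphic_on S" "open S" "complex_of_real x : S"
 shows "((%x. Re (f (of_real x))) has_real_derivative Re (deriv f (of_real x))) (at x)"
proof -
 have "(f has_field_derivative deriv f (of_real x)) (at (of_real x))"
  using assms holomorphic_derivI by blast
 then have "((%x. f (of_real x)) has_vector_derivative deriv f (of_real x)) (at x)"
  by (rule has_vector_derivative_real_field)
 then have "((%x. Re (f (of_real x))) has_vector_derivative Re (deriv f (of_real x))) (at x)"
  by (rule bounded_linear.has_vector_derivative[OF bounded_linear_Re])
 then show ?thesis by (simp add: has_real_derivative_iff_has_vector_derivative)
qed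

lemma anl_derivatives:
 assumes "anl rh M u s" "rh > 0"
 shows "((deriv ^^ i) u has_real_derivative (deriv ^^ Suc i) u s) (at s)"
  and "\<bar>(deriv ^^ i) u s\<bar> <= fact i * (2 * M) * (2 / rh) ^ i"
proof -
 obtain a where a: "!!i. \<bar>a i\<bar> * rh ^ i <= M" "!!v. \<bar>v\<bar> < rh ==> (%i. a i * v ^ i) sums u (s + v)"
  using assms unfolding anl_def by blast
 have M: "M \<ge> 0" using a(1)[of 0] by simp
 define f where "f = (%z. \<Sum>n. complex_of_real (a n) * (z - of_real s) ^ n)"
 let ?B = "ball (complex_of_real s) rh"
 have dom: "norm (complex_of_real (a n) * (z - of_real s) ^ n) <= M * (norm (z - of_real s) / rh) ^ n"
  if "norm (z - of_real s) < rh" for z n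
  using geometric_dominated(1)[OF a(1), of "norm (z - of_real s)" n] that by (simp add: norm_mult norm_power abs_mult)
 have domsum: "summable (%n. M * (norm (z - of_real s) / rh) ^ n)" if "norm (z - of_real s) < rh" for z
  using geometric_dominated(2)[OF a(1), of "norm (z - of_real s)"] that by simp
 have fs: "(%n. complex_of_real (a n) * (z - of_real s) ^ n) sums f z" if "z : ?B" for z
 proof -
  have n: "norm (z - of_real s) < rh" using that by (simp add: dist_norm norm_minus_commute)
  have "summable (%n. complex_of_real (a n) * (z - of_real s) ^ n)"
  by (rule summable_comparison_test'[OF domsum[OF n] dom[OF n]])
  then show ?thesis unfolding f_def by (rule summable_sums)
 qed
 have holf: "f holomorphic_on ?B" by (rule power_series_holomorphic) (rule fs)
 have hold: "(deriv ^^ i) f holomorphic_on ?B" for i by (intro holomorphic_higher_deriv holf) auto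
 have inB: "complex_of_real x : ?B \<longleftrightarrow> \<bar>x - s\<bar> < rh" for x
 proof -
  have "dist (complex_of_real s) (of_real x) = \<bar>x - s\<bar>"
  by (metis abs_minus_commute dist_norm norm_of_real of_real_diff)
  then show ?thesis by simp
 qed
 have u: "u x = Re (f (of_real x))" if "\<bar>x - s\<bar> < rh" for x
 proof -
  have "(%n. a n * (x - s) ^ n) sums Re (f (of_real x))"
  using sums_Re[OF fs[of "of_real x"]] that inB by (simp flip: of_real_diff of_real_power of_real_mult)
  then show ?thesis using a(2)[OF that] sums_unique2 by fastforce
 qed
 have claim: "(deriv ^^ i) u x = Re ((deriv ^^ i) f (of_real x)) \<and>
  ((deriv ^^ i) u has_real_derivative Re ((deriv ^^ Suc i) f (of_real x))) (at x)" if "\<bar>x - s\<bar> < rh" for i x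
  using that
 proof (induction i arbitrary: x)
  have *: "(g has_real_derivative Re ((deriv ^^ Suc i) f (of_real x))) (at x)"
  if x: "\<bar>x - s\<bar> < rh" and g: "!!x. \<bar>x - s\<bar> < rh ==> g x = Re ((deriv ^^ i) f (of_real x))" for g i x
  proof (rule has_field_derivative_transform_within_open)
  show "((%x. Re ((deriv ^^ i) f (of_real x))) has_real_derivative Re ((deriv ^^ Suc i) f (of_real x))) (at x)"
  using Re_of_real_has_derivative[OF hold[of i] open_ball] inB x by simp
  show "x : ball s rh" "open (ball s rh)" using x by (auto simp: dist_real_def)
  qed (use g in \<open>auto simp: dist_real_def\<close>)
  {
  case 0
  then show ?case using u *[of x u 0] by simp
  next
  case (Suc i)
  have eq: "(deriv ^^ Suc i) u y = Re ((deriv ^^ Suc i) f (of_real y))" if "\<bar>y - s\<bar> < rh" for y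
  using Suc.IH[OF that] by (simp add: DERIV_imp_deriv)
  then show ?case using *[of x "(deriv ^^ Suc i) u" "Suc i"] Suc.prems by blast
  }
 qed
 have s: "\<bar>s - s\<bar> < rh" using assms by simp
 show "((deriv ^^ i) u has_real_derivative (deriv ^^ Suc i) u s) (at s)"
  using claim[OF s, of i] claim[OF s, of "Suc i"] by simp
 have "norm ((deriv ^^ i) f (of_real s)) <= fact i * (2 * M) / (rh/2) ^ i"
 proof (rule Cauchy_inequality)
  have sub: "cball (complex_of_real s) (rh/2) <= ?B" using \<open>rh > 0\<close> by auto
  show "f holomorphic_on ball (complex_of_real s) (rh/2)"
  using holf sub ball_subset_cball by (meson holomorphic_on_subset subset_trans)
  show "continuous_on (cball (complex_of_real s) (rh/2)) f"
  using holf sub by (meson holomorphic_on_imp_continuous_on holomorphic_on_subset)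
  fix z assume z: "norm (complex_of_real s - z) = rh/2"
  then have n: "norm (z - of_real s) = rh/2" by (simp add: norm_minus_commute)
  then have n': "norm (z - of_real s) < rh" using \<open>rh > 0\<close> by simp
  have "norm (f z) <= (\<Sum>n. M * (norm (z - of_real s) / rh) ^ n)"
  unfolding f_def by (rule norm_suminf_le[OF dom[OF n'] domsum[OF n']])
  also have "... = 2 * M"
  proof -
  have h: "norm (z - of_real s) / rh = 1/2" using n \<open>rh > 0\<close> by simp
  have "(%k. M * (1/2) ^ k) sums (M * (1 / (1 - 1/2)))" by (intro sums_mult geometric_sums) simp
  then show ?thesis unfolding h by (simp add: sums_iff)
  qed
  finally show "norm (f z) <= 2 * M" .
 qed (use \<open>rh > 0\<close> in auto)
 then have "norm ((deriv ^^ i) f (of_real s)) <= fact i * (2 * M) * (2/rh) ^ i"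
  by (simp add: power_divide)
 then show "\<bar>(deriv ^^ i) u s\<bar> <= fact i * (2 * M) * (2 / rh) ^ i"
  using claim[OF s, of i] abs_Re_le_cmod[of "(deriv ^^ i) f (of_real s)"] by simp
qed

text \<open>A Whitney jet of order \<open>r\<close> and Hoelder exponent 1/2. The derivatives are carried as separate functions related by
inequalities only, so that the whole structure is closed under pointwise limits.\<close>

definition holder_jet :: "nat => real => real set => (real => real) => (nat => real => real) => bool" where
 "holder_jet r C J u U \<longleftrightarrow> (ALL x:J. U 0 x = u x) & (\<forall>i\<le>r. ALL x:J. \<bar>U i x\<bar> <= C) \<and>
  (\<forall>i<r. ALL x:J. ALL y:J. \<bar>U i y - U i x - (y - x) * U (Suc i) x\<bar> <= C * (\<bar>y - x\<bar> * sqrt \<bar>y - x\<bar>)) \<and>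
  (ALL x:J. ALL y:J. \<bar>U r y - U r x\<bar> <= C * sqrt \<bar>y - x\<bar>)"

definition hold :: "nat => real => real set => (real => real) => bool" where
 "hold r C J u \<longleftrightarrow> (EX U. holder_jet r C J u U)"

lemma taylor1_remainder:
 fixes g g' :: "real => real"
 assumes J: "convex J" "x : J" "y : J"
  and d: "!!z. z : J ==> (g has_real_derivative g' z) (at z)"
  and b: "!!z. z : J ==> \<bar>g' z - g' x\<bar> <= B * \<bar>z - x\<bar>" and B: "B \<ge> 0"
 shows "\<bar>g y - g x - (y - x) * g' x\<bar> <= B * \<bar>y - x\<bar>\<^sup>2"
proof -
 let ?S = "closed_segment x y"
 have sub: "?S <= J" using J by (simp add: closed_segment_subset)
 have "norm ((g y - y * g' x) - (g x - x * g' x)) <= (B * \<bar>y - x\<bar>) * norm (y - x)"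
 proof (rule field_differentiable_bound[of ?S "%z. g z - z * g' x" "%z. g' z - g' x"])
  fix z assume z: "z : ?S"
  then have zJ: "z : J" using sub by auto
  show "((%z. g z - z * g' x) has_field_derivative g' z - g' x) (at z within ?S)"
  by (rule DERIV_subset[of _ _ _ UNIV]) (auto intro!: derivative_eq_intros d[OF zJ])
  have "\<bar>z - x\<bar> <= \<bar>y - x\<bar>" using z by (auto simp: closed_segment_eq_real_ivl split: if_splits)
  then show "norm (g' z - g' x) <= B * \<bar>y - x\<bar>"
  using b[OF zJ] B by (smt (verit, best) mult_left_mono real_norm_def)
 qed auto
 then show ?thesis by (simp add: power2_eq_square algebra_simps)
qed

text \<open>A function with Cauchy bounds at radius \<open>rh\<close> loses a factor \<open>1/rh\<close> per derivative, and half a power of \<open>rh\<close> for the Hoelder quotient: at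
distances below \<open>rh\<close> one interpolates with one further derivative, and beyond \<open>rh\<close> the sup bound suffices.\<close>

lemma anl_imp_hold:
 fixes r :: nat
 assumes J: "convex J" and anl: "!!s. s : J ==> anl rh M u s" and rh: "0 < rh" "rh <= 1" and M: "0 <= M"
 shows "hold r (3 * (fact (Suc r) * 2 * 2 ^ Suc r) * M / (rh ^ r * sqrt rh)) J u"
proof -
 define K where "K = fact (Suc r) * 2 * 2 ^ Suc r * M"
 have K: "K \<ge> 0" using M by (simp add: K_def)
 let ?C = "3 * K / (rh ^ r * sqrt rh)"
 have sr: "sqrt rh > 0" "sqrt rh <= 1" "sqrt rh * sqrt rh = rh" using rh by auto
 define U where "U = (%i. (deriv ^^ i) u)"
 have dU: "(U i has_real_derivative U (Suc i) x) (at x)" if "x : J" for i x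
  unfolding U_def by (rule anl_derivatives(1)[OF anl[OF that] rh(1)])
 have bU: "\<bar>U i x\<bar> <= K / rh ^ i" if "x : J" "i <= Suc r" for i x
 proof -
  have "\<bar>U i x\<bar> <= fact i * (2 * M) * (2 / rh) ^ i"
  unfolding U_def by (rule anl_derivatives(2)[OF anl[OF that(1)] rh(1)])
  also have "... = (fact i * 2 * M * 2 ^ i) / rh ^ i" by (simp add: power_divide)
  also have "... <= K / rh ^ i"
  proof (rule divide_right_mono)
  have "fact i * 2 * M * 2 ^ i <= fact (Suc r) * 2 * M * 2 ^ Suc r"
  using that(2) M by (intro mult_mono fact_mono power_increasing) auto
  then show "fact i * 2 * M * 2 ^ i <= K" by (simp add: K_def mult_ac)
  qed (use rh in auto)
  finally show ?thesis .
 qed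
 have pw: "K / rh ^ i <= K / rh ^ r" if "i <= r" for i
  using rh K that by (intro divide_left_mono power_decreasing mult_pos_pos) auto
 have lip: "\<bar>U i y - U i x\<bar> <= K / rh ^ Suc i * \<bar>y - x\<bar>" if "x : J" "y : J" "i <= r" for i x y
 proof -
  have "norm (U i y - U i x) <= K / rh ^ Suc i * norm (y - x)"
  using that bU[of _ "Suc i"] dU
  by (intro field_differentiable_bound[OF J, of "U i" "U (Suc i)"]) (auto intro: DERIV_subset)
  then show ?thesis by simp
 qed
 have sq: "\<bar>d\<bar> = sqrt \<bar>d\<bar> * sqrt \<bar>d\<bar>" for d :: real by simp
 have scale: "K / rh ^ i * d <= K / (rh ^ r * sqrt rh) * e"
  if "0 <= d" "rh ^ r * sqrt rh * d <= rh ^ i * e" for d e i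
 proof -
  have "K * (rh ^ r * sqrt rh * d) <= K * (rh ^ i * e)" using that K by (intro mult_left_mono) auto
  then show ?thesis using rh sr by (simp add: field_simps)
 qed
 have rem: "\<bar>U i y - U i x - (y - x) * U (Suc i) x\<bar> <= ?C * (\<bar>y - x\<bar> * sqrt \<bar>y - x\<bar>)"
  if xy: "x : J" "y : J" and i: "i < r" for i x y
 proof -
  define d where "d = \<bar>y - x\<bar>"
  have d0: "d \<ge> 0" by (simp add: d_def)
  have pwi: "rh ^ r <= rh ^ Suc i" using i rh by (intro power_decreasing) auto
  have e0: "0 <= K / (rh ^ r * sqrt rh) * (d * sqrt d)" using K rh d0 by simp
  have "\<bar>U i y - U i x - (y - x) * U (Suc i) x\<bar> <= 3 * (K / (rh ^ r * sqrt rh) * (d * sqrt d))"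
  proof (cases "d <= rh")
  case True
  have "\<bar>U i y - U i x - (y - x) * U (Suc i) x\<bar> <= K / rh ^ Suc (Suc i) * \<bar>y - x\<bar>\<^sup>2"
  using lip[OF xy(1), of _ "Suc i"] i K rh by (intro taylor1_remainder[OF J xy dU]) auto
  also have "... <= K / (rh ^ r * sqrt rh) * (d * sqrt d)" unfolding d_def[symmetric]
  proof (rule scale)
  have "rh ^ r * sqrt rh * d\<^sup>2 <= rh ^ Suc i * (sqrt rh * d\<^sup>2)"
  using mult_right_mono[OF pwi, of "sqrt rh * d\<^sup>2"] sr d0 by (simp only: mult.assoc) simp
  also have "sqrt rh * d\<^sup>2 = sqrt rh * sqrt d * (d * sqrt d)"
  using d0 by (simp add: power2_eq_square)
  also have "sqrt rh * sqrt d * (d * sqrt d) <= sqrt rh * sqrt rh * (d * sqrt d)"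
  using True d0 sr by (intro mult_right_mono mult_left_mono) auto
  finally show "rh ^ r * sqrt rh * d\<^sup>2 <= rh ^ Suc (Suc i) * (d * sqrt d)"
  using sr rh by (simp add: mult_ac)
  qed simp
  finally show ?thesis using e0 by linarith
  next
  case False
  then have dr: "rh <= d" by simp
  have sd: "sqrt rh <= sqrt d" using dr by simp
  have "\<bar>U i y - U i x\<bar> <= K / rh ^ i * 1 + K / rh ^ i * 1"
  using bU[OF xy(1), of i] bU[OF xy(2), of i] i abs_triangle_ineq4[of "U i y" "U i x"] by simp
  moreover have "\<bar>(y - x) * U (Suc i) x\<bar> <= K / rh ^ Suc i * d"
  proof -
  have "\<bar>y - x\<bar> * \<bar>U (Suc i) x\<bar> <= \<bar>y - x\<bar> * (K / rh ^ Suc i)"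
  using bU[OF xy(1), of "Suc i"] i by (intro mult_left_mono) auto
  then show ?thesis by (simp add: abs_mult d_def mult.commute)
  qed
  moreover have "K / rh ^ i * 1 <= K / (rh ^ r * sqrt rh) * (d * sqrt d)"
  proof (rule scale)
  have "rh ^ r * sqrt rh * 1 <= rh ^ Suc i * sqrt rh" using pwi sr by (simp add: mult_right_mono)
  also have "... = rh ^ i * (rh * sqrt rh)" by simp
  also have "... <= rh ^ i * (d * sqrt d)"
  using dr sd rh d0 by (intro mult_left_mono mult_mono) auto
  finally show "rh ^ r * sqrt rh * 1 <= rh ^ i * (d * sqrt d)" .
  qed simp
  moreover have "K / rh ^ Suc i * d <= K / (rh ^ r * sqrt rh) * (d * sqrt d)"
  proof (rule scale)
  have "rh ^ r * sqrt rh * d <= rh ^ Suc i * sqrt d * d"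
  using pwi sd sr d0 rh by (intro mult_right_mono mult_mono) auto
  then show "rh ^ r * sqrt rh * d <= rh ^ Suc i * (d * sqrt d)" by (simp add: mult_ac)
  qed (rule d0)
  ultimately show ?thesis by linarith
  qed
  then show ?thesis by (simp add: d_def)
 qed
 have last: "\<bar>U r y - U r x\<bar> <= ?C * sqrt \<bar>y - x\<bar>" if xy: "x : J" "y : J" for x y
 proof -
  define d where "d = \<bar>y - x\<bar>"
  have d0: "d \<ge> 0" by (simp add: d_def)
  have e0: "0 <= K / (rh ^ r * sqrt rh) * sqrt d" using K rh d0 by simp
  have "\<bar>U r y - U r x\<bar> <= 3 * (K / (rh ^ r * sqrt rh) * sqrt d)"
  proof (cases "d <= rh")
  case True
  have "\<bar>U r y - U r x\<bar> <= K / rh ^ Suc r * d" using lip[OF xy, of r] by (simp add: d_def)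
  also have "... <= K / (rh ^ r * sqrt rh) * sqrt d"
  proof (rule scale)
  have "rh ^ r * sqrt rh * d = rh ^ r * (sqrt rh * sqrt d) * sqrt d" using d0 by simp
  also have "... <= rh ^ r * (sqrt rh * sqrt rh) * sqrt d"
  using True rh sr d0 by (intro mult_right_mono mult_left_mono) auto
  finally show "rh ^ r * sqrt rh * d <= rh ^ Suc r * sqrt d" using sr by (simp add: mult_ac)
  qed (rule d0)
  finally show ?thesis using e0 by linarith
  next
  case False
  then have sd: "sqrt rh <= sqrt d" by simp
  have "\<bar>U r y - U r x\<bar> <= K / rh ^ r * 1 + K / rh ^ r * 1"
  using bU[OF xy(1), of r] bU[OF xy(2), of r] abs_triangle_ineq4[of "U r y" "U r x"] by simp
  moreover have "K / rh ^ r * 1 <= K / (rh ^ r * sqrt rh) * sqrt d"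
  by (rule scale) (use sd rh mult_left_mono[of "sqrt rh" "sqrt d" "rh ^ r"] in auto)
  ultimately show ?thesis using e0 by linarith
  qed
  then show ?thesis by (simp add: d_def)
 qed
 have bd: "\<bar>U i x\<bar> <= ?C" if "i <= r" "x : J" for i x
 proof -
  have "\<bar>U i x\<bar> <= K / rh ^ r * 1" using bU[OF that(2), of i] pw[OF that(1)] that(1) by simp
  also have "... <= K / (rh ^ r * sqrt rh) * 1"
  by (rule scale) (use sr rh mult_left_mono[of "sqrt rh" 1 "rh ^ r"] in auto)
  finally show ?thesis using K rh by (simp add: field_simps)
 qed
 have "hold r ?C J u"
  unfolding hold_def holder_jet_def by (intro exI[of _ U]) (use rem last bd in \<open>auto simp: U_def\<close>)
 then show ?thesis by (simp add: K_def mult_ac)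
qed
lemma abs_quotient_le: "\<bar>n\<bar> <= C * (\<bar>h\<bar> * s) ==> h ~= 0 ==> \<bar>n / h\<bar> <= C * s" for n h s C :: real
 by (simp add: abs_divide pos_divide_le_eq mult_ac)

lemma hold_mono: "hold r C J u ==> C <= C' ==> hold r C' J u"
 unfolding hold_def holder_jet_def
proof (elim exE conjE, intro exI conjI)
 fix U assume CC: "C <= C'"
 show "\<forall>i\<le>r. ALL x:J. \<bar>U i x\<bar> <= C'" if "\<forall>i\<le>r. ALL x:J. \<bar>U i x\<bar> <= C" using that CC by force
 have m: "C * d <= C' * d" if "d \<ge> 0" for d using CC that by (rule mult_right_mono)
 show "\<forall>i<r. ALL x:J. ALL y:J. \<bar>U i y - U i x - (y - x) * U (Suc i) x\<bar> <= C' * (\<bar>y - x\<bar> * sqrt \<bar>y - x\<bar>)"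
  if "\<forall>i<r. ALL x:J. ALL y:J. \<bar>U i y - U i x - (y - x) * U (Suc i) x\<bar> <= C * (\<bar>y - x\<bar> * sqrt \<bar>y - x\<bar>)"
  using that m by (meson abs_ge_zero mult_nonneg_nonneg order_trans real_sqrt_ge_zero)
 show "ALL x:J. ALL y:J. \<bar>U r y - U r x\<bar> <= C' * sqrt \<bar>y - x\<bar>"
  if "ALL x:J. ALL y:J. \<bar>U r y - U r x\<bar> <= C * sqrt \<bar>y - x\<bar>"
  using that m by (meson abs_ge_zero order_trans real_sqrt_ge_zero)
qed

lemma hold_add:
 assumes "hold r C J u" "hold r C' J u'"
 shows "hold r (C + C') J (%x. u x + u' x)"
proof -
 obtain U where HU: "holder_jet r C J u U" using assms(1) unfolding hold_def by blast
 then have U: "!!x. x : J ==> U 0 x = u x" "!!i x. i <= r ==> x : J ==> \<bar>U i x\<bar> <= C"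
  "!!i x y. i < r ==> x : J ==> y : J ==> \<bar>U i y - U i x - (y - x) * U (Suc i) x\<bar> <= C * (\<bar>y - x\<bar> * sqrt \<bar>y - x\<bar>)"
  "!!x y. x : J ==> y : J ==> \<bar>U r y - U r x\<bar> <= C * sqrt \<bar>y - x\<bar>"
  by (simp_all add: holder_jet_def)
 obtain V where HV: "holder_jet r C' J u' V" using assms(2) unfolding hold_def by blast
 then have V: "!!x. x : J ==> V 0 x = u' x" "!!i x. i <= r ==> x : J ==> \<bar>V i x\<bar> <= C'"
  "!!i x y. i < r ==> x : J ==> y : J ==> \<bar>V i y - V i x - (y - x) * V (Suc i) x\<bar> <= C' * (\<bar>y - x\<bar> * sqrt \<bar>y - x\<bar>)"
  "!!x y. x : J ==> y : J ==> \<bar>V r y - V r x\<bar> <= C' * sqrt \<bar>y - x\<bar>"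
  by (simp_all add: holder_jet_def)
 show ?thesis unfolding hold_def holder_jet_def
 proof (intro exI[of _ "%i x. U i x + V i x"] conjI ballI allI impI)
  fix i x y assume "i < r" "x : J" "y : J"
  then show "\<bar>U i y + V i y - (U i x + V i x) - (y - x) * (U (Suc i) x + V (Suc i) x)\<bar> <= (C + C') * (\<bar>y - x\<bar> * sqrt \<bar>y - x\<bar>)"
  using U(3)[of i x y] V(3)[of i x y]
  abs_triangle_ineq[of "U i y - U i x - (y - x) * U (Suc i) x" "V i y - V i x - (y - x) * V (Suc i) x"]
  by (simp add: algebra_simps)
 next
  fix x y assume "x : J" "y : J"
  then show "\<bar>U r y + V r y - (U r x + V r x)\<bar> <= (C + C') * sqrt \<bar>y - x\<bar>"
  using U(4)[of x y] V(4)[of x y] abs_triangle_ineq[of "U r y - U r x" "V r y - V r x"]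
  by (simp add: algebra_simps)
 next
  fix i x assume "i <= r" "x : J"
  then show "\<bar>U i x + V i x\<bar> <= C + C'" using U(2)[of i x] V(2)[of i x] by linarith
 qed (use U V in auto)
qed

text \<open>The lower components of a jet are determined by its values through difference quotients with uniform error terms, so pointwise convergence of
the functions forces convergence of all components, and the inequalities are closed.\<close>

lemma hold_limit:
 assumes J: "open J" and hold: "!!n. hold r C J (u n)" and lim: "!!x. x : J ==> (%n. u n x) \<longlonglongrightarrow> v x"
 shows "hold r C J v"
proof (cases "J = {}")
 case True then show ?thesis by (simp add: hold_def holder_jet_def)
next
 case False
 obtain U where "!!n. holder_jet r C J (u n) (U n)" using hold unfolding hold_def by metis
 then have U: "!!n x. x : J ==> U n 0 x = u n x" "!!n i x. i <= r ==> x : J ==> \<bar>U n i x\<bar> <= C"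
  "!!n i x y. i < r ==> x : J ==> y : J ==> \<bar>U n i y - U n i x - (y - x) * U n (Suc i) x\<bar> <= C * (\<bar>y - x\<bar> * sqrt \<bar>y - x\<bar>)"
  "!!n x y. x : J ==> y : J ==> \<bar>U n r y - U n r x\<bar> <= C * sqrt \<bar>y - x\<bar>"
  by (simp_all add: holder_jet_def)
 have C: "C \<ge> 0" using False U(2)[of 0] abs_ge_zero by (meson all_not_in_conv le0 order_trans)
 have conv: "convergent (%n. U n i x)" if "i <= r" "x : J" for i x
  using that
 proof (induction i arbitrary: x)
  case 0
  then show ?case using lim U(1) by (auto simp: convergent_def)
 next
  case (Suc i)
  obtain d where d: "d > 0" "ball x d <= J" using J Suc.prems openE by blast
  have "Cauchy (%n. U n (Suc i) x)"
  proof (rule metric_CauchyI)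
  fix e :: real assume e: "e > 0"
  define q where "q = e / (4 * (C + 1))"
  have q: "q > 0" "C * q <= e/4"
  using e C by (auto simp: q_def field_simps)
  define w where "w = min (d/2) (q\<^sup>2)"
  have w: "0 < w" "w < d" using d q by (auto simp: w_def)
  have "sqrt w <= sqrt (q\<^sup>2)" unfolding w_def by (subst real_sqrt_le_iff) simp
  then have sw: "sqrt w <= q" using q by simp
  define y where "y = x + w"
  have y: "y : J" "y - x = w" using d w by (auto simp: y_def dist_real_def)
  define Q where "Q = (%n. (U n i y - U n i x) / w)"
  have QU: "\<bar>Q n - U n (Suc i) x\<bar> <= e/4" for n
  proof -
  have "\<bar>U n i y - U n i x - w * U n (Suc i) x\<bar> <= C * (w * sqrt w)"
  using U(3)[of i x y n] Suc.prems y w by simp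
  moreover have "Q n - U n (Suc i) x = (U n i y - U n i x - w * U n (Suc i) x) / w"
  using w by (simp add: Q_def field_simps)
  ultimately have "\<bar>Q n - U n (Suc i) x\<bar> <= C * sqrt w"
  using w abs_quotient_le[of "U n i y - U n i x - w * U n (Suc i) x" C w "sqrt w"] by simp
  also have "... <= C * q" using sw C by (intro mult_left_mono)
  finally show ?thesis using q by linarith
  qed
  have "convergent (%n. U n i y)" "convergent (%n. U n i x)" using Suc y by auto
  then obtain ly lx where "(%n. U n i y) \<longlonglongrightarrow> ly" "(%n. U n i x) \<longlonglongrightarrow> lx" by (auto simp: convergent_def)
  then have "Q \<longlonglongrightarrow> (ly - lx) / w" unfolding Q_def using w by (intro tendsto_intros) auto
  then have "Cauchy Q" by (rule LIMSEQ_imp_Cauchy)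
  then obtain N where N: "!!m n. m \<ge> N ==> n \<ge> N ==> dist (Q m) (Q n) < e/4"
  using e metric_CauchyD by (metis zero_less_divide_iff zero_less_numeral)
  have "dist (U m (Suc i) x) (U n (Suc i) x) < e" if "m \<ge> N" "n \<ge> N" for m n
  using N[OF that] QU[of m] QU[of n] e unfolding dist_real_def by linarith
  then show "EX N. \<forall>m\<ge>N. \<forall>n\<ge>N. dist (U m (Suc i) x) (U n (Suc i) x) < e" by blast
  qed
  then show ?case by (simp add: Cauchy_convergent_iff)
 qed
 define V where "V = (%i x. lim (%n. U n i x))"
 have V: "(%n. U n i x) \<longlonglongrightarrow> V i x" if "i <= r" "x : J" for i x
  using conv[OF that] by (simp add: V_def convergent_LIMSEQ_iff)
 have "V 0 x = v x" if "x : J" for x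
  using V[of 0 x] lim[OF that] U(1)[OF that] that LIMSEQ_unique by auto
 moreover have "\<bar>V i x\<bar> <= C" if "i <= r" "x : J" for i x
  by (rule LIMSEQ_le_const2[OF tendsto_rabs[OF V[OF that]]]) (use U(2)[OF that] in auto)
 moreover have "\<bar>V i y - V i x - (y - x) * V (Suc i) x\<bar> <= C * (\<bar>y - x\<bar> * sqrt \<bar>y - x\<bar>)"
  if "i < r" "x : J" "y : J" for i x y
 proof (rule LIMSEQ_le_const2)
  show "(%n. \<bar>U n i y - U n i x - (y - x) * U n (Suc i) x\<bar>) \<longlonglongrightarrow> \<bar>V i y - V i x - (y - x) * V (Suc i) x\<bar>"
  using that by (intro tendsto_intros V) auto
 qed (use U(3)[OF that] in auto)
 moreover have "\<bar>V r y - V r x\<bar> <= C * sqrt \<bar>y - x\<bar>" if "x : J" "y : J" for x y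
 proof (rule LIMSEQ_le_const2)
  show "(%n. \<bar>U n r y - U n r x\<bar>) \<longlonglongrightarrow> \<bar>V r y - V r x\<bar>"
  using that by (intro tendsto_intros V) auto
 qed (use U(4)[OF that] in auto)
 ultimately show ?thesis unfolding hold_def holder_jet_def by (intro exI[of _ V]) blast
qed

lemma frechet_derivative_real:
 "(G has_real_derivative d) (at z) ==> frechet_derivative G (at z) 1 = d"
 by (metis frechet_derivative_at has_field_derivative_def mult.right_neutral)

lemma hold_imp_C_nat_on:
 assumes J: "open J" and "hold r C J u"
 shows "C_nat_on r J u"
proof -
 obtain U where HU: "holder_jet r C J u U" using assms(2) unfolding hold_def by blast
 then have U: "!!x. x : J ==> U 0 x = u x"
  "!!i x y. i < r ==> x : J ==> y : J ==> \<bar>U i y - U i x - (y - x) * U (Suc i) x\<bar> <= C * (\<bar>y - x\<bar> * sqrt \<bar>y - x\<bar>)"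
  "!!x y. x : J ==> y : J ==> \<bar>U r y - U r x\<bar> <= C * sqrt \<bar>y - x\<bar>"
  by (simp_all add: holder_jet_def)
 have sq0: "((%y. C * sqrt \<bar>y - x\<bar>) \<longlongrightarrow> 0) (at x)" for x
 proof -
  have "((%y. C * sqrt \<bar>y - x\<bar>) \<longlongrightarrow> C * sqrt \<bar>x - x\<bar>) (at x)" by (intro tendsto_intros)
  then show ?thesis by simp
 qed
 have dU: "(U i has_real_derivative U (Suc i) x) (at x)" if "i < r" "x : J" for i x
  unfolding has_field_derivative_iff
 proof (rule LIM_zero_cancel, rule Lim_null_comparison[OF _ sq0])
  have "eventually (%y. y : J) (at x)" using J that(2) by (intro eventually_at_in_open') auto
  then show "\<forall>\<^sub>F y in at x. norm ((U i y - U i x) / (y - x) - U (Suc i) x) <= C * sqrt \<bar>y - x\<bar>"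
  using eventually_neq_at_within[of x x UNIV]
  proof eventually_elim
  case (elim y)
  have eq: "(U i y - U i x) / (y - x) - U (Suc i) x = (U i y - U i x - (y - x) * U (Suc i) x) / (y - x)"
  using elim by (simp add: field_simps)
  show ?case unfolding eq
  using abs_quotient_le[OF U(2)[OF that elim(1)]] elim(2) by simp
  qed
 qed
 have contr: "isCont (U r) x" if "x : J" for x
  unfolding isCont_def
 proof (rule LIM_zero_cancel, rule Lim_null_comparison[OF _ sq0])
  have "eventually (%y. y : J) (at x)" using J that by (intro eventually_at_in_open') auto
  then show "\<forall>\<^sub>F y in at x. norm (U r y - U r x) <= C * sqrt \<bar>y - x\<bar>"
  by eventually_elim (use U(3)[OF that] in auto)
 qed
 have it: "iter_deriv bs u z = U (length bs) z" if "bs : lists Basis" "length bs <= r" "z : J" for bs z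
  using that
 proof (induction bs arbitrary: z)
  case Nil then show ?case using U(1) by (simp add: iter_deriv_def)
 next
  case (Cons b bs)
  have "b : Basis" using Cons.hyps by auto
  then have b: "b = 1" by (simp add: Basis_real_def)
  have "(iter_deriv bs u has_real_derivative U (Suc (length bs)) z) (at z)"
  proof (rule has_field_derivative_transform_within_open[OF dU J])
  show "!!y. y : J ==> U (length bs) y = iter_deriv bs u y" using Cons by auto
  qed (use Cons.prems in auto)
  then show ?case using frechet_derivative_real b by (simp add: iter_deriv_def)
 qed
 have "iter_deriv bs u differentiable (at z)" if "bs : lists Basis" "length bs < r" "z : J" for bs z
 proof -
  have "(iter_deriv bs u has_real_derivative U (Suc (length bs)) z) (at z)"
  by (rule has_field_derivative_transform_within_open[OF dU J]) (use that it in auto)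
  then show ?thesis unfolding has_field_derivative_def by (rule differentiableI)
 qed
 moreover have "continuous_on J (iter_deriv bs u)" if "bs : lists Basis" "length bs <= r" for bs
 proof -
  have "isCont (U (length bs)) x" if "x : J" for x
  proof (cases "length bs = r")
  case True then show ?thesis using contr that by simp
  next
  case False
  then have "length bs < r" using \<open>length bs <= r\<close> by simp
  from dU[OF this \<open>x : J\<close>] show ?thesis by (rule DERIV_isCont)
  qed
  then have "continuous_on J (U (length bs))" by (simp add: continuous_at_imp_continuous_on)
  then show ?thesis using it[OF that] by (simp cong: continuous_on_cong)
 qed
 ultimately show ?thesis by (simp add: C_nat_on_def)
qed

lemma C_nat_on_local:
 fixes F :: "'a::euclidean_space => 'b::real_normed_vector"
 assumes "!!s. s : I ==> EX J. open J & s : J & C_nat_on n J F"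
 shows "C_nat_on n I F"
 unfolding C_nat_on_def
proof (intro conjI ballI impI)
 fix bs :: "'a list" and z assume bs: "bs : lists Basis" "length bs < n" and z: "z : I"
 then show "iter_deriv bs F differentiable at z" using assms[OF z] unfolding C_nat_on_def by blast
next
 fix bs :: "'a list" assume bs: "bs : lists Basis" "length bs <= n"
 show "continuous_on I (iter_deriv bs F)"
 proof (intro continuous_at_imp_continuous_on ballI)
  fix z assume "z : I"
  then obtain J where J: "open J" "z : J" "C_nat_on n J F" using assms by blast
  then have "continuous_on J (iter_deriv bs F)" using bs by (simp add: C_nat_on_def)
  then show "isCont (iter_deriv bs F) z" using J by (simp add: continuous_on_eq_continuous_at)
 qed
qed

lemma anl_imp_real_analytic:
 assumes "!!s. s : I ==> \<exists>rh>0. EX M. anl rh M F s"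
 shows "real_analytic_on I F"
 unfolding real_analytic_on_def
proof
 fix s assume "s : I"
 then obtain rh M where rh: "rh > 0" and "anl rh M F s" using assms by blast
 then obtain a where a: "!!i. \<bar>a i\<bar> * rh ^ i <= M" "!!v. \<bar>v\<bar> < rh ==> (%i. a i * v ^ i) sums F (s + v)"
  unfolding anl_def by blast
 have "((%al. (\<Prod>b\<in>Basis. ((z - s) \<bullet> b) ^ al b) *\<^sub>R a (al 1)) has_sum F z) (Basis \<rightarrow>\<^sub>E (UNIV :: nat set))"
  if z: "z : ball s rh" for z
 proof -
  have v: "\<bar>z - s\<bar> < rh" using z by (simp add: dist_real_def abs_minus_commute)
  have "summable (%i. norm (a i * (z - s) ^ i))"
  by (rule summable_comparison_test'[OF geometric_dominated(2)[OF a(1) v]])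
  (simp only: real_norm_def abs_abs geometric_dominated(1)[OF a(1) v])
  then have hs: "((%i. a i * (z - s) ^ i) has_sum F z) UNIV"
  using a(2)[OF v] by (intro norm_summable_imp_has_sum) auto
  define g where "g = (%n::nat. \<lambda>b\<in>(Basis::real set). n)"
  have inj: "inj g" by (rule injI) (auto simp: g_def fun_eq_iff split: if_splits)
  have img: "range g = Basis \<rightarrow>\<^sub>E (UNIV :: nat set)"
  proof (intro equalityI subsetI)
  fix al :: "real => nat" assume "al : Basis \<rightarrow>\<^sub>E UNIV"
  then have "al = g (al 1)" by (auto simp: g_def fun_eq_iff PiE_def extensional_def)
  then show "al : range g" by blast
  qed (auto simp: g_def PiE_iff)
  show ?thesis unfolding img[symmetric] has_sum_reindex[OF inj]
  using hs by (simp add: o_def g_def mult.commute)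
 qed
 then show "\<exists>rh>0. EX c. ALL z:ball s rh. ((%al. (\<Prod>b\<in>Basis. ((z - s) \<bullet> b) ^ al b) *\<^sub>R c al) has_sum F z) (Basis \<rightarrow>\<^sub>E (UNIV :: nat set))"
  using rh by (intro exI[of _ rh] conjI exI[of _ "%al. a (al 1)"]) auto
qed

section \<open>Means of logarithms over horizontal circles\<close>

lemma has_derivative_ln_norm:
 fixes h :: "real => complex"
 assumes "(h has_vector_derivative h') (at y within S)" "h y ~= 0"
 shows "((%y. ln (norm (h y))) has_real_derivative Re (h' / h y)) (at y within S)"
proof -
 have 1: "((%y. Re (h y)) has_real_derivative Re h') (at y within S)"
  "((%y. Im (h y)) has_real_derivative Im h') (at y within S)"
  using bounded_linear.has_vector_derivative[OF bounded_linear_Re assms(1)]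
  bounded_linear.has_vector_derivative[OF bounded_linear_Im assms(1)]
  by (simp_all add: has_real_derivative_iff_has_vector_derivative)
 define a b where "a = (%y. Re (h y))" and "b = (%y. Im (h y))"
 have 1: "(a has_real_derivative Re h') (at y within S)" "(b has_real_derivative Im h') (at y within S)"
  using 1 by (simp_all add: a_def b_def)
 have pos: "(a y)\<^sup>2 + (b y)\<^sup>2 > 0" unfolding a_def b_def
  using assms(2) by (simp add: complex_neq_0)
 have eq: "ln (norm z) = ln ((Re z)\<^sup>2 + (Im z)\<^sup>2) / 2" for z :: complex
  by (simp add: cmod_def ln_sqrt)
 have half: "1 / Q * (2 * N) / 2 = N / Q" for Q N :: real by simp
 have "((%y. (a y)\<^sup>2 + (b y)\<^sup>2) has_real_derivative 2 * (a y * Re h' + b y * Im h')) (at y within S)"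
  by (auto intro!: derivative_eq_intros 1 simp: algebra_simps)
 from DERIV_cdivide[OF DERIV_chain2[OF DERIV_ln_divide[OF pos] this], of 2]
 have "((%y. ln ((a y)\<^sup>2 + (b y)\<^sup>2) / 2) has_real_derivative
  (a y * Re h' + b y * Im h') / ((a y)\<^sup>2 + (b y)\<^sup>2)) (at y within S)"
  unfolding half .
 moreover have "(a y * Re h' + b y * Im h') / ((a y)\<^sup>2 + (b y)\<^sup>2) = Re (h' / h y)"
  by (simp add: Re_divide a_def b_def algebra_simps)
 ultimately show ?thesis by (simp add: eq a_def b_def)
qed

text \<open>The derivative of the mean in the height is, up to sign, the imaginary part of the integral of \<open>D' / D\<close> over the circle. By Cauchy's theorem and periodicity
that integral does not depend on the height as long as no zero is met.\<close>

lemma mean_log_affine: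
 fixes D :: "complex => complex"
 assumes hol: "D holomorphic_on {z. \<bar>Im z\<bar> < de}" and per: "!!z. \<bar>Im z\<bar> < de ==> D (z + 1) = D z"
  and si: "\<bar>si\<bar> = 1" and t: "0 < t" "2 * t < de"
  and nz: "!!th y. 0 <= y ==> y <= 2 * t ==> D (Complex th (si * y)) ~= 0"
 shows "integral {0..1} (%th. ln (norm (D (Complex th 0)))) =
  2 * integral {0..1} (%th. ln (norm (D (Complex th (si * t))))) -
  integral {0..1} (%th. ln (norm (D (Complex th (si * (2 * t))))))"
proof -
 define W where "W = {z. \<bar>Im z\<bar> < de} \<inter> {z. \<bar>Im z\<bar> < de & D z ~= 0}"
 have oS: "open {z. \<bar>Im z\<bar> < de}"
  by (intro open_Collect_less continuous_intros)
 have oW: "open W"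
 proof -
  have "open ({z. \<bar>Im z\<bar> < de} \<inter> D -` (- {0}))"
  using continuous_open_preimage[OF holomorphic_on_imp_continuous_on[OF hol] oS] by blast
  moreover have "W = {z. \<bar>Im z\<bar> < de} \<inter> D -` (- {0})" by (auto simp: W_def)
  ultimately show ?thesis by simp
 qed
 have inW: "Complex th (si * y) : W" if "0 <= y" "y <= 2 * t" for th y
  using that nz[OF that] si t by (auto simp: W_def abs_mult)
 have holW: "D holomorphic_on W" using hol by (rule holomorphic_on_subset) (auto simp: W_def)
 define g where "g = (%z. deriv D z / D z)"
 have holg: "g holomorphic_on W" unfolding g_def
  by (intro holomorphic_intros holW oW) (auto simp: W_def)
 have perd: "deriv D (z + 1) = deriv D z" if "\<bar>Im z\<bar> < de" for z
 proof -
  have "((%z. D (z + 1)) has_field_derivative deriv D (z + 1)) (at z)"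
  using holomorphic_derivI[OF hol oS, of "z + 1" UNIV] that by (simp add: DERIV_shift[THEN iffD1])
  then have "(D has_field_derivative deriv D (z + 1)) (at z)"
  by (rule has_field_derivative_transform_within_open[OF _ oS]) (use that per in auto)
  then show ?thesis by (simp add: DERIV_imp_deriv)
 qed
 have perg: "g (z + 1) = g z" if "\<bar>Im z\<bar> < de" for z
  using per[OF that] perd[OF that] by (simp add: g_def)
 let ?U = "{0..2 * t}"
 let ?c = "%y th. Complex th (si * y)"
 have c_vd: "((%y. ?c y th) has_vector_derivative \<i> * of_real si) (at y within S)" for y th S
  unfolding Complex_eq by (auto intro!: derivative_eq_intros simp: has_vector_derivative_def scaleR_conv_of_real mult_ac)
 have c_vd': "((%th. ?c y th) has_vector_derivative 1) (at th within S)" for y th S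
  unfolding Complex_eq by (auto intro!: derivative_eq_intros simp: has_vector_derivative_def scaleR_conv_of_real mult_ac)
 have contc: "continuous_on T (%(y, th). ?c y th)" for T
  unfolding Complex_eq case_prod_unfold by (intro continuous_intros)
 have contF: "continuous_on (?U \<times> cbox 0 1) (%(y, th). F (?c y th))" if "continuous_on W F" for F :: "complex => complex"
 proof -
  have "continuous_on (?U \<times> cbox 0 1) (%p. F ((%(y, th). ?c y th) p))"
  by (rule continuous_on_compose2[OF that contc]) (auto intro: inW)
  then show ?thesis by (simp add: case_prod_unfold)
 qed
 have contF1: "continuous_on (cbox 0 1) (%th. F (?c y th))" if "continuous_on W F" "y : ?U" for F :: "complex => complex" and y
 proof (rule continuous_on_compose2[OF that(1)])
  show "continuous_on (cbox 0 1) (%th. ?c y th)" unfolding Complex_eq by (intro continuous_intros)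
 qed (use that inW in auto)
 define ph where "ph = (%y. integral (cbox 0 1) (%th. ln (norm (D (?c y th)))))"
 define \<psi> where "\<psi> = (%y. integral (cbox 0 1) (%th. g (?c y th)))"
 have contD: "continuous_on W D" and contg: "continuous_on W g"
  using holW holg holomorphic_on_imp_continuous_on by blast+
 have contg': "continuous_on W (deriv g)"
  using holg oW holomorphic_deriv holomorphic_on_imp_continuous_on by blast
 have d\<psi>: "(\<psi> has_vector_derivative 0) (at y within ?U)" if y: "y : ?U" for y
 proof -
  have "((%y. integral (cbox 0 1) (%th. g (?c y th))) has_vector_derivative
  integral (cbox 0 1) (%th. \<i> * of_real si * deriv g (?c y th))) (at y within ?U)"
  proof (rule leibniz_rule_vector_derivative[where fx = "%y th. \<i> * of_real si * deriv g (?c y th)"])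
  fix y th assume y: "y : ?U" and "th : cbox 0 (1::real)"
  have "(g has_field_derivative deriv g (?c y th)) (at (?c y th))"
  using holomorphic_derivI[OF holg oW] inW y by auto
  from field_vector_diff_chain_within[OF c_vd has_field_derivative_at_within[OF this], of ?U]
  show "((%y. g (?c y th)) has_vector_derivative \<i> * of_real si * deriv g (?c y th)) (at y within ?U)"
  by (simp add: o_def mult_ac)
  next
  show "(%th. g (?c y th)) integrable_on cbox 0 1" if "y : ?U" for y
  by (intro integrable_continuous contF1 contg that)
  show "continuous_on (?U \<times> cbox 0 1) (%(y, th). \<i> * of_real si * deriv g (?c y th))"
  using contF[OF contg'] by (auto simp: case_prod_unfold intro!: continuous_intros)
  qed (use y in auto)
  moreover have "integral (cbox 0 1) (%th. \<i> * of_real si * deriv g (?c y th)) = 0"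
  proof -
  have "((%th. deriv g (?c y th)) has_integral (g (?c y 1) - g (?c y 0))) {0..1}"
  proof (rule fundamental_theorem_of_calculus)
  fix th :: real
  have "(g has_field_derivative deriv g (?c y th)) (at (?c y th))"
  using holomorphic_derivI[OF holg oW] inW y by auto
  from field_vector_diff_chain_within[OF c_vd' has_field_derivative_at_within[OF this], of "{0..1}"]
  show "((%th. g (?c y th)) has_vector_derivative deriv g (?c y th)) (at th within {0..1})"
  by (simp add: o_def)
  qed simp
  moreover have "?c y 1 = ?c y 0 + 1" by (simp add: complex_eq_iff)
  moreover have "\<bar>Im (?c y 0)\<bar> < de" using y t si by (simp add: abs_mult)
  ultimately have "((%th. deriv g (?c y th)) has_integral 0) (cbox 0 1)" using perg by simp
  from integral_unique[OF has_integral_mult_right[OF this, of "\<i> * of_real si"]]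
  show ?thesis by (simp only: mult_zero_right)
  qed
  ultimately show ?thesis unfolding \<psi>_def by (simp only:)
 qed
 obtain k where k: "!!y. y : ?U ==> \<psi> y = k"
  using has_vector_derivative_zero_constant[OF _ d\<psi>] by (metis convex_real_interval(5))
 have d\<phi>: "(ph has_real_derivative Re (\<i> * of_real si * k)) (at y within ?U)" if y: "y : ?U" for y
 proof -
  have "((%y. integral (cbox 0 1) (%th. ln (norm (D (?c y th))))) has_real_derivative
  integral (cbox 0 1) (%th. Re (\<i> * of_real si * g (?c y th)))) (at y within ?U)"
  proof (rule leibniz_rule_field_derivative[where fx = "%y th. Re (\<i> * of_real si * g (?c y th))"])
  fix y th assume y: "y : ?U" and "th : cbox 0 (1::real)"
  have "(D has_field_derivative deriv D (?c y th)) (at (?c y th))"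
  using holomorphic_derivI[OF holW oW] inW y by auto
  from field_vector_diff_chain_within[OF c_vd has_field_derivative_at_within[OF this], of ?U]
  have "((%y. D (?c y th)) has_vector_derivative \<i> * of_real si * deriv D (?c y th)) (at y within ?U)"
  by (simp add: o_def mult_ac)
  from has_derivative_ln_norm[OF this] nz[of y th] y
  show "((%y. ln (norm (D (?c y th)))) has_real_derivative Re (\<i> * of_real si * g (?c y th))) (at y within ?U)"
  by (simp add: g_def mult_ac)
  next
  fix y assume y: "y : ?U"
  have "continuous_on (cbox 0 1) (%th. ln (norm (D (?c y th))))"
  using contF1[OF contD y] nz y by (auto intro!: continuous_intros)
  then show "(%th. ln (norm (D (?c y th)))) integrable_on cbox 0 1" by (rule integrable_continuous)
  next
  show "continuous_on (?U \<times> cbox 0 1) (%(y, th). Re (\<i> * of_real si * g (?c y th)))"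
  using contF[OF contg] by (auto simp only: case_prod_unfold intro!: continuous_intros)
  qed (use y in auto)
  moreover have "integral (cbox 0 1) (%th. Re (\<i> * of_real si * g (?c y th))) = Re (\<i> * of_real si * k)"
  proof -
  have "((%th. g (?c y th)) has_integral k) (cbox 0 1)"
  using k[OF y] contF1[OF contg y] unfolding \<psi>_def by (metis integrable_continuous integrable_integral)
  then have "((%th. Re (\<i> * of_real si * g (?c y th))) has_integral Re (\<i> * of_real si * k)) (cbox 0 1)"
  by (intro has_integral_Re has_integral_mult_right)
  then show ?thesis by (rule integral_unique)
  qed
  ultimately show ?thesis unfolding ph_def by (simp only:)
 qed
 define ka where "ka = Re (\<i> * of_real si * k)"
 have "((%y. ph y - ka * y) has_field_derivative 0) (at y within ?U)" if "y : ?U" for y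
  using d\<phi>[OF that] by (auto intro!: derivative_eq_intros simp: ka_def)
 then obtain b where b: "!!y. y : ?U ==> ph y - ka * y = b"
  using has_field_derivative_zero_constant[of ?U "%y. ph y - ka * y"] by (metis convex_real_interval(5))
 have "ph 0 = 2 * ph t - ph (2 * t)" using b[of 0] b[of t] b[of "2 * t"] t by simp
 then show ?thesis by (simp add: ph_def)
qed
section \<open>Holomorphic approximation of jets\<close>

lemma bounded_entire_lipschitz:
 assumes "f holomorphic_on UNIV"
 obtains L where "L > 0" "!!z. norm z <= 4 ==> norm (f z - f 0) <= L * norm z"
proof -
 have "continuous_on (cball 0 4) (deriv f)"
  using assms by (meson holomorphic_deriv holomorphic_on_imp_continuous_on holomorphic_on_subset open_UNIV subset_UNIV)
 then have "bounded (deriv f ` cball 0 4)" by (intro compact_imp_bounded compact_continuous_image) auto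
 then obtain L where L: "L > 0" "!!z. norm z <= 4 ==> norm (deriv f z) <= L"
  unfolding bounded_pos by auto
 have "norm (f z - f 0) <= L * norm (z - 0)" if "norm z <= 4" for z
 proof (rule field_differentiable_bound[of "cball 0 4" f "deriv f"])
  fix w show "(f has_field_derivative deriv f w) (at w within cball 0 4)"
  using assms holomorphic_derivI[of f UNIV] by auto
 qed (use L that in auto)
 then show ?thesis using L that by simp
qed

lemma hol_sin: "(%z. sin (complex_of_real pi * z)) holomorphic_on UNIV"
 and hol_cos: "(%z. cos (complex_of_real pi * z)) holomorphic_on UNIV"
 by (intro holomorphic_intros)+

text \<open>A periodic function that agrees with the identity to high order at the origin can replace \<open>z\<close> in Taylor polynomials without
destroying periodicity.\<close>

lemma exists_periodic_coordinate:
 obtains ta :: "complex => complex" and C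
 where "ta holomorphic_on UNIV" "!!z. ta (z + 1) = ta z" "!!x. Im (ta (of_real x)) = 0"
  "C > 0" "!!z. norm z <= 1 ==> norm (ta z - z) <= C * norm z ^ K"
proof -
 define f where "f = (%z::complex. sin (of_real pi * z) ^ (2 * K))"
 have holf: "f holomorphic_on UNIV" unfolding f_def by (intro holomorphic_intros)
 obtain S0 where S0: "!!z. (S0 has_field_derivative f z) (at z)"
  using holomorphic_convex_primitive'[of UNIV f] holf by auto
 define S where "S = (%z. S0 z - S0 0)"
 have S: "(S has_field_derivative f z) (at z within T)" for z T
  unfolding S_def using DERIV_subset[OF S0] by (auto intro!: derivative_eq_intros)
 have S_0: "S 0 = 0" by (simp add: S_def)
 have fper: "f (z + 1) = f z" for z
  by (simp add: f_def distrib_left sin_add power_mult)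
 define ka where "ka = S 1"
 have "((%z. S (z + 1) - S z) has_field_derivative 0) (at z within UNIV)" for z
 proof -
  have "((%z. S (z + 1)) has_field_derivative f (z + 1)) (at z)"
  by (rule DERIV_shift[THEN iffD1]) (rule S)
  then show ?thesis using DERIV_diff[OF _ S[of z UNIV]] fper by fastforce
 qed
 then obtain k where k: "!!z. S (z + 1) - S z = k"
  using has_field_derivative_zero_constant[of UNIV "%z. S (z + 1) - S z"] by auto
 have Sper: "S (z + 1) = S z + ka" for z using k[of z] k[of 0] S_0 by (simp add: ka_def algebra_simps)
 have fx: "f (of_real x) = of_real (sin (pi * x) ^ (2 * K))" for x
  by (simp add: f_def flip: sin_of_real of_real_mult)
 have vd: "((%x. S (of_real x)) has_vector_derivative of_real (sin (pi * x) ^ (2 * K))) (at x within T)" for x T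
  using has_vector_derivative_real_field[OF S[of "of_real x" UNIV]] fx by simp
 have ImS: "Im (S (of_real x)) = 0" for x
 proof -
  have "((%x. Im (S (of_real x))) has_vector_derivative Im (of_real (sin (pi * x) ^ (2 * K)))) (at x within UNIV)" for x
  by (rule bounded_linear.has_vector_derivative[OF bounded_linear_Im vd])
  then have "((%x. Im (S (of_real x))) has_vector_derivative 0) (at x within UNIV)" for x by simp
  then obtain c where "!!x. Im (S (of_real x)) = c"
  using has_vector_derivative_zero_constant[of UNIV "%x. Im (S (of_real x))"] by auto
  from this[of x] this[of 0] show ?thesis using S_0 by simp
 qed
 have dRe: "((%x. Re (S (of_real x))) has_real_derivative sin (pi * x) ^ (2 * K)) (at x)" for x
  using bounded_linear.has_vector_derivative[OF bounded_linear_Re vd, of x UNIV]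
  by (simp add: has_real_derivative_iff_has_vector_derivative)
 have "Re (S (of_real 0)) < Re (S (of_real 1))"
 proof (rule DERIV_pos_imp_increasing_open[of 0 1 "%x. Re (S (of_real x))"])
  fix x :: real assume x: "0 < x" "x < 1"
  then have "sin (pi * x) > 0" by (intro sin_gt_zero) auto
  then show "EX y. ((%x. Re (S (of_real x))) has_real_derivative y) (at x) & y > 0" using dRe by (meson zero_less_power)
 next
  show "continuous_on {0..1} (%x. Re (S (of_real x)))"
  using dRe by (meson DERIV_isCont continuous_at_imp_continuous_on)
 qed simp
 then have Re\<kappa>: "Re ka > 0" using S_0 by (simp add: ka_def)
 then have ka0: "ka ~= 0" by auto
 have Im\<kappa>: "Im ka = 0" using ImS[of 1] by (simp add: ka_def)
 define ta where "ta = (%z. z - S z / ka)"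
 obtain L where L: "L > 0" "!!z. norm z <= 4 ==> norm (sin (of_real pi * z) - sin (of_real pi * 0)) <= L * norm (z::complex)"
  using bounded_entire_lipschitz[OF hol_sin] by blast
 have bf: "norm (f w) <= (L * norm z) ^ (2 * K)" if "norm w <= norm z" "norm z <= 1" for w z
 proof -
  have "norm (sin (of_real pi * w)) <= L * norm w" using L(2)[of w] that by simp
  also have "... <= L * norm z" using that L by (intro mult_left_mono) auto
  finally show ?thesis unfolding f_def norm_power by (intro power_mono) auto
 qed
 have bS: "norm (S z) <= L ^ (2 * K) * norm z ^ K" if z: "norm z <= 1" for z
 proof -
  have "norm (S z - S 0) <= (L * norm z) ^ (2 * K) * norm (z - 0)"
  by (rule field_differentiable_bound[of "cball 0 (norm z)" S f]) (use S bf z in auto)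
  also have "... = L ^ (2 * K) * (norm z ^ K * (norm z ^ K * norm z))"
  by (simp add: power_mult_distrib mult_2 power_add)
  also have "... <= L ^ (2 * K) * (norm z ^ K * 1)"
  using z L by (intro mult_left_mono mult_le_one power_le_one) auto
  finally show ?thesis using S_0 by simp
 qed
 show ?thesis
 proof (rule that[of ta "L ^ (2 * K) / norm ka"])
  have "S holomorphic_on UNIV" using S by (auto simp: holomorphic_on_def field_differentiable_def)
  then show "ta holomorphic_on UNIV" unfolding ta_def using ka0 by (intro holomorphic_intros) auto
  show "ta (z + 1) = ta z" for z using ka0 by (simp add: ta_def Sper add_divide_distrib)
  show "Im (ta (of_real x)) = 0" for x using ImS[of x] Im\<kappa> by (simp add: ta_def Im_divide)
  show "L ^ (2 * K) / norm ka > 0" using L ka0 by simp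
  show "norm (ta z - z) <= L ^ (2 * K) / norm ka * norm z ^ K" if "norm z <= 1" for z
  using bS[OF that] ka0 by (simp add: ta_def norm_divide divide_right_mono)
 qed
qed

subsection \<open>Localised periodic weights\<close>

text \<open>A periodic kernel of width \<open>1/N\<close>, holomorphic in the strip of height comparable to \<open>1/N\<close>, with decay fast enough for moments of order \<open>K\<close>.\<close>

definition ker :: "nat => nat => complex => complex" where
 "ker K N z = inverse (1 / of_nat N ^ 2 + sin (of_real pi * z) ^ 2) ^ Suc K"

definition kr :: "nat => nat => real => real" where
 "kr K N x = inverse (1 / real N ^ 2 + sin (pi * x) ^ 2) ^ Suc K"

lemma ker_of_real: "ker K N (of_real x) = of_real (kr K N x)"
proof -
 have "1 / of_nat N ^ 2 + sin (of_real pi * of_real x) ^ 2 = complex_of_real (1 / real N ^ 2 + sin (pi * x) ^ 2)"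
  by (simp add: sin_of_real flip: of_real_mult)
 then show ?thesis by (simp only: ker_def kr_def of_real_power of_real_inverse)
qed

lemma kr_pos: "N \<ge> 1 ==> kr K N x > 0"
 unfolding kr_def by (intro zero_less_power positive_imp_inverse_positive add_pos_nonneg) auto

lemma ker_plus_1: "ker K N (z + 1) = ker K N z"
 by (simp add: ker_def distrib_left sin_add)

lemma ker_perturb:
 obtains c where "0 < c" "c <= 1/2"
  "!!N x de. N \<ge> 1 ==> norm de <= c / real N ==>
  1 / of_nat N ^ 2 + sin (of_real pi * (of_real x + de)) ^ 2 ~= (0::complex) \<and>
  norm (ker K N (of_real x + de) - of_real (kr K N x)) <= kr K N x / 2"
proof -
 have "isCont (%om::complex. inverse om ^ Suc K) 1" by (intro continuous_intros) auto
 then obtain et0 where et0: "et0 > 0" "!!om. dist om 1 < et0 ==> dist (inverse om ^ Suc K) ((inverse 1 ^ Suc K)::complex) < 1/2"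
  unfolding continuous_at_eps_delta by (metis half_gt_zero_iff zero_less_one)
 define et where "et = min (et0 / 2) (1/2)"
 have et: "0 < et" "et < 1" using et0 by (auto simp: et_def)
 have et3: "norm (inverse om ^ Suc K - 1) <= (1/2::real)" if "dist om 1 <= et" for om :: complex
 proof -
  have "dist om 1 < et0" using et0(1) that by (auto simp: et_def)
  from et0(2)[OF this] show ?thesis by (simp add: dist_norm)
 qed
 obtain L1 where L1: "L1 > 0" "!!z. norm z <= 4 ==> norm (sin (of_real pi * z) - sin (of_real pi * 0)) <= L1 * norm (z::complex)"
  using bounded_entire_lipschitz[OF hol_sin] by blast
 obtain L2 where L2: "L2 > 0" "!!z. norm z <= 4 ==> norm (cos (of_real pi * z) - cos (of_real pi * 0)) <= L2 * norm (z::complex)"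
  using bounded_entire_lipschitz[OF hol_cos] by blast
 define Q where "Q = L1 * (1 + L2 + L1)"
 have Q: "Q > 0" using L1 L2 by (simp add: Q_def add_pos_pos)
 define c where "c = min (1/2) (et / Q)"
 have c: "0 < c" "c <= 1/2" "Q * c <= et" using et(1) Q by (auto simp: c_def min_def field_simps)
 show ?thesis
 proof (rule that[OF c(1,2)])
  fix N :: nat and x :: real and de :: complex
  assume N: "N \<ge> 1" and de: "norm de <= c / real N"
  define G where "G = 1 / real N ^ 2 + sin (pi * x) ^ 2"
  have G: "G > 0" using N by (simp add: G_def add_pos_nonneg)
  define iN where "iN = 1 / real N"
  have iN: "iN > 0" using N by (simp add: iN_def)
  have Gi: "G = iN^2 + \<bar>sin (pi * x)\<bar>^2" by (simp add: G_def iN_def power_divide)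
  have de': "norm de <= c * iN" using de by (simp add: iN_def)
  have cN: "c / real N <= 1/2" using c N by (simp add: field_simps)
  have de1: "norm de <= 1" using de cN by linarith
  have s\<delta>: "norm (sin (of_real pi * de)) <= L1 * norm de" using L1(2)[of de] de1 by simp
  have c\<delta>: "norm (cos (of_real pi * de)) <= 1 + L2"
  proof -
  have "norm (cos (of_real pi * de) - 1) <= L2 * norm de" using L2(2)[of de] de1 by simp
  also have "... <= L2 * 1" using de1 L2 by (intro mult_left_mono) auto
  finally show ?thesis using norm_triangle_ineq2[of "cos (of_real pi * de)" 1] by simp
  qed
  let ?X = "complex_of_real (pi * x)" and ?\<Delta> = "complex_of_real pi * de"
  have prod: "sin (?X + ?\<Delta>) ^ 2 - sin ?X ^ 2 = sin (2 * ?X + ?\<Delta>) * sin ?\<Delta>"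
  proof -
  have half: "(1 - 2 * A - (1 - 2 * B)) / 2 = B - A" for A B :: complex by (simp add: field_simps)
  have "sin (2 * ?X + ?\<Delta>) * sin ?\<Delta> = (cos (2 * ?X + ?\<Delta> - ?\<Delta>) - cos (2 * ?X + ?\<Delta> + ?\<Delta>)) / 2"
  by (rule sin_times_sin)
  also have "... = (cos (2 * ?X) - cos (2 * (?X + ?\<Delta>))) / 2" by (simp add: algebra_simps)
  also have "... = sin (?X + ?\<Delta>) ^ 2 - sin ?X ^ 2" unfolding cos_double_sin[of ?X] cos_double_sin[of "?X + ?\<Delta>"] by (rule half)
  finally show ?thesis by simp
  qed
  have n1: "norm (sin (2 * ?X + ?\<Delta>)) <= 2 * \<bar>sin (pi * x)\<bar> * (1 + L2) + L1 * norm de"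
  proof -
  have sx: "norm (sin (2 * ?X)) <= 2 * \<bar>sin (pi * x)\<bar>"
  proof -
  have "2 * ?X = complex_of_real (2 * (pi * x))" by simp
  then have "sin (2 * ?X) = of_real (sin (2 * (pi * x)))" by (simp only: sin_of_real)
  then have "norm (sin (2 * ?X)) = \<bar>sin (2 * (pi * x))\<bar>" by simp
  also have "... = 2 * \<bar>sin (pi * x)\<bar> * \<bar>cos (pi * x)\<bar>" by (simp add: sin_double abs_mult)
  also have "... <= 2 * \<bar>sin (pi * x)\<bar> * 1" by (intro mult_left_mono) auto
  finally show ?thesis by simp
  qed
  have cx: "norm (cos (2 * ?X)) <= 1"
  proof -
  have "2 * ?X = complex_of_real (2 * (pi * x))" by simp
  then have "cos (2 * ?X) = of_real (cos (2 * (pi * x)))" by (simp only: cos_of_real)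
  then show ?thesis by (simp only: norm_of_real) simp
  qed
  have "norm (sin (2 * ?X + ?\<Delta>)) <= norm (sin (2 * ?X)) * norm (cos ?\<Delta>) + norm (cos (2 * ?X)) * norm (sin ?\<Delta>)"
  unfolding sin_add by (metis norm_mult norm_triangle_ineq)
  also have "... <= 2 * \<bar>sin (pi * x)\<bar> * (1 + L2) + 1 * (L1 * norm de)"
  using sx cx s\<delta> c\<delta> L1 by (intro add_mono mult_mono) auto
  finally show ?thesis by simp
  qed
  have nd: "norm (sin (?X + ?\<Delta>) ^ 2 - sin ?X ^ 2) <= et * G"
  proof -
  have "norm (sin (?X + ?\<Delta>) ^ 2 - sin ?X ^ 2) <= (2 * \<bar>sin (pi * x)\<bar> * (1 + L2) + L1 * norm de) * (L1 * norm de)"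
  unfolding prod norm_mult using n1 s\<delta> L1 L2 by (intro mult_mono) auto
  also have "... <= (2 * \<bar>sin (pi * x)\<bar> * (1 + L2) + L1 * (c * iN)) * (L1 * (c * iN))"
  using de' iN L1 L2 c by (intro mult_mono add_mono) auto
  also have "... = L1 * c * ((1 + L2) * (2 * \<bar>sin (pi * x)\<bar> * iN) + L1 * (c * iN^2))"
  by (simp add: power2_eq_square algebra_simps)
  also have "... <= L1 * c * ((1 + L2) * G + L1 * G)"
  proof (intro mult_left_mono add_mono)
  show "2 * \<bar>sin (pi * x)\<bar> * iN <= G"
  using zero_le_power2[of "\<bar>sin (pi * x)\<bar> - iN"] by (simp add: Gi power2_eq_square algebra_simps)
  have "c * iN^2 <= 1 * iN^2" using c by (intro mult_right_mono) auto
  also have "... <= G" by (simp add: Gi)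
  finally show "c * iN^2 <= G" .
  qed (use L1 L2 c in auto)
  also have "... = Q * c * G" by (simp add: Q_def algebra_simps)
  also have "... <= et * G" using c G by (intro mult_right_mono) auto
  finally show ?thesis .
  qed
  define g where "g = 1 / of_nat N ^ 2 + sin (of_real pi * (of_real x + de)) ^ 2"
  have gG: "norm (g - of_real G) <= et * G"
  proof -
  have "g - of_real G = sin (?X + ?\<Delta>) ^ 2 - sin ?X ^ 2"
  by (simp add: g_def G_def distrib_left sin_of_real flip: of_real_mult)
  then show ?thesis using nd by simp
  qed
  define om where "om = g / of_real G"
  have "om - 1 = (g - of_real G) / of_real G" using G by (simp add: om_def field_simps)
  then have "norm (om - 1) <= et" using gG G by (simp add: norm_divide divide_le_eq)
  then have om: "dist om 1 <= et" by (simp add: dist_norm)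
  have "om ~= 0" using om et(2) by auto
  then have g0: "g ~= 0" by (auto simp: om_def)
  have "ker K N (of_real x + de) = inverse g ^ Suc K" by (simp add: ker_def g_def)
  also have "... = inverse om ^ Suc K * of_real (kr K N x)"
  using G by (simp add: om_def kr_def G_def[symmetric] power_mult_distrib[symmetric] flip: of_real_inverse of_real_power) (simp add: field_simps)
  finally have "ker K N (of_real x + de) - of_real (kr K N x) = (inverse om ^ Suc K - 1) * of_real (kr K N x)"
  by (simp add: algebra_simps)
  then have "norm (ker K N (of_real x + de) - of_real (kr K N x)) <= 1/2 * kr K N x"
  using et3[OF om] kr_pos[OF N, of K x] by (simp add: norm_mult mult_right_mono del: power_Suc)
  then show "1 / of_nat N ^ 2 + sin (of_real pi * (of_real x + de)) ^ 2 ~= (0::complex) \<and>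
  norm (ker K N (of_real x + de) - of_real (kr K N x)) <= kr K N x / 2"
  using g0 by (simp add: g_def)
 qed
qed

lemma sum_inverse_squares_bounded:
 obtains C :: real where "C > 0" "!!(E::int set) y. finite E ==> (\<Sum>e\<in>E. 1 / (1 + (y - of_int e)^2)) <= C"
proof -
 define g where "g = (%n::nat. 1 / (1 + real n ^ 2))"
 have sg: "summable g"
 proof (rule summable_comparison_test_ev)
  show "eventually (%n. norm (g n) <= 1 / real n ^ 2) sequentially"
  using eventually_gt_at_top[of 0] by eventually_elim (auto simp: g_def intro!: divide_left_mono mult_pos_pos add_pos_nonneg)
  show "summable (%n. 1 / real n ^ 2)" using inverse_power_summable[of 2, where ?'a = real] by (simp add: inverse_eq_divide)
 qed
 have half: "(\<Sum>j\<in>E. 1 / (1 + (of_int j)^2)) <= suminf g" if "finite E" "inj_on (%j. nat \<bar>j\<bar>) E" for E :: "int set"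
 proof -
  have "(\<Sum>j\<in>E. 1 / (1 + (of_int j)^2)) = (\<Sum>j\<in>E. g (nat \<bar>j\<bar>))" by (simp add: g_def)
  also have "... = sum g ((%j. nat \<bar>j\<bar>) ` E)" using that by (simp add: sum.reindex)
  also have "... <= suminf g" using that sg by (intro sum_le_suminf) (auto simp: g_def)
  finally show ?thesis .
 qed
 have int: "(\<Sum>j\<in>E. 1 / (1 + (of_int j)^2)) <= 2 * suminf g" if "finite E" for E :: "int set"
 proof -
  have "E = (E \<inter> {0..}) \<union> (E \<inter> {..<0})" by auto
  then have "(\<Sum>j\<in>E. 1 / (1 + (of_int j)^2)) = (\<Sum>j\<in>E \<inter> {0..}. 1 / (1 + (of_int j)^2)) + (\<Sum>j\<in>E \<inter> {..<0}. 1 / (1 + (of_int j)^2 :: real))"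
  using that by (subst sum.union_disjoint[symmetric]) (auto intro!: sum.cong)
  also have "... <= suminf g + suminf g"
  using that by (intro add_mono half) (auto simp: inj_on_def)
  finally show ?thesis by simp
 qed
 have "suminf g \<ge> g 0" using sum_le_suminf[OF sg, of "{0}"] by (simp add: g_def)
 then have pos: "suminf g > 0" by (simp add: g_def)
 show ?thesis
 proof (rule that[of "3 * (2 * suminf g)"])
  fix E :: "int set" and y :: real assume fin: "finite E"
  define f where "f = \<lfloor>y\<rfloor>"
  have f: "0 <= y - of_int f" "y - of_int f <= 1" unfolding f_def by linarith+
  have "1 / (1 + (y - of_int e)^2) <= 3 * (1 / (1 + (of_int (e - f))^2))" for e
  proof -
  define p q where "p = y - of_int e" and "q = y - of_int f"
  have "(of_int (e - f))^2 = (q - p)^2" by (simp add: p_def q_def)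
  also have "... <= 2 * p^2 + 2 * q^2" using zero_le_power2[of "p + q"] by (simp add: power2_eq_square algebra_simps)
  also have "... <= 2 * p^2 + 2 * 1" using f by (intro add_left_mono mult_left_mono power_le_one) (auto simp: q_def)
  finally have h: "1 + (of_int (e - f))^2 <= 3 * (1 + p^2)" by (smt (verit) zero_le_power2)
  have p1: "1 + p^2 > 0" "1 + (of_int (e - f))^2 > (0::real)" by (auto intro: add_pos_nonneg)
  have "1 / (1 + p^2) <= 3 / (1 + (of_int (e - f))^2)"
  using h p1 by (simp add: divide_le_eq pos_le_divide_eq mult.commute)
  then show ?thesis by (simp add: p_def)
  qed
  then have "(\<Sum>e\<in>E. 1 / (1 + (y - of_int e)^2)) <= (\<Sum>e\<in>E. 3 * (1 / (1 + (of_int (e - f))^2)))"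
  by (intro sum_mono) auto
  also have "... = 3 * (\<Sum>j\<in>(%e. e - f) ` E. 1 / (1 + (of_int j)^2))"
  by (simp add: sum_distrib_left sum.reindex inj_on_def)
  also have "... <= 3 * (2 * suminf g)" using int[of "(%e. e - f) ` E"] fin by simp
  finally show "(\<Sum>e\<in>E. 1 / (1 + (y - of_int e)^2)) <= 3 * (2 * suminf g)" .
 qed (use pos in simp)
qed

lemma sin_pi_lower: "\<bar>x\<bar> <= 1/2 ==> \<bar>x\<bar> <= \<bar>sin (pi * x)\<bar>"
proof -
 have main: "x <= sin (pi * x)" if x: "0 <= x" "x <= 1/2" for x :: real
 proof (cases "x <= 1/6")
  case True
  show ?thesis
  proof (cases "x = 0")
  case False
  then have "pi * x > 0" using x by simp
  then obtain \<xi> where \<xi>: "0 < \<xi>" "\<xi> < pi * x" "sin (pi * x) - sin 0 = (pi * x - 0) * cos \<xi>"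
  using MVT2[of 0 "pi * x" sin cos] by (auto intro!: derivative_eq_intros)
  have "pi * x <= pi * (1/6)" using True by (intro mult_left_mono) auto
  then have "\<xi> <= pi / 3" using \<xi>(2) pi_gt_zero by linarith
  then have "cos \<xi> \<ge> cos (pi / 3)" using \<xi>(1) by (intro cos_monotone_0_pi_le) auto
  then have "cos \<xi> \<ge> 1/2" by (simp add: cos_60)
  then have h1: "pi * x * cos \<xi> \<ge> pi * x * (1/2)" using x by (intro mult_left_mono) auto
  have h2: "2 * x <= pi * x" using x pi_ge_two by (intro mult_right_mono) auto
  have "sin (pi * x) = pi * x * cos \<xi>" using \<xi>(3) by simp
  then show ?thesis using h1 h2 by linarith
  qed simp
 next
  case False
  have "sin (pi / 6) <= sin (pi * x)"
  proof (rule sin_monotone_2pi_le)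
  show "pi / 6 <= pi * x" using False mult_left_mono[of "1/6" x pi] by simp
  show "pi * x <= pi / 2" using x mult_left_mono[of x "1/2" pi] by simp
  qed (simp add: pi_ge_two)
  then show ?thesis using x by (simp add: sin_30)
 qed
 assume "\<bar>x\<bar> <= 1/2"
 then show ?thesis using main[of x] main[of "-x"] by (cases "x \<ge> 0") auto
qed
text \<open>The quotient of the \<open>K\<close>-th moment of the kernel weights on a grid of mesh \<open>1/N\<close> by their total mass is of order \<open>N^-K\<close>. The total mass is
bounded below by the single weight of the nearest grid point, the moment by a convergent series over the grid.\<close>

lemma grid_moments:
 obtains C :: real where "C > 0"
  "!!N (a::int) G th o'. N \<ge> 1 ==> G <= {a..<a + int N} ==>
  (EX n:G. \<exists>m::int. \<bar>th - (o' + of_int n / real N) - of_int m\<bar> <= 1 / real N) ==>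
  (\<Sum>n\<in>G. kr K N (th - (o' + of_int n / real N)) * \<bar>sin (pi * (th - (o' + of_int n / real N)))\<bar> ^ K)
  <= C / real N ^ K * (\<Sum>n\<in>G. kr K N (th - (o' + of_int n / real N)))"
proof -
 obtain C0 :: real where C0: "C0 > 0" "!!(E::int set) y. finite E ==> (\<Sum>e\<in>E. 1 / (1 + (y - of_int e)^2)) <= C0"
  using sum_inverse_squares_bounded by blast
 define P where "P = (1 + pi^2) ^ Suc K"
 have P: "P > 0" unfolding P_def by (intro zero_less_power add_pos_nonneg) auto
 show ?thesis
 proof (rule that[of "C0 * P"])
  fix N :: nat and a :: int and G :: "int set" and th o' :: real
  assume N: "N \<ge> 1" and G: "G <= {a..<a + int N}"
  and near: "EX n:G. \<exists>m::int. \<bar>th - (o' + of_int n / real N) - of_int m\<bar> <= 1 / real N"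
  define x where "x = (%n::int. th - (o' + of_int n / real N))"
  define m where "m = (%n. round (x n))"
  define S where "S = (%n. \<bar>sin (pi * x n)\<bar>)"
  have finG: "finite G" using G finite_subset by blast
  have N0: "real N > 0" using N by simp
  have sin_shift: "\<bar>sin (pi * y)\<bar> = \<bar>sin (pi * (y - of_int k))\<bar>" for y and k :: int
  proof -
  have "sin (pi * (y - of_int k)) = sin (pi * y) * cos (of_int k * pi) - cos (pi * y) * sin (of_int k * pi)"
  by (simp add: right_diff_distrib sin_diff mult.commute)
  moreover have "sin (of_int k * pi) = 0" using sin_integer_2pi[of "of_int k / 2"] sin_zero_iff_int2 by blast
  moreover have "\<bar>cos (of_int k * pi)\<bar> = 1"
  using sin_cos_squared_add[of "of_int k * pi"] \<open>sin (of_int k * pi) = 0\<close> by (simp add: power2_eq_1_iff) linarith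
  ultimately show ?thesis by (simp add: abs_mult)
  qed
  have Slow: "S n \<ge> \<bar>x n - of_int (m n)\<bar>" for n
  proof -
  have "\<bar>x n - of_int (m n)\<bar> <= 1/2" unfolding m_def using of_int_round_abs_le[of "x n"] by (simp add: abs_minus_commute)
  from sin_pi_lower[OF this] show ?thesis unfolding S_def sin_shift[of "x n" "m n"] .
  qed
  have krS: "kr K N (x n) = real N ^ (2 * Suc K) * inverse (1 + (real N * S n)^2) ^ Suc K" for n
  proof -
  have "1 / real N ^ 2 + sin (pi * x n) ^ 2 = (1 + (real N * S n)^2) / real N ^ 2"
  using N0 by (simp add: S_def power_mult_distrib field_simps)
  then have "kr K N (x n) = (real N ^ 2 * inverse (1 + (real N * S n)^2)) ^ Suc K"
  unfolding kr_def by (simp add: divide_inverse mult.commute)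
  also have "... = real N ^ (2 * Suc K) * inverse (1 + (real N * S n)^2) ^ Suc K"
  by (simp only: power_mult_distrib power_mult)
  finally show ?thesis .
  qed
  have y1: "y ^ K * inverse (1 + y^2) ^ Suc K <= 1 / (1 + y^2)" if "y \<ge> 0" for y :: real
  proof -
  have q: "1 + y^2 > 0" by (intro add_pos_nonneg) auto
  have "y <= 1 + y^2" using zero_le_power2[of "y - 1"] zero_le_power2[of "y + 1"] that by (simp add: power2_eq_square algebra_simps)
  then have "y ^ K <= (1 + y^2) ^ K" using that by (intro power_mono) auto
  then have "y ^ K * inverse (1 + y^2) ^ Suc K <= (1 + y^2) ^ K * inverse (1 + y^2) ^ Suc K"
  using q by (intro mult_right_mono) auto
  also have "... = 1 / (1 + y^2)"
  proof -
  have h: "Q ^ K * inverse Q ^ Suc K = 1 / Q" if "Q ~= 0" for Q :: real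
  proof -
  have "Q ^ K * inverse Q ^ Suc K = (Q * inverse Q) ^ K * inverse Q"
  unfolding power_mult_distrib power_Suc by (simp only: mult_ac)
  then show ?thesis using that by (simp add: inverse_eq_divide)
  qed
  show ?thesis by (rule h) (use q in simp)
  qed
  finally show ?thesis .
  qed
  have tm: "kr K N (x n) * S n ^ K <= real N ^ (2 * Suc K) / real N ^ K * (1 / (1 + (real N * S n)^2))" for n
  proof -
  have "kr K N (x n) * S n ^ K = real N ^ (2 * Suc K) / real N ^ K * ((real N * S n) ^ K * inverse (1 + (real N * S n)^2) ^ Suc K)"
  unfolding krS using N0 by (simp add: power_mult_distrib field_simps del: power_Suc)
  also have "... <= real N ^ (2 * Suc K) / real N ^ K * (1 / (1 + (real N * S n)^2))"
  by (intro mult_left_mono y1) (auto simp: S_def)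
  finally show ?thesis .
  qed
  define e where "e = (%n. n + int N * m n)"
  have inj: "inj_on e G"
  proof (rule inj_onI)
  fix n n' assume n: "n : G" "n' : G" and eq: "e n = e n'"
  have nn: "n - n' = int N * (m n' - m n)" using eq by (simp add: e_def algebra_simps)
  moreover have "n : {a..<a + int N}" "n' : {a..<a + int N}" using n G by blast+
  then have "\<bar>n - n'\<bar> < int N" by auto
  moreover have "int N * 1 <= int N * \<bar>m n' - m n\<bar>" if "m n' - m n ~= 0"
  using that by (intro mult_left_mono) auto
  ultimately have "m n' - m n = 0" by (auto simp: abs_mult)
  then show "n = n'" using nn by simp
  qed
  have "(\<Sum>n\<in>G. 1 / (1 + (real N * S n)^2)) <= (\<Sum>n\<in>G. 1 / (1 + (real N * (th - o') - of_int (e n))^2))"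
  proof (rule sum_mono)
  fix n
  have "real N * (x n - of_int (m n)) = real N * (th - o') - of_int (e n)"
  using N0 by (simp add: x_def e_def field_simps)
  then have "\<bar>real N * (th - o') - of_int (e n)\<bar> = real N * \<bar>x n - of_int (m n)\<bar>" using N0 by (metis abs_mult abs_of_pos)
  also have "... <= real N * S n" using Slow N0 by (intro mult_left_mono) auto
  finally have "(real N * (th - o') - of_int (e n))^2 <= (real N * S n)^2"
  by (metis abs_ge_zero power2_abs power_mono)
  then show "1 / (1 + (real N * S n)^2) <= 1 / (1 + (real N * (th - o') - of_int (e n))^2)"
  by (intro divide_left_mono mult_pos_pos add_pos_nonneg) auto
  qed
  also have "... = (\<Sum>e\<in>e ` G. 1 / (1 + (real N * (th - o') - of_int e)^2))" using inj by (simp add: sum.reindex)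
  also have "... <= C0" using C0(2) finG by simp
  finally have num: "(\<Sum>n\<in>G. 1 / (1 + (real N * S n)^2)) <= C0" .
  obtain n0 k where n0: "n0 : G" "\<bar>x n0 - of_int k\<bar> <= 1 / real N" using near unfolding x_def by blast
  have "real N * S n0 <= pi"
  proof -
  have "S n0 <= \<bar>pi * (x n0 - of_int k)\<bar>" unfolding S_def sin_shift[of "x n0" k] by (rule abs_sin_x_le_abs_x)
  also have "... <= pi * (1 / real N)" unfolding abs_mult using n0(2) by (intro mult_mono) auto
  finally show ?thesis using N0 by (simp add: field_simps)
  qed
  moreover have "real N * S n0 \<ge> 0" by (simp add: S_def)
  ultimately have "(real N * S n0)^2 <= pi^2" by (intro power_mono) auto
  then have "inverse (1 + (real N * S n0)^2) \<ge> inverse (1 + pi^2)"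
  by (intro le_imp_inverse_le add_pos_nonneg) auto
  then have "inverse (1 + pi^2) ^ Suc K <= inverse (1 + (real N * S n0)^2) ^ Suc K"
  by (intro power_mono) auto
  then have "real N ^ (2 * Suc K) * inverse P <= kr K N (x n0)" unfolding krS P_def power_inverse
  by (intro mult_left_mono) auto
  also have "... <= (\<Sum>n\<in>G. kr K N (x n))" using n0 finG kr_pos[OF N] by (intro member_le_sum) (auto intro: less_imp_le)
  finally have den: "real N ^ (2 * Suc K) <= P * (\<Sum>n\<in>G. kr K N (x n))" using P by (simp add: field_simps)
  have "(\<Sum>n\<in>G. kr K N (x n) * S n ^ K) <= (\<Sum>n\<in>G. real N ^ (2 * Suc K) / real N ^ K * (1 / (1 + (real N * S n)^2)))"
  by (intro sum_mono tm)
  also have "... = real N ^ (2 * Suc K) / real N ^ K * (\<Sum>n\<in>G. 1 / (1 + (real N * S n)^2))" by (simp only: sum_distrib_left)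
  also have "... <= real N ^ (2 * Suc K) / real N ^ K * C0" using num by (intro mult_left_mono) auto
  also have "... <= (P * (\<Sum>n\<in>G. kr K N (x n))) / real N ^ K * C0"
  using den C0(1) by (intro mult_right_mono divide_right_mono) auto
  finally show "(\<Sum>n\<in>G. kr K N (th - (o' + of_int n / real N)) * \<bar>sin (pi * (th - (o' + of_int n / real N)))\<bar> ^ K)
  <= C0 * P / real N ^ K * (\<Sum>n\<in>G. kr K N (th - (o' + of_int n / real N)))"
  by (simp add: x_def S_def mult_ac)
 qed (use C0 P in simp)
qed

subsection \<open>Taylor polynomials\<close>

definition tpoly :: "nat => (nat => nat => real) => complex => complex => complex" where
 "tpoly K b al \<beta> = (\<Sum>l<K. \<Sum>i<K - l. of_real (b i l) * al ^ i * \<beta> ^ l / (fact i * fact l))"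

lemma triangle_swap: "(\<Sum>l<K. \<Sum>i<K - l. g i l) = (\<Sum>i<K. \<Sum>l<K - i. g i l)" for K :: nat
proof -
 have "(\<Sum>l<K. \<Sum>i<K - l. g i l) = (\<Sum>l<K. \<Sum>i\<in>{i. i : {..<K} & i + l < K}. g i l)"
  by (intro sum.cong) auto
 also have "... = (\<Sum>i<K. \<Sum>l\<in>{l. l : {..<K} & i + l < K}. g i l)"
  by (rule sum.swap_restrict) auto
 also have "... = (\<Sum>i<K. \<Sum>l<K - i. g i l)" by (intro sum.cong) auto
 finally show ?thesis .
qed

lemma vector_derivative_bound:
 fixes f :: "real => complex"
 assumes f: "!!x. x : closed_segment a b ==> (f has_vector_derivative f' x) (at x within closed_segment a b)"
  and B: "!!x. x : closed_segment a b ==> norm (f' x) <= B"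
 shows "norm (f b - f a) <= B * \<bar>b - a\<bar>"
proof -
 have "norm (f b - f a) <= B * norm (b - a)"
 proof (rule differentiable_bound[of "closed_segment a b" f "%x h. h *\<^sub>R f' x"])
  fix x assume x: "x : closed_segment a b"
  show "(f has_derivative (%h. h *\<^sub>R f' x)) (at x within closed_segment a b)"
  using f[OF x] by (simp add: has_vector_derivative_def)
  show "onorm (%h. h *\<^sub>R f' x) <= B"
  proof (rule onorm_le)
  fix h :: real
  show "norm (h *\<^sub>R f' x) <= B * norm h"
  using mult_left_mono[OF B[OF x], of "\<bar>h\<bar>"] by (simp add: mult.commute)
  qed
 qed auto
 then show ?thesis by simp
qed

lemma taylor_telescope:
 fixes c :: "nat => real => real" and z :: complex
 assumes "!!i. i < m ==> (c i has_real_derivative c (Suc i) u) (at u within S)" and "m > 0"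
 shows "((%u. \<Sum>i<m. of_real (c i u) * (z - of_real u) ^ i / fact i) has_vector_derivative
  of_real (c m u) * (z - of_real u) ^ (m - 1) / fact (m - 1)) (at u within S)"
 using assms
proof (induction m)
 case (Suc m)
 have cv: "((%u. complex_of_real (c i u)) has_vector_derivative of_real (c (Suc i) u)) (at u within S)" if "i < Suc m" for i
  using bounded_linear.has_vector_derivative[OF bounded_linear_of_real Suc.prems(1)[OF that, unfolded has_real_derivative_iff_has_vector_derivative]] .
 have pv: "((%u. (z - of_real u) ^ i / fact i) has_vector_derivative - (of_nat i * (z - of_real u) ^ (i - 1) / fact i)) (at u within S)" for i
 proof -
  have "((%w. (z - w) ^ i / fact i) has_field_derivative - (of_nat i * (z - of_real u) ^ (i - 1) / fact i)) (at (of_real u))"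
  by (auto intro!: derivative_eq_intros simp: field_simps)
  then show ?thesis by (rule has_vector_derivative_real_field)
 qed
 have prod: "((%u. of_real (c m u) * ((z - of_real u) ^ m / fact m)) has_vector_derivative
  (of_real (c m u) * - (of_nat m * (z - of_real u) ^ (m - 1) / fact m) + of_real (c (Suc m) u) * ((z - of_real u) ^ m / fact m))) (at u within S)"
  by (rule has_vector_derivative_mult[OF cv pv]) simp
 show ?case
 proof (cases "m = 0")
  case True
  then show ?thesis using cv[of 0] by simp
 next
  case False
  then have IH: "((%u. \<Sum>i<m. of_real (c i u) * (z - of_real u) ^ i / fact i) has_vector_derivative
  of_real (c m u) * (z - of_real u) ^ (m - 1) / fact (m - 1)) (at u within S)"
  using Suc by simp
  have f: "of_nat m / fact m = (1 / fact (m - 1) :: complex)"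
  using False by (simp add: fact_reduce[of m])
  have "of_real (c m u) * (z - of_real u) ^ (m - 1) / fact (m - 1) +
  (of_real (c m u) * - (of_nat m * (z - of_real u) ^ (m - 1) / fact m) + of_real (c (Suc m) u) * ((z - of_real u) ^ m / fact m))
  = of_real (c m u) * (z - of_real u) ^ (m - 1) * (1 / fact (m - 1) - of_nat m / fact m) + of_real (c (Suc m) u) * ((z - of_real u) ^ m / fact m)"
  by (simp add: algebra_simps)
  also have "... = of_real (c (Suc m) u) * (z - of_real u) ^ m / fact m" unfolding f by simp
  finally show ?thesis using has_vector_derivative_add[OF IH prod] by simp
 qed
qed simp

lemma sum_inverse_fact_product: "(\<Sum>l<Suc k. 1 / (fact (k - l) * fact l)) = (2 ^ k / fact k :: real)"
proof -
 have "(\<Sum>l<Suc k. 1 / (fact (k - l) * fact l)) = (\<Sum>l\<le>k. of_nat (k choose l) / fact k :: real)"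
  by (intro sum.cong) (auto simp: binomial_fact)
 also have "... = of_nat (\<Sum>l\<le>k. k choose l) / fact k" by (simp only: of_nat_sum sum_divide_distrib)
 also have "... = 2 ^ k / fact k" by (simp add: choose_row_sum)
 finally show ?thesis .
qed


definition jets_on :: "nat => real set => (nat => nat => real => real => real) => bool" where
 "jets_on K J b \<longleftrightarrow> (ALL i l th. ALL s:J. i + l <= K --> b i l (th + 1) s = b i l th s) \<and>
  (ALL i l th. ALL s:J. i + l < K --> ((%th. b i l th s) has_real_derivative b (Suc i) l th s) (at th)) \<and>
  (ALL i l th. ALL s:J. i + l < K --> ((%s. b i l th s) has_real_derivative b i (Suc l) th s) (at s within J))"

lemma jets_onD:
 assumes "jets_on K J b" "s : J"
 shows "i + l <= K ==> b i l (th + 1) s = b i l th s"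
  and "i + l < K ==> ((%th. b i l th s) has_real_derivative b (Suc i) l th s) (at th)"
  and "i + l < K ==> ((%s. b i l th s) has_real_derivative b i (Suc l) th s) (at s within J)"
 using assms by (simp_all add: jets_on_def)

text \<open>Moving the base point of a Taylor polynomial, the derivative of the polynomial in the base point telescopes and leaves only terms of top order.\<close>

lemma taylor_rebase:
 assumes jets: "jets_on K J b" and J: "convex J" "v : J" "v' : J" and K: "K \<ge> 1"
  and B: "!!i l th s. i + l = K ==> s : J ==> \<bar>b i l th s\<bar> <= B"
  and d: "norm (z - of_real u) <= d" "norm (z - of_real u') <= d" "norm (w - of_real v) <= d" "norm (w - of_real v') <= d"
 shows "norm (tpoly K (%i l. b i l u' v') (z - of_real u') (w - of_real v') -
  tpoly K (%i l. b i l u v) (z - of_real u) (w - of_real v))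
  <= (\<bar>u' - u\<bar> + \<bar>v' - v\<bar>) * B * (2 * d) ^ (K - 1) / fact (K - 1)"
proof -
 define T where "T = (%u v. tpoly K (%i l. b i l u v) (z - of_real u) (w - of_real v))"
 have B0: "B \<ge> 0" using B[of K 0] J(2) by (metis abs_ge_zero add_0_right order_trans)
 have d0: "d \<ge> 0" using d(1) norm_ge_zero order_trans by blast
 have seg: "norm (c - of_real x) <= d" if "x : closed_segment p q" "norm (c - of_real p) <= d" "norm (c - of_real q) <= d"
  for c :: complex and x p q :: real
 proof -
  have "of_real x : closed_segment (complex_of_real p) (of_real q)"
  using closed_segment_linear_image[OF bounded_linear.linear[OF bounded_linear_of_real], of p q] that(1) by blast
  moreover have "closed_segment (complex_of_real p) (of_real q) <= cball c d"
  using that(2,3) by (intro closed_segment_subset) (auto simp: dist_norm)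
  ultimately have "of_real x : cball c d" by blast
  then show ?thesis by (simp add: dist_norm)
 qed
 have bound: "norm (\<Sum>l<K. of_real (g l) * al ^ (K - l - 1) * \<beta> ^ l / (fact (K - l - 1) * fact l)) <= B * (2 * d) ^ (K - 1) / fact (K - 1)"
  if g: "!!l. l < K ==> \<bar>g l\<bar> <= B" and ab: "norm al <= d" "norm \<beta> <= d" for g :: "nat => real" and al \<beta> :: complex
 proof -
  have "norm (\<Sum>l<K. of_real (g l) * al ^ (K - l - 1) * \<beta> ^ l / (fact (K - l - 1) * fact l))
  <= (\<Sum>l<K. B * d ^ (K - 1) * (1 / (fact (K - 1 - l) * fact l)))"
  proof (rule sum_norm_le)
  fix l assume "l : {..<K}"
  then have l: "l < K" by simp
  have "norm (of_real (g l) * al ^ (K - l - 1) * \<beta> ^ l / (fact (K - l - 1) * fact l))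
  = \<bar>g l\<bar> * norm al ^ (K - l - 1) * norm \<beta> ^ l * (1 / (fact (K - 1 - l) * fact l))"
  by (simp add: norm_mult norm_divide norm_power)
  also have "... <= B * d ^ (K - l - 1) * d ^ l * (1 / (fact (K - 1 - l) * fact l))"
  using g[OF l] ab B0 d0 by (intro mult_right_mono mult_mono power_mono) auto
  also have "B * d ^ (K - l - 1) * d ^ l = B * d ^ (K - 1)" using l by (simp add: mult.assoc flip: power_add)
  finally show "norm (of_real (g l) * al ^ (K - l - 1) * \<beta> ^ l / (fact (K - l - 1) * fact l))
  <= B * d ^ (K - 1) * (1 / (fact (K - 1 - l) * fact l))" .
  qed
  also have "... = B * d ^ (K - 1) * (\<Sum>l<Suc (K - 1). 1 / (fact (K - 1 - l) * fact l))"
  using K by (simp only: sum_distrib_left) simp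
  also have "... = B * (2 * d) ^ (K - 1) / fact (K - 1)"
  unfolding sum_inverse_fact_product by (simp add: power_mult_distrib)
  finally show ?thesis .
 qed
 have 1: "norm (T u' v - T u v) <= B * (2 * d) ^ (K - 1) / fact (K - 1) * \<bar>u' - u\<bar>"
 proof (rule vector_derivative_bound)
  fix x assume x: "x : closed_segment u u'"
  show "((%u. T u v) has_vector_derivative
  (\<Sum>l<K. of_real (b (K - l) l x v) * (z - of_real x) ^ (K - l - 1) * (w - of_real v) ^ l / (fact (K - l - 1) * fact l)))
  (at x within closed_segment u u')"
  unfolding T_def tpoly_def
  proof (rule has_vector_derivative_sum)
  fix l assume "l : {..<K}"
  then have l: "l < K" by simp
  have "((%u. \<Sum>i<K - l. of_real (b i l u v) * (z - of_real u) ^ i / fact i) has_vector_derivative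
  of_real (b (K - l) l x v) * (z - of_real x) ^ (K - l - 1) / fact (K - l - 1)) (at x within closed_segment u u')"
  by (rule taylor_telescope) (use jets_onD(2)[OF jets J(2)] l in \<open>auto intro: has_field_derivative_at_within\<close>)
  from has_vector_derivative_mult_left[OF this, of "(w - of_real v) ^ l / fact l"]
  show "((%u. \<Sum>i<K - l. of_real (b i l u v) * (z - of_real u) ^ i * (w - of_real v) ^ l / (fact i * fact l)) has_vector_derivative
  of_real (b (K - l) l x v) * (z - of_real x) ^ (K - l - 1) * (w - of_real v) ^ l / (fact (K - l - 1) * fact l)) (at x within closed_segment u u')"
  by (simp add: sum_distrib_left sum_distrib_right sum_divide_distrib mult_ac)
  qed
  show "norm (\<Sum>l<K. of_real (b (K - l) l x v) * (z - of_real x) ^ (K - l - 1) * (w - of_real v) ^ l / (fact (K - l - 1) * fact l))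
  <= B * (2 * d) ^ (K - 1) / fact (K - 1)"
  by (rule bound) (use B J seg[OF x] d in auto)
 qed
 have 2: "norm (T u' v' - T u' v) <= B * (2 * d) ^ (K - 1) / fact (K - 1) * \<bar>v' - v\<bar>"
 proof (rule vector_derivative_bound)
  fix y assume y: "y : closed_segment v v'"
  have sub: "closed_segment v v' <= J" using J by (simp add: closed_segment_subset)
  have Ts: "T u' = (%v. \<Sum>i<K. (\<Sum>l<K - i. of_real (b i l u' v) * (w - of_real v) ^ l / fact l) * ((z - of_real u') ^ i / fact i))"
  unfolding T_def tpoly_def
  by (intro ext, subst triangle_swap, intro sum.cong refl)
  (simp add: sum_distrib_left sum_divide_distrib mult_ac)
  show "(T u' has_vector_derivative
  (\<Sum>i<K. of_real (b i (K - i) u' y) * (w - of_real y) ^ (K - i - 1) * (z - of_real u') ^ i / (fact (K - i - 1) * fact i)))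
  (at y within closed_segment v v')"
  unfolding Ts
  proof (rule has_vector_derivative_sum)
  fix i assume "i : {..<K}"
  then have i: "i < K" by simp
  have "((%v. \<Sum>l<K - i. of_real (b i l u' v) * (w - of_real v) ^ l / fact l) has_vector_derivative
  of_real (b i (K - i) u' y) * (w - of_real y) ^ (K - i - 1) / fact (K - i - 1)) (at y within closed_segment v v')"
  proof (rule taylor_telescope)
  fix l assume l: "l < K - i"
  have "((%s. b i l u' s) has_real_derivative b i (Suc l) u' y) (at y within J)"
  by (rule jets_onD(3)[OF jets]) (use sub y l in auto)
  then show "((%s. b i l u' s) has_real_derivative b i (Suc l) u' y) (at y within closed_segment v v')"
  using sub by (rule DERIV_subset)
  qed (use i in simp)
  from has_vector_derivative_mult_left[OF this, of "(z - of_real u') ^ i / fact i"]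
  show "((%v. (\<Sum>l<K - i. of_real (b i l u' v) * (w - of_real v) ^ l / fact l) * ((z - of_real u') ^ i / fact i)) has_vector_derivative
  of_real (b i (K - i) u' y) * (w - of_real y) ^ (K - i - 1) * (z - of_real u') ^ i / (fact (K - i - 1) * fact i)) (at y within closed_segment v v')"
  by (simp add: mult_ac)
  qed
  show "norm (\<Sum>i<K. of_real (b i (K - i) u' y) * (w - of_real y) ^ (K - i - 1) * (z - of_real u') ^ i / (fact (K - i - 1) * fact i))
  <= B * (2 * d) ^ (K - 1) / fact (K - 1)"
  by (rule bound) (use B J sub y seg[OF y] d in auto)
 qed
 note norm_diff_triangle_le[OF 2 1]
 then show ?thesis unfolding T_def by (simp add: algebra_simps add_divide_distrib)
qed
lemma power_diff_bound:
 fixes a b :: complex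
 assumes "norm a <= R" "norm b <= R" "1 <= R"
 shows "norm (a ^ i - b ^ i) <= real i * R ^ i * norm (a - b)"
proof (induction i)
 case (Suc i)
 have "a ^ Suc i - b ^ Suc i = a * (a ^ i - b ^ i) + (a - b) * b ^ i" by (simp add: algebra_simps)
 then have "norm (a ^ Suc i - b ^ Suc i) <= norm a * norm (a ^ i - b ^ i) + norm (a - b) * norm b ^ i"
  by (metis norm_mult norm_power norm_triangle_ineq)
 also have "... <= R * (real i * R ^ i * norm (a - b)) + norm (a - b) * R ^ i"
  using Suc assms by (intro add_mono mult_mono mult_left_mono power_mono) auto
 also have "... <= R * (real i * R ^ i * norm (a - b)) + norm (a - b) * R ^ Suc i"
  using assms by (intro add_left_mono mult_left_mono power_increasing) auto
 also have "... = real (Suc i) * R ^ Suc i * norm (a - b)" by (simp add: algebra_simps)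
 finally show ?case .
qed simp

lemma tpoly_lipschitz:
 assumes b: "!!i l. i + l < K ==> \<bar>b i l\<bar> <= B" and R: "1 <= R" "norm al <= R" "norm \<beta> <= R" "norm al' <= R" "norm \<beta>' <= R"
 shows "norm (tpoly K b al \<beta> - tpoly K b al' \<beta>') <= real K * (real K * (B * (real K * R ^ (2 * K)))) * (norm (al - al') + norm (\<beta> - \<beta>'))"
proof (cases "K = 0")
 case False
 have "\<bar>b 0 0\<bar> <= B" using b[of 0 0] False by simp
 then have B: "B \<ge> 0" by linarith
 let ?D = "norm (al - al') + norm (\<beta> - \<beta>')"
 let ?M = "B * (real K * R ^ (2 * K) * ?D)"
 have M0: "?M \<ge> 0" using B R by simp
 have pw: "R ^ i <= R ^ K" if "i <= K" for i using R that by (intro power_increasing) auto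
 have mono: "norm (al ^ i * \<beta> ^ l - al' ^ i * \<beta>' ^ l) <= real K * R ^ (2 * K) * ?D" if "i < K" "l < K" for i l
 proof -
  have "al ^ i * \<beta> ^ l - al' ^ i * \<beta>' ^ l = (al ^ i - al' ^ i) * \<beta> ^ l + al' ^ i * (\<beta> ^ l - \<beta>' ^ l)" by (simp add: algebra_simps)
  then have "norm (al ^ i * \<beta> ^ l - al' ^ i * \<beta>' ^ l) <= norm (al ^ i - al' ^ i) * norm \<beta> ^ l + norm al' ^ i * norm (\<beta> ^ l - \<beta>' ^ l)"
  by (metis norm_mult norm_power norm_triangle_ineq)
  also have "... <= (real K * R ^ K * norm (al - al')) * R ^ K + R ^ K * (real K * R ^ K * norm (\<beta> - \<beta>'))"
  proof (intro add_mono mult_mono)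
  show "norm (al ^ i - al' ^ i) <= real K * R ^ K * norm (al - al')"
  by (rule order_trans[OF power_diff_bound[OF R(2,4,1)]]) (use that R pw in \<open>auto intro!: mult_right_mono mult_mono\<close>)
  show "norm (\<beta> ^ l - \<beta>' ^ l) <= real K * R ^ K * norm (\<beta> - \<beta>')"
  by (rule order_trans[OF power_diff_bound[OF R(3,5,1)]]) (use that R pw in \<open>auto intro!: mult_right_mono mult_mono\<close>)
  have "norm \<beta> ^ l <= R ^ l" "norm al' ^ i <= R ^ i" using R by (auto intro!: power_mono)
  then show "norm \<beta> ^ l <= R ^ K" "norm al' ^ i <= R ^ K" using pw[of l] pw[of i] that by linarith+
  qed (use R in auto)
  also have "... = real K * R ^ (2 * K) * ?D" unfolding mult_2 power_add by (simp add: algebra_simps)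
  finally show ?thesis .
 qed
 have trm: "norm (of_real (b i l) * al ^ i * \<beta> ^ l / (fact i * fact l) - of_real (b i l) * al' ^ i * \<beta>' ^ l / (fact i * fact l)) <= ?M"
  if il: "i + l < K" for i l
 proof -
  have "of_real (b i l) * al ^ i * \<beta> ^ l / (fact i * fact l) - of_real (b i l) * al' ^ i * \<beta>' ^ l / (fact i * fact l)
  = of_real (b i l) * (al ^ i * \<beta> ^ l - al' ^ i * \<beta>' ^ l) / (fact i * fact l)"
  by (simp add: algebra_simps diff_divide_distrib)
  also have "norm ... = \<bar>b i l\<bar> * norm (al ^ i * \<beta> ^ l - al' ^ i * \<beta>' ^ l) / (fact i * fact l)"
  by (simp add: norm_mult norm_divide)
  also have "... <= ?M / (fact i * fact l)"
  using b[OF il] mono[of i l] il B by (intro divide_right_mono mult_mono) auto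
  also have "... <= ?M / 1"
  proof (rule divide_left_mono)
  show "1 <= (fact i * fact l :: real)" using mult_mono[of 1 "fact i :: real" 1 "fact l"] by simp
  qed (use M0 in auto)
  finally show ?thesis by simp
 qed
 have "norm (tpoly K b al \<beta> - tpoly K b al' \<beta>')
  <= (\<Sum>l<K. \<Sum>i<K - l. norm (of_real (b i l) * al ^ i * \<beta> ^ l / (fact i * fact l) - of_real (b i l) * al' ^ i * \<beta>' ^ l / (fact i * fact l)))"
  unfolding tpoly_def sum_subtractf[symmetric] by (intro order_trans[OF norm_sum] sum_mono norm_sum)
 also have "... <= (\<Sum>l<K. \<Sum>i<K - l. ?M)" by (intro sum_mono trm) auto
 also have "... <= (\<Sum>l<K. real K * ?M)"
  using M0 by (intro sum_mono) (simp add: mult_right_mono)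
 also have "... = real K * (real K * (B * (real K * R ^ (2 * K)))) * ?D" by (simp add: algebra_simps)
 finally show ?thesis .
qed (simp add: tpoly_def)

definition cells :: "nat => real => int set" where
 "cells N rh = {m. \<bar>of_int m\<bar> <= rh * real N}"

text \<open>A weighted average of the Taylor polynomials at the points of a grid of mesh \<open>1/N\<close>, written in periodic coordinates. In \<open>s\<close> the grid covers only
the interval where jets are available; there \<open>rh \<le> 1/8\<close> keeps it within one period of the kernel.\<close>

definition smooth :: "(complex => complex) => nat => nat => real => real => (nat => nat => real => real => real) => complex => complex => complex" where
 "smooth ta K N s0 rh b z w =
  (\<Sum>n\<in>{0..<int N}. \<Sum>m\<in>cells N rh. ker K N (z - of_real (of_int n / real N)) * ker K N (w - of_real (s0 + of_int m / real N)) *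
  tpoly K (%i l. b i l (of_int n / real N) (s0 + of_int m / real N)) (ta (z - of_real (of_int n / real N))) (ta (w - of_real (s0 + of_int m / real N))))
  / ((\<Sum>n\<in>{0..<int N}. ker K N (z - of_real (of_int n / real N))) * (\<Sum>m\<in>cells N rh. ker K N (w - of_real (s0 + of_int m / real N))))"

lemma finite_cells: "finite (cells N rh)"
proof -
 have "cells N rh <= {- \<lceil>rh * real N\<rceil>..\<lceil>rh * real N\<rceil>}"
 proof
  fix m assume "m : cells N rh"
  then have "\<bar>real_of_int m\<bar> <= rh * real N" by (simp add: cells_def)
  then have "\<bar>real_of_int m\<bar> <= of_int \<lceil>rh * real N\<rceil>" using le_of_int_ceiling[of "rh * real N"] by linarith
  then have "\<bar>m\<bar> <= \<lceil>rh * real N\<rceil>" by linarith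
  then show "m : {- \<lceil>rh * real N\<rceil>..\<lceil>rh * real N\<rceil>}" by auto
 qed
 then show ?thesis using finite_subset by blast
qed

lemma sum_perturb:
 fixes W :: "'i => complex" and k :: "'i => real"
 assumes "finite G" and W: "!!n. n : G ==> norm (W n - of_real (k n)) <= k n / 2"
 shows "norm (\<Sum>n\<in>G. W n) \<ge> (\<Sum>n\<in>G. k n) / 2" "!!n. n : G ==> norm (W n) <= 3/2 * k n"
proof -
 show "norm (W n) <= 3/2 * k n" if "n : G" for n
 proof -
  have "k n \<ge> 0" using W[OF that] norm_ge_zero[of "W n - of_real (k n)"] by linarith
  then show ?thesis using W[OF that] norm_triangle_ineq2[of "W n" "of_real (k n)"] by simp
 qed
 have "(\<Sum>n\<in>G. k n / 2) <= (\<Sum>n\<in>G. Re (W n))"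
 proof (rule sum_mono)
  fix n assume n: "n : G"
  show "k n / 2 <= Re (W n)" using W[OF n] abs_Re_le_cmod[of "W n - of_real (k n)"] by simp
 qed
 also have "... = Re (\<Sum>n\<in>G. W n)" by simp
 also have "... <= norm (\<Sum>n\<in>G. W n)" by (rule complex_Re_le_cmod)
 finally show "norm (\<Sum>n\<in>G. W n) \<ge> (\<Sum>n\<in>G. k n) / 2" by (simp add: sum_divide_distrib)
qed

lemma weighted_average_error:
 fixes W :: "'i => complex" and V :: "'j => complex" and Q :: "'i => 'j => complex" and k S :: "'i => real" and k' S' :: "'j => real"
 assumes fin: "finite G" "finite G'"
  and W: "!!n. n : G ==> norm (W n - of_real (k n)) <= k n / 2" and V: "!!m. m : G' ==> norm (V m - of_real (k' m)) <= k' m / 2"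
  and pos: "(\<Sum>n\<in>G. k n) > 0" "(\<Sum>m\<in>G'. k' m) > 0"
  and mom: "(\<Sum>n\<in>G. k n * S n) <= e * (\<Sum>n\<in>G. k n)" "(\<Sum>m\<in>G'. k' m * S' m) <= e * (\<Sum>m\<in>G'. k' m)"
  and Q: "!!n m. n : G ==> m : G' ==> norm (Q n m - T) <= D * (S n + S' m + e')" and D: "D \<ge> 0"
 shows "norm ((\<Sum>n\<in>G. \<Sum>m\<in>G'. W n * V m * Q n m) / ((\<Sum>n\<in>G. W n) * (\<Sum>m\<in>G'. V m)) - T) <= 9 * D * (2 * e + e')"
proof -
 define A A' where "A = (\<Sum>n\<in>G. k n)" and "A' = (\<Sum>m\<in>G'. k' m)"
 note sW = sum_perturb[of G W k, OF fin(1) W] and sV = sum_perturb[of G' V k', OF fin(2) V]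
 have AA: "A > 0" "A' > 0" using pos by (auto simp: A_def A'_def)
 have k0: "k n \<ge> 0" if "n : G" for n using W[OF that] norm_ge_zero[of "W n - of_real (k n)"] by linarith
 have k'0: "k' m \<ge> 0" if "m : G'" for m using V[OF that] norm_ge_zero[of "V m - of_real (k' m)"] by linarith
 let ?SW = "\<Sum>n\<in>G. W n" and ?SV = "\<Sum>m\<in>G'. V m"
 have den: "norm (?SW * ?SV) \<ge> (A / 2) * (A' / 2)"
  unfolding norm_mult using sW(1) sV(1) AA by (intro mult_mono) (auto simp: A_def A'_def)
 have den0: "norm (?SW * ?SV) > 0" using den mult_pos_pos[of "A / 2" "A' / 2"] AA by linarith
 have nz: "?SW * ?SV ~= 0" using den0 by auto
 have "?SW * ?SV * T = (\<Sum>n\<in>G. \<Sum>m\<in>G'. W n * V m * T)"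
  by (simp only: sum_product[symmetric] sum_distrib_right[symmetric])
 then have "(\<Sum>n\<in>G. \<Sum>m\<in>G'. W n * V m * Q n m) - ?SW * ?SV * T = (\<Sum>n\<in>G. \<Sum>m\<in>G'. W n * V m * (Q n m - T))"
  by (simp add: right_diff_distrib sum_subtractf)
 also have "norm ... <= (\<Sum>n\<in>G. \<Sum>m\<in>G'. norm (W n * V m * (Q n m - T)))"
  by (intro order_trans[OF norm_sum] sum_mono norm_sum)
 also have "... <= (\<Sum>n\<in>G. \<Sum>m\<in>G'. (3/2 * k n) * (3/2 * k' m) * (D * (S n + S' m + e')))"
  unfolding norm_mult using sW(2) sV(2) k0 k'0 Q
  by (intro sum_mono mult_mono mult_nonneg_nonneg) auto
 also have "... = (\<Sum>n\<in>G. \<Sum>m\<in>G'. 9/4 * D * ((k n * S n) * k' m + k n * (k' m * S' m) + e' * (k n * k' m)))"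
  by (intro sum.cong) (auto simp: algebra_simps)
 also have "... = 9/4 * D * ((\<Sum>n\<in>G. k n * S n) * A' + A * (\<Sum>m\<in>G'. k' m * S' m) + e' * (A * A'))"
  unfolding A_def A'_def sum_product sum_distrib_left[symmetric] sum.distrib by (simp add: sum_distrib_left)
 also have "... <= 9/4 * D * ((e * A) * A' + A * (e * A') + e' * (A * A'))"
  using mom AA D by (intro mult_left_mono add_mono mult_right_mono) (auto simp: A_def A'_def)
 also have "... = 9 * D * (2 * e + e') * ((A / 2) * (A' / 2))" by (simp add: algebra_simps)
 finally have num: "norm ((\<Sum>n\<in>G. \<Sum>m\<in>G'. W n * V m * Q n m) - ?SW * ?SV * T) <= 9 * D * (2 * e + e') * ((A / 2) * (A' / 2))" .
 have "0 <= 9 * D * (2 * e + e') * ((A / 2) * (A' / 2))" using num norm_ge_zero order_trans by blast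
 moreover have "0 < (A / 2) * (A' / 2)" using AA by simp
 ultimately have E0: "0 <= 9 * D * (2 * e + e')"
  using mult_neg_pos[of "9 * D * (2 * e + e')" "(A / 2) * (A' / 2)"] by linarith
 have "(\<Sum>n\<in>G. \<Sum>m\<in>G'. W n * V m * Q n m) / (?SW * ?SV) - T = ((\<Sum>n\<in>G. \<Sum>m\<in>G'. W n * V m * Q n m) - ?SW * ?SV * T) / (?SW * ?SV)"
  using nz by (simp add: diff_divide_distrib)
 also have "norm ... <= (9 * D * (2 * e + e') * ((A / 2) * (A' / 2))) / norm (?SW * ?SV)"
  unfolding norm_divide using num by (intro divide_right_mono) auto
 also have "... <= (9 * D * (2 * e + e') * norm (?SW * ?SV)) / norm (?SW * ?SV)"
  using den E0 by (intro divide_right_mono mult_left_mono) auto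
 also have "... = 9 * D * (2 * e + e')" using den0 by simp
 finally show ?thesis .
qed

lemma ker_perturb_ex:
 "EX c. 0 < c & c <= 1/2 & (ALL N x de. N \<ge> 1 --> norm de <= c / real N \<longrightarrow>
  1 / of_nat N ^ 2 + sin (of_real pi * (of_real x + de)) ^ 2 ~= (0::complex) \<and>
  norm (ker K N (of_real x + de) - of_real (kr K N x)) <= kr K N x / 2)"
proof (rule ker_perturb[of K])
 fix c assume a: "0 < c" "c <= 1/2" "!!N x de. N \<ge> 1 ==> norm de <= c / real N ==>
  1 / of_nat N ^ 2 + sin (of_real pi * (of_real x + de)) ^ 2 ~= (0::complex) \<and>
  norm (ker K N (of_real x + de) - of_real (kr K N x)) <= kr K N x / 2"
 show ?thesis
  by (intro exI[of _ c] conjI[OF a(1)] conjI[OF a(2)] allI impI) (rule a(3); assumption)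
qed

lemma grid_moments_ex:
 "\<exists>Cm::real. Cm > 0 & (\<forall>N (a::int) G th o'. N \<ge> 1 --> G <= {a..<a + int N} \<longrightarrow>
  (EX n:G. \<exists>m::int. \<bar>th - (o' + of_int n / real N) - of_int m\<bar> <= 1 / real N) \<longrightarrow>
  (\<Sum>n\<in>G. kr K N (th - (o' + of_int n / real N)) * \<bar>sin (pi * (th - (o' + of_int n / real N)))\<bar> ^ K)
  <= Cm / real N ^ K * (\<Sum>n\<in>G. kr K N (th - (o' + of_int n / real N))))"
proof (rule grid_moments[of K])
 fix Cm :: real assume a: "Cm > 0" "!!N (a::int) G th o'. N \<ge> 1 ==> G <= {a..<a + int N} ==>
  (EX n:G. \<exists>m::int. \<bar>th - (o' + of_int n / real N) - of_int m\<bar> <= 1 / real N) ==>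
  (\<Sum>n\<in>G. kr K N (th - (o' + of_int n / real N)) * \<bar>sin (pi * (th - (o' + of_int n / real N)))\<bar> ^ K)
  <= Cm / real N ^ K * (\<Sum>n\<in>G. kr K N (th - (o' + of_int n / real N)))"
 show ?thesis
  by (intro exI[of _ Cm] conjI[OF a(1)] allI impI) (rule a(2); assumption)
qed

text \<open>Each Taylor polynomial differs from the one at \<open>(th, s)\<close> by a \<open>K\<close>-th power of the distance of the base points, and the weights average these powers to \<open>N^-K\<close>.
The constants depend on the jets only through the bound \<open>B\<close>.\<close>

lemma smooth_approximates_jet:
 fixes K :: nat
 assumes ta: "!!z. ta (z + 1) = ta z" "!!z. norm z <= 1 ==> norm (ta z - z) <= C\<tau> * norm z ^ K" "C\<tau> > 0"
  and K: "K \<ge> 1" and B: "B \<ge> 0" and rh: "0 < rh" "rh <= 1/8"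
 obtains C c :: real where "C > 0" "0 < c" "c <= 1/2"
  "!!N s0 b th s z w. real N * rh \<ge> 2 ==> jets_on K {s0 - rh..s0 + rh} b ==>
  (!!i l th s. i + l <= K ==> s : {s0 - rh..s0 + rh} ==> \<bar>b i l th s\<bar> <= B) ==>
  \<bar>s - s0\<bar> <= rh / 2 ==> norm (z - of_real th) <= c / real N ==> norm (w - of_real s) <= c / real N ==>
  norm (smooth ta K N s0 rh b z w - tpoly K (%i l. b i l th s) (z - of_real th) (w - of_real s)) <= C / real N ^ K
  & (\<Sum>n\<in>{0..<int N}. ker K N (z - of_real (of_int n / real N))) ~= 0
  & (\<Sum>m\<in>cells N rh. ker K N (w - of_real (s0 + of_int m / real N))) ~= 0
  & (ALL n. 1 / of_nat N ^ 2 + sin (of_real pi * (z - of_real (of_int n / real N))) ^ 2 ~= (0::complex))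
  & (ALL m. 1 / of_nat N ^ 2 + sin (of_real pi * (w - of_real (s0 + of_int m / real N))) ^ 2 ~= (0::complex))"
proof -
 obtain c where c: "0 < c" "c <= 1/2"
  "!!N x de. N \<ge> 1 ==> norm de <= c / real N ==>
  1 / of_nat N ^ 2 + sin (of_real pi * (of_real x + de)) ^ 2 ~= (0::complex) \<and>
  norm (ker K N (of_real x + de) - of_real (kr K N x)) <= kr K N x / 2"
  using ker_perturb_ex[of K] by blast
 obtain Cm :: real where Cm: "Cm > 0"
  "!!N (a::int) G th o'. N \<ge> 1 ==> G <= {a..<a + int N} ==>
  (EX n:G. \<exists>m::int. \<bar>th - (o' + of_int n / real N) - of_int m\<bar> <= 1 / real N) ==>
  (\<Sum>n\<in>G. kr K N (th - (o' + of_int n / real N)) * \<bar>sin (pi * (th - (o' + of_int n / real N)))\<bar> ^ K)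
  <= Cm / real N ^ K * (\<Sum>n\<in>G. kr K N (th - (o' + of_int n / real N)))"
  using grid_moments_ex[of K] by blast
 define R where "R = 1 + C\<tau>"
 define D1 where "D1 = real K * (real K * (B * (real K * R ^ (2 * K)))) * (2 * C\<tau>)"
 define D where "D = (D1 + B * 2 ^ K) * 3 ^ K"
 have D1: "D1 \<ge> 0" unfolding D1_def using B ta(3) by (intro mult_nonneg_nonneg zero_le_power) (auto simp: R_def)
 have D: "D \<ge> 0" unfolding D_def using D1 B by simp
 define C where "C = 9 * D * (2 * Cm + 1) + 1"
 show ?thesis
 proof (rule that[of C c])
  show "C > 0" unfolding C_def using D Cm(1) by (intro add_nonneg_pos mult_nonneg_nonneg) auto
  fix N :: nat and s0 th s :: real and b and z w :: complex
  assume N\<rho>: "real N * rh \<ge> 2" and jets: "jets_on K {s0 - rh..s0 + rh} b"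
  and bB: "!!i l th s. i + l <= K ==> s : {s0 - rh..s0 + rh} ==> \<bar>b i l th s\<bar> <= B"
  and s: "\<bar>s - s0\<bar> <= rh / 2" and z: "norm (z - of_real th) <= c / real N" and w: "norm (w - of_real s) <= c / real N"
  let ?J = "{s0 - rh..s0 + rh}"
  have N0: "real N > 0" using N\<rho> by (cases "N = 0") auto
  then have N: "N \<ge> 1" by simp
  define h where "h = 1 / real N"
  have h: "0 < h" "h <= rh / 2" using N\<rho> N0 by (auto simp: h_def field_simps)
  have ch: "c / real N <= h / 2" using c(2) N0 by (simp add: h_def field_simps)
  have zh: "norm (z - of_real th) <= h / 2" and wh: "norm (w - of_real s) <= h / 2" by (rule order_trans[OF z ch], rule order_trans[OF w ch])
  define u where "u = (%n::int. of_int n / real N)"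
  define v where "v = (%m::int. s0 + of_int m / real N)"
  have un: "of_int n / real N = u n" for n by (simp add: u_def)
  have vn: "s0 + u m = v m" for m by (simp add: u_def v_def)
  let ?G = "{0..<int N}" and ?G' = "cells N rh"
  define S where "S = (%n. \<bar>sin (pi * (th - u n))\<bar> ^ K)"
  define S' where "S' = (%m. \<bar>sin (pi * (s - v m))\<bar> ^ K)"
  have kz: "1 / of_nat N ^ 2 + sin (of_real pi * (z - of_real (u n))) ^ 2 ~= (0::complex)"
  "norm (ker K N (z - of_real (u n)) - of_real (kr K N (th - u n))) <= kr K N (th - u n) / 2" for n
  using c(3)[OF N z, of "th - u n"] by (simp_all add: algebra_simps)
  have kw: "1 / of_nat N ^ 2 + sin (of_real pi * (w - of_real (v m))) ^ 2 ~= (0::complex)"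
  "norm (ker K N (w - of_real (v m)) - of_real (kr K N (s - v m))) <= kr K N (s - v m) / 2" for m
  using c(3)[OF N w, of "s - v m"] by (simp_all add: algebra_simps)
  \<comment> \<open>the grid points closest to the base point\<close>
  have near: "EX n:?G. \<exists>m::int. \<bar>th - (0 + of_int n / real N) - of_int m\<bar> <= 1 / real N"
  proof -
  define n where "n = \<lfloor>frac th * real N\<rfloor>"
  have f: "0 <= frac th" "frac th < 1" by (auto simp: frac_lt_1)
  have "0 <= n" "n < int N" using f N0 by (auto simp: n_def floor_less_iff)
  moreover have "\<bar>frac th - of_int n / real N\<bar> <= 1 / real N"
  proof -
  have "\<bar>frac th * real N - of_int n\<bar> <= 1" unfolding n_def by linarith
  moreover have "frac th - of_int n / real N = (frac th * real N - of_int n) / real N" using N0 by (simp add: field_simps)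
  ultimately show ?thesis using N0 by (simp add: divide_right_mono)
  qed
  ultimately show ?thesis by (intro bexI[of _ n] exI[of _ "\<lfloor>th\<rfloor>"]) (auto simp: frac_def algebra_simps)
  qed
  have near': "EX n:?G'. \<exists>m::int. \<bar>s - (s0 + of_int n / real N) - of_int m\<bar> <= 1 / real N"
  proof -
  define n where "n = \<lfloor>(s - s0) * real N\<rfloor>"
  have fl: "of_int n <= (s - s0) * real N" "(s - s0) * real N - 1 <= of_int n" unfolding n_def by linarith+
  have "\<bar>(s - s0) * real N\<bar> <= rh / 2 * real N" unfolding abs_mult using s N0 rh by (intro mult_mono) auto
  moreover have "\<bar>a\<bar> <= q" if "\<bar>p\<bar> <= q / 2" "a <= p" "p - 1 <= a" "2 <= q" for a p q :: real
  using that by linarith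
  ultimately have "\<bar>real_of_int n\<bar> <= rh * real N"
  using fl N\<rho> by (metis mult.commute times_divide_eq_left)
  then have "n : ?G'" by (simp add: cells_def)
  moreover have "\<bar>s - (s0 + of_int n / real N) - of_int 0\<bar> <= 1 / real N"
  proof -
  have "s - (s0 + of_int n / real N) - of_int 0 = ((s - s0) * real N - of_int n) / real N" using N0 by (simp add: field_simps)
  moreover have "\<bar>(s - s0) * real N - of_int n\<bar> <= 1" using fl by linarith
  ultimately show ?thesis using N0 by (simp add: divide_right_mono)
  qed
  ultimately show ?thesis by blast
  qed
  have GN: "?G <= {0..<0 + int N}" by simp
  have G'N: "?G' <= {- \<lfloor>rh * real N\<rfloor>..< - \<lfloor>rh * real N\<rfloor> + int N}"
  proof
  fix m assume m: "m : ?G'"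
  then have "real_of_int m <= rh * real N" "real_of_int (- m) <= rh * real N" by (auto simp: cells_def)
  then have m': "m <= \<lfloor>rh * real N\<rfloor>" "- m <= \<lfloor>rh * real N\<rfloor>" by (simp_all only: le_floor_iff)
  have "rh * real N <= 1/8 * real N" using rh N0 by (intro mult_right_mono) auto
  then have "2 * real_of_int \<lfloor>rh * real N\<rfloor> < real N" using N0 of_int_floor_le[of "rh * real N"] by linarith
  then have "2 * \<lfloor>rh * real N\<rfloor> < int N" by linarith
  then show "m : {- \<lfloor>rh * real N\<rfloor>..< - \<lfloor>rh * real N\<rfloor> + int N}" using m' by auto
  qed
  have mom: "(\<Sum>n\<in>?G. kr K N (th - u n) * S n) <= Cm / real N ^ K * (\<Sum>n\<in>?G. kr K N (th - u n))"
  using Cm(2)[OF N GN near] by (simp add: S_def u_def)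
  have mom': "(\<Sum>n\<in>?G'. kr K N (s - v n) * S' n) <= Cm / real N ^ K * (\<Sum>n\<in>?G'. kr K N (s - v n))"
  using Cm(2)[OF N G'N near'] by (simp add: S'_def v_def)
  have pos: "(\<Sum>n\<in>?G. kr K N (th - u n)) > 0" using near kr_pos[OF N] by (intro sum_pos) auto
  have pos': "(\<Sum>n\<in>?G'. kr K N (s - v n)) > 0" using near' kr_pos[OF N] finite_cells by (intro sum_pos) auto
  have per\<tau>: "ta (\<zeta> + of_int k) = ta \<zeta>" for \<zeta> k
  proof (induction k rule: int_induct[where k = 0])
  case (step1 i) then show ?case using ta(1)[of "\<zeta> + of_int i"] by (simp add: add.assoc)
  next
  case (step2 i) then show ?case using ta(1)[of "\<zeta> + of_int (i - 1)"] by (simp add: add.assoc)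
  qed simp
  have perb: "b i l (x + of_int k) y = b i l x y" if "i + l <= K" "y : ?J" for i l x y and k :: int
  proof (induction k rule: int_induct[where k = 0])
  case (step1 j)
  have "b i l (x + of_int j + 1) y = b i l (x + of_int j) y" by (rule jets_onD(1)[OF jets that(2,1)])
  then show ?case using step1 by (simp add: add.assoc)
  next
  case (step2 j)
  have "b i l (x + of_int (j - 1) + 1) y = b i l (x + of_int (j - 1)) y" by (rule jets_onD(1)[OF jets that(2,1)])
  then show ?case using step2 by simp
  qed simp
  let ?T = "tpoly K (%i l. b i l th s) (z - of_real th) (w - of_real s)"
  let ?Q = "%n m. tpoly K (%i l. b i l (u n) (v m)) (ta (z - of_real (u n))) (ta (w - of_real (v m)))"
  have Q: "norm (?Q n m - ?T) <= D * (S n + S' m + h ^ K)" if m: "m : ?G'" for n m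
  proof -
  define k where "k = round (th - u n)"
  define u' where "u' = u n + of_int k"
  define x where "x = \<bar>th - u'\<bar>"
  define y where "y = \<bar>s - v m\<bar>"
  have x1: "x <= 1/2" unfolding x_def u'_def k_def using of_int_round_abs_le[of "th - u n"] by (simp add: abs_minus_commute algebra_simps)
  have vm: "\<bar>v m - s0\<bar> <= rh"
  proof -
  have "\<bar>of_int m / real N\<bar> <= rh" using m N0 by (simp add: cells_def abs_divide divide_le_eq)
  then show ?thesis by (simp add: v_def)
  qed
  have "\<bar>s - s0\<bar> <= rh" using s rh by linarith
  then have vJ: "v m : ?J" "s : ?J" using vm by (auto simp: abs_le_iff)
  have y1: "y <= 1/4" using vm s rh unfolding y_def by linarith
  have h1: "h <= 1/4" using h rh by linarith
  have xS: "x ^ K <= S n"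
  proof -
  have "\<bar>sin (pi * (th - u n))\<bar> = \<bar>sin (pi * (th - u'))\<bar>"
  proof -
  have "sin (pi * (th - u')) = sin (pi * (th - u n)) * cos (of_int k * pi) - cos (pi * (th - u n)) * sin (of_int k * pi)"
  unfolding sin_diff[symmetric] by (simp add: u'_def algebra_simps)
  moreover have sk: "sin (of_int k * pi) = 0" using sin_zero_iff_int2 by blast
  moreover have "\<bar>cos (of_int k * pi)\<bar> = 1"
  using sin_cos_squared_add[of "of_int k * pi"] sk by (simp add: power2_eq_1_iff) linarith
  ultimately show ?thesis by (simp add: abs_mult)
  qed
  moreover have "x <= \<bar>sin (pi * (th - u'))\<bar>" using sin_pi_lower[of "th - u'"] x1 by (simp add: x_def)
  ultimately show ?thesis unfolding S_def by (intro power_mono) (auto simp: x_def)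
  qed
  have yS: "y ^ K <= S' m" unfolding S'_def
  using sin_pi_lower[of "s - v m"] y1 by (intro power_mono) (auto simp: y_def)
  define q where "q = x + y + h"
  have q: "0 <= x" "0 <= y" "0 <= q" "x + h/2 <= q" "y + h/2 <= q" "q <= 1" using x1 y1 h1 h by (auto simp: q_def x_def y_def)
  have zu: "norm (z - of_real u') <= x + h/2"
  proof -
  have "z - of_real u' = (z - of_real th) + of_real (th - u')" by simp
  then show ?thesis using zh norm_triangle_ineq[of "z - of_real th" "of_real (th - u')"]
  unfolding x_def by (simp only: norm_of_real)
  qed
  have wv: "norm (w - of_real (v m)) <= y + h/2"
  proof -
  have "w - of_real (v m) = (w - of_real s) + of_real (s - v m)" by simp
  then show ?thesis using wh norm_triangle_ineq[of "w - of_real s" "of_real (s - v m)"]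
  unfolding y_def by (simp only: norm_of_real)
  qed
  have z1: "norm (z - of_real u') <= 1" "norm (w - of_real (v m)) <= 1" using zu wv q by linarith+
  have taz: "ta (z - of_real (u n)) = ta (z - of_real u')"
  using per\<tau>[of "z - of_real u'" k] by (simp add: u'_def algebra_simps)
  have bu: "tpoly K (%i l. b i l (u n) (v m)) al \<beta> = tpoly K (%i l. b i l u' (v m)) al \<beta>" for al \<beta>
  unfolding tpoly_def u'_def using perb vJ by (intro sum.cong refl) auto
  have tad: "norm (ta \<zeta> - \<zeta>) <= C\<tau> * q ^ K" "norm (ta \<zeta>) <= R" "norm \<zeta> <= R" if "norm \<zeta> <= q" for \<zeta>
  proof -
  have l: "norm \<zeta> <= 1" using that q by linarith
  have "norm (ta \<zeta> - \<zeta>) <= C\<tau> * norm \<zeta> ^ K" by (rule ta(2)[OF l])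
  also have p: "... <= C\<tau> * q ^ K" using that ta(3) by (intro mult_left_mono power_mono) auto
  finally show d: "norm (ta \<zeta> - \<zeta>) <= C\<tau> * q ^ K" .
  have "C\<tau> * q ^ K <= C\<tau> * 1" using q ta(3) by (intro mult_left_mono power_le_one) auto
  then show "norm (ta \<zeta>) <= R" using d l norm_triangle_ineq2[of "ta \<zeta>" \<zeta>] unfolding R_def by linarith
  show "norm \<zeta> <= R" using l ta(3) by (simp add: R_def)
  qed
  have zq: "norm (z - of_real u') <= q" and wq: "norm (w - of_real (v m)) <= q" using zu wv q by linarith+
  have zq': "norm (z - of_real th) <= q" and wq': "norm (w - of_real s) <= q" using zh wh q by linarith+
  have "norm (?Q n m - tpoly K (%i l. b i l u' (v m)) (z - of_real u') (w - of_real (v m)))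
  <= real K * (real K * (B * (real K * R ^ (2 * K)))) * (norm (ta (z - of_real u') - (z - of_real u')) + norm (ta (w - of_real (v m)) - (w - of_real (v m))))"
  unfolding taz bu
  by (rule tpoly_lipschitz) (use bB vJ tad(2,3)[OF zq] tad(2,3)[OF wq] ta(3) in \<open>auto simp: R_def\<close>)
  also have "... <= real K * (real K * (B * (real K * R ^ (2 * K)))) * (C\<tau> * q ^ K + C\<tau> * q ^ K)"
  using tad(1)[OF zq] tad(1)[OF wq] B ta(3) by (intro mult_left_mono add_mono mult_nonneg_nonneg) (auto simp: R_def)
  also have "... = D1 * q ^ K" by (simp add: D1_def algebra_simps)
  finally have e1: "norm (?Q n m - tpoly K (%i l. b i l u' (v m)) (z - of_real u') (w - of_real (v m))) <= D1 * q ^ K" .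
  have "norm (tpoly K (%i l. b i l u' (v m)) (z - of_real u') (w - of_real (v m)) - ?T)
  <= (\<bar>u' - th\<bar> + \<bar>v m - s\<bar>) * B * (2 * q) ^ (K - 1) / fact (K - 1)"
  by (rule taylor_rebase[OF jets _ vJ(2,1) K _ zq' zq wq' wq]) (use bB in auto)
  also have "... <= (\<bar>u' - th\<bar> + \<bar>v m - s\<bar>) * B * (2 * q) ^ (K - 1) / 1"
  using B q by (intro divide_left_mono mult_nonneg_nonneg) auto
  also have "... <= (2 * q) * B * (2 * q) ^ (K - 1) / 1"
  proof (intro divide_right_mono mult_right_mono)
  have "\<bar>u' - th\<bar> = x" "\<bar>v m - s\<bar> = y" by (simp_all add: x_def y_def abs_minus_commute)
  then show "\<bar>u' - th\<bar> + \<bar>v m - s\<bar> <= 2 * q" using h q(1,2) by (simp add: q_def)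
  qed (use B q in auto)
  also have "... = B * 2 ^ K * q ^ K"
  using K by (cases K) (simp_all add: power_mult_distrib)
  finally have e2: "norm (tpoly K (%i l. b i l u' (v m)) (z - of_real u') (w - of_real (v m)) - ?T) <= B * 2 ^ K * q ^ K" .
  have "q ^ K <= 3 ^ K * (x ^ K + y ^ K + h ^ K)"
  proof -
  define M where "M = max x (max y h)"
  have "q <= 3 * M" by (auto simp: q_def M_def max_def)
  then have "q ^ K <= (3 * M) ^ K" using q by (intro power_mono) auto
  also have "... = 3 ^ K * M ^ K" by (simp add: power_mult_distrib)
  also have "... <= 3 ^ K * (x ^ K + y ^ K + h ^ K)"
  using q h by (intro mult_left_mono) (auto simp: M_def max_def)
  finally show ?thesis .
  qed
  also have "... <= 3 ^ K * (S n + S' m + h ^ K)" using xS yS by (intro mult_left_mono) auto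
  finally have qK: "q ^ K <= 3 ^ K * (S n + S' m + h ^ K)" .
  have "norm (?Q n m - ?T) <= (D1 + B * 2 ^ K) * q ^ K"
  using norm_diff_triangle_le[OF e1 e2] by (simp add: distrib_right)
  also have "... <= (D1 + B * 2 ^ K) * (3 ^ K * (S n + S' m + h ^ K))" using qK D1 B by (intro mult_left_mono) auto
  finally show ?thesis by (simp add: D_def mult.assoc)
  qed
  have "norm (smooth ta K N s0 rh b z w - ?T) <= 9 * D * (2 * (Cm / real N ^ K) + h ^ K)"
  unfolding smooth_def un vn
  by (rule weighted_average_error[OF _ finite_cells kz(2) kw(2) pos pos' mom mom' Q D]) auto
  also have "... = 9 * D * (2 * Cm + 1) / real N ^ K" by (simp add: h_def power_divide add_divide_distrib algebra_simps)
  also have "... <= C / real N ^ K" unfolding C_def using N0 by (intro divide_right_mono) auto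
  finally have main: "norm (smooth ta K N s0 rh b z w - ?T) <= C / real N ^ K" .
  have n0: "(\<Sum>n\<in>?G. ker K N (z - of_real (u n))) ~= 0"
  using sum_perturb(1)[of ?G "%n. ker K N (z - of_real (u n))" "%n. kr K N (th - u n)"] kz(2) pos by auto
  have n0': "(\<Sum>n\<in>?G'. ker K N (w - of_real (v n))) ~= 0"
  using sum_perturb(1)[of ?G' "%n. ker K N (w - of_real (v n))" "%n. kr K N (s - v n)"] kw(2) pos' finite_cells by auto
  show "norm (smooth ta K N s0 rh b z w - ?T) <= C / real N ^ K
  & (\<Sum>n\<in>{0..<int N}. ker K N (z - of_real (of_int n / real N))) ~= 0
  & (\<Sum>m\<in>cells N rh. ker K N (w - of_real (s0 + of_int m / real N))) ~= 0
  & (ALL n. 1 / of_nat N ^ 2 + sin (of_real pi * (z - of_real (of_int n / real N))) ^ 2 ~= (0::complex))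
  & (ALL m. 1 / of_nat N ^ 2 + sin (of_real pi * (w - of_real (s0 + of_int m / real N))) ^ 2 ~= (0::complex))"
  using main n0 n0' kz(1) kw(1) by (simp add: u_def v_def)
 qed (use c in auto)
qed
section \<open>The Lyapunov exponent as a limit of integrals\<close>

lemma cmat_nth: "cmat M $ i $ j = of_real (M $ i $ j)"
 by (simp add: cmat_def)

text \<open>Subadditivity makes the limit defining the exponent exist, so that \<open>lim\<close> in its definition is a genuine limit.\<close>

lemma fekete:
 fixes a :: "nat => real"
 assumes sub: "!!m n. a (m + n) <= a m + a n" and pos: "!!n. 0 <= a n"
 shows "convergent (%n. a n / real n)"
proof -
 define L where "L = Inf ((%n. a n / real n) ` {1..})"
 have bdd: "bdd_below ((%n. a n / real n) ` {1..})"
  by (rule bdd_belowI[of _ 0]) (use pos in auto)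
 have low: "L <= a n / real n" if "n \<ge> 1" for n
  unfolding L_def using that by (intro cInf_lower bdd) auto
 have mult: "a (q * m) <= real q * a m + a 0" for q m
 proof (induction q)
  case (Suc q)
  have "a (Suc q * m) <= a m + a (q * m)" using sub[of m "q * m"] by simp
  then show ?case using Suc by (simp add: algebra_simps)
 qed simp
 have "(%n. a n / real n) \<longlonglongrightarrow> L"
 proof (rule LIMSEQ_I)
  fix e :: real assume e: "e > 0"
  have "L < L + e/2" using e by simp
  then obtain m where m: "m \<ge> 1" "a m / real m < L + e/2"
  using cInf_lessD[of "(%n. a n / real n) ` {1..}" "L + e/2"] unfolding L_def by auto
  define M where "M = Max (a ` {..<m}) + a 0"
  have M: "a j + a 0 <= M" if "j < m" for j unfolding M_def using that by (simp add: Max_ge)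
  have M0: "M \<ge> 0" using M[of 0] pos[of 0] m by simp
  obtain N where N: "real N > 2 * M / e" using reals_Archimedean2 by blast
  have "norm (a n / real n - L) < e" if n: "n \<ge> max N 1" for n
  proof -
  have n1: "n \<ge> 1" "real n > 2 * M / e" using n N by (auto intro: less_le_trans)
  have "a n <= a ((n div m) * m) + a (n mod m)" using sub[of "(n div m) * m" "n mod m"] by simp
  also have "... <= real (n div m) * a m + (a (n mod m) + a 0)" using mult[of "n div m" m] by simp
  also have "... <= real (n div m) * a m + M" using M[of "n mod m"] m by simp
  also have "real (n div m) * a m <= (real n / real m) * a m"
  proof (intro mult_right_mono pos)
  have "real (n div m) * real m <= real n"
  by (metis div_times_less_eq_dividend of_nat_le_iff of_nat_mult)
  then show "real (n div m) <= real n / real m" using m by (simp add: le_divide_eq)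
  qed
  finally have "a n <= real n * (a m / real m) + M" by simp
  then have "a n / real n <= (real n * (a m / real m) + M) / real n" by (intro divide_right_mono) auto
  also have "... = a m / real m + M / real n" using n1 by (simp add: add_divide_distrib)
  also have "M / real n < e/2"
  using n1 e by (simp add: field_simps)
  finally have "a n / real n < L + e" using m(2) by linarith
  then show ?thesis using low[OF n1(1)] e by simp
  qed
  then show "EX no. \<forall>n\<ge>no. norm (a n / real n - L) < e" by blast
 qed
 then show ?thesis by (auto simp: convergent_def)
qed

lemma onorm_diff_le: "\<bar>onorm ((*v) A) - onorm ((*v) B)\<bar> <= norm (A - B)" for A B :: "real^2^2"
proof -
 have bl: "bounded_linear ((*v) M)" for M :: "real^2^2" by simp
 have *: "onorm ((*v) A) <= onorm ((*v) B) + norm (A - B)" for A B :: "real^2^2"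
 proof (rule onorm_le)
  fix x
  have "A *v x = B *v x + (A - B) *v x" by (simp add: matrix_vector_mult_diff_rdistrib)
  then have "norm (A *v x) <= norm (B *v x) + norm ((A - B) *v x)" by (metis norm_triangle_ineq)
  also have "... <= onorm ((*v) B) * norm x + norm (A - B) * norm x"
  by (intro add_mono onorm[OF bl] norm_mat_vec)
  finally show "norm (A *v x) <= (onorm ((*v) B) + norm (A - B)) * norm x" by (simp add: algebra_simps)
 qed
 show ?thesis using *[of A B] *[of B A] by (simp add: norm_minus_commute abs_le_iff)
qed

lemma continuous_onorm: "continuous_on UNIV (%M :: real^2^2. onorm ((*v) M))"
 unfolding continuous_on_iff
proof (intro ballI allI impI)
 fix M :: "real^2^2" and e :: real assume "e > 0"
 then show "\<exists>d>0. ALL M':UNIV. dist M' M < d --> dist (onorm ((*v) M')) (onorm ((*v) M)) < e"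
  using onorm_diff_le by (intro exI[of _ e]) (auto simp: dist_norm intro: le_less_trans)
qed

lemma orbit_cocycle: "orbit (%k. cmat (A ((f ^^ k) x))) n = cmat (cocycle f A n x) *v x0"
proof (induction n)
 case 0
 show ?case by (simp add: vec_eq_iff forall_2 mat2_vec cmat_def mat_def)
next
 case (Suc n)
 have "cmat (M ** N) = cmat M ** cmat N" for M N :: "real^2^2"
  by (simp add: cmat_def matrix_matrix_mult_def vec_eq_iff)
 then show ?case using Suc by (simp add: matrix_vector_mul_assoc)
qed

lemma det_cocycle: "(!!x. det (A x) = 1) ==> det (cocycle f A n x) = 1"
 by (induction n) (simp_all add: det_mul)

text \<open>Since \<open>x0 = (1, i)\<close> and the functional is \<open>(1, - i)\<close>, the square of \<open>|D|\<close> is the sum of squares of the entries plus twice the determinant.\<close>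

lemma onorm_Dn:
 fixes M :: "real^2^2"
 assumes "det M = 1"
 defines "D \<equiv> lfun (cmat M *v x0)"
 shows "1 <= onorm ((*v) M)" "onorm ((*v) M) <= norm D" "norm D <= 2 * onorm ((*v) M)"
proof -
 have x: "(cmat M *v x0) $ i = Complex (M$i$1) (M$i$2)" for i
  by (simp add: mat2_vec cmat_def x0_def complex_eq_iff)
 have "crossE (cmat M *v x0) = 1" using crossE_cmat[of M x0] assms norm_x0 by simp
 moreover have "(norm (cmat M *v x0))\<^sup>2 = (norm M)\<^sup>2"
  unfolding norm_vec2_sq x by (simp add: cmod_power2)
 ultimately have D: "(norm D)\<^sup>2 = (norm M)\<^sup>2 + 2" unfolding D_def norm_lfun_sq by simp
 have nM: "(norm M)\<^sup>2 \<ge> 2" using det_bound[of M] assms(1) by simp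
 have bl: "bounded_linear ((*v) M)" by simp
 have le: "onorm ((*v) M) <= norm M" by (rule onorm_le) (rule norm_mat_vec)
 have o0: "onorm ((*v) M) \<ge> 0" by (rule onorm_pos_le[OF bl])
 have col: "(M$1$j)\<^sup>2 + (M$2$j)\<^sup>2 <= (onorm ((*v) M))\<^sup>2" for j
 proof -
  have "norm (M *v axis j 1) <= onorm ((*v) M) * norm (axis j 1 :: real^2)" by (rule onorm[OF bl])
  then have "norm (column j M) <= onorm ((*v) M)" by (simp add: matrix_vector_mult_basis)
  then have "(norm (column j M))\<^sup>2 <= (onorm ((*v) M))\<^sup>2" by (intro power_mono) auto
  then show ?thesis by (simp add: norm_vec2_sq column_def)
 qed
 have M2: "(norm M)\<^sup>2 <= 2 * (onorm ((*v) M))\<^sup>2" using col[of 1] col[of 2] by (simp add: norm_vec2_sq)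
 then have "1 <= (onorm ((*v) M))\<^sup>2" using nM by linarith
 then show 1: "1 <= onorm ((*v) M)" using o0 by (metis abs_of_nonneg power2_le_imp_le one_power2)
 have "norm M <= norm D" by (rule power2_le_imp_le) (use D in auto)
 then show "onorm ((*v) M) <= norm D" using le by linarith
 have "(norm D)\<^sup>2 <= (2 * onorm ((*v) M))\<^sup>2" using D M2 nM by (simp add: power_mult_distrib)
 then show "norm D <= 2 * onorm ((*v) M)" using o0 by (intro power2_le_imp_le[of "norm D"]) auto
qed

locale mpt =
 fixes f :: "'x::metric_space => 'x" and \<mu> :: "'x measure"
 assumes prob: "prob_space \<mu>" and sets_\<mu>: "sets \<mu> = sets borel"
  and inv: "distr \<mu> \<mu> f = \<mu>" and cont_f: "continuous_on UNIV f"
begin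

sublocale prob_space \<mu> by (rule prob)

lemma cont_iter: "continuous_on UNIV (f ^^ n)"
proof (induction n)
 case (Suc n)
 then show ?case using continuous_on_compose[OF Suc continuous_on_subset[OF cont_f]] by simp
qed (simp add: id_def)

lemma meas_cont: "continuous_on UNIV g ==> g : borel_measurable \<mu>" for g :: "'x => 'b::topological_space"
 using borel_measurable_continuous_onI measurable_cong_sets[OF sets_\<mu> refl] by blast

lemma meas_f: "f : measurable \<mu> \<mu>"
 using meas_cont[OF cont_f] measurable_cong_sets[OF refl sets_\<mu>] by blast

lemma meas_iter: "f ^^ n : measurable \<mu> \<mu>"
 using meas_cont[OF cont_iter] measurable_cong_sets[OF refl sets_\<mu>] by blast

lemma distr_iter: "distr \<mu> \<mu> (f ^^ n) = \<mu>"
proof (induction n)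
 case 0 then show ?case by (simp add: distr_id id_def)
next
 case (Suc n)
 have "distr \<mu> \<mu> (f \<circ> (f ^^ n)) = distr (distr \<mu> \<mu> (f ^^ n)) \<mu> f"
  by (rule distr_distr[symmetric, OF meas_f meas_iter])
 then show ?case using Suc inv by (simp add: o_def)
qed

lemma integral_iter:
 fixes g :: "'x => real"
 assumes "g : borel_measurable \<mu>"
 shows "(\<integral>x. g ((f ^^ n) x) \<partial>\<mu>) = (\<integral>x. g x \<partial>\<mu>)"
 using integral_distr[OF meas_iter assms, of n] distr_iter by simp

lemma cont_cocycle:
 fixes A :: "'x => real^2^2"
 assumes "continuous_on UNIV A"
 shows "continuous_on UNIV (cocycle f A n)"
proof (induction n)
 case (Suc n)
 have 1: "continuous_on UNIV (%x. A ((f ^^ n) x))"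
  using continuous_on_compose[OF cont_iter continuous_on_subset[OF assms]] by (simp add: o_def)
 have "continuous_on UNIV (%x. A ((f ^^ n) x) ** cocycle f A n x)"
  unfolding matrix_matrix_mult_def sum_2
  by (intro continuous_on_vec_lambda continuous_intros continuous_on_component 1 Suc)
 then show ?case by simp
qed simp

lemma cocycle_add: "cocycle f A (m + n) x = cocycle f A m ((f ^^ n) x) ** cocycle f A n x" for A :: "'x => real^2^2"
proof (induction m)
 case (Suc m)
 have "(f ^^ (m + n)) x = (f ^^ m) ((f ^^ n) x)" by (simp add: funpow_add)
 then show ?case using Suc by (simp add: matrix_mul_assoc)
qed simp

lemma lyapunov_as_limit:
 fixes A :: "'x => real^2^2"
 assumes A: "continuous_on UNIV A" and det: "!!x. det (A x) = 1" and B: "!!x. norm (A x) <= B" "1 <= B"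
 shows "(%n. 1 / real n * (\<integral>x. ln (norm (Dn (%k. cmat (A ((f ^^ k) x))) n)) \<partial>\<mu>)) \<longlonglongrightarrow> lyapunov f \<mu> A"
  and "!!n. (%x. ln (norm (Dn (%k. cmat (A ((f ^^ k) x))) n))) : borel_measurable \<mu>"
  and "!!n x. 0 <= ln (norm (Dn (%k. cmat (A ((f ^^ k) x))) n))"
  and "!!n x. ln (norm (Dn (%k. cmat (A ((f ^^ k) x))) n)) <= real n * ln B + ln 2"
proof -
 let ?o = "%n x. onorm ((*v) (cocycle f A n x))"
 let ?D = "%n x. norm (Dn (%k. cmat (A ((f ^^ k) x))) n)"
 have D: "1 <= ?o n x" "?o n x <= ?D n x" "?D n x <= 2 * ?o n x" for x n
  using onorm_Dn[OF det_cocycle[where f = f and n = n and x = x and A = A, OF det]] by (simp_all add: Dn_def orbit_cocycle)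
 have bl: "bounded_linear ((*v) M)" for M :: "real^2^2" by simp
 have oB: "?o n x <= B ^ n" for n x
 proof (induction n)
  case 0
  have "onorm (%v::real^2. v) <= 1" by (rule onorm_id_le)
  then show ?case by (simp add: matrix_vector_mul_lid[abs_def])
 next
  case (Suc n)
  have "?o (Suc n) x = onorm ((*v) (A ((f ^^ n) x)) \<circ> (*v) (cocycle f A n x))"
  by (simp add: o_def matrix_vector_mul_assoc)
  also have "... <= onorm ((*v) (A ((f ^^ n) x))) * ?o n x" by (rule onorm_compose[OF bl bl])
  also have "... <= B * B ^ n"
  proof (rule mult_mono)
  have "onorm ((*v) (A ((f ^^ n) x))) <= norm (A ((f ^^ n) x))" by (rule onorm_le) (rule norm_mat_vec)
  then show "onorm ((*v) (A ((f ^^ n) x))) <= B" using B(1)[of "(f ^^ n) x"] by linarith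
  qed (use Suc B onorm_pos_le[OF bl] in auto)
  finally show ?case by simp
 qed
 have lo: "0 <= ln (?o n x)" "ln (?o n x) <= real n * ln B" for n x
 proof -
  show "0 <= ln (?o n x)" using D(1)[of n x] by simp
  have "ln (?o n x) <= ln (B ^ n)" using oB[of n x] D(1)[of n x] by (subst ln_le_cancel_iff) auto
  then show "ln (?o n x) <= real n * ln B" using B(2) by (simp add: ln_realpow)
 qed
 have lD: "ln (?o n x) <= ln (?D n x)" "ln (?D n x) <= ln 2 + ln (?o n x)" for n x
 proof -
  show "ln (?o n x) <= ln (?D n x)" using D(1)[of n x] D(2)[of n x] by (subst ln_le_cancel_iff) auto
  have "ln (?D n x) <= ln (2 * ?o n x)" using D(1)[of n x] D(2)[of n x] D(3)[of x n] by (subst ln_le_cancel_iff) auto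
  also have "... = ln 2 + ln (?o n x)" using D(1)[of n x] by (subst ln_mult) auto
  finally show "ln (?D n x) <= ln 2 + ln (?o n x)" .
 qed
 show "0 <= ln (?D n x)" "ln (?D n x) <= real n * ln B + ln 2" for n x
  using lD(1)[of n x] lD(2)[of x n] lo[of n x] by linarith+
 have mo: "(%x. ln (?o n x)) : borel_measurable \<mu>" for n
  using meas_cont[OF continuous_on_compose2[OF continuous_onorm cont_cocycle[OF A]]] by (intro borel_measurable_ln) auto
 have mD: "(%x. ln (?D n x)) : borel_measurable \<mu>" for n
 proof -
  have c: "continuous_on UNIV (%x. cocycle f A n x $ i $ j)" for i j
  by (intro continuous_on_component cont_cocycle A)
  have "continuous_on UNIV (%x. ?D n x)"
  unfolding Dn_def orbit_cocycle lfun_def mat2_vec cmat_nth by (intro continuous_intros c)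
  then show ?thesis by (intro borel_measurable_ln meas_cont)
 qed
 then show "(%x. ln (?D n x)) : borel_measurable \<mu>" for n .
 have io: "integrable \<mu> (%x. ln (?o n x))" for n
  using lo[of n] by (intro integrable_const_bound[OF _ mo, of _ "real n * ln B"]) auto
 have iD: "integrable \<mu> (%x. ln (?D n x))" for n
 proof (intro integrable_const_bound[OF _ mD, of _ "real n * ln B + ln 2"] AE_I2)
  fix x show "norm (ln (?D n x)) <= real n * ln B + ln 2" using lD(1)[of n x] lD(2)[of x n] lo[of n x] by simp
 qed
 define a where "a = (%n. \<integral>x. ln (?o n x) \<partial>\<mu>)"
 have "a (m + n) <= a m + a n" for m n
 proof -
  have i2: "integrable \<mu> (%x. ln (?o m ((f ^^ n) x)))"
  using lo[of m] by (intro integrable_const_bound[of _ "real m * ln B"] measurable_compose[OF meas_iter mo]) auto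
  have "a (m + n) <= (\<integral>x. ln (?o m ((f ^^ n) x)) + ln (?o n x) \<partial>\<mu>)"
  unfolding a_def
  proof (intro integral_mono io Bochner_Integration.integrable_add i2)
  fix x
  have "?o (m + n) x = onorm ((*v) (cocycle f A m ((f ^^ n) x)) \<circ> (*v) (cocycle f A n x))"
  by (simp add: o_def matrix_vector_mul_assoc cocycle_add)
  also have "... <= ?o m ((f ^^ n) x) * ?o n x" by (rule onorm_compose[OF bl bl])
  finally have "ln (?o (m + n) x) <= ln (?o m ((f ^^ n) x) * ?o n x)"
  using D(1)[of "m + n" x] by (subst ln_le_cancel_iff) auto
  also have "... = ln (?o m ((f ^^ n) x)) + ln (?o n x)"
  using D(1)[of m "(f ^^ n) x"] D(1)[of n x] by (subst ln_mult) auto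
  finally show "ln (?o (m + n) x) <= ln (?o m ((f ^^ n) x)) + ln (?o n x)" .
  qed
  also have "... = a m + a n" unfolding a_def using integral_iter[OF mo[of m], where n = n] io i2 by simp
  finally show ?thesis .
 qed
 moreover have "a n \<ge> 0" for n unfolding a_def using lo by (intro integral_nonneg_AE) auto
 ultimately have "convergent (%n. a n / real n)" by (rule fekete)
 then have L: "(%n. 1 / real n * a n) \<longlonglongrightarrow> lyapunov f \<mu> A"
  unfolding lyapunov_def a_def convergent_LIMSEQ_iff by simp
 have "(%n. 1 / real n * (\<integral>x. ln (?D n x) \<partial>\<mu>) - 1 / real n * a n) \<longlonglongrightarrow> 0"
 proof (rule Lim_null_comparison)
  show "(%n. ln 2 / real n) \<longlonglongrightarrow> 0" by real_asymp
  show "\<forall>\<^sub>F n in sequentially. norm (1 / real n * (\<integral>x. ln (?D n x) \<partial>\<mu>) - 1 / real n * a n) <= ln 2 / real n"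
  proof (intro always_eventually allI)
  fix n
  have "a n <= (\<integral>x. ln (?D n x) \<partial>\<mu>)" unfolding a_def using lD(1) io iD by (intro integral_mono) auto
  moreover have "(\<integral>x. ln (?D n x) \<partial>\<mu>) <= (\<integral>x. ln 2 + ln (?o n x) \<partial>\<mu>)" using lD(2) io iD by (intro integral_mono) auto
  moreover have "(\<integral>x. ln 2 + ln (?o n x) \<partial>\<mu>) = ln 2 + a n" unfolding a_def using io by (simp add: prob_space)
  ultimately have "\<bar>(\<integral>x. ln (?D n x) \<partial>\<mu>) - a n\<bar> <= ln 2" by linarith
  then have "\<bar>((\<integral>x. ln (?D n x) \<partial>\<mu>) - a n) / real n\<bar> <= ln 2 / real n" by (simp add: abs_divide divide_right_mono)
  then show "norm (1 / real n * (\<integral>x. ln (?D n x) \<partial>\<mu>) - 1 / real n * a n) <= ln 2 / real n"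
  by (simp add: diff_divide_distrib)
  qed
 qed
 from tendsto_add[OF this L] show "(%n. 1 / real n * (\<integral>x. ln (?D n x) \<partial>\<mu>)) \<longlonglongrightarrow> lyapunov f \<mu> A" by simp
qed

end

definition circ :: "real measure" where "circ = restrict_space lborel {0..1}"

lemma prob_circ: "prob_space circ"
 by (rule prob_spaceI) (simp add: circ_def space_restrict_space emeasure_restrict_space)

lemma caratheodory_measurable:
 fixes g :: "real => 'x => real"
 assumes cont: "!!x. continuous_on UNIV (%th. g th x)" and meas: "!!th. g th : borel_measurable \<mu>"
 shows "(%p. g (fst p) (snd p)) : borel_measurable (circ \<Otimes>\<^sub>M \<mu>)"
proof (rule borel_measurable_LIMSEQ_real)
 fix N :: nat
 have fl: "(%p. \<lfloor>real (Suc N) * fst p\<rfloor>) : measurable (circ \<Otimes>\<^sub>M \<mu>) (count_space UNIV)"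
 proof -
  have "(%th. th) : measurable circ borel" unfolding circ_def by (simp add: measurable_restrict_space1)
  then have "(%p. fst p) : measurable (circ \<Otimes>\<^sub>M \<mu>) (borel::real measure)" by measurable
  then show ?thesis by measurable
 qed
 show "(%p. g (of_int \<lfloor>real (Suc N) * fst p\<rfloor> / real (Suc N)) (snd p)) : borel_measurable (circ \<Otimes>\<^sub>M \<mu>)"
  by (rule measurable_compose_countable[OF _ fl, of "%i p. g (of_int i / real (Suc N)) (snd p)"])
  (rule measurable_compose[OF measurable_snd meas])
next
 fix p :: "real \<times> 'x"
 have "(%N. of_int \<lfloor>real (Suc N) * fst p\<rfloor> / real (Suc N)) \<longlonglongrightarrow> fst p"
 proof (rule LIM_zero_cancel, rule Lim_null_comparison)
  show "(%N. 1 / real (Suc N)) \<longlonglongrightarrow> 0" by real_asymp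
  show "\<forall>\<^sub>F N in sequentially. norm (of_int \<lfloor>real (Suc N) * fst p\<rfloor> / real (Suc N) - fst p) <= 1 / real (Suc N)"
  proof (intro always_eventually allI)
  fix N
  have "\<bar>of_int \<lfloor>real (Suc N) * fst p\<rfloor> - real (Suc N) * fst p\<bar> <= 1" by linarith
  then have "\<bar>of_int \<lfloor>real (Suc N) * fst p\<rfloor> - real (Suc N) * fst p\<bar> / real (Suc N) <= 1 / real (Suc N)"
  by (intro divide_right_mono) auto
  moreover have "of_int \<lfloor>real (Suc N) * fst p\<rfloor> / real (Suc N) - fst p = (of_int \<lfloor>real (Suc N) * fst p\<rfloor> - real (Suc N) * fst p) / real (Suc N)"
  by (simp add: diff_divide_distrib)
  ultimately show "norm (of_int \<lfloor>real (Suc N) * fst p\<rfloor> / real (Suc N) - fst p) <= 1 / real (Suc N)" by (simp add: abs_divide)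
  qed
 qed
 then show "(%N. g (of_int \<lfloor>real (Suc N) * fst p\<rfloor> / real (Suc N)) (snd p)) \<longlonglongrightarrow> g (fst p) (snd p)"
  using cont[of "snd p"] by (intro isCont_tendsto_compose[where g = "%th. g th (snd p)"]) (auto simp: continuous_on_eq_continuous_at)
qed

lemma circ_integral:
 fixes g :: "real => real"
 shows "(\<integral>th. g th \<partial>circ) = (LINT th:{0..1}|lborel. g th)"
  and "continuous_on {0..1} g ==> (\<integral>th. g th \<partial>circ) = integral {0..1} g"
proof -
 show 1: "(\<integral>th. g th \<partial>circ) = (LINT th:{0..1}|lborel. g th)"
  unfolding circ_def set_lebesgue_integral_def by (subst integral_restrict_space) auto
 assume "continuous_on {0..1} g"
 then have "set_integrable lborel {0..1} g" by (rule borel_integrable_atLeastAtMost')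
 from set_borel_integral_eq_integral(2)[OF this] show "(\<integral>th. g th \<partial>circ) = integral {0..1} g" using 1 by simp
qed

section \<open>Averages at complex height\<close>

context mpt begin

lemma integral_circ_product:
 fixes g :: "real => 'x => real"
 assumes cont: "!!x. continuous_on UNIV (%th. g th x)" and meas: "!!th. g th : borel_measurable \<mu>" and bd: "!!th x. \<bar>g th x\<bar> <= M"
 shows "(\<integral>p. g (fst p) (snd p) \<partial>(circ \<Otimes>\<^sub>M \<mu>)) = (\<integral>th. (\<integral>x. g th x \<partial>\<mu>) \<partial>circ)"
  and "(\<integral>p. g (fst p) (snd p) \<partial>(circ \<Otimes>\<^sub>M \<mu>)) = (\<integral>x. integral {0..1} (%th. g th x) \<partial>\<mu>)"
  and "(%th. \<integral>x. g th x \<partial>\<mu>) : borel_measurable circ"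
  and "integrable \<mu> (%x. integral {0..1} (%th. g th x))"
proof -
 interpret c: prob_space circ by (rule prob_circ)
 interpret P: pair_prob_space circ \<mu> ..
 have m: "(%p. g (fst p) (snd p)) : borel_measurable (circ \<Otimes>\<^sub>M \<mu>)" by (rule caratheodory_measurable[OF cont meas])
 have i: "integrable (circ \<Otimes>\<^sub>M \<mu>) (%p. g (fst p) (snd p))"
  by (rule P.integrable_const_bound[of _ M]) (use bd m in auto)
 then have i': "integrable (circ \<Otimes>\<^sub>M \<mu>) (%(th, x). g th x)" by (simp add: case_prod_unfold)
 show "(\<integral>p. g (fst p) (snd p) \<partial>(circ \<Otimes>\<^sub>M \<mu>)) = (\<integral>th. (\<integral>x. g th x \<partial>\<mu>) \<partial>circ)"
  using P.integral_fst'[OF i'] by (simp add: case_prod_unfold)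
 have x: "(\<integral>th. g th x \<partial>circ) = integral {0..1} (%th. g th x)" for x
  by (rule circ_integral(2)) (rule continuous_on_subset[OF cont], simp)
 show "(\<integral>p. g (fst p) (snd p) \<partial>(circ \<Otimes>\<^sub>M \<mu>)) = (\<integral>x. integral {0..1} (%th. g th x) \<partial>\<mu>)"
  using P.integral_snd[OF i'] x by (simp add: case_prod_unfold)
 show "(%th. \<integral>x. g th x \<partial>\<mu>) : borel_measurable circ"
  using borel_measurable_lebesgue_integral[of "%th x. g th x" circ] m by (simp add: case_prod_unfold)
 show "integrable \<mu> (%x. integral {0..1} (%th. g th x))"
  using P.integrable_snd[OF i'] x by simp
qed

lemma mean_lyapunov_as_limit:
 fixes A :: "real => 'x => real^2^2"
 assumes A: "!!th. continuous_on UNIV (A th)" and A': "!!x. continuous_on UNIV (%th. A th x)"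
  and det: "!!th x. det (A th x) = 1" and B: "!!th x. norm (A th x) <= B" "1 <= B"
 shows "(%n. \<integral>p. (1 / real n) * ln (norm (Dn (%k. cmat (A (fst p) ((f ^^ k) (snd p)))) n)) \<partial>(circ \<Otimes>\<^sub>M \<mu>))
  \<longlonglongrightarrow> (LINT th:{0..1}|lborel. lyapunov f \<mu> (A th))"
proof -
 interpret c: prob_space circ by (rule prob_circ)
 let ?g = "%n th x. (1 / real n) * ln (norm (Dn (%k. cmat (A th ((f ^^ k) x))) n))"
 note L = lyapunov_as_limit[OF A det B]
 have bd: "\<bar>?g n th x\<bar> <= ln B + ln 2" for n th x
 proof (cases "n = 0")
  case True then show ?thesis using B(2) by simp
 next
  case False
  have "0 <= ln (norm (Dn (%k. cmat (A th ((f ^^ k) x))) n))" by (rule L(3))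
  moreover have "ln (norm (Dn (%k. cmat (A th ((f ^^ k) x))) n)) <= real n * ln B + ln 2" by (rule L(4))
  ultimately have "\<bar>?g n th x\<bar> <= (real n * ln B + ln 2) / real n"
  by (simp add: divide_right_mono)
  also have "... = ln B + ln 2 / real n" using False by (simp add: add_divide_distrib)
  also have "... <= ln B + ln 2" using False by (simp add: divide_le_eq)
  finally show ?thesis .
 qed
 have cont: "continuous_on UNIV (%th. ?g n th x)" for n x
 proof -
  have o: "continuous_on UNIV (%th. orbit (%k. cmat (A th ((f ^^ k) x))) n $ i)" for i
  proof (induction n arbitrary: i)
  case (Suc n)
  show ?case unfolding orbit.simps mat2_vec cmat_nth
  by (intro continuous_intros Suc continuous_on_component A')
  qed simp
  have "1 <= norm (Dn (%k. cmat (A th ((f ^^ k) x))) n)" for th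
  using onorm_Dn(1,2)[OF det_cocycle[where f = f and n = n and x = x and A = "A th", OF det]] unfolding Dn_def orbit_cocycle by linarith
  then have "norm (Dn (%k. cmat (A th ((f ^^ k) x))) n) ~= 0" for th
  by (metis not_one_le_zero)
  then show ?thesis unfolding Dn_def lfun_def by (intro continuous_intros o) auto
 qed
 have meas: "?g n th : borel_measurable \<mu>" for n th
  by (intro borel_measurable_times borel_measurable_const L(2))
 have eq: "(\<integral>p. ?g n (fst p) (snd p) \<partial>(circ \<Otimes>\<^sub>M \<mu>)) = (\<integral>th. (\<integral>x. ?g n th x \<partial>\<mu>) \<partial>circ)" for n
  by (rule integral_circ_product(1)[OF cont meas bd])
 have lim: "(%n. \<integral>x. ?g n th x \<partial>\<mu>) \<longlonglongrightarrow> lyapunov f \<mu> (A th)" for th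
  unfolding integral_mult_right_zero by (rule L(1))
 have m: "(%th. \<integral>x. ?g n th x \<partial>\<mu>) : borel_measurable circ" for n
  by (rule integral_circ_product(3)[OF cont meas bd])
 have ig: "integrable \<mu> (?g n th)" for n th
 proof (rule integrable_const_bound[where B = "ln B + ln 2"])
  show "AE x in \<mu>. norm (?g n th x) <= ln B + ln 2" using bd by auto
 qed (rule meas)
 have "(%n. \<integral>th. (\<integral>x. ?g n th x \<partial>\<mu>) \<partial>circ) \<longlonglongrightarrow> (\<integral>th. lyapunov f \<mu> (A th) \<partial>circ)"
 proof (rule integral_dominated_convergence[where w = "%_. ln B + ln 2"])
  show "(%th. lyapunov f \<mu> (A th)) : borel_measurable circ"
  by (rule borel_measurable_LIMSEQ_real[OF lim m])
  show "AE th in circ. norm (\<integral>x. ?g n th x \<partial>\<mu>) <= ln B + ln 2" for n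
  proof (intro AE_I2)
  fix th
  have "norm (\<integral>x. ?g n th x \<partial>\<mu>) <= (\<integral>x. norm (?g n th x) \<partial>\<mu>)" by (rule integral_norm_bound)
  also have "... <= (\<integral>x. ln B + ln 2 \<partial>\<mu>)" using bd ig by (intro integral_mono integrable_norm) auto
  finally show "norm (\<integral>x. ?g n th x \<partial>\<mu>) <= ln B + ln 2" by (simp add: prob_space)
  qed
 qed (use m lim in auto)
 then show ?thesis unfolding eq circ_integral(1) .
qed

end

section \<open>Iterated partial derivatives and compact families\<close>

lemma iter_deriv_Cons: "iter_deriv (b # bs) F z = frechet_derivative (iter_deriv bs F) (at z) b"
 by (simp add: iter_deriv_def)

lemma iter_deriv_Nil [simp]: "iter_deriv [] F = F"
 by (simp add: iter_deriv_def)

lemma frechet_derivative_cong_open: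
 assumes "open U" "z : U" "!!y. y : U ==> G y = G' y" "G differentiable (at z)"
 shows "frechet_derivative G (at z) = frechet_derivative G' (at z)"
proof -
 have "(G has_derivative frechet_derivative G (at z)) (at z)"
  using assms(4) frechet_derivative_works by blast
 then have "(G' has_derivative frechet_derivative G (at z)) (at z)"
  by (rule has_derivative_transform_within_open[OF _ assms(1,2,3)])
 then show ?thesis by (rule frechet_derivative_at)
qed

lemma C_nat_onD:
 assumes "C_nat_on n U F" "bs : lists Basis"
 shows "length bs < n ==> z : U ==> iter_deriv bs F differentiable (at z)"
  and "length bs <= n ==> continuous_on U (iter_deriv bs F)"
 using assms by (auto simp: C_nat_on_def)

lemma C_nat_on_mono: "C_nat_on n U F ==> m <= n ==> C_nat_on m U F"
 unfolding C_nat_on_def by auto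

lemma iter_deriv_has_partial:
 fixes F :: "real \<times> real => 'b::real_normed_vector"
 assumes "C_nat_on n U F" "bs : lists Basis" "length bs < n" "(th, s) : U"
 shows "((%th. iter_deriv bs F (th, s)) has_vector_derivative iter_deriv ((1, 0) # bs) F (th, s)) (at th)"
  and "((%s. iter_deriv bs F (th, s)) has_vector_derivative iter_deriv ((0, 1) # bs) F (th, s)) (at s)"
proof -
 let ?G = "iter_deriv bs F" and ?D = "frechet_derivative (iter_deriv bs F) (at (th, s))"
 have d: "(?G has_derivative ?D) (at (th, s))"
  using C_nat_onD(1)[OF assms(1-4)] frechet_derivative_works by blast
 have lin: "linear ?D" using d has_derivative_linear by blast
 have "((%th. (th, s)) has_derivative (%h. (h, 0))) (at th)" by (auto intro!: derivative_eq_intros)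
 from has_derivative_compose[OF this, of ?G ?D] d
 have "((%th. ?G (th, s)) has_derivative (%h. ?D (h, 0))) (at th)" by simp
 moreover have "(%h. ?D (h, 0)) = (%h. h *\<^sub>R ?D (1, 0))"
  by (rule ext) (metis linear_scale[OF lin] mult.right_neutral mult_zero_right real_scaleR_def scaleR_Pair)
 ultimately show "((%th. ?G (th, s)) has_vector_derivative iter_deriv ((1, 0) # bs) F (th, s)) (at th)"
  unfolding has_vector_derivative_def iter_deriv_Cons by (simp only:)
 have "((%s. (th, s)) has_derivative (%h. (0, h))) (at s)" by (auto intro!: derivative_eq_intros)
 from has_derivative_compose[OF this, of ?G ?D] d
 have "((%s. ?G (th, s)) has_derivative (%h. ?D (0, h))) (at s)" by simp
 moreover have "(%h. ?D (0, h)) = (%h. h *\<^sub>R ?D (0, 1))"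
  by (rule ext) (metis linear_scale[OF lin] mult.right_neutral mult_zero_right real_scaleR_def scaleR_Pair)
 ultimately show "((%s. ?G (th, s)) has_vector_derivative iter_deriv ((0, 1) # bs) F (th, s)) (at s)"
  unfolding has_vector_derivative_def iter_deriv_Cons by (simp only:)
qed

lemma Basis2 [simp]: "(1, 0) : (Basis :: (real \<times> real) set)" "(0, 1) : (Basis :: (real \<times> real) set)"
 by (simp_all add: Basis_prod_def)

lemma mixed_partials_commute:
 fixes F :: "real \<times> real => 'b::banach"
 assumes C: "C_nat_on n U F" and bs: "bs : lists Basis" "length bs + 2 <= n" and U: "open U" "(th0, s0) : U"
 shows "iter_deriv ((0, 1) # (1, 0) # bs) F (th0, s0) = iter_deriv ((1, 0) # (0, 1) # bs) F (th0, s0)"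
proof -
 obtain e where e: "e > 0" "cball (th0, s0) e <= U" using U open_contains_cball by blast
 define d where "d = e / 2"
 have d: "d > 0" using e by (simp add: d_def)
 have inU: "(th, s) : U" if "th : {th0 - d..th0 + d}" "s : {s0 - d..s0 + d}" for th s
 proof -
  have "dist (th0, s0) (th, s) <= \<bar>th0 - th\<bar> + \<bar>s0 - s\<bar>"
  using sqrt_sum_squares_le_sum_abs[of "th0 - th" "s0 - s"] by (simp add: dist_prod_def dist_real_def)
  also have "... <= d + d" using that by (intro add_mono) (auto simp: abs_le_iff)
  finally show ?thesis using e(2) by (auto simp: d_def)
 qed
 let ?I = "{th0 - d..th0 + d}" and ?S = "{s0 - d..s0 + d}"
 let ?G = "iter_deriv bs F" and ?G\<theta> = "iter_deriv ((1, 0) # bs) F" and ?Gs = "iter_deriv ((0, 1) # bs) F"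
 let ?A = "iter_deriv ((0, 1) # (1, 0) # bs) F" and ?B = "iter_deriv ((1, 0) # (0, 1) # bs) F"
 have bs1: "(1, 0) # bs : lists Basis" "(0, 1) # bs : lists Basis" using bs by auto
 have bs2: "(0, 1) # (1, 0) # bs : lists Basis" using bs by auto
 have contA: "continuous_on U ?A" using C_nat_onD(2)[OF C bs2] bs by simp
 have contG\<theta>: "continuous_on U ?G\<theta>" using C_nat_onD(2)[OF C bs1(1)] bs by simp
 have G\<theta>: "((%th. ?G (th, s)) has_vector_derivative ?G\<theta> (th, s)) (at th)" if "(th, s) : U" for th s
  using iter_deriv_has_partial(1)[OF C bs(1) _ that] bs by simp
 have Gs: "((%s. ?G (th, s)) has_vector_derivative ?Gs (th, s)) (at s)" if "(th, s) : U" for th s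
  using iter_deriv_has_partial(2)[OF C bs(1) _ that] bs by simp
 have A: "((%s. ?G\<theta> (th, s)) has_vector_derivative ?A (th, s)) (at s)" if "(th, s) : U" for th s
  using iter_deriv_has_partial(2)[OF C bs1(1) _ that] bs by simp
 have Bd: "((%th. ?Gs (th, s)) has_vector_derivative ?B (th, s)) (at th)" if "(th, s) : U" for th s
  using iter_deriv_has_partial(1)[OF C bs1(2) _ that] bs by simp
 let ?a = "th0 - d"
 have key: "?Gs (th, s0) - ?Gs (?a, s0) = integral {?a..th} (%t. ?A (t, s0))" if th: "th : ?I" for th
 proof -
  have sub: "(t, s) : U" if "t : {?a..th}" "s : ?S" for t s using inU that th by auto
  have int: "?G (th, s) - ?G (?a, s) = integral (cbox ?a th) (%t. ?G\<theta> (t, s))" if s: "s : ?S" for s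
  proof -
  have "((%t. ?G\<theta> (t, s)) has_integral (?G (th, s) - ?G (?a, s))) {?a..th}"
  by (rule fundamental_theorem_of_calculus) (use th sub s G\<theta> in \<open>auto intro: has_vector_derivative_at_within\<close>)
  then show ?thesis by (simp add: integral_unique)
  qed
  have "((%s. integral (cbox ?a th) (%t. ?G\<theta> (t, s))) has_vector_derivative
  integral (cbox ?a th) (%t. ?A (t, s0))) (at s0 within ?S)"
  proof (rule leibniz_rule_vector_derivative[where fx = "%s t. ?A (t, s)"])
  fix s t assume "s : ?S" "t : cbox ?a th"
  then show "((%s. ?G\<theta> (t, s)) has_vector_derivative ?A (t, s)) (at s within ?S)"
  using sub A by (auto intro: has_vector_derivative_at_within)
  next
  fix s assume "s : ?S"
  then have "continuous_on (cbox ?a th) (%t. ?G\<theta> (t, s))"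
  using sub by (intro continuous_on_compose2[OF contG\<theta>] continuous_intros) auto
  then show "(%t. ?G\<theta> (t, s)) integrable_on cbox ?a th" by (rule integrable_continuous)
  next
  have "continuous_on (?S \<times> cbox ?a th) (%p. ?A (snd p, fst p))"
  using sub by (intro continuous_on_compose2[OF contA] continuous_intros) auto
  then show "continuous_on (?S \<times> cbox ?a th) (%(s, t). ?A (t, s))" by (simp add: case_prod_unfold)
  qed (use d in auto)
  note D1 = this
  have s0S: "s0 : ?S" and aI: "?a : ?I" using d by auto
  have D0: "((%s. ?G (th, s) - ?G (?a, s)) has_vector_derivative ?Gs (th, s0) - ?Gs (?a, s0)) (at s0 within ?S)"
  by (rule has_vector_derivative_diff[OF has_vector_derivative_at_within[OF Gs[OF inU[OF th s0S]]]
  has_vector_derivative_at_within[OF Gs[OF inU[OF aI s0S]]]])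
  have D2: "((%s. integral (cbox ?a th) (%t. ?G\<theta> (t, s))) has_vector_derivative ?Gs (th, s0) - ?Gs (?a, s0)) (at s0 within ?S)"
  by (rule has_vector_derivative_transform[OF s0S _ D0]) (rule int[symmetric])
  have e: "at s0 within ?S = at s0" using d by (intro at_within_Icc_at) auto
  show ?thesis using vector_derivative_unique_at[OF D2[unfolded e] D1[unfolded e]] by simp
 qed
 have thI: "th0 : ?I" using d by auto
 have "((%th. integral {?a..th} (%t. ?A (t, s0))) has_vector_derivative ?A (th0, s0)) (at th0 within ?I)"
 proof (rule integral_has_vector_derivative)
  show "continuous_on ?I (%t. ?A (t, s0))"
  using inU d by (intro continuous_on_compose2[OF contA] continuous_intros) auto
 qed (use d in auto)
 note E1 = this
 have E0: "((%th. ?Gs (th, s0) - ?Gs (?a, s0)) has_vector_derivative ?B (th0, s0) - 0) (at th0 within ?I)"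
  by (rule has_vector_derivative_diff[OF has_vector_derivative_at_within[OF Bd[OF U(2)]] has_vector_derivative_const])
 have E2: "((%th. integral {?a..th} (%t. ?A (t, s0))) has_vector_derivative ?B (th0, s0) - 0) (at th0 within ?I)"
  by (rule has_vector_derivative_transform[OF thI _ E0]) (rule key[symmetric])
 have e: "at th0 within ?I = at th0" using d by (intro at_within_Icc_at) auto
 show ?thesis using vector_derivative_unique_at[OF E1[unfolded e] E2[unfolded e]] by simp
qed

definition word :: "nat => nat => (real \<times> real) list" where
 "word i l = replicate i (1, 0) @ replicate l (0, 1)"

lemma word_simps [simp]: "word i l : lists Basis" "length (word i l) = i + l" "word (Suc i) l = (1, 0) # word i l"
 "word 0 (Suc l) = (0, 1) # word 0 l" "word 0 0 = []"
 by (auto simp: word_def)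

lemma iter_deriv_word_s:
 fixes F :: "real \<times> real => 'b::banach"
 assumes C: "C_nat_on n U F" and U: "open U" and "i + l < n" "z : U"
 shows "iter_deriv ((0, 1) # word i l) F z = iter_deriv (word i (Suc l)) F z"
 using assms(3,4)
proof (induction i arbitrary: z)
 case 0 then show ?case by simp
next
 case (Suc i)
 obtain th s where z: "z = (th, s)" by (cases z)
 have "iter_deriv ((0, 1) # word (Suc i) l) F z = iter_deriv ((1, 0) # (0, 1) # word i l) F z"
  using mixed_partials_commute[OF C, of "word i l" th s] Suc.prems U z by simp
 also have "... = iter_deriv ((1, 0) # word i (Suc l)) F z"
  unfolding iter_deriv_Cons[of "(1, 0)"]
 proof (rule fun_cong[OF frechet_derivative_cong_open[OF U Suc.prems(2)]])
  show "iter_deriv ((0, 1) # word i l) F y = iter_deriv (word i (Suc l)) F y" if "y : U" for y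
  using Suc.IH[OF _ that] Suc.prems by simp
  show "iter_deriv ((0, 1) # word i l) F differentiable at z"
  by (rule C_nat_onD(1)[OF C]) (use Suc.prems in auto)
 qed
 finally show ?case by simp
qed

lemma iter_deriv_diff:
 fixes F G :: "'a::euclidean_space => 'b::real_normed_vector"
 assumes F: "C_nat_on n U F" and G: "C_nat_on n U G" and U: "open U"
 shows "bs : lists Basis ==> length bs <= n ==> z : U ==> iter_deriv bs (%z. G z - F z) z = iter_deriv bs G z - iter_deriv bs F z"
proof (induction bs arbitrary: z rule: list.induct)
 case Nil then show ?case by simp
next
 case (Cons b bs)
 have bs: "bs : lists Basis" "length bs < n" using Cons.prems by auto
 have d: "(iter_deriv bs G has_derivative frechet_derivative (iter_deriv bs G) (at z)) (at z)"
  "(iter_deriv bs F has_derivative frechet_derivative (iter_deriv bs F) (at z)) (at z)"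
  using C_nat_onD(1)[OF G bs] C_nat_onD(1)[OF F bs] Cons.prems frechet_derivative_works by blast+
 have "((%z. iter_deriv bs G z - iter_deriv bs F z) has_derivative
  (%h. frechet_derivative (iter_deriv bs G) (at z) h - frechet_derivative (iter_deriv bs F) (at z) h)) (at z)"
  by (rule has_derivative_diff[OF d])
 then have "(iter_deriv bs (%z. G z - F z) has_derivative
  (%h. frechet_derivative (iter_deriv bs G) (at z) h - frechet_derivative (iter_deriv bs F) (at z) h)) (at z)"
  by (rule has_derivative_transform_within_open[OF _ U]) (use Cons bs in auto)
 from frechet_derivative_at[OF this] show ?case unfolding iter_deriv_Cons by (metis (no_types, lifting))
qed

lemma iter_deriv_periodic:
 fixes F :: "real \<times> real => 'b::real_normed_vector"
 assumes C: "C_nat_on n (UNIV \<times> I) F" and I: "open I" and per: "!!th s. s : I ==> F (th + 1, s) = F (th, s)"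
 shows "bs : lists Basis ==> length bs <= n ==> s : I ==> iter_deriv bs F (th + 1, s) = iter_deriv bs F (th, s)"
proof (induction bs arbitrary: th s rule: list.induct)
 case Nil then show ?case using per by simp
next
 case (Cons b bs)
 let ?G = "iter_deriv bs F"
 have bs: "bs : lists Basis" "length bs < n" using Cons.prems by auto
 have d: "(?G has_derivative frechet_derivative ?G (at (th + 1, s))) (at ((th, s) + (1, 0)))"
  using C_nat_onD(1)[OF C bs, of "(th + 1, s)"] Cons.prems frechet_derivative_works by auto
 have "((%z. z + (1, 0)) has_derivative (%h. h)) (at (th, s))" by (auto intro!: derivative_eq_intros)
 from has_derivative_compose[OF this d]
 have "((%z. ?G (z + (1, 0))) has_derivative frechet_derivative ?G (at (th + 1, s))) (at (th, s))" by simp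
 then have "(?G has_derivative frechet_derivative ?G (at (th + 1, s))) (at (th, s))"
 proof (rule has_derivative_transform_within_open)
  show "open (UNIV \<times> I :: (real \<times> real) set)" using I by (intro open_Times) auto
  show "(th, s) : UNIV \<times> I" using Cons.prems by auto
  show "?G (z + (1, 0)) = ?G z" if "z : UNIV \<times> I" for z using that Cons.IH bs by (cases z) auto
 qed
 from frechet_derivative_at[OF this] show ?case unfolding iter_deriv_Cons by simp
qed

lemma vector_derivative_quotient:
 fixes G :: "'a::real_normed_vector => 'b::real_normed_vector"
 assumes "((%t. G (z + t *\<^sub>R b)) has_vector_derivative v) (at 0)"
 shows "((%t. (1 / t) *\<^sub>R (G (z + t *\<^sub>R b) - G z)) \<longlongrightarrow> v) (at 0)"
proof (rule LIM_zero_cancel, rule tendsto_norm_zero_cancel)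
 have "((%t. norm (G (z + t *\<^sub>R b) - G z - t *\<^sub>R v) / norm t) \<longlongrightarrow> 0) (at 0)"
  using assms unfolding has_vector_derivative_def has_derivative_at by simp
 then show "((%t. norm ((1 / t) *\<^sub>R (G (z + t *\<^sub>R b) - G z) - v)) \<longlongrightarrow> 0) (at 0)"
 proof (rule Lim_transform_eventually)
  show "\<forall>\<^sub>F t in at 0. norm (G (z + t *\<^sub>R b) - G z - t *\<^sub>R v) / norm t = norm ((1 / t) *\<^sub>R (G (z + t *\<^sub>R b) - G z) - v)"
  using eventually_neq_at_within[of 0 0 UNIV]
  proof eventually_elim
  case (elim t)
  then have "(1 / t) *\<^sub>R (G (z + t *\<^sub>R b) - G z) - v = (1 / t) *\<^sub>R (G (z + t *\<^sub>R b) - G z - t *\<^sub>R v)"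
  by (simp add: scaleR_diff_right)
  then show ?case by (simp add: divide_inverse mult.commute)
  qed
 qed
qed

lemma iter_deriv_measurable:
 fixes F :: "'x => real \<times> real => real^2^2"
 assumes C: "!!x. C_nat_on n U (F x)" and U: "open U" and meas: "!!z. z : U ==> (%x. F x z) : borel_measurable \<mu>"
 shows "bs : lists Basis ==> length bs <= n ==> z : U ==> (%x. iter_deriv bs (F x) z) : borel_measurable \<mu>"
proof (induction bs arbitrary: z rule: list.induct)
 case Nil then show ?case using meas by simp
next
 case (Cons b bs)
 have bs: "bs : lists Basis" "length bs < n" and b: "b : Basis" using Cons.prems by auto
 obtain e where e: "e > 0" "ball z e <= U" using U Cons.prems openE by blast
 define h where "h = (%m::nat. e / real (m + 2))"
 have h: "h m > 0" "h m < e" for m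
 proof -
  show "h m > 0" using e by (simp add: h_def)
  have "e * 1 < e * real (m + 2)" using e by (intro mult_strict_left_mono) auto
  then show "h m < e" by (simp add: h_def divide_less_eq)
 qed
 have h0: "h \<longlonglongrightarrow> 0" unfolding h_def by real_asymp
 show ?case
 proof (rule borel_measurable_LIMSEQ_metric)
  fix m
  have "z + h m *\<^sub>R b : U" using e h[of m] b by (auto simp: dist_norm)
  then show "(%x. (1 / h m) *\<^sub>R (iter_deriv bs (F x) (z + h m *\<^sub>R b) - iter_deriv bs (F x) z)) : borel_measurable \<mu>"
  using Cons.IH bs Cons.prems by (intro borel_measurable_scaleR borel_measurable_diff borel_measurable_const) auto
 next
  fix x
  let ?G = "iter_deriv bs (F x)"
  have d: "(?G has_derivative frechet_derivative ?G (at z)) (at z)"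
  using C_nat_onD(1)[OF C bs] Cons.prems frechet_derivative_works by blast
  have lin: "linear (frechet_derivative ?G (at z))" using d has_derivative_linear by blast
  have "((%t. z + t *\<^sub>R b) has_derivative (%t. t *\<^sub>R b)) (at 0)" by (auto intro!: derivative_eq_intros)
  from has_derivative_compose[OF this, of ?G "frechet_derivative ?G (at z)"] d
  have "((%t. ?G (z + t *\<^sub>R b)) has_derivative (%t. frechet_derivative ?G (at z) (t *\<^sub>R b))) (at 0)" by simp
  then have "((%t. ?G (z + t *\<^sub>R b)) has_vector_derivative frechet_derivative ?G (at z) b) (at 0)"
  by (simp add: has_vector_derivative_def linear_scale[OF lin])
  then have "((%t. (1 / t) *\<^sub>R (?G (z + t *\<^sub>R b) - ?G z)) \<longlongrightarrow> frechet_derivative ?G (at z) b) (at 0)"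
  by (rule vector_derivative_quotient)
  then show "(%m. (1 / h m) *\<^sub>R (?G (z + h m *\<^sub>R b) - ?G z)) \<longlonglongrightarrow> iter_deriv (b # bs) (F x) z"
  unfolding iter_deriv_Cons
  by (rule filterlim_compose) (use h h0 in \<open>auto simp: filterlim_at intro!: always_eventually less_imp_neq[symmetric]\<close>)
 qed
qed

text \<open>Cover the compact set by unit balls of the seminorm. Finiteness and the triangle inequality are hypotheses because the seminorms are defined on all functions,
where they can fail.\<close>

lemma compactin_seminorm_bounded:
 fixes p :: "('a => 'b::real_normed_vector) => ennreal"
 assumes K: "compactin (seminorm_topology P S) K" and p: "p : P"
  and fin: "!!F. F : S ==> p F < \<infinity>" and zero: "!!F. F : S ==> p (%z. F z - F z) = 0"
  and tri: "!!F G. F : S ==> G : S ==> p G <= p (%z. G z - F z) + p F"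
 shows "K <= S" and "\<exists>M<\<infinity>. ALL G:K. p G <= M"
proof -
 let ?B = "{{G\<in>S. p (%z. G z - F z) < ennreal e} | p F e. p : P & F : S & 0 < e}"
 have "topspace (seminorm_topology P S) <= S"
  unfolding seminorm_topology_def topology_generated_by_topspace by auto
 then show KS: "K <= S" using compactin_subset_topspace[OF K] by blast
 let ?N = "%F. {G\<in>S. p (%z. G z - F z) < ennreal 1}"
 have "openin (seminorm_topology P S) (?N F)" if "F : S" for F
  unfolding seminorm_topology_def by (rule topology_generated_by_Basis) (use p that in \<open>auto intro!: exI[of _ p] exI[of _ F] exI[of _ 1]\<close>)
 then have op: "ALL N:?N ` K. openin (seminorm_topology P S) N" using KS by auto
 have "G : ?N G" if "G : K" for G
 proof -
  have GS: "G : S" using that KS by blast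
  then show ?thesis using zero[OF GS] by (simp only: mem_Collect_eq) simp
 qed
 then have cov: "K <= \<Union>(?N ` K)" by blast
 obtain \<F> where \<F>: "finite \<F>" "\<F> <= ?N ` K" "K <= \<Union>\<F>"
  using compactinD[OF K _ cov] op by auto
 obtain T where T: "finite T" "T <= K" "\<F> = ?N ` T" using finite_subset_image[OF \<F>(1,2)] by blast
 define M where "M = (\<Sum>F\<in>T. p F) + 1"
 have "(\<Sum>F\<in>T. p F) < \<infinity>" using T KS fin by (auto simp: sum_Pinfty less_top[symmetric])
 then have "M < \<infinity>" by (simp add: M_def less_top[symmetric])
 moreover have "p G <= M" if "G : K" for G
 proof -
  have "G : \<Union>(?N ` T)" using that \<F>(3) unfolding T(3) by (rule rev_subsetD)
  then obtain F where F: "F : T" "G : ?N F" by (elim UN_E)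
  have "p G <= p (%z. G z - F z) + p F" using F T KS by (intro tri) auto
  also have "... <= 1 + p F" using F(2) by (intro add_right_mono) auto
  also have "p F <= (\<Sum>F\<in>T. p F)" using F(1) T(1) by (intro member_le_sum) auto
  finally show ?thesis by (simp add: M_def add.commute)
 qed
 ultimately show "\<exists>M<\<infinity>. ALL G:K. p G <= M" by blast
qed

lemma sup_seminorm_bounded:
 fixes S :: "('a::euclidean_space => 'b::real_normed_vector) set"
 assumes K: "compactin (seminorm_topology P S) \<K>" and p: "sup_seminorm bs C : P" and C: "compact C" "C <= U" "open U"
  and bs: "bs : lists Basis" "length bs <= n" and S: "!!F. F : S ==> C_nat_on n U F"
 obtains M where "!!F z. F : \<K> ==> z : C ==> norm (iter_deriv bs F z) <= M"
proof -
 let ?p = "sup_seminorm bs C"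
 have fin: "?p F < \<infinity>" if F: "F : S" for F
 proof -
  have "continuous_on C (iter_deriv bs F)"
  using C_nat_onD(2)[OF S[OF F] bs] C(2) continuous_on_subset by blast
  then have "bounded (iter_deriv bs F ` C)" using C(1) compact_continuous_image compact_imp_bounded by blast
  then obtain B where B: "!!z. z : C ==> norm (iter_deriv bs F z) <= B" unfolding bounded_iff by auto
  have "?p F <= ennreal B" unfolding sup_seminorm_def by (intro SUP_least ennreal_leI B)
  then show ?thesis by (simp add: le_less_trans)
 qed
 have dif: "iter_deriv bs (%z. G z - F z) z = iter_deriv bs G z - iter_deriv bs F z" if "F : S" "G : S" "z : C" for F G z
  using iter_deriv_diff[OF S[OF that(1)] S[OF that(2)] C(3) bs] that(3) C(2) by blast
 have zero: "?p (%z. F z - F z) = 0" if "F : S" for F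
  unfolding sup_seminorm_def using dif[OF that that] by (simp add: SUP_eq_const bot_ennreal[symmetric] cong: SUP_cong)
 have tri: "?p G <= ?p (%z. G z - F z) + ?p F" if "F : S" "G : S" for F G
  unfolding sup_seminorm_def
 proof (rule SUP_least)
  fix z assume z: "z : C"
  have "ennreal (norm (iter_deriv bs G z)) <= ennreal (norm (iter_deriv bs (%z. G z - F z) z) + norm (iter_deriv bs F z))"
  using dif[OF that z] norm_triangle_ineq[of "iter_deriv bs G z - iter_deriv bs F z" "iter_deriv bs F z"] by (intro ennreal_leI) simp
  also have "... = ennreal (norm (iter_deriv bs (%z. G z - F z) z)) + ennreal (norm (iter_deriv bs F z))" by (simp add: ennreal_plus)
  also have "... <= (SUP z\<in>C. ennreal (norm (iter_deriv bs (%z. G z - F z) z))) + (SUP z\<in>C. ennreal (norm (iter_deriv bs F z)))"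
  using z by (intro add_mono SUP_upper)
  finally show "ennreal (norm (iter_deriv bs G z)) <= (SUP z\<in>C. ennreal (norm (iter_deriv bs (%z. G z - F z) z))) + (SUP z\<in>C. ennreal (norm (iter_deriv bs F z)))" .
 qed
 obtain M where M: "M < \<infinity>" "!!G. G : \<K> ==> ?p G <= M" using compactin_seminorm_bounded(2)[OF K p fin zero tri] by blast
 show ?thesis
 proof (rule that[of "enn2real M"])
  fix F z assume "F : \<K>" "z : C"
  then have "ennreal (norm (iter_deriv bs F z)) <= M"
  using M(2)[of F] unfolding sup_seminorm_def by (meson SUP_upper order_trans)
  then show "norm (iter_deriv bs F z) <= enn2real M" using M(1) by (metis enn2real_ennreal enn2real_mono norm_ge_zero infinity_ennreal_def)
 qed
qed

lemma jets_of_C_nat_on: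
 fixes F :: "real \<times> real => real^2^2"
 assumes C: "C_nat_on K (UNIV \<times> I) F" and I: "open I" and per: "!!th s. s : I ==> F (th + 1, s) = F (th, s)" and J: "J <= I"
 shows "jets_on K J (%i l th s. iter_deriv (word i l) F (th, s) $ p $ q)"
proof -
 have oU: "open (UNIV \<times> I :: (real \<times> real) set)" using I by (intro open_Times) auto
 have comp: "((%t. g t $ p $ q) has_real_derivative v $ p $ q) Fl" if "(g has_vector_derivative v) Fl" for g :: "real => real^2^2" and v Fl
 proof -
  have "bounded_linear (%M :: real^2^2. M $ p $ q)"
  using bounded_linear_compose[OF bounded_linear_vec_nth bounded_linear_vec_nth] .
  then show ?thesis unfolding has_real_derivative_iff_has_vector_derivative
  using that by (rule bounded_linear.has_vector_derivative)
 qed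
 show ?thesis unfolding jets_on_def
 proof (intro conjI allI ballI impI)
  fix i l :: nat and th s :: real assume s: "s : J" and il: "i + l <= K"
  show "iter_deriv (word i l) F (th + 1, s) $ p $ q = iter_deriv (word i l) F (th, s) $ p $ q"
  using iter_deriv_periodic[OF C I per, of "word i l" s th] s J il by auto
 next
  fix i l :: nat and th s :: real assume s: "s : J" and il: "i + l < K"
  have z: "(th, s) : UNIV \<times> I" using s J by auto
  show "((%th. iter_deriv (word i l) F (th, s) $ p $ q) has_real_derivative iter_deriv (word (Suc i) l) F (th, s) $ p $ q) (at th)"
  using comp[OF iter_deriv_has_partial(1)[OF C _ _ z, of "word i l"]] il by simp
  have "((%s. iter_deriv (word i l) F (th, s) $ p $ q) has_real_derivative iter_deriv (word i (Suc l)) F (th, s) $ p $ q) (at s)"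
  using comp[OF iter_deriv_has_partial(2)[OF C _ _ z, of "word i l"]] il iter_deriv_word_s[OF C oU il z] by simp
  then show "((%s. iter_deriv (word i l) F (th, s) $ p $ q) has_real_derivative iter_deriv (word i (Suc l)) F (th, s) $ p $ q) (at s within J)"
  by (rule has_field_derivative_at_within)
 qed
qed
context mpt begin

text \<open>The logarithm is divided by the number of factors before averaging, so that all bounds below are independent of \<open>n\<close>.\<close>

definition LL :: "(complex => complex => 'x => complex^2^2) => nat => complex => complex => 'x => real" where
 "LL \<Phi> n z w x = (1 / real n) * ln (norm (Dn (%k. \<Phi> z w ((f ^^ k) x)) n))"

definition HH :: "(complex => complex => 'x => complex^2^2) => nat => real => real => real" where
 "HH \<Phi> n y v = (\<integral>p. LL \<Phi> n (Complex (fst p) y) (of_real v) (snd p) \<partial>(circ \<Otimes>\<^sub>M \<mu>))"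

lemma scaled_log_bound:
 assumes "\<bar>L\<bar> <= real n * ln C + ln 4" "1 <= C"
 shows "\<bar>(1 / real n) * L\<bar> <= ln C + ln 4"
proof (cases "n = 0")
 case False
 have "\<bar>(1 / real n) * L\<bar> = \<bar>L\<bar> / real n" by (simp add: abs_mult)
 also have "... <= (real n * ln C + ln 4) / real n" using assms by (intro divide_right_mono) auto
 also have "... = ln C + ln 4 / real n" using False by (simp add: add_divide_distrib)
 also have "ln 4 / real n <= ln 4 / 1" using False by (intro divide_left_mono) auto
 finally show ?thesis by simp
qed (use assms in simp)

lemma LL_bound:
 assumes "!!x. good C (\<Phi> z w x)" "1 <= C"
 shows "\<bar>LL \<Phi> n z w x\<bar> <= ln C + ln 4"
 unfolding LL_def by (rule scaled_log_bound[OF Dn_good(2)]) (use assms in auto)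

lemma measurable_entries_orbit:
 assumes "!!i j. (%x. \<Phi> x $ i $ j) : borel_measurable \<mu>"
 shows "(%x. ln (norm (Dn (%k. \<Phi> ((f ^^ k) x)) n))) : borel_measurable \<mu>"
proof -
 have "(%x. orbit (%k. \<Phi> ((f ^^ k) x)) n $ i) : borel_measurable \<mu>" for i
 proof (induction n arbitrary: i)
  case (Suc n)
  have "(%x. \<Phi> ((f ^^ n) x) $ i $ j) : borel_measurable \<mu>" for i j
  by (rule measurable_compose[OF meas_iter assms])
  then show ?case unfolding orbit.simps mat2_vec by (intro borel_measurable_add borel_measurable_times Suc)
 qed simp
 then have "(%x. Dn (%k. \<Phi> ((f ^^ k) x)) n) : borel_measurable \<mu>"
  unfolding Dn_def lfun_def by (intro borel_measurable_diff borel_measurable_times borel_measurable_const)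
 then show ?thesis by measurable
qed


definition level :: "(complex => complex => 'x => complex^2^2) => real => real => real => bool" where
 "level \<Phi> C y v \<longleftrightarrow> (ALL th x. good C (\<Phi> (Complex th y) (of_real v) x)) \<and>
  (ALL x i j. continuous_on UNIV (%th. \<Phi> (Complex th y) (of_real v) x $ i $ j)) \<and>
  (ALL th i j. (%x. \<Phi> (Complex th y) (of_real v) x $ i $ j) : borel_measurable \<mu>)"

lemma level_LL:
 assumes "level \<Phi> C y v" "1 <= C"
 shows "continuous_on UNIV (%th. LL \<Phi> n (Complex th y) (of_real v) x)"
  and "LL \<Phi> n (Complex th y) (of_real v) : borel_measurable \<mu>"
  and "\<bar>LL \<Phi> n (Complex th y) (of_real v) x\<bar> <= ln C + ln 4"
proof -
 have g: "good C (\<Phi> (Complex th y) (of_real v) x)" for th x using assms by (simp add: level_def)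
 have c: "continuous_on UNIV (%th. \<Phi> (Complex th y) (of_real v) x $ i $ j)" for x i j using assms by (simp add: level_def)
 have m: "(%x. \<Phi> (Complex th y) (of_real v) x $ i $ j) : borel_measurable \<mu>" for th i j using assms by (simp add: level_def)
 have c1: "continuous_on UNIV (%th. orbit (%k. \<Phi> (Complex th y) (of_real v) ((f ^^ k) x)) n $ i)" for i
 proof (induction n arbitrary: i)
  case (Suc n) show ?case unfolding orbit.simps mat2_vec by (intro continuous_on_add continuous_on_mult c Suc.IH)
 qed simp
 have nz: "Dn (%k. \<Phi> (Complex th y) (of_real v) ((f ^^ k) x)) n ~= 0" for th
  by (rule Dn_good(1)[OF g assms(2)])
 show "continuous_on UNIV (%th. LL \<Phi> n (Complex th y) (of_real v) x)"
  unfolding LL_def Dn_def lfun_def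
  by (intro continuous_on_mult continuous_on_const continuous_on_ln continuous_on_norm continuous_on_diff c1) (use nz in \<open>auto simp: Dn_def lfun_def\<close>)
 show "LL \<Phi> n (Complex th y) (of_real v) : borel_measurable \<mu>"
  unfolding LL_def[abs_def] by (intro borel_measurable_times borel_measurable_const measurable_entries_orbit m)
 show "\<bar>LL \<Phi> n (Complex th y) (of_real v) x\<bar> <= ln C + ln 4" by (rule LL_bound[where z = "Complex th y" and w = "of_real v" and \<Phi> = \<Phi>]) (use g assms in auto)
qed

lemma level_product_measurable:
 assumes "level \<Phi> C y v" "1 <= C"
 shows "(%p. LL \<Phi> n (Complex (fst p) y) (of_real v) (snd p)) : borel_measurable (circ \<Otimes>\<^sub>M \<mu>)"
  "integrable (circ \<Otimes>\<^sub>M \<mu>) (%p. LL \<Phi> n (Complex (fst p) y) (of_real v) (snd p))"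
proof -
 interpret c: prob_space circ by (rule prob_circ)
 interpret P: pair_prob_space circ \<mu> ..
 show m: "(%p. LL \<Phi> n (Complex (fst p) y) (of_real v) (snd p)) : borel_measurable (circ \<Otimes>\<^sub>M \<mu>)"
  by (rule caratheodory_measurable[OF level_LL(1,2)[OF assms]])
 show "integrable (circ \<Otimes>\<^sub>M \<mu>) (%p. LL \<Phi> n (Complex (fst p) y) (of_real v) (snd p))"
  by (rule P.integrable_const_bound[of _ "ln C + ln 4"]) (use level_LL(3)[OF assms] m in auto)
qed

text \<open>Continuation of the mean from the good side of the real axis back to the axis, where \<open>s\<close> could not be made complex directly.\<close>

lemma HH_reflection:
 assumes hol: "!!x i j. (%z. \<Phi> z (of_real v) x $ i $ j) holomorphic_on {z. \<bar>Im z\<bar> < de}"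
  and per: "!!z x. \<bar>Im z\<bar> < de ==> \<Phi> (z + 1) (of_real v) x = \<Phi> z (of_real v) x"
  and lev: "!!y. 0 <= y ==> y <= 2 * t ==> level \<Phi> C (si * y) v" and C: "1 <= C"
  and si: "\<bar>si\<bar> = 1" and t: "0 < t" "2 * t < de"
 shows "HH \<Phi> n 0 v = 2 * HH \<Phi> n (si * t) v - HH \<Phi> n (si * (2 * t)) v"
proof -
 have I: "HH \<Phi> n y v = (\<integral>x. integral {0..1} (%th. LL \<Phi> n (Complex th y) (of_real v) x) \<partial>\<mu>)"
  "integrable \<mu> (%x. integral {0..1} (%th. LL \<Phi> n (Complex th y) (of_real v) x))" if "level \<Phi> C y v" for y
  unfolding HH_def using integral_circ_product(2,4)[OF level_LL[OF that C]] by simp_all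
 have l: "level \<Phi> C 0 v" "level \<Phi> C (si * t) v" "level \<Phi> C (si * (2 * t)) v"
  using lev[of 0] lev[of t] lev[of "2 * t"] t by simp_all
 have pt: "integral {0..1} (%th. LL \<Phi> n (Complex th 0) (of_real v) x) =
  2 * integral {0..1} (%th. LL \<Phi> n (Complex th (si * t)) (of_real v) x) - integral {0..1} (%th. LL \<Phi> n (Complex th (si * (2 * t))) (of_real v) x)" for x
 proof -
  let ?D = "%z. Dn (%k. \<Phi> z (of_real v) ((f ^^ k) x)) n"
  have E: "integral {0..1} (%th. ln (norm (?D (Complex th 0)))) =
  2 * integral {0..1} (%th. ln (norm (?D (Complex th (si * t))))) - integral {0..1} (%th. ln (norm (?D (Complex th (si * (2 * t))))))"
  proof (rule mean_log_affine[OF _ _ si t])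
  show "?D holomorphic_on {z. \<bar>Im z\<bar> < de}" by (rule Dn_holomorphic) (rule hol)
  show "?D (z + 1) = ?D z" if "\<bar>Im z\<bar> < de" for z using per[OF that] by simp
  show "?D (Complex th (si * y)) ~= 0" if "0 <= y" "y <= 2 * t" for th y
  by (rule Dn_good(1)[OF _ C]) (use lev[OF that] in \<open>auto simp: level_def\<close>)
  qed
  have aux: "c * (2 * a - b) = 2 * (c * a) - c * b" for a b c :: real by (simp add: algebra_simps)
  show ?thesis unfolding LL_def integral_mult_right E by (rule aux)
 qed
 show ?thesis unfolding I(1)[OF l(1)] I(1)[OF l(2)] I(1)[OF l(3)] pt using I(2)[OF l(2)] I(2)[OF l(3)] by simp
qed

lemma HH_anl:
 assumes hol: "!!th x i j. (%w. \<Phi> (Complex th y) w x $ i $ j) holomorphic_on ball (of_real s) R"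
  and good: "!!th w x. w : ball (of_real s) R ==> good C (\<Phi> (Complex th y) w x)" and C: "1 <= C" and R: "0 < R"
  and lev: "!!v. \<bar>v - s\<bar> < R ==> level \<Phi> C y v"
 shows "anl (R / 2) (9 * (ln C + ln 4)) (HH \<Phi> n y) s"
proof -
 interpret c: prob_space circ by (rule prob_circ)
 interpret P: pair_prob_space circ \<mu> ..
 have Lam: "ln C + ln 4 > 0" using C by (simp add: add_nonneg_pos)
 have pt: "anl (R / 2) (9 * (ln C + ln 4)) (%v. LL \<Phi> n (Complex (fst p) y) (of_real v) (snd p)) s" for p
 proof (cases "n = 0")
  case True
  then show ?thesis unfolding anl_def LL_def using Lam by (intro exI[of _ "%_. 0"]) auto
 next
  case False
  let ?D = "%w. Dn (%k. \<Phi> (Complex (fst p) y) w ((f ^^ k) (snd p))) n"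
  have b: "\<bar>ln (norm (?D w))\<bar> <= real n * ln C + ln 4" if "w : ball (of_real s) R" for w
  by (rule Dn_good(2)[OF good[OF that] C])
  have "anl (R / 2) (9 * (real n * ln C + ln 4)) (%v. ln (norm (?D (of_real v)))) s"
  proof (rule log_norm_anl[OF _ _ b R])
  show "?D holomorphic_on ball (of_real s) R" by (rule Dn_holomorphic) (rule hol)
  show "?D w ~= 0" if "w : ball (of_real s) R" for w by (rule Dn_good(1)[OF good[OF that] C])
  show "real n * ln C + ln 4 > 0" using C by (simp add: add_nonneg_pos)
  qed
  from anl_lincomb[OF this this, of "1 / real n" 0]
  have "anl (R / 2) (1 / real n * (9 * (real n * ln C + ln 4))) (%v. LL \<Phi> n (Complex (fst p) y) (of_real v) (snd p)) s"
  by (simp add: LL_def)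
  moreover have "1 / real n * (9 * (real n * ln C + ln 4)) <= 9 * (ln C + ln 4)"
  using False by (simp add: field_simps)
  ultimately show ?thesis by (rule anl_mono)
 qed
 have "anl (R / 2) (9 * (ln C + ln 4)) (%v. \<integral>p. LL \<Phi> n (Complex (fst p) y) (of_real v) (snd p) \<partial>(circ \<Otimes>\<^sub>M \<mu>)) s"
  proof (rule anl_average[OF P.prob_space_axioms pt])
  fix v assume "\<bar>v - s\<bar> < R / 2"
  then have vR: "\<bar>v - s\<bar> < R" using R by simp
  show "(%p. LL \<Phi> n (Complex (fst p) y) (of_real v) (snd p)) : borel_measurable (circ \<Otimes>\<^sub>M \<mu>)"
  by (rule level_product_measurable(1)[OF lev[OF vR] C])
 qed (use R in simp)
 then show ?thesis unfolding HH_def[abs_def] .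
qed

text \<open>For fixed \<open>w\<close> the function \<open>ln |D|\<close> of the interpolation parameter is bounded and has a holomorphic logarithm in the disc of radius \<open>Q\<close>, hence changes by \<open>O(1/Q)\<close> between
0 and 1. The quotient of the two values of \<open>D\<close> is a zero-free holomorphic function of \<open>w\<close> whose logarithm is that small.\<close>

lemma HH_difference_anl:
 assumes hol: "!!th x i j. (%w. \<Phi>0 (Complex th y) w x $ i $ j) holomorphic_on ball (of_real s) R"
  "!!th x i j. (%w. \<Phi>1 (Complex th y) w x $ i $ j) holomorphic_on ball (of_real s) R"
  and good: "!!om th w x. w : ball (of_real s) R ==> norm om < Q ==> good C (mix om (\<Phi>0 (Complex th y) w x) (\<Phi>1 (Complex th y) w x))"
  and C: "1 <= C" and R: "0 < R" and Q: "2 <= Q"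
  and lev: "!!v. \<bar>v - s\<bar> < R ==> level \<Phi>0 C y v" "!!v. \<bar>v - s\<bar> < R ==> level \<Phi>1 C y v"
 shows "anl (R / 2) (144 * (ln C + ln 4) / Q) (%v. HH \<Phi>1 n y v - HH \<Phi>0 n y v) s"
proof -
 interpret c: prob_space circ by (rule prob_circ)
 interpret P: pair_prob_space circ \<mu> ..
 have Lam: "ln C + ln 4 > 0" using C by (simp add: add_nonneg_pos)
 have g0: "good C (\<Phi>0 (Complex th y) w x)" "good C (\<Phi>1 (Complex th y) w x)" if "w : ball (of_real s) R" for th w x
  using good[OF that, of 0] good[OF that, of 1] Q by simp_all
 have pt: "anl (R / 2) (144 * (ln C + ln 4) / Q) (%v. LL \<Phi>1 n (Complex (fst p) y) (of_real v) (snd p) - LL \<Phi>0 n (Complex (fst p) y) (of_real v) (snd p)) s" for p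
 proof (cases "n = 0")
  case True
  then show ?thesis unfolding anl_def LL_def using Lam Q by (intro exI[of _ "%_. 0"]) auto
 next
  case False
  let ?M0 = "%w k. \<Phi>0 (Complex (fst p) y) w ((f ^^ k) (snd p))" and ?M1 = "%w k. \<Phi>1 (Complex (fst p) y) w ((f ^^ k) (snd p))"
  define E where "E = real n * ln C + ln 4"
  have E: "E > 0" using C by (simp add: E_def add_nonneg_pos)
  have cmp: "\<bar>ln (norm (Dn (?M1 w) n)) - ln (norm (Dn (?M0 w) n))\<bar> <= 16 * E / Q" if w: "w : ball (of_real s) R" for w
  proof -
  let ?D = "%om. Dn (%k. mix om (?M0 w k) (?M1 w k)) n"
  have gm: "good C (mix om (?M0 w k) (?M1 w k))" if "om : ball 0 Q" for om k using good[OF w] that by simp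
  have "\<bar>ln (norm (?D 1)) - ln (norm (?D 0))\<bar> <= 16 * E / Q"
  proof (rule log_norm_compare[OF _ _ _ Q E])
  show "?D holomorphic_on ball 0 Q"
  by (rule Dn_holomorphic) (simp add: mix_def, intro holomorphic_intros)
  show "?D om ~= 0" if "om : ball 0 Q" for om by (rule Dn_good(1)[OF gm[OF that] C])
  show "\<bar>ln (norm (?D om))\<bar> <= E" if "om : ball 0 Q" for om unfolding E_def by (rule Dn_good(2)[OF gm[OF that] C])
  qed
  then show ?thesis by simp
  qed
  have nz: "Dn (?M0 w) n ~= 0" "Dn (?M1 w) n ~= 0" if "w : ball (of_real s) R" for w
  using Dn_good(1)[OF g0(1)[OF that] C] Dn_good(1)[OF g0(2)[OF that] C] by auto
  let ?q = "%w. Dn (?M1 w) n / Dn (?M0 w) n"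
  have lnq: "ln (norm (?q w)) = ln (norm (Dn (?M1 w) n)) - ln (norm (Dn (?M0 w) n))" if "w : ball (of_real s) R" for w
  using nz[OF that] by (simp add: norm_divide ln_div)
  have "anl (R / 2) (9 * (16 * E / Q)) (%v. ln (norm (?q (of_real v)))) s"
  proof (rule log_norm_anl[OF _ _ _ R])
  show "?q holomorphic_on ball (of_real s) R"
  by (intro holomorphic_on_divide Dn_holomorphic hol nz)
  show "?q w ~= 0" if "w : ball (of_real s) R" for w using nz[OF that] by simp
  show "\<bar>ln (norm (?q w))\<bar> <= 16 * E / Q" if "w : ball (of_real s) R" for w
  unfolding lnq[OF that] by (rule cmp[OF that])
  show "16 * E / Q > 0" using E Q by simp
  qed
  from anl_lincomb[OF this this, of "1 / real n" 0]
  have 1: "anl (R / 2) (1 / real n * (144 * E / Q)) (%v. 1 / real n * ln (norm (?q (of_real v)))) s" by simp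
  have "1 / real n * (144 * E / Q) <= 144 * (ln C + ln 4) / Q"
  proof -
  have "\<bar>1 / real n * E\<bar> <= ln C + ln 4" by (rule scaled_log_bound) (use E C in \<open>auto simp: E_def\<close>)
  then have "1 / real n * E <= ln C + ln 4" using abs_ge_self order_trans by blast
  then have "144 / Q * (1 / real n * E) <= 144 / Q * (ln C + ln 4)" using Q by (intro mult_left_mono) auto
  then show ?thesis by (simp add: mult_ac)
  qed
  from anl_mono[OF 1 this]
  have "anl (R / 2) (144 * (ln C + ln 4) / Q) (%v. 1 / real n * ln (norm (?q (of_real v)))) s" .
  then obtain a where a: "!!i. \<bar>a i\<bar> * (R/2) ^ i <= 144 * (ln C + ln 4) / Q"
  "!!v. \<bar>v\<bar> < R/2 ==> (%i. a i * v ^ i) sums (1 / real n * ln (norm (?q (of_real (s + v)))))"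
  unfolding anl_def by blast
  have "1 / real n * ln (norm (?q (of_real (s + v)))) = LL \<Phi>1 n (Complex (fst p) y) (of_real (s + v)) (snd p) - LL \<Phi>0 n (Complex (fst p) y) (of_real (s + v)) (snd p)"
  if "\<bar>v\<bar> < R/2" for v
  proof -
  have "of_real (s + v) : ball (complex_of_real s) R" using that R by (simp add: dist_norm)
  from lnq[OF this] show ?thesis by (simp add: LL_def right_diff_distrib)
  qed
  then show ?thesis unfolding anl_def using a by (intro exI[of _ a]) auto
 qed
 have eq: "HH \<Phi>1 n y v - HH \<Phi>0 n y v = (\<integral>p. (LL \<Phi>1 n (Complex (fst p) y) (of_real v) (snd p) - LL \<Phi>0 n (Complex (fst p) y) (of_real v) (snd p)) \<partial>(circ \<Otimes>\<^sub>M \<mu>))"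
  if "\<bar>v - s\<bar> < R" for v
  unfolding HH_def by (rule Bochner_Integration.integral_diff[symmetric]) (rule level_product_measurable(2)[OF _ C], rule lev, rule that)+
 have "anl (R / 2) (144 * (ln C + ln 4) / Q) (%v. \<integral>p. (LL \<Phi>1 n (Complex (fst p) y) (of_real v) (snd p) - LL \<Phi>0 n (Complex (fst p) y) (of_real v) (snd p)) \<partial>(circ \<Otimes>\<^sub>M \<mu>)) s"
 proof (rule anl_average[OF P.prob_space_axioms pt])
  fix v assume "\<bar>v - s\<bar> < R / 2"
  then have vR: "\<bar>v - s\<bar> < R" using R by simp
  show "(%p. LL \<Phi>1 n (Complex (fst p) y) (of_real v) (snd p) - LL \<Phi>0 n (Complex (fst p) y) (of_real v) (snd p)) : borel_measurable (circ \<Otimes>\<^sub>M \<mu>)"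
  by (rule borel_measurable_diff[OF level_product_measurable(1)[OF lev(2)[OF vR] C] level_product_measurable(1)[OF lev(1)[OF vR] C]])
 qed (use R in simp)
 then obtain a where a: "!!i. \<bar>a i\<bar> * (R / 2) ^ i <= 144 * (ln C + ln 4) / Q"
  "!!v. \<bar>v\<bar> < R / 2 ==> (%i. a i * v ^ i) sums (\<integral>p. (LL \<Phi>1 n (Complex (fst p) y) (of_real (s + v)) (snd p) - LL \<Phi>0 n (Complex (fst p) y) (of_real (s + v)) (snd p)) \<partial>(circ \<Otimes>\<^sub>M \<mu>))"
  unfolding anl_def by blast
 show ?thesis unfolding anl_def
 proof (intro exI[of _ a] conjI allI impI)
  fix i show "\<bar>a i\<bar> * (R / 2) ^ i <= 144 * (ln C + ln 4) / Q" by (rule a(1))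
 next
  fix v assume v: "\<bar>v\<bar> < R / 2"
  then have "\<bar>(s + v) - s\<bar> < R" using R by simp
  from a(2)[OF v] show "(%i. a i * v ^ i) sums (HH \<Phi>1 n y (s + v) - HH \<Phi>0 n y (s + v))" unfolding eq[OF \<open>\<bar>(s + v) - s\<bar> < R\<close>] .
 qed
qed

end
lemma norm_mat_le:
 fixes M :: "('a::real_normed_vector)^2^2"
 assumes "!!p q. norm (M $ p $ q) <= e"
 shows "norm M <= 2 * e"
proof (rule power2_le_imp_le)
 have e: "0 <= e" using assms[of 1 1] norm_ge_zero order_trans by blast
 have s: "(norm (M $ p $ q))\<^sup>2 <= e\<^sup>2" for p q using assms by (intro power_mono) auto
 show "(norm M)\<^sup>2 <= (2 * e)\<^sup>2" unfolding norm_vec2_sq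
  using s[of 1 1] s[of 1 2] s[of 2 1] s[of 2 2] by (simp add: power_mult_distrib)
 show "0 <= 2 * e" using e by simp
qed

lemma entry_le_norm: "norm (M $ p $ q) <= norm M" for M :: "('a::real_normed_vector)^2^2"
 using Finite_Cartesian_Product.norm_nth_le[of "M $ p" q] Finite_Cartesian_Product.norm_nth_le[of M p] by linarith

lemma tpoly_first_order:
 assumes b: "!!i l. i + l < K ==> \<bar>b i l\<bar> <= B" and K: "2 <= K" and r: "norm al <= r" "norm \<beta> <= r" "r <= 1"
 shows "norm (tpoly K b al \<beta> - (of_real (b 0 0) + of_real (b 1 0) * al + of_real (b 0 1) * \<beta>)) <= real K * (real K * (B * r\<^sup>2))"
proof -
 have r0: "0 <= r" using r(1) norm_ge_zero order_trans by blast
 have "\<bar>b 0 0\<bar> <= B" using b[of 0 0] K by simp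
 then have B: "0 <= B" by linarith
 define b' where "b' = (%i l. if i + l <= 1 then b i l else 0)"
 define g where "g = (%i l. if i + l <= 1 then of_real (b i l) * al ^ i * \<beta> ^ l / (fact i * fact l) else 0)"
 have low: "(\<Sum>l<K. \<Sum>i<K - l. g i l) = of_real (b 0 0) + of_real (b 1 0) * al + of_real (b 0 1) * \<beta>"
 proof -
  have "(\<Sum>l<K. \<Sum>i<K - l. g i l) = (\<Sum>l\<in>{0, 1}. \<Sum>i<K - l. g i l)"
  by (rule sum.mono_neutral_right) (use K in \<open>auto simp: g_def intro!: sum.neutral\<close>)
  also have "... = (\<Sum>i<K. g i 0) + (\<Sum>i<K - 1. g i 1)" by simp
  also have "(\<Sum>i<K. g i 0) = (\<Sum>i\<in>{0, 1}. g i 0)"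
  by (rule sum.mono_neutral_right) (use K in \<open>auto simp: g_def\<close>)
  also have "(\<Sum>i<K - 1. g i 1) = (\<Sum>i\<in>{0}. g i 1)"
  by (rule sum.mono_neutral_right) (use K in \<open>auto simp: g_def\<close>)
  finally show ?thesis by (simp add: g_def)
 qed
 have trm: "norm (of_real (b i l) * al ^ i * \<beta> ^ l / (fact i * fact l) - g i l) <= B * r\<^sup>2" if il: "i + l < K" for i l
 proof (cases "i + l <= 1")
  case True then show ?thesis using B by (simp add: g_def)
 next
  case False
  have "norm (of_real (b i l) * al ^ i * \<beta> ^ l / (fact i * fact l)) = \<bar>b i l\<bar> * (norm al ^ i * norm \<beta> ^ l) / (fact i * fact l)"
  by (simp add: norm_mult norm_divide norm_power)
  also have "... <= \<bar>b i l\<bar> * (norm al ^ i * norm \<beta> ^ l) / 1"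
  proof (rule divide_left_mono)
  show "1 <= (fact i * fact l :: real)" using mult_mono[of 1 "fact i :: real" 1 "fact l"] by simp
  qed auto
  also have "... <= B * (r ^ i * r ^ l) / 1"
  using b[OF il] r B r0 by (intro divide_right_mono mult_mono power_mono) auto
  also have "... = B * r ^ (i + l)" by (simp add: power_add)
  also have "... <= B * r\<^sup>2" using False r r0 B by (intro mult_left_mono power_decreasing) auto
  finally show ?thesis using False by (simp add: g_def)
 qed
 have "norm (tpoly K b al \<beta> - (\<Sum>l<K. \<Sum>i<K - l. g i l)) <= (\<Sum>l<K. \<Sum>i<K - l. norm (of_real (b i l) * al ^ i * \<beta> ^ l / (fact i * fact l) - g i l))"
  unfolding tpoly_def sum_subtractf[symmetric] by (intro order_trans[OF norm_sum] sum_mono norm_sum)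
 also have "... <= (\<Sum>l<K. \<Sum>i<K - l. B * r\<^sup>2)" by (intro sum_mono trm) auto
 also have "... <= (\<Sum>l<K. real K * (B * r\<^sup>2))" using B by (intro sum_mono) (simp add: mult_right_mono)
 also have "... = real K * (real K * (B * r\<^sup>2))" by simp
 finally show ?thesis unfolding low .
qed

lemma holomorphic_lipschitz_at_centre:
 assumes f: "f holomorphic_on ball c R" and b: "!!z. z : ball c R ==> norm (f z) <= M" and R: "R > 0" and z: "norm (z - c) <= R / 2"
 shows "norm (f z - f c) <= 4 * M / R * norm (z - c)"
proof (rule field_differentiable_bound[of "cball c (R/2)" f "deriv f"])
 fix w assume w: "w : cball c (R/2)"
 have wB: "w : ball c R" using w R by auto
 show "(f has_field_derivative deriv f w) (at w within cball c (R/2))"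
  using holomorphic_derivI[OF f open_ball wB] .
 have sub: "cball w (R/4) <= ball c R"
 proof
  fix v assume "v : cball w (R/4)"
  then have "dist c v <= R/2 + R/4" using w dist_triangle[of c v w] by (simp add: dist_commute)
  then show "v : ball c R" using R by simp
 qed
 have "norm ((deriv ^^ 1) f w) <= fact 1 * M / (R/4) ^ 1"
 proof (rule Cauchy_inequality)
  show "f holomorphic_on ball w (R/4)" using f sub ball_subset_cball holomorphic_on_subset by blast
  show "continuous_on (cball w (R/4)) f" using f sub holomorphic_on_imp_continuous_on continuous_on_subset by blast
  fix v assume "norm (w - v) = R/4"
  then have "v : cball w (R/4)" by (simp add: dist_norm)
  then show "norm (f v) <= M" using b sub by blast
 qed (use R in simp)
 then show "norm (deriv f w) <= 4 * M / R" by (simp add: mult_ac)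
qed (use z R in \<open>auto simp: dist_norm norm_minus_commute\<close>)

lemma smooth_holomorphic:
 assumes ta: "ta holomorphic_on UNIV"
 shows "(!!z. z : S ==> (ALL n. 1 / of_nat N ^ 2 + sin (of_real pi * (z - of_real (of_int n / real N))) ^ 2 ~= (0::complex)) \<and>
  (\<Sum>n\<in>{0..<int N}. ker K N (z - of_real (of_int n / real N))) ~= 0 & (\<Sum>m\<in>cells N rh. ker K N (w - of_real (s0 + of_int m / real N))) ~= 0) ==>
  (%z. smooth ta K N s0 rh b z w) holomorphic_on S"
  and "(!!w. w : S ==> (ALL m. 1 / of_nat N ^ 2 + sin (of_real pi * (w - of_real (s0 + of_int m / real N))) ^ 2 ~= (0::complex)) \<and>
  (\<Sum>n\<in>{0..<int N}. ker K N (z - of_real (of_int n / real N))) ~= 0 & (\<Sum>m\<in>cells N rh. ker K N (w - of_real (s0 + of_int m / real N))) ~= 0) ==>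
  (%w. smooth ta K N s0 rh b z w) holomorphic_on S"
proof -
 have t: "(%z. ta (z - c)) holomorphic_on S" for c
 proof -
  have "(%z. z - c) holomorphic_on S" by (intro holomorphic_intros)
  from holomorphic_on_compose_gen[OF this ta] show ?thesis by (simp add: o_def)
 qed
 have k: "(%z. ker K N (z - c)) holomorphic_on S"
  if "!!z. z : S ==> 1 / of_nat N ^ 2 + sin (of_real pi * (z - c)) ^ 2 ~= (0::complex)" for c
  unfolding ker_def using that by (intro holomorphic_intros) auto
 show "(%z. smooth ta K N s0 rh b z w) holomorphic_on S"
  if "!!z. z : S ==> (ALL n. 1 / of_nat N ^ 2 + sin (of_real pi * (z - of_real (of_int n / real N))) ^ 2 ~= (0::complex)) \<and>
  (\<Sum>n\<in>{0..<int N}. ker K N (z - of_real (of_int n / real N))) ~= 0 & (\<Sum>m\<in>cells N rh. ker K N (w - of_real (s0 + of_int m / real N))) ~= 0"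
 proof -
  have k': "(%z. ker K N (z - of_real (of_int n / real N))) holomorphic_on S" for n using that by (intro k) blast
  show ?thesis unfolding smooth_def tpoly_def
  by (intro holomorphic_on_divide holomorphic_on_sum holomorphic_on_mult holomorphic_on_power holomorphic_on_const k' t) (use that in auto)
 qed
 show "(%w. smooth ta K N s0 rh b z w) holomorphic_on S"
  if "!!w. w : S ==> (ALL m. 1 / of_nat N ^ 2 + sin (of_real pi * (w - of_real (s0 + of_int m / real N))) ^ 2 ~= (0::complex)) \<and>
  (\<Sum>n\<in>{0..<int N}. ker K N (z - of_real (of_int n / real N))) ~= 0 & (\<Sum>m\<in>cells N rh. ker K N (w - of_real (s0 + of_int m / real N))) ~= 0"
 proof -
  have k': "(%w. ker K N (w - of_real (s0 + of_int m / real N))) holomorphic_on S" for m using that by (intro k) blast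
  show ?thesis unfolding smooth_def tpoly_def
  by (intro holomorphic_on_divide holomorphic_on_sum holomorphic_on_mult holomorphic_on_power holomorphic_on_const k' t) (use that in auto)
 qed
qed

lemma smooth_periodic:
 assumes "!!z. ta (z + 1) = ta z"
 shows "smooth ta K N s0 rh b (z + 1) w = smooth ta K N s0 rh b z w"
proof -
 have e: "z + 1 - c = (z - c) + 1" for c :: complex by simp
 show ?thesis unfolding smooth_def e ker_plus_1 assms ..
qed

lemma smooth_real:
 assumes ta: "!!x. Im (ta (of_real x)) = 0"
 shows "Im (smooth ta K N s0 rh b (of_real th) (of_real s)) = 0"
proof -
 have t: "ta (of_real x) : \<real>" for x using ta[of x] by (simp add: complex_is_Real_iff)
 have r: "smooth ta K N s0 rh b (of_real th) (of_real s) : \<real>"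
  unfolding smooth_def tpoly_def of_real_diff[symmetric] ker_of_real
  by (intro Reals_divide Reals_mult sum_in_Reals Reals_power Reals_of_real t fact_in_Reals)
 then show ?thesis by (simp add: complex_is_Real_iff)
qed

lemma smooth_measurable:
 assumes "!!i l th s. i + l < K ==> \<bar>s - s0\<bar> <= rh ==> (%x. b x i l th s) : borel_measurable \<mu>" and N: "N \<ge> 1"
 shows "(%x. smooth ta K N s0 rh (b x) z w) : borel_measurable \<mu>"
proof -
 have m: "\<bar>s0 + of_int m / real N - s0\<bar> <= rh" if "m : cells N rh" for m
  using that N by (simp add: cells_def abs_divide divide_le_eq)
 have h: "(%x. complex_of_real (b x i l th s)) : borel_measurable \<mu>" if "i + l < K" "\<bar>s - s0\<bar> <= rh" for i l th s
  by (rule measurable_compose[OF assms(1)[OF that] borel_measurable_continuous_onI]) (intro continuous_intros)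
 show ?thesis unfolding smooth_def tpoly_def
  by (intro borel_measurable_divide borel_measurable_sum borel_measurable_times borel_measurable_const
  h m) auto
qed

lemma norm_triangle_chain: "norm (s - g) <= norm (s - t) + norm (t - l) + norm (l - g)" for s :: "'a::real_normed_vector"
 using norm_triangle_ineq[of "s - t" "t - l"] norm_triangle_ineq[of "s - l" "l - g"] by simp

section \<open>Families of finite smoothness\<close>

text \<open>The data produced by a monotone family with jets of order \<open>K\<close> near \<open>s0\<close>: entries of the jets \<open>a\<close>, their common bound \<open>B\<close>, the monotonicity constant \<open>c\<close> with sign \<open>si\<close>,
and the constants \<open>C\<close>, \<open>cc\<close> of the holomorphic approximation.\<close>

locale smooth_family = mpt f \<mu> for f :: "'x::metric_space => 'x" and \<mu> +
 fixes a :: "'x => 2 => 2 => nat => nat => real => real => real" and K :: nat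
  and B c si rh s0 C cc :: real and ta :: "complex => complex"
 assumes K: "2 <= K" and B: "1 <= B" and c: "0 < c" "c <= 1" and si: "\<bar>si\<bar> = 1" and rh: "0 < rh" "rh <= 1/8"
  and C: "0 < C" and cc: "0 < cc" "cc <= 1/2"
  and ta: "ta holomorphic_on UNIV" "!!z. ta (z + 1) = ta z" "!!x. Im (ta (of_real x)) = 0"
  and bd: "!!x p q i l th s. i + l <= K ==> \<bar>s - s0\<bar> <= rh ==> \<bar>a x p q i l th s\<bar> <= B"
  and meas_jet: "!!p q i l th s. i + l < K ==> \<bar>s - s0\<bar> <= rh ==> (%x. a x p q i l th s) : borel_measurable \<mu>"
  and cont_x: "!!th s p q. \<bar>s - s0\<bar> <= rh ==> continuous_on UNIV (%x. a x p q 0 0 th s)"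
  and cont_\<theta>: "!!x s p q. \<bar>s - s0\<bar> <= rh ==> continuous_on UNIV (%th. a x p q 0 0 th s)"
  and det_jet: "!!x th s. \<bar>s - s0\<bar> <= rh ==> det ((\<chi> p q. a x p q 0 0 th s) :: real^2^2) = 1"
  and mono_jet: "!!x th s w. \<bar>s - s0\<bar> <= rh ==>
  si * area ((\<chi> p q. a x p q 0 0 th s) *v w) ((\<chi> p q. a x p q 1 0 th s) *v w) \<ge> c * (norm w)\<^sup>2"
  and approx: "!!N x p q th s z w. real N * rh \<ge> 2 ==>
  \<bar>s - s0\<bar> <= rh / 2 ==> norm (z - of_real th) <= cc / real N ==> norm (w - of_real s) <= cc / real N ==>
  norm (smooth ta K N s0 rh (a x p q) z w - tpoly K (%i l. a x p q i l th s) (z - of_real th) (w - of_real s)) <= C / real N ^ K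
  & (\<Sum>n\<in>{0..<int N}. ker K N (z - of_real (of_int n / real N))) ~= 0
  & (\<Sum>m\<in>cells N rh. ker K N (w - of_real (s0 + of_int m / real N))) ~= 0
  & (ALL n. 1 / of_nat N ^ 2 + sin (of_real pi * (z - of_real (of_int n / real N))) ^ 2 ~= (0::complex))
  & (ALL m. 1 / of_nat N ^ 2 + sin (of_real pi * (w - of_real (s0 + of_int m / real N))) ^ 2 ~= (0::complex))"
begin

definition MA :: "nat => nat => real => real => 'x => real^2^2" where
 "MA i l th s x = (\<chi> p q. a x p q i l th s)"

definition Ph :: "nat => complex => complex => 'x => complex^2^2" where
 "Ph N z w x = (\<chi> p q. smooth ta K N s0 rh (a x p q) z w)"

lemma height: "Complex th y - of_real th = \<i> * of_real y"
 by (simp add: complex_eq_iff)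

lemma N_pos: "2 <= real N * rh ==> 1 <= real N"
proof (rule ccontr)
 assume "2 <= real N * rh" "~ 1 <= real N"
 then have "real N = 0" by simp
 then show False using \<open>2 <= real N * rh\<close> by simp
qed

lemma entry_disc:
 assumes N: "2 <= real N * rh" and s: "\<bar>s - s0\<bar> <= rh / 2" and y: "\<bar>y\<bar> <= r"
  and w: "norm (w - of_real s) <= r'" "r' <= r" and r: "r <= cc / real N"
 shows "norm (smooth ta K N s0 rh (a x p q) (Complex th y) w - (of_real (a x p q 0 0 th s) + \<i> * of_real (y * a x p q 1 0 th s)))
  <= C / real N ^ K + real K * (real K * (B * r\<^sup>2)) + B * r'"
proof -
 let ?S = "smooth ta K N s0 rh (a x p q) (Complex th y) w"
 let ?T = "tpoly K (%i l. a x p q i l th s) (\<i> * of_real y) (w - of_real s)"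
 let ?L = "of_real (a x p q 0 0 th s) + of_real (a x p q 1 0 th s) * (\<i> * of_real y) + of_real (a x p q 0 1 th s) * (w - of_real s)"
 let ?G = "of_real (a x p q 0 0 th s) + \<i> * of_real (y * a x p q 1 0 th s)"
 have s': "\<bar>s - s0\<bar> <= rh" using s rh by simp
 have "cc / real N <= cc / 1" using N_pos[OF N] cc by (intro divide_left_mono) auto
 then have r1: "r <= 1" using r cc by simp
 have ny: "norm (\<i> * of_real y) = \<bar>y\<bar>" by (simp add: norm_mult)
 have "norm (Complex th y - of_real th) <= cc / real N" "norm (w - of_real s) <= cc / real N"
  unfolding height ny using y w r by linarith+
 from approx[OF N s this, of x p q] have 1: "norm (?S - ?T) <= C / real N ^ K" unfolding height by blast
 have 2: "norm (?T - ?L) <= real K * (real K * (B * r\<^sup>2))"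
  by (rule tpoly_first_order) (use bd[OF _ s'] K y w r1 ny in auto)
 have 3: "norm (?L - ?G) <= B * r'"
 proof -
  have "?L - ?G = of_real (a x p q 0 1 th s) * (w - of_real s)" by simp
  also have "norm ... = \<bar>a x p q 0 1 th s\<bar> * norm (w - of_real s)" by (simp add: norm_mult)
  also have "... <= B * r'" using bd[OF _ s', of 0 1] K w B by (intro mult_mono) auto
  finally show ?thesis .
 qed
 have "norm (?S - ?G) <= norm (?S - ?T) + norm (?T - ?L) + norm (?L - ?G)" by (rule norm_triangle_chain)
 then show ?thesis using 1 2 3 by linarith
qed

lemma strip_holomorphic:
 assumes N: "2 <= real N * rh" and v: "\<bar>v - s0\<bar> <= rh / 2"
 shows "(%z. smooth ta K N s0 rh (a x p q) z (of_real v)) holomorphic_on {z. \<bar>Im z\<bar> < cc / real N}"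
proof (rule smooth_holomorphic(1)[OF ta(1)])
 fix z assume z: "z : {z. \<bar>Im z\<bar> < cc / real N}"
 have "norm (z - of_real (Re z)) <= cc / real N"
 proof -
  have "z - of_real (Re z) = \<i> * of_real (Im z)" by (simp add: complex_eq_iff)
  then show ?thesis using z by (simp add: norm_mult)
 qed
 moreover have "norm (of_real v - complex_of_real v) <= cc / real N" using cc by simp
 ultimately show "(ALL n. 1 / of_nat N ^ 2 + sin (of_real pi * (z - of_real (of_int n / real N))) ^ 2 ~= (0::complex)) \<and>
  (\<Sum>n\<in>{0..<int N}. ker K N (z - of_real (of_int n / real N))) ~= 0 & (\<Sum>m\<in>cells N rh. ker K N (of_real v - of_real (s0 + of_int m / real N))) ~= 0"
  using approx[OF N v] by blast
qed

lemma disc_holomorphic: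
 assumes N: "2 <= real N * rh" and s: "\<bar>s - s0\<bar> <= rh / 2" and y: "\<bar>y\<bar> <= cc / real N" and R: "R <= cc / real N"
 shows "(%w. smooth ta K N s0 rh (a x p q) (Complex th y) w) holomorphic_on ball (of_real s) R"
proof (rule smooth_holomorphic(2)[OF ta(1)])
 fix w assume w: "w : ball (complex_of_real s) R"
 have 1: "norm (Complex th y - of_real th) <= cc / real N" unfolding height using y by (simp add: norm_mult)
 have 2: "norm (w - of_real s) <= cc / real N" using w R by (simp add: dist_norm norm_minus_commute)
 show "(ALL m. 1 / of_nat N ^ 2 + sin (of_real pi * (w - of_real (s0 + of_int m / real N))) ^ 2 ~= (0::complex)) \<and>
  (\<Sum>n\<in>{0..<int N}. ker K N (Complex th y - of_real (of_int n / real N))) ~= 0 & (\<Sum>m\<in>cells N rh. ker K N (w - of_real (s0 + of_int m / real N))) ~= 0"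
  using approx[OF N s 1 2] by blast
qed

text \<open>Near the real axis the error must be proportional to the height. The difference to the Taylor polynomial is holomorphic and of order \<open>N^-K\<close> on a disc of
radius \<open>1/N\<close>, so its variation over height \<open>y\<close> is of order \<open>N^(1-K) y\<close>; the constant value at the real point is real and enters as a real perturbation.\<close>

lemma entry_line:
 assumes N: "2 <= real N * rh" and s: "\<bar>s - s0\<bar> <= rh / 2" and y: "\<bar>y\<bar> <= cc / real N / 2"
 shows "norm (smooth ta K N s0 rh (a x p q) (Complex th y) (of_real s) - smooth ta K N s0 rh (a x p q) (of_real th) (of_real s) - \<i> * of_real (y * a x p q 1 0 th s))
  <= (4 * (C / real N ^ K) / (cc / real N) + real K * (real K * (B * \<bar>y\<bar>))) * \<bar>y\<bar>"
  and "norm (smooth ta K N s0 rh (a x p q) (of_real th) (of_real s) - of_real (a x p q 0 0 th s)) <= C / real N ^ K"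
proof -
 let ?b = "%i l. a x p q i l th s"
 let ?S = "%z. smooth ta K N s0 rh (a x p q) z (of_real s)" and ?T = "%z. tpoly K ?b (z - of_real th) 0"
 have s': "\<bar>s - s0\<bar> <= rh" using s rh by simp
 have N1: "1 <= real N" by (rule N_pos[OF N])
 have cN: "0 < cc / real N" using cc N1 by simp
 have "cc / real N <= cc / 1" using N1 cc by (intro divide_left_mono) auto
 then have "cc / real N / 2 <= 1" using cc by simp
 with y have y1: "\<bar>y\<bar> <= 1" by (rule order_trans)
 have ap: "norm (?S z - ?T z) <= C / real N ^ K" if "norm (z - of_real th) <= cc / real N" for z
  using approx[OF N s that, of "of_real s" x p q] cN by simp
 have t0: "norm (tpoly K ?b (\<i> * of_real y) 0 - (of_real (?b 0 0) + of_real (?b 1 0) * (\<i> * of_real y) + of_real (?b 0 1) * 0)) <= real K * (real K * (B * \<bar>y\<bar>\<^sup>2))"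
  by (rule tpoly_first_order) (use bd[OF _ s'] K y1 in \<open>auto simp: norm_mult\<close>)
 have "norm (tpoly K ?b 0 0 - (of_real (?b 0 0) + of_real (?b 1 0) * 0 + of_real (?b 0 1) * 0)) <= real K * (real K * (B * 0\<^sup>2))"
  by (rule tpoly_first_order) (use bd[OF _ s'] K in auto)
 then have t00: "tpoly K ?b 0 0 = of_real (?b 0 0)" by simp
 show "norm (?S (of_real th) - of_real (?b 0 0)) <= C / real N ^ K"
  using ap[of "of_real th"] cN t00 by simp
 have "norm ((?S (Complex th y) - ?T (Complex th y)) - (?S (of_real th) - ?T (of_real th))) <= 4 * (C / real N ^ K) / (cc / real N) * norm (Complex th y - of_real th)"
 proof (rule holomorphic_lipschitz_at_centre)
  have "ball (of_real th) (cc / real N) <= {z. \<bar>Im z\<bar> < cc / real N}"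
  proof
  fix z assume "z : ball (complex_of_real th) (cc / real N)"
  then have "norm (z - of_real th) < cc / real N" by (simp add: dist_norm norm_minus_commute)
  then show "z : {z. \<bar>Im z\<bar> < cc / real N}" using abs_Im_le_cmod[of "z - of_real th"] by simp
  qed
  then have "?S holomorphic_on ball (of_real th) (cc / real N)"
  using holomorphic_on_subset[OF strip_holomorphic[OF N s]] by blast
  moreover have "?T holomorphic_on ball (of_real th) (cc / real N)"
  unfolding tpoly_def by (intro holomorphic_on_divide holomorphic_on_sum holomorphic_on_mult holomorphic_on_power holomorphic_on_diff holomorphic_on_const holomorphic_on_ident) auto
  ultimately show "(%z. ?S z - ?T z) holomorphic_on ball (of_real th) (cc / real N)" by (rule holomorphic_on_diff)
  show "norm (?S z - ?T z) <= C / real N ^ K" if "z : ball (of_real th) (cc / real N)" for z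
  using that by (intro ap) (simp add: dist_norm norm_minus_commute)
  show "norm (Complex th y - of_real th) <= cc / real N / 2" unfolding height using y by (simp add: norm_mult)
 qed (use cN in auto)
 then have l: "norm ((?S (Complex th y) - tpoly K ?b (\<i> * of_real y) 0) - (?S (of_real th) - of_real (?b 0 0))) <= 4 * (C / real N ^ K) / (cc / real N) * \<bar>y\<bar>"
  unfolding height by (simp add: t00 norm_mult)
 have "?S (Complex th y) - ?S (of_real th) - \<i> * of_real (y * ?b 1 0) =
  ((?S (Complex th y) - tpoly K ?b (\<i> * of_real y) 0) - (?S (of_real th) - of_real (?b 0 0)))
  + (tpoly K ?b (\<i> * of_real y) 0 - (of_real (?b 0 0) + of_real (?b 1 0) * (\<i> * of_real y) + of_real (?b 0 1) * 0))"
  by simp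
 also have "norm ... <= 4 * (C / real N ^ K) / (cc / real N) * \<bar>y\<bar> + real K * (real K * (B * \<bar>y\<bar>\<^sup>2))"
  by (rule order_trans[OF norm_triangle_ineq add_mono[OF l t0]])
 also have "... = (4 * (C / real N ^ K) / (cc / real N) + real K * (real K * (B * \<bar>y\<bar>))) * \<bar>y\<bar>"
  by (simp add: distrib_right power2_eq_square mult.assoc)
 finally show "norm (?S (Complex th y) - ?S (of_real th) - \<i> * of_real (y * ?b 1 0)) <= ..." .
qed

definition et where "et = c / (16 * (2 * B))"
text \<open>A threshold for \<open>N\<close>: each summand enforces one of the smallness conditions below.\<close>

definition XX where "XX = 2 / rh + 64 * C * (2 * B)\<^sup>2 / c + 16 * C / (cc * et) + 4 * real K * real K * B * cc / et + 16 * cc * (2 * B)\<^sup>2 / c + 320 * C / (et * cc)"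

lemma et: "0 < et" "et <= 1 / 32" "et / (8 * B) <= 1"
proof -
 show e: "0 < et" using c B by (simp add: et_def)
 show e2: "et <= 1 / 32" using c B by (simp add: et_def divide_le_eq)
 show "et / (8 * B) <= 1" using e2 B by (simp add: divide_le_eq)
qed

lemma XX:
 assumes "XX <= real N"
 shows "2 <= real N * rh" and "2 * (C / real N) <= c / (32 * (2 * B)\<^sup>2)" and "2 * (4 * C / (cc * real N)) <= et / 2"
  and "real K * real K * B * cc / real N <= et / 4" and "cc / real N / 2 <= c / (32 * (2 * B)\<^sup>2)" and "320 * C / (et * cc) <= real N"
proof -
 let ?a = "2 / rh" and ?b = "64 * C * (2 * B)\<^sup>2 / c" and ?d = "16 * C / (cc * et)" and ?e = "4 * real K * real K * B * cc / et" and ?g = "16 * cc * (2 * B)\<^sup>2 / c" and ?h = "320 * C / (et * cc)"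
 have p: "0 < ?a" "0 < ?b" "0 < ?d" "0 <= ?e" "0 < ?g" "0 < ?h" using rh C c cc et(1) B by simp_all
 have l: "?a <= real N" "?b <= real N" "?d <= real N" "?e <= real N" "?g <= real N" "?h <= real N"
  using assms p unfolding XX_def by linarith+
 have N: "0 < real N" using l(1) p(1) by linarith
 have B2: "0 < (2 * B)\<^sup>2" using B by simp
 show "2 <= real N * rh" using l(1) rh by (simp add: divide_le_eq)
 show "2 * (C / real N) <= c / (32 * (2 * B)\<^sup>2)"
  using l(2) N c B2 by (simp add: divide_le_eq le_divide_eq mult_ac)
 show "2 * (4 * C / (cc * real N)) <= et / 2"
  using l(3) N cc et(1) by (simp add: divide_le_eq le_divide_eq mult_ac)
 show "real K * real K * B * cc / real N <= et / 4"
  using l(4) N et(1) by (simp add: divide_le_eq le_divide_eq mult_ac)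
 show "cc / real N / 2 <= c / (32 * (2 * B)\<^sup>2)"
  using l(5) N c B2 by (simp add: divide_le_eq le_divide_eq mult_ac)
 show "?h <= real N" by (rule l(6))
qed

lemma jet_matrix:
 assumes "\<bar>s - s0\<bar> <= rh"
 shows "norm (MA 0 0 th s x) <= 2 * B" "norm (MA 1 0 th s x) <= 2 * B" "det (MA 0 0 th s x) = 1"
  "si * area (MA 0 0 th s x *v w) (MA 1 0 th s x *v w) \<ge> c * (norm w)\<^sup>2"
 using bd[OF _ assms] K det_jet[OF assms] mono_jet[OF assms]
 by (auto simp: MA_def intro!: norm_mat_le)

lemma power_ge: "1 <= real N ==> real N <= real N ^ (K - 1)" "real N ^ K = real N * real N ^ (K - 1)"
 using self_le_power[of "real N" "K - 1"] K by (auto simp: power_eq_if)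

lemma inverse_power_le: "1 <= real N ==> C / real N ^ K <= C / real N" "1 <= real N ==> C / real N ^ K / (cc / real N) <= C / (cc * real N)"
proof -
 assume N: "1 <= real N"
 have "real N * 1 <= real N * real N ^ (K - 1)" using N power_ge(1)[OF N] by (intro mult_left_mono) auto
 then show "C / real N ^ K <= C / real N" unfolding power_ge(2) using N C by (intro divide_left_mono) auto
 have "C / real N ^ K / (cc / real N) = C / (cc * real N ^ (K - 1))" unfolding power_ge(2) using N cc by (simp add: field_simps)
 also have "... <= C / (cc * real N)" using N C cc power_ge(1)[OF N] by (intro divide_left_mono mult_left_mono) auto
 finally show "C / real N ^ K / (cc / real N) <= C / (cc * real N)" .
qed

lemma Ph_level:
 assumes N: "XX <= real N" and y: "0 <= y" "y <= cc / real N / 2" and v: "\<bar>v - s0\<bar> <= rh / 2"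
 shows "level (Ph N) (4 * (2 * B)) (si * y) v"
proof -
 note X = XX[OF N]
 have N1: "1 <= real N" by (rule N_pos[OF X(1)])
 have cN: "0 < cc / real N" using cc N1 by simp
 have v': "\<bar>v - s0\<bar> <= rh" using v rh by simp
 have ay: "\<bar>si * y\<bar> = y" using si y by (simp add: abs_mult)
 have B1: "1 <= 2 * B" using B by simp
 show ?thesis unfolding level_def
 proof (intro conjI allI)
  fix th x
  define R where "R = (\<chi> p q. Re (Ph N (of_real th) (of_real v) x $ p $ q)) - MA 0 0 th v x"
  define E where "E = (\<chi> p q. Ph N (Complex th (si * y)) (of_real v) x $ p $ q - Ph N (of_real th) (of_real v) x $ p $ q - \<i> * of_real (si * y * a x p q 1 0 th v))"
  have im: "Im (Ph N (of_real th) (of_real v) x $ p $ q) = 0" for p q unfolding Ph_def by (simp add: smooth_real[where ta = ta, OF ta(3)])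
  have eq: "Ph N (Complex th (si * y)) (of_real v) x = tilt (MA 0 0 th v x + R) (si * y) (MA 1 0 th v x) + E"
  using im by (simp add: vec_eq_iff tilt_def E_def R_def MA_def complex_eq_iff)
  have nR: "norm R <= c / (32 * (2 * B)\<^sup>2)"
  proof -
  have "norm (R $ p $ q) <= C / real N" for p q
  proof -
  let ?u = "smooth ta K N s0 rh (a x p q) (of_real th) (of_real v) - of_real (a x p q 0 0 th v)"
  have "R $ p $ q = Re ?u" by (simp add: R_def Ph_def MA_def)
  then have "norm (R $ p $ q) <= norm ?u" using abs_Re_le_cmod[of ?u] by simp
  also have "norm ?u <= C / real N ^ K" by (rule entry_line(2)[OF X(1) v, of 0]) (use cN in simp)
  finally show ?thesis using inverse_power_le(1)[OF N1] by linarith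
  qed
  from norm_mat_le[OF this] show ?thesis using X(2) by linarith
  qed
  have nE: "norm E <= c / (16 * (2 * B)) * y"
  proof -
  have "norm (E $ p $ q) <= (et / 2) * y" for p q
  proof -
  have "norm (E $ p $ q) <= (4 * (C / real N ^ K) / (cc / real N) + real K * (real K * (B * \<bar>si * y\<bar>))) * \<bar>si * y\<bar>"
  unfolding E_def Ph_def using entry_line(1)[OF X(1) v, of "si * y" x p q th] y ay by simp
  also have "... = (4 * (C / real N ^ K / (cc / real N)) + real K * real K * B * y) * y" unfolding ay by simp
  also have "... <= (et / 2) * y"
  proof (rule mult_right_mono)
  have "real K * real K * B * y <= real K * real K * B * (cc / real N / 2)" using y B by (intro mult_left_mono) auto
  then have "real K * real K * B * y <= real K * real K * B * cc / real N / 2" by simp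
  then have h2: "real K * real K * B * y <= et / 4" proof (rule order_trans)
  have "real K * real K * B * cc / real N / 2 <= et / 4 / 2" by (rule divide_right_mono[OF X(4)]) simp
  also have "... <= et / 4" using et(1) by simp
  finally show "real K * real K * B * cc / real N / 2 <= et / 4" .
  qed
  have "4 * (C / real N ^ K / (cc / real N)) <= 4 * (C / (cc * real N))" using inverse_power_le(2)[OF N1] by simp
  also have "... <= et / 4" using X(3) by simp
  finally have h1: "4 * (C / real N ^ K / (cc / real N)) <= et / 4" .
  show "4 * (C / real N ^ K / (cc / real N)) + real K * real K * B * y <= et / 2" using add_mono[OF h1 h2] by simp
  qed (use y in simp)
  finally show ?thesis .
  qed
  from norm_mat_le[OF this] show ?thesis by (simp add: et_def)
  qed
  show "good (4 * (2 * B)) (Ph N (Complex th (si * y)) (of_real v) x)" unfolding eq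
  by (rule good_perturbation[OF jet_matrix(1,2)[OF v'] B1 jet_matrix(3)[OF v'] si jet_matrix(4)[OF v'] c nR y(1) order_trans[OF y(2) X(5)] nE])
 next
  fix x p q
  have c1: "continuous_on {z. \<bar>Im z\<bar> < cc / real N} (%z. smooth ta K N s0 rh (a x p q) z (of_real v))"
  by (rule holomorphic_on_imp_continuous_on[OF strip_holomorphic[OF X(1) v]])
  have c2: "continuous_on UNIV (%th. Complex th (si * y))" unfolding complex_eq by (intro continuous_intros)
  have c3: "Complex th (si * y) : {z. \<bar>Im z\<bar> < cc / real N}" for th
  proof -
  have h: "u / 2 < u" if "0 < u" for u :: real using that by simp
  have "y < cc / real N" by (rule le_less_trans[OF y(2) h[OF cN]])
  then show ?thesis using ay by simp
  qed
  have "continuous_on UNIV (%th. smooth ta K N s0 rh (a x p q) (Complex th (si * y)) (of_real v))"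
  by (rule continuous_on_compose2[OF c1 c2]) (use c3 in blast)
  then show "continuous_on UNIV (%th. Ph N (Complex th (si * y)) (of_real v) x $ p $ q)"
  by (simp only: Ph_def vec_lambda_beta)
 next
  fix th p q
  show "(%x. Ph N (Complex th (si * y)) (of_real v) x $ p $ q) : borel_measurable \<mu>"
  unfolding Ph_def vec_lambda_beta by (rule smooth_measurable[OF meas_jet]) (use N1 in simp_all)
 qed
qed

text \<open>At heights between \<open>t\<close> and \<open>2 t\<close> an error of size \<open>et t / 2\<close> per entry is affordable. The two approximations differ by \<open>O(N^-K)\<close>, which leaves room for \<open>|om|\<close> of
order \<open>t N^K\<close>, that is \<open>N^(K-1)\<close>.\<close>

lemma mix_good:
 assumes N: "XX <= real N" and t: "t = cc / (8 * real N)" and y: "t <= y" "y <= 2 * t" and s: "\<bar>s - s0\<bar> <= rh / 2"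
  and w: "norm (w - of_real s) <= et / (8 * B) * t" and om: "norm om <= et * cc * real N ^ (K - 1) / (160 * C)"
 shows "good (4 * (2 * B)) (mix om (Ph N (Complex th (si * y)) w x) (Ph (2 * N) (Complex th (si * y)) w x))"
proof -
 note X = XX[OF N]
 have N1: "1 <= real N" by (rule N_pos[OF X(1)])
 have X2: "2 <= real (2 * N) * rh" using X(1) rh N1 by simp
 have s': "\<bar>s - s0\<bar> <= rh" using s rh by simp
 have tp: "0 < t" using t cc N1 by simp
 have ay: "\<bar>si * y\<bar> = y" using si y tp by (simp add: abs_mult)
 have t2: "2 * t <= cc / real (2 * N)" "2 * t <= cc / real N" using t cc N1 by (simp_all add: field_simps)
 have t3: "et / (8 * B) * t <= 2 * t"
 proof -
  have "et / (8 * B) * t <= 1 * t" using et(3) tp by (intro mult_right_mono) auto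
  then show ?thesis using tp by linarith
 qed
 define G where "G p q = of_real (a x p q 0 0 th s) + \<i> * of_real (si * y * a x p q 1 0 th s)" for p q
 define e where "e = real K * (real K * (B * (2 * t)\<^sup>2)) + B * (et / (8 * B) * t)"
 have d0: "norm (Ph N (Complex th (si * y)) w x $ p $ q - G p q) <= C / real N ^ K + e" for p q
  unfolding Ph_def G_def e_def using entry_disc[OF X(1) s, of "si * y" "2 * t" w "et / (8 * B) * t" x p q th] ay y w t3 t2(2) by (simp add: add.assoc)
 define L where "L = C / real N ^ K"
 have L0: "0 <= L" using C by (simp add: L_def)
 have CN2: "C / real (2 * N) ^ K <= L" unfolding L_def
  using C N1 by (intro divide_left_mono power_mono) auto
 have d1: "norm (Ph (2 * N) (Complex th (si * y)) w x $ p $ q - Ph N (Complex th (si * y)) w x $ p $ q) <= 2 * L" for p q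
 proof -
  let ?T = "tpoly K (%i l. a x p q i l th s) (Complex th (si * y) - of_real th) (w - of_real s)"
  have h: "norm (Complex th (si * y) - of_real th) <= 2 * t" unfolding height using ay y by (simp add: norm_mult)
  have "norm (w - of_real s) <= 2 * t" using w t3 by linarith
  then have "norm (Ph (2 * N) (Complex th (si * y)) w x $ p $ q - ?T) <= L" "norm (Ph N (Complex th (si * y)) w x $ p $ q - ?T) <= L"
  using approx[OF X2 s order_trans[OF h t2(1)], of w x p q] approx[OF X(1) s order_trans[OF h t2(2)], of w x p q] t2 CN2
  by (auto simp: Ph_def L_def)
  then show ?thesis using norm_triangle_ineq4[of "Ph (2 * N) (Complex th (si * y)) w x $ p $ q - ?T" "Ph N (Complex th (si * y)) w x $ p $ q - ?T"] by simp
 qed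
 define E where "E = mix om (Ph N (Complex th (si * y)) w x) (Ph (2 * N) (Complex th (si * y)) w x) - tilt (MA 0 0 th s x) (si * y) (MA 1 0 th s x)"
 have nE: "norm E <= c / (16 * (2 * B)) * y"
 proof -
  have "norm (E $ p $ q) <= (et / 2) * t" for p q
  proof -
  let ?M0 = "Ph N (Complex th (si * y)) w x $ p $ q" and ?M1 = "Ph (2 * N) (Complex th (si * y)) w x $ p $ q"
  have "E $ p $ q = (?M0 - G p q) + om * (?M1 - ?M0)" by (simp add: E_def mix_def tilt_def MA_def G_def)
  then have "norm (E $ p $ q) <= norm (?M0 - G p q) + norm om * norm (?M1 - ?M0)" using norm_triangle_ineq[of "?M0 - G p q" "om * (?M1 - ?M0)"] by (simp add: norm_mult)
  also have "... <= (L + e) + et * cc * real N ^ (K - 1) / (160 * C) * (2 * L)"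
  using d0[of p q] d1[of p q] om L0 et(1) cc C by (intro add_mono mult_mono) (auto simp: L_def)
  also have "... <= (et / 2) * t"
  proof -
  have LL: "et * cc * real N ^ (K - 1) / (160 * C) * (2 * L) = et * t / 10"
  unfolding L_def power_ge(2)[of N] t using C N1 by (simp add: field_simps)
  have "L <= et * t / 40"
  proof -
  have "320 * C / (et * cc) <= real N ^ (K - 1)" using X(6) power_ge(1)[OF N1] by linarith
  then have "320 * C <= real N ^ (K - 1) * (et * cc)" using et(1) cc by (simp add: divide_le_eq)
  then have "C <= real N ^ (K - 1) * (et * cc) / 320" by simp
  then have "L <= real N ^ (K - 1) * (et * cc) / 320 / real N ^ K" unfolding L_def by (intro divide_right_mono) auto
  also have "... = et * t / 40" unfolding power_ge(2)[of N] t using N1 by (simp add: field_simps)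
  finally show ?thesis .
  qed
  moreover have "e <= et * t / 8 + et * t / 8"
  proof -
  have "real K * (real K * (B * (2 * t)\<^sup>2)) = real K * real K * B * cc / real N * (t / 2)"
  unfolding t using N1 by (simp add: power2_eq_square field_simps)
  also have "... <= et / 4 * (t / 2)" using X(4) tp by (intro mult_right_mono) auto
  finally have "real K * (real K * (B * (2 * t)\<^sup>2)) <= et / 4 * (t / 2)" .
  moreover have "B * (et / (8 * B) * t) = et * t / 8" using B by simp
  moreover have "et / 4 * (t / 2) = et * t / 8" by simp
  ultimately show ?thesis unfolding e_def by linarith
  qed
  moreover have "0 <= et * t" using et(1) tp by simp
  moreover have "et / 2 * t = et * t / 2" by simp
  ultimately show ?thesis unfolding LL by linarith
  qed
  finally show ?thesis .
  qed
  from norm_mat_le[OF this] have "norm E <= et * t" by simp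
  also have "... <= et * y" using y et(1) by (intro mult_left_mono) auto
  finally show ?thesis by (simp add: et_def)
 qed
 have yt: "0 <= y" "y <= c / (32 * (2 * B)\<^sup>2)"
 proof -
  have "2 * t <= cc / real N / 2" using t cc N1 by (simp add: field_simps)
  then show "y <= c / (32 * (2 * B)\<^sup>2)" using y X(5) by linarith
 qed (use y tp in simp)
 have B1: "1 <= 2 * B" using B by simp
 have z: "norm (0 :: real^2^2) <= c / (32 * (2 * B)\<^sup>2)" using c by simp
 have "good (4 * (2 * B)) (tilt (MA 0 0 th s x + 0) (si * y) (MA 1 0 th s x) + E)"
  by (rule good_perturbation[OF jet_matrix(1,2)[OF s'] B1 jet_matrix(3)[OF s'] si jet_matrix(4)[OF s'] c z yt nE])
 then show ?thesis unfolding E_def by (simp only: add_0_right add_diff_eq add_diff_cancel_left')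
qed

end
lemma anl_cong: "anl rh M u s ==> (!!v. \<bar>v - s\<bar> < rh ==> u v = u' v) ==> anl rh M u' s"
 unfolding anl_def by simp

context smooth_family begin

definition Lam where "Lam = ln (4 * (2 * B)) + ln 4"
definition c4 where "c4 = et / (8 * B) * (cc / 16)"

lemma Lam: "0 < Lam" "1 <= 4 * (2 * B)"
proof -
 show 1: "1 <= 4 * (2 * B)" using B by simp
 have "0 <= ln (4 * (2 * B))" using 1 by (rule ln_ge_zero)
 moreover have "0 < ln (4 :: real)" by simp
 ultimately show "0 < Lam" unfolding Lam_def by (rule add_nonneg_pos)
qed

lemma c4: "0 < c4" "c4 <= 1"
proof -
 show "0 < c4" using et B cc by (simp add: c4_def)
 have "c4 <= 1 * (cc / 16)" unfolding c4_def by (rule mult_right_mono[OF et(3)]) (use cc in simp)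
 then show "c4 <= 1" using cc by simp
qed

lemma scales:
 assumes N: "XX <= real N" and s: "\<bar>s - s0\<bar> <= rh / 4"
 defines "t \<equiv> cc / (8 * real N)" defines "R \<equiv> et / (8 * B) * t" defines "Q \<equiv> et * cc * real N ^ (K - 1) / (160 * C)"
 shows "0 < t" "0 < R" "2 <= Q" "R / 2 = c4 / real N" "R <= t" "\<bar>s - s0\<bar> <= rh / 2"
  "!!v. \<bar>v - s\<bar> < R ==> \<bar>v - s0\<bar> <= rh / 2" "2 * t <= cc / real N / 2" "2 * t <= cc / real (2 * N) / 2"
  "2 * t < cc / real N" "2 * t < cc / real (2 * N)" "XX <= real (2 * N)"
proof -
 note X = XX[OF N]
 have N1: "1 <= real N" by (rule N_pos[OF X(1)])
 show t: "0 < t" using cc N1 by (simp add: t_def)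
 show R: "0 < R" using t et B by (simp add: R_def)
 have "320 * C / (et * cc) <= real N ^ (K - 1)" using X(6) power_ge(1)[OF N1] by linarith
 then have "320 * C <= real N ^ (K - 1) * (et * cc)" using et(1) cc by (simp add: divide_le_eq)
 then show "2 <= Q" unfolding Q_def using C by (simp add: le_divide_eq mult_ac)
 show "R / 2 = c4 / real N" by (simp add: R_def t_def c4_def)
 have "R <= 1 * t" unfolding R_def by (rule mult_right_mono[OF et(3)]) (use t in simp)
 then show Rt: "R <= t" by simp
 show "\<bar>s - s0\<bar> <= rh / 2" using s rh by simp
 have "t <= rh / 4"
 proof -
  have "cc <= 1 * (2 * real N * rh)" using X(1) cc by simp
  then show ?thesis unfolding t_def using N1 by (simp add: divide_le_eq mult_ac)
 qed
 then show "\<bar>v - s0\<bar> <= rh / 2" if "\<bar>v - s\<bar> < R" for v using that Rt s by linarith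
 have e: "cc / real N = 8 * t" "cc / real (2 * N) = 4 * t" using N1 by (simp_all add: t_def)
 show "2 * t <= cc / real N / 2" "2 * t <= cc / real (2 * N) / 2" "2 * t < cc / real N" "2 * t < cc / real (2 * N)"
  unfolding e using t by simp_all
 show "XX <= real (2 * N)" using N N1 by simp
qed

lemma Ph_disc_holomorphic:
 assumes M: "XX <= real M" and s: "\<bar>s - s0\<bar> <= rh / 2" and y: "0 <= y" "y <= cc / real M" and R: "R <= cc / real M"
 shows "(%w. Ph M (Complex th (si * y)) w x $ i $ j) holomorphic_on ball (of_real s) R"
proof -
 have "\<bar>si * y\<bar> <= cc / real M" using si y by (simp add: abs_mult)
 from disc_holomorphic[OF XX(1)[OF M] s this R, of x i j th] show ?thesis by (simp add: Ph_def)
qed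

lemma Ph_reflection:
 assumes M: "XX <= real M" and v: "\<bar>v - s0\<bar> <= rh / 2" and t: "0 < t" "2 * t <= cc / real M / 2"
 shows "HH (Ph M) n 0 v = 2 * HH (Ph M) n (si * t) v - HH (Ph M) n (si * (2 * t)) v"
proof (rule HH_reflection[where de = "cc / real M" and C = "4 * (2 * B)"])
 show "(%z. Ph M z (of_real v) x $ i $ j) holomorphic_on {z. \<bar>Im z\<bar> < cc / real M}" for x i j
  using strip_holomorphic[OF XX(1)[OF M] v, of x i j] by (simp add: Ph_def)
 show "Ph M (z + 1) (of_real v) x = Ph M z (of_real v) x" for z x
  unfolding Ph_def by (simp add: smooth_periodic[where ta = ta, OF ta(2)])
 show "level (Ph M) (4 * (2 * B)) (si * y) v" if "0 <= y" "y <= 2 * t" for y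
  by (rule Ph_level[OF M that(1) order_trans[OF that(2) t(2)] v])
 have h: "x / 2 < x" if "0 < x" for x :: real using that by simp
 have "0 < cc / real M" using cc N_pos[OF XX(1)[OF M]] by simp
 then show "2 * t < cc / real M" by (rule le_less_trans[OF t(2) h])
qed (use Lam si t in auto)

lemma HH_step:
 assumes N: "XX <= real N" and s: "\<bar>s - s0\<bar> <= rh / 4"
 shows "anl (c4 / real N) (69120 * Lam * C / (et * cc) / real N ^ (K - 1)) (%v. HH (Ph (2 * N)) n 0 v - HH (Ph N) n 0 v) s"
  and "anl (c4 / real N) (27 * Lam) (HH (Ph N) n 0) s"
proof -
 define t where "t = cc / (8 * real N)"
 define R where "R = et / (8 * B) * t"
 define Q where "Q = et * cc * real N ^ (K - 1) / (160 * C)"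
 note S = scales[OF N s, folded t_def, folded R_def Q_def]
 have y0: "0 <= y" if "t <= y" "y <= 2 * t" for y using that S(1) by linarith
 have hol: "(%w. Ph N (Complex th (si * y)) w x $ i $ j) holomorphic_on ball (of_real s) R"
  "(%w. Ph (2 * N) (Complex th (si * y)) w x $ i $ j) holomorphic_on ball (of_real s) R" if "t <= y" "y <= 2 * t" for y th x i j
  using that S(1,5,8,9,10,11) by (intro Ph_disc_holomorphic N S(12) S(6); linarith)+
 have lev: "level (Ph N) (4 * (2 * B)) (si * y) v" "level (Ph (2 * N)) (4 * (2 * B)) (si * y) v"
  if "t <= y" "y <= 2 * t" "\<bar>v - s\<bar> < R" for y v
  by (rule Ph_level[OF N y0[OF that(1,2)] order_trans[OF that(2) S(8)] S(7)[OF that(3)]],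
  rule Ph_level[OF S(12) y0[OF that(1,2)] order_trans[OF that(2) S(9)] S(7)[OF that(3)]])
 have gm: "good (4 * (2 * B)) (mix om (Ph N (Complex th (si * y)) w x) (Ph (2 * N) (Complex th (si * y)) w x))"
  if "t <= y" "y <= 2 * t" "w : ball (of_real s) R" "norm om < Q" for om th y w x
 proof (rule mix_good[OF N t_def that(1,2) S(6)])
  show "norm (w - of_real s) <= et / (8 * B) * t" using that(3) by (simp add: R_def dist_norm norm_minus_commute)
  show "norm om <= et * cc * real N ^ (K - 1) / (160 * C)" using that(4) by (simp add: Q_def)
 qed
 have Q0: "norm (0 :: complex) < Q" using S(3) by simp
 have tt: "t <= t" "t <= 2 * t" "2 * t <= 2 * t" using S(1) by simp_all
 have d: "anl (R / 2) (144 * Lam / Q) (%v. HH (Ph (2 * N)) n (si * y) v - HH (Ph N) n (si * y) v) s"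
  "anl (R / 2) (9 * Lam) (HH (Ph N) n (si * y)) s" if y: "t <= y" "y <= 2 * t" for y
  unfolding Lam_def
  by (rule HH_difference_anl[OF hol(1)[OF y] hol(2)[OF y] gm[OF y] Lam(2) S(2,3) lev[OF y]]; assumption)
  (rule HH_anl[OF hol(1)[OF y] gm[OF y _ Q0, unfolded mix_0] Lam(2) S(2) lev(1)[OF y]]; assumption)
 have "anl (R / 2) (\<bar>2\<bar> * (144 * Lam / Q) + \<bar>- 1\<bar> * (144 * Lam / Q)) (%v. 2 * (HH (Ph (2 * N)) n (si * t) v - HH (Ph N) n (si * t) v) + (- 1) * (HH (Ph (2 * N)) n (si * (2 * t)) v - HH (Ph N) n (si * (2 * t)) v)) s"
  by (rule anl_lincomb[OF d(1)[OF tt(1,2)] d(1)[OF tt(2,3)]])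
 moreover have "\<bar>2\<bar> * (144 * Lam / Q) + \<bar>- 1\<bar> * (144 * Lam / Q) = 69120 * Lam * C / (et * cc) / real N ^ (K - 1)"
  using C by (simp add: Q_def mult_ac)
 ultimately have "anl (c4 / real N) (69120 * Lam * C / (et * cc) / real N ^ (K - 1)) (%v. 2 * (HH (Ph (2 * N)) n (si * t) v - HH (Ph N) n (si * t) v) + (- 1) * (HH (Ph (2 * N)) n (si * (2 * t)) v - HH (Ph N) n (si * (2 * t)) v)) s"
  unfolding S(4) by simp
 then show "anl (c4 / real N) (69120 * Lam * C / (et * cc) / real N ^ (K - 1)) (%v. HH (Ph (2 * N)) n 0 v - HH (Ph N) n 0 v) s"
 proof (rule anl_cong)
  fix v assume "\<bar>v - s\<bar> < c4 / real N"
  then have "\<bar>v - s\<bar> < R" using S(2) unfolding S(4)[symmetric] by simp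
  note r = Ph_reflection[OF N S(7)[OF this] S(1,8), of n] Ph_reflection[OF S(12) S(7)[OF this] S(1,9), of n]
  show "2 * (HH (Ph (2 * N)) n (si * t) v - HH (Ph N) n (si * t) v) + (- 1) * (HH (Ph (2 * N)) n (si * (2 * t)) v - HH (Ph N) n (si * (2 * t)) v)
  = HH (Ph (2 * N)) n 0 v - HH (Ph N) n 0 v" unfolding r by simp
 qed
 have "anl (R / 2) (\<bar>2\<bar> * (9 * Lam) + \<bar>- 1\<bar> * (9 * Lam)) (%v. 2 * HH (Ph N) n (si * t) v + (- 1) * HH (Ph N) n (si * (2 * t)) v) s"
  by (rule anl_lincomb[OF d(2)[OF tt(1,2)] d(2)[OF tt(2,3)]])
 then have "anl (c4 / real N) (27 * Lam) (%v. 2 * HH (Ph N) n (si * t) v + (- 1) * HH (Ph N) n (si * (2 * t)) v) s"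
  unfolding S(4) by simp
 then show "anl (c4 / real N) (27 * Lam) (HH (Ph N) n 0) s"
 proof (rule anl_cong)
  fix v assume "\<bar>v - s\<bar> < c4 / real N"
  then have "\<bar>v - s\<bar> < R" using S(2) unfolding S(4)[symmetric] by simp
  note r = Ph_reflection[OF N S(7)[OF this] S(1,8), of n]
  show "2 * HH (Ph N) n (si * t) v + (- 1) * HH (Ph N) n (si * (2 * t)) v = HH (Ph N) n 0 v" unfolding r by simp
 qed
qed

text \<open>With \<open>M = O(N^-(r+1))\<close> and radius of order \<open>1/N\<close>, the Hoelder norm of one step is of order \<open>N^-(r+1) * N^(r + 1/2) = N^-(1/2)\<close>; along powers of two this is geometric.\<close>

lemma HH_uniformly_regular:
 assumes N0: "XX <= real N0" and K': "K = r + 2"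
 shows "EX D. ALL n j. hold r D {s0 - rh / 4<..<s0 + rh / 4} (HH (Ph (2 ^ j * N0)) n 0)"
proof -
 let ?J = "{s0 - rh / 4<..<s0 + rh / 4}"
 define k :: real where "k = 3 * (fact (Suc r) * 2 * 2 ^ Suc r)"
 define M where "M = 69120 * Lam * C / (et * cc)"
 define E where "E = k * M / (c4 ^ r * sqrt c4)"
 define H where "H = k * (27 * Lam) / ((c4 / real N0) ^ r * sqrt (c4 / real N0))"
 have k0: "0 < k" by (simp add: k_def)
 have M0: "0 < M" using Lam C et cc by (simp add: M_def)
 have E0: "0 < E" using k0 M0 c4 by (simp add: E_def)
 have N1: "1 <= real N0" by (rule N_pos[OF XX(1)[OF N0]])
 have big: "XX <= real (2 ^ j * N0)" "1 <= real (2 ^ j * N0)" for j :: nat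
 proof -
  have e: "real (2 ^ j * N0) = real N0 * 2 ^ j" by simp
  have "real N0 * 1 <= real N0 * 2 ^ j" by (intro mult_left_mono) auto
  then show "XX <= real (2 ^ j * N0)" "1 <= real (2 ^ j * N0)" unfolding e using N0 N1 by linarith+
 qed
 have sJ: "\<bar>s - s0\<bar> <= rh / 4" if "s : ?J" for s using that unfolding greaterThanLessThan_iff abs_le_iff by linarith
 have sc: "0 < c4 / real (2 ^ j * N0)" "c4 / real (2 ^ j * N0) <= 1" for j
 proof -
  have pos: "0 < real (2 ^ j * N0)" using big(2)[of j] by linarith
  show "0 < c4 / real (2 ^ j * N0)" by (rule divide_pos_pos[OF c4(1) pos])
  show "c4 / real (2 ^ j * N0) <= 1" unfolding pos_divide_le_eq[OF pos] mult_1 by (rule order_trans[OF c4(2) big(2)])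
 qed
 have st: "hold r (E * (1 / sqrt 2) ^ j) ?J (%v. HH (Ph (2 * (2 ^ j * N0))) n 0 v - HH (Ph (2 ^ j * N0)) n 0 v)" for n j
 proof -
  define N where "N = real (2 ^ j * N0)"
  have N: "1 <= N" using big(2)[of j] by (simp add: N_def)
  have "hold r (k * (M / N ^ (K - 1)) / ((c4 / N) ^ r * sqrt (c4 / N))) ?J (%v. HH (Ph (2 * (2 ^ j * N0))) n 0 v - HH (Ph (2 ^ j * N0)) n 0 v)"
  unfolding k_def N_def M_def
  by (rule anl_imp_hold[OF _ HH_step(1)[OF big(1) sJ] sc]) (use Lam C et cc in \<open>auto intro!: divide_nonneg_nonneg mult_nonneg_nonneg\<close>)
  moreover have "k * (M / N ^ (K - 1)) / ((c4 / N) ^ r * sqrt (c4 / N)) <= E * (1 / sqrt 2) ^ j"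
  proof -
  have q: "sqrt N * sqrt N = N" using N by simp
  have p: "N ^ (K - 1) = N ^ r * (sqrt N * sqrt N)" unfolding q K' by simp
  have "k * (M / N ^ (K - 1)) / ((c4 / N) ^ r * sqrt (c4 / N)) = E * (1 / sqrt N)"
  unfolding p E_def power_divide real_sqrt_divide using N c4 by (simp add: field_simps)
  also have "... <= E * (1 / sqrt 2) ^ j"
  proof (rule mult_left_mono)
  have "(2::real) ^ j * 1 <= N" unfolding N_def using N1 by (simp add: mult_left_mono)
  then have "sqrt (2 ^ j) <= sqrt N" by simp
  then have "1 / sqrt N <= 1 / sqrt (2 ^ j)" by (intro divide_left_mono) (use N in auto)
  then show "1 / sqrt N <= (1 / sqrt 2) ^ j" by (simp add: power_divide real_sqrt_power)
  qed (use E0 in simp)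
  finally show ?thesis .
  qed
  ultimately show ?thesis by (rule hold_mono)
 qed
 have ind: "hold r (H + (\<Sum>i<j. E * (1 / sqrt 2) ^ i)) ?J (HH (Ph (2 ^ j * N0)) n 0)" for n j
 proof (induction j)
  case 0
  have "hold r H ?J (HH (Ph N0) n 0)"
  unfolding H_def k_def
  by (rule anl_imp_hold[OF _ HH_step(2)[OF N0 sJ]]) (use Lam sc[of 0] in auto)
  then show ?case by simp
 next
  case (Suc j)
  have "hold r ((H + (\<Sum>i<j. E * (1 / sqrt 2) ^ i)) + E * (1 / sqrt 2) ^ j) ?J (%v. HH (Ph (2 ^ j * N0)) n 0 v + (HH (Ph (2 * (2 ^ j * N0))) n 0 v - HH (Ph (2 ^ j * N0)) n 0 v))"
  by (rule hold_add[OF Suc.IH st])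
  then show ?case by (simp add: add.assoc mult.assoc)
 qed
 have "(\<Sum>i<j. E * (1 / sqrt 2) ^ i) <= E * (1 / (1 - 1 / sqrt 2))" for j :: nat
 proof -
  have q: "0 <= 1 / sqrt 2" "1 / sqrt 2 < (1::real)" by (simp_all add: divide_less_eq)
  have "(\<Sum>i<j. (1 / sqrt 2) ^ i) <= (\<Sum>i. (1 / sqrt 2 :: real) ^ i)"
  by (rule sum_le_suminf) (use q in \<open>auto intro!: summable_geometric\<close>)
  also have "... = 1 / (1 - 1 / sqrt 2)" by (rule suminf_geometric) (use q in simp)
  finally show ?thesis unfolding sum_distrib_left[symmetric] using E0 by (intro mult_left_mono) auto
 qed
 then have "hold r (H + E * (1 / (1 - 1 / sqrt 2))) ?J (HH (Ph (2 ^ j * N0)) n 0)" for n j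
  by (intro hold_mono[OF ind]) simp
 then show ?thesis by blast
qed

lemma HH_converges:
 assumes N0: "XX <= real N0" and v: "\<bar>v - s0\<bar> <= rh / 2"
 shows "(%j. HH (Ph (2 ^ j * N0)) n 0 v) \<longlonglongrightarrow>
  (\<integral>p. (1 / real n) * ln (norm (Dn (%k. cmat (MA 0 0 (fst p) v ((f ^^ k) (snd p)))) n)) \<partial>(circ \<Otimes>\<^sub>M \<mu>))"
proof -
 interpret c: prob_space circ by (rule prob_circ)
 interpret P: pair_prob_space circ \<mu> ..
 have v': "\<bar>v - s0\<bar> <= rh" using v rh by simp
 have N1: "1 <= real N0" by (rule N_pos[OF XX(1)[OF N0]])
 have big: "XX <= real (2 ^ j * N0)" "1 <= real (2 ^ j * N0)" "2 ^ j <= real (2 ^ j * N0)" for j :: nat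
 proof -
  have "real N0 * 1 <= real N0 * 2 ^ j" "2 ^ j * 1 <= 2 ^ j * real N0" using N1 by (intro mult_left_mono; simp)+
  moreover have e: "real (2 ^ j * N0) = real N0 * 2 ^ j" "2 ^ j * real N0 = real N0 * 2 ^ j" by simp_all
  ultimately show "XX <= real (2 ^ j * N0)" "1 <= real (2 ^ j * N0)" "2 ^ j <= real (2 ^ j * N0)" unfolding e using N0 N1 by linarith+
 qed
 have lev: "level (Ph (2 ^ j * N0)) (4 * (2 * B)) 0 v" for j
  using Ph_level[OF big(1) order_refl _ v, of j] cc by simp
 have ent: "(%j. Ph (2 ^ j * N0) (Complex th 0) (of_real v) x $ p $ q) \<longlonglongrightarrow> cmat (MA 0 0 th v x) $ p $ q" for th x p q
 proof (rule Lim_transform_bound[where g = "%j. C * (1 / 2) ^ j", THEN LIM_zero_cancel])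
  show "\<forall>\<^sub>F j in sequentially. norm (Ph (2 ^ j * N0) (Complex th 0) (of_real v) x $ p $ q - cmat (MA 0 0 th v x) $ p $ q) <= norm (C * (1 / 2) ^ j)"
  proof (intro always_eventually allI)
  fix j :: nat
  define N where "N = 2 ^ j * N0"
  note X = XX(1)[OF big(1)[of j], folded N_def]
  have "Complex th 0 = of_real th" by (simp add: complex_eq_iff)
  then have "norm (Ph N (Complex th 0) (of_real v) x $ p $ q - cmat (MA 0 0 th v x) $ p $ q) <= C / real N ^ K"
  using entry_line(2)[OF X v, of 0 x p q th] cc by (simp add: Ph_def MA_def cmat_def)
  also have "... <= C / real N" by (rule inverse_power_le(1)) (use big(2)[of j] in \<open>simp add: N_def\<close>)
  also have "... <= C / 2 ^ j" using big(3)[of j] C unfolding N_def[symmetric] by (intro divide_left_mono) (auto intro!: mult_pos_pos simp: N_def N1)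
  also have "... = norm (C * (1 / 2) ^ j)" using C by (simp add: power_divide abs_mult)
  finally show "norm (Ph (2 ^ j * N0) (Complex th 0) (of_real v) x $ p $ q - cmat (MA 0 0 th v x) $ p $ q) <= norm (C * (1 / 2) ^ j)" by (simp add: N_def)
  qed
  have "(%j. C * (1 / 2) ^ j) \<longlonglongrightarrow> C * 0" by (intro tendsto_mult tendsto_const LIMSEQ_power_zero) simp
  then show "(%j. C * (1 / 2) ^ j) \<longlonglongrightarrow> 0" by simp
 qed
 have orb: "(%j. orbit (%k. Ph (2 ^ j * N0) (Complex th 0) (of_real v) ((f ^^ k) x)) m $ i) \<longlonglongrightarrow> orbit (%k. cmat (MA 0 0 th v ((f ^^ k) x))) m $ i" for th x m i
 proof (induction m arbitrary: i)
  case (Suc m)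
  show ?case unfolding orbit.simps mat2_vec by (intro tendsto_add tendsto_mult ent Suc.IH)
 qed simp
 have Dlim: "(%j. Dn (%k. Ph (2 ^ j * N0) (Complex th 0) (of_real v) ((f ^^ k) x)) n) \<longlonglongrightarrow> Dn (%k. cmat (MA 0 0 th v ((f ^^ k) x))) n" for th x
  unfolding Dn_def lfun_def by (intro tendsto_diff tendsto_mult tendsto_const orb)
 have nz: "Dn (%k. cmat (MA 0 0 th v ((f ^^ k) x))) n ~= 0" for th x
 proof -
  have "det (cocycle f (MA 0 0 th v) n x) = 1" by (rule det_cocycle[OF jet_matrix(3)[OF v']])
  from onorm_Dn(1,2)[OF this] have "1 <= norm (lfun (cmat (cocycle f (MA 0 0 th v) n x) *v x0))" by linarith
  then show ?thesis unfolding Dn_def orbit_cocycle by auto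
 qed
 have lim: "(%j. LL (Ph (2 ^ j * N0)) n (Complex (fst p) 0) (of_real v) (snd p)) \<longlonglongrightarrow> (1 / real n) * ln (norm (Dn (%k. cmat (MA 0 0 (fst p) v ((f ^^ k) (snd p)))) n))" for p
  unfolding LL_def by (intro tendsto_mult tendsto_const tendsto_ln tendsto_norm Dlim) (use nz in simp)
 note m = level_product_measurable(1)[OF lev Lam(2)]
 show ?thesis unfolding HH_def
 proof (rule integral_dominated_convergence[where w = "%_. Lam"])
  show "(%p. (1 / real n) * ln (norm (Dn (%k. cmat (MA 0 0 (fst p) v ((f ^^ k) (snd p)))) n))) : borel_measurable (circ \<Otimes>\<^sub>M \<mu>)"
  by (rule borel_measurable_LIMSEQ_real[OF lim m])
  show "(%p. LL (Ph (2 ^ j * N0)) n (Complex (fst p) 0) (of_real v) (snd p)) : borel_measurable (circ \<Otimes>\<^sub>M \<mu>)" for j by (rule m)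
  show "AE p in circ \<Otimes>\<^sub>M \<mu>. (%j. LL (Ph (2 ^ j * N0)) n (Complex (fst p) 0) (of_real v) (snd p)) \<longlonglongrightarrow> (1 / real n) * ln (norm (Dn (%k. cmat (MA 0 0 (fst p) v ((f ^^ k) (snd p)))) n))"
  by (rule AE_I2) (rule lim)
  show "AE p in circ \<Otimes>\<^sub>M \<mu>. norm (LL (Ph (2 ^ j * N0)) n (Complex (fst p) 0) (of_real v) (snd p)) <= Lam" for j
  by (rule AE_I2) (use level_LL(3)[OF lev Lam(2), of j n] in \<open>simp add: Lam_def\<close>)
 qed simp
qed

theorem mean_exponent_C_nat:
 assumes K': "K = r + 2"
 shows "C_nat_on r {s0 - rh / 4<..<s0 + rh / 4} (%s. LINT th:{0..1}|lborel. lyapunov f \<mu> (MA 0 0 th s))"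
proof -
 let ?J = "{s0 - rh / 4<..<s0 + rh / 4}"
 obtain N0 :: nat where N0: "XX <= real N0" using real_arch_simple by blast
 obtain D where D: "!!n j. hold r D ?J (HH (Ph (2 ^ j * N0)) n 0)" using HH_uniformly_regular[OF N0 K'] by blast
 have vJ: "\<bar>v - s0\<bar> <= rh / 2" "\<bar>v - s0\<bar> <= rh" if "v : ?J" for v
 proof -
  have "\<bar>v - s0\<bar> <= rh / 4" using that unfolding greaterThanLessThan_iff abs_le_iff by linarith
  then show "\<bar>v - s0\<bar> <= rh / 2" "\<bar>v - s0\<bar> <= rh" using rh by simp_all
 qed
 let ?F = "%n v. \<integral>p. (1 / real n) * ln (norm (Dn (%k. cmat (MA 0 0 (fst p) v ((f ^^ k) (snd p)))) n)) \<partial>(circ \<Otimes>\<^sub>M \<mu>)"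
 have h: "hold r D ?J (?F n)" for n
  by (rule hold_limit[OF open_greaterThanLessThan D[of _ n]]) (rule HH_converges[OF N0 vJ(1)])
 have "hold r D ?J (%s. LINT th:{0..1}|lborel. lyapunov f \<mu> (MA 0 0 th s))"
 proof (rule hold_limit[OF open_greaterThanLessThan h])
  fix v assume "v : ?J"
  note v = vJ(2)[OF this]
  show "(%n. ?F n v) \<longlonglongrightarrow> (LINT th:{0..1}|lborel. lyapunov f \<mu> (MA 0 0 th v))"
  by (rule mean_lyapunov_as_limit[where B = "2 * B"])
  (use jet_matrix[OF v] B in \<open>auto simp: MA_def[abs_def] intro!: continuous_on_vec_lambda cont_x[OF v] cont_\<theta>[OF v]\<close>)
 qed
 then show ?thesis by (rule hold_imp_C_nat_on[OF open_greaterThanLessThan])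
qed

end
section \<open>Monotonicity in terms of areas\<close>

lemma unimodular_lower_bound:
 fixes M :: "real^2^2"
 assumes "det M = 1"
 shows "norm w <= norm M * norm (M *v w)"
proof -
 define D where "D = (vector [vector [M$2$2, - M$1$2], vector [- M$2$1, M$1$1]] :: real^2^2)"
 have d: "M$1$1 * M$2$2 - M$1$2 * M$2$1 = 1" using assms by (simp add: det_2)
 have "(D *v (M *v w)) $ 1 = (M$1$1 * M$2$2 - M$1$2 * M$2$1) * w $ 1" "(D *v (M *v w)) $ 2 = (M$1$1 * M$2$2 - M$1$2 * M$2$1) * w $ 2"
  by (simp_all add: mat2_vec D_def algebra_simps)
 then have e: "D *v (M *v w) = w" unfolding d by (simp add: vec_eq_iff forall_2)
 have "(norm D)\<^sup>2 = (norm M)\<^sup>2" unfolding norm_vec2_sq by (simp add: D_def norm_vec2_sq)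
 then have "norm D = norm M" by simp
 then show ?thesis using norm_mat_vec[of D "M *v w"] unfolding e by simp
qed

text \<open>In polar form the area of \<open>M th w\<close> and \<open>M t w\<close> is the product of the norms and of the sine of the angle between them, and the lift bounds that angle below by a multiple of
\<open>t - th\<close>. Dividing by \<open>t - th\<close> and letting \<open>t\<close> tend to \<open>th\<close> gives the derivative.\<close>

lemma area_lower_of_lift:
 fixes M :: "real => real^2^2"
 assumes der: "!!p q. ((%t. M t $ p $ q) has_real_derivative M' $ p $ q) (at th)" and si: "\<bar>si\<bar> = 1"
  and lift: "circle_lift (%t. (M t *v w) /\<^sub>R norm (M t *v w)) ph"
  and inc: "!!t. th < t ==> e * (t - th) <= si * (ph t - ph th)" and e: "e > 0"
 shows "2 * e * (norm (M th *v w))\<^sup>2 <= si * area (M th *v w) (M' *v w)"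
proof -
 define n where "n t = norm (M t *v w)" for t
 define u where "u t = area (M th *v w) (M t *v w)" for t
 have pol: "(M t *v w) $ 1 = n t * cos (2 * pi * ph t)" "(M t *v w) $ 2 = n t * sin (2 * pi * ph t)" for t
 proof -
  have "M t *v w = n t *\<^sub>R ((M t *v w) /\<^sub>R norm (M t *v w))" by (cases "M t *v w = 0") (simp_all add: n_def)
  also have "(M t *v w) /\<^sub>R norm (M t *v w) = vector [cos (2 * pi * ph t), sin (2 * pi * ph t)]"
  using lift unfolding circle_lift_def by blast
  finally have *: "M t *v w = n t *\<^sub>R vector [cos (2 * pi * ph t), sin (2 * pi * ph t)]" .
  show "(M t *v w) $ 1 = n t * cos (2 * pi * ph t)" by (subst *) simp
  show "(M t *v w) $ 2 = n t * sin (2 * pi * ph t)" by (subst *) simp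
 qed
 have us: "si * u t = n th * n t * sin (2 * pi * (si * (ph t - ph th)))" for t
 proof -
  have "u t = n th * n t * (cos (2 * pi * ph th) * sin (2 * pi * ph t) - sin (2 * pi * ph th) * cos (2 * pi * ph t))"
  unfolding u_def area_def pol by (simp add: algebra_simps)
  also have "... = n th * n t * sin (2 * pi * ph t - 2 * pi * ph th)" by (simp add: sin_diff mult_ac)
  also have "2 * pi * ph t - 2 * pi * ph th = 2 * pi * (ph t - ph th)" by (simp add: right_diff_distrib)
  finally have *: "u t = n th * n t * sin (2 * pi * (ph t - ph th))" .
  have "si = 1 \<or> si = - 1" using si by linarith
  then show ?thesis
  proof
  assume s: "si = - 1"
  have e: "2 * pi * (- 1 * (ph t - ph th)) = - (2 * pi * (ph t - ph th))" by (simp add: algebra_simps)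
  show ?thesis unfolding * s e sin_minus by simp
  qed (simp add: *)
 qed
 have dv: "((%t. (M t *v w) $ i) has_real_derivative (M' *v w) $ i) (at th)" for i
  unfolding mat2_vec by (intro DERIV_add DERIV_cmult_right der)
 have du: "(u has_real_derivative area (M th *v w) (M' *v w)) (at th)"
  unfolding u_def[abs_def] area_def by (intro DERIV_diff DERIV_cmult dv)
 have u0: "u th = 0" by (simp add: u_def area_def)
 have lim1: "((%t. si * (u t / (t - th))) \<longlongrightarrow> si * area (M th *v w) (M' *v w)) (at_right th)"
  using du unfolding has_field_derivative_iff u0 by (intro tendsto_mult tendsto_const) (auto intro: filterlim_mono simp: at_le elim!: tendsto_mono[rotated])
 have "((%t. M t *v w) \<longlongrightarrow> M th *v w) (at th)"
  using dv[THEN DERIV_isCont] by (intro vec_tendstoI) (simp add: isCont_def)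
 then have "((%t. 2 * e * (n th * n t)) \<longlongrightarrow> 2 * e * (n th * n th)) (at th)"
  unfolding n_def by (intro tendsto_mult tendsto_const tendsto_norm)
 then have lim2: "((%t. 2 * e * (n th * n t)) \<longlongrightarrow> 2 * e * (n th * n th)) (at_right th)"
  by (rule tendsto_mono[rotated]) (simp add: at_le)
 have "isCont ph th" using lift unfolding circle_lift_def continuous_on_eq_continuous_at[OF open_UNIV] by blast
 then have "((%t. si * (ph t - ph th)) \<longlongrightarrow> si * (ph th - ph th)) (at th)"
  unfolding isCont_def by (intro tendsto_mult tendsto_diff tendsto_const)
 then have "((%t. si * (ph t - ph th)) \<longlongrightarrow> 0) (at th)" by simp
 then have "((%t. si * (ph t - ph th)) \<longlongrightarrow> 0) (at_right th)"
  by (rule tendsto_mono[rotated]) (simp add: at_le)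
 then have "\<forall>\<^sub>F t in at_right th. si * (ph t - ph th) < 1 / 4" by (rule order_tendstoD) simp
 moreover have "\<forall>\<^sub>F t in at_right th. th < t" by (rule eventually_at_right_less)
 ultimately have ev: "\<forall>\<^sub>F t in at_right th. 2 * e * (n th * n t) <= si * (u t / (t - th))"
 proof eventually_elim
  fix t assume t: "si * (ph t - ph th) < 1 / 4" "th < t"
  define d where "d = si * (ph t - ph th)"
  have d: "e * (t - th) <= d" "d < 1 / 4" using inc[OF t(2)] t(1) by (simp_all add: d_def)
  have "0 < e * (t - th)" using e t by simp
  then have d0: "0 < d" using d by linarith
  have "0 <= sin (2 * pi * d)"
  proof (rule sin_ge_zero)
  have "2 * pi * d <= 2 * pi * (1 / 2)" using d by (intro mult_left_mono) auto
  then show "2 * pi * d <= pi" by simp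
  qed (use d0 in simp)
  moreover have "\<bar>2 * d\<bar> <= \<bar>sin (pi * (2 * d))\<bar>" using d d0 by (intro sin_pi_lower) simp
  ultimately have "2 * d <= sin (2 * pi * d)" using d0 by (simp add: mult_ac)
  then have "2 * (e * (t - th)) <= sin (2 * pi * d)" using d by linarith
  then have "n th * n t * (2 * (e * (t - th))) <= n th * n t * sin (2 * pi * d)" by (intro mult_left_mono) (simp_all add: n_def)
  then have "2 * e * (n th * n t) * (t - th) <= si * u t" unfolding us d_def by (simp add: mult_ac)
  then show "2 * e * (n th * n t) <= si * (u t / (t - th))" using t(2) by (simp add: le_divide_eq)
 qed
 have "2 * e * (n th * n th) <= si * area (M th *v w) (M' *v w)"
  by (rule tendsto_le[OF _ lim1 lim2 ev]) simp
 then show ?thesis by (simp add: n_def power2_eq_square)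
qed

lemma monotonic_family_area:
 fixes A :: "real => 'x => real^2^2"
 assumes mono: "monotonic_family A"
  and der: "!!th x p q. ((%t. A t x $ p $ q) has_real_derivative A' th x $ p $ q) (at th)"
  and det: "!!th x. det (A th x) = 1" and B: "!!th x. norm (A th x) <= B" "1 <= B"
 shows "EX si c. \<bar>si\<bar> = 1 & 0 < c & c <= 1 & (ALL th x w. c * (norm w)\<^sup>2 <= si * area (A th x *v w) (A' th x *v w))"
proof -
 obtain e where e: "e > 0" "eps_monotonic_family e A" using mono unfolding monotonic_family_def by blast
 obtain si :: real where si: "\<bar>si\<bar> = 1" and lift: "!!x w. w ~= 0 ==> EX ph. circle_lift (%th. (A th x *v w) /\<^sub>R norm (A th x *v w)) ph & (ALL th t. th < t --> e * (t - th) <= si * (ph t - ph th))"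
 proof -
  have em: "e * (t - th) <= \<bar>ph t - ph th\<bar>" if "eps_monotonic_on UNIV e ph" "th < t" for ph th t
  proof -
  have "e <= \<bar>ph t - ph th\<bar> / \<bar>t - th\<bar>" using that unfolding eps_monotonic_on_def by (metis UNIV_I less_irrefl)
  then show ?thesis using that(2) by (simp add: le_divide_eq)
  qed
  from e(2) consider
  (inc) "ALL x w. w ~= 0 --> circle_eps_increasing e (%th. (A th x *v w) /\<^sub>R norm (A th x *v w))"
  | (dec) "ALL x w. w ~= 0 --> circle_eps_decreasing e (%th. (A th x *v w) /\<^sub>R norm (A th x *v w))"
  unfolding eps_monotonic_family_def by blast
  then show ?thesis
  proof cases
  case inc
  show ?thesis
  proof (rule that[of 1])
  fix x and w :: "real^2" assume "w ~= 0"
  then obtain ph where p: "circle_lift (%th. (A th x *v w) /\<^sub>R norm (A th x *v w)) ph" "eps_monotonic_on UNIV e ph" "mono ph"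
  using inc unfolding circle_eps_increasing_def by blast
  have "e * (t - th) <= 1 * (ph t - ph th)" if "th < t" for th t
  using em[OF p(2) that] monoD[OF p(3), of th t] that by simp
  then show "EX ph. circle_lift (%th. (A th x *v w) /\<^sub>R norm (A th x *v w)) ph & (ALL th t. th < t --> e * (t - th) <= 1 * (ph t - ph th))" using p(1) by blast
  qed simp
  next
  case dec
  show ?thesis
  proof (rule that[of "- 1"])
  fix x and w :: "real^2" assume "w ~= 0"
  then obtain ph where p: "circle_lift (%th. (A th x *v w) /\<^sub>R norm (A th x *v w)) ph" "eps_monotonic_on UNIV e ph" "antimono ph"
  using dec unfolding circle_eps_decreasing_def by blast
  have "e * (t - th) <= - 1 * (ph t - ph th)" if "th < t" for th t
  using em[OF p(2) that] antimonoD[OF p(3), of th t] that by simp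
  then show "EX ph. circle_lift (%th. (A th x *v w) /\<^sub>R norm (A th x *v w)) ph & (ALL th t. th < t --> e * (t - th) <= - 1 * (ph t - ph th))" using p(1) by blast
  qed simp
  qed
 qed
 define c where "c = min 1 (2 * e / B\<^sup>2)"
 have B2: "0 < B\<^sup>2" using B(2) by simp
 have c: "0 < c" "c <= 1" "c * B\<^sup>2 <= 2 * e"
 proof -
  have "c <= 2 * e / B\<^sup>2" by (simp add: c_def)
  then show "c * B\<^sup>2 <= 2 * e" using B2 by (simp add: le_divide_eq)
 qed (use e B2 in \<open>auto simp: c_def\<close>)
 have "c * (norm w)\<^sup>2 <= si * area (A th x *v w) (A' th x *v w)" for th x w
 proof (cases "w = 0")
  case False
  obtain ph where p: "circle_lift (%th. (A th x *v w) /\<^sub>R norm (A th x *v w)) ph" "!!th t. th < t ==> e * (t - th) <= si * (ph t - ph th)"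
  using lift[OF False] by blast
  have l: "2 * e * (norm (A th x *v w))\<^sup>2 <= si * area (A th x *v w) (A' th x *v w)"
  by (rule area_lower_of_lift[OF der si p e(1)])
  have "norm w <= B * norm (A th x *v w)"
  using unimodular_lower_bound[OF det, of w th x] mult_right_mono[OF B(1)[of th x] norm_ge_zero[of "A th x *v w"]] by linarith
  then have "(norm w)\<^sup>2 <= (B * norm (A th x *v w))\<^sup>2" by (intro power_mono) auto
  then have "c * (norm w)\<^sup>2 <= c * (B * norm (A th x *v w))\<^sup>2" using c by (intro mult_left_mono) auto
  also have "... = (c * B\<^sup>2) * (norm (A th x *v w))\<^sup>2" by (simp add: power_mult_distrib)
  also have "... <= 2 * e * (norm (A th x *v w))\<^sup>2" using c by (intro mult_right_mono) auto
  finally show ?thesis using l by linarith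
 qed (simp add: area_def mat2_vec)
 then show ?thesis using si c by blast
qed

lemma area_perturbation:
 fixes M :: "real^2^2" and w :: "real^2"
 assumes "norm M <= b" "norm M0 <= b" "norm M' <= b" "norm M0' <= b" "norm (M - M0) <= d" "norm (M' - M0') <= d" and si: "\<bar>si\<bar> = 1"
  and c: "c * (norm w)\<^sup>2 <= si * area (M0 *v w) (M0' *v w)"
 shows "(c - 2 * b * d) * (norm w)\<^sup>2 <= si * area (M *v w) (M' *v w)"
proof -
 have bd: "\<bar>area (P *v w) (P' *v w)\<bar> <= p * p' * (norm w)\<^sup>2" if "norm P <= p" "norm P' <= p'" for P P' :: "real^2^2" and p p'
 proof -
  have "\<bar>area (P *v w) (P' *v w)\<bar> <= norm (P *v w) * norm (P' *v w)" by (rule area_bound)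
  also have "... <= (p * norm w) * (p' * norm w)"
  using norm_mat_vec_le[OF that(1), of w] norm_mat_vec_le[OF that(2), of w] order_trans[OF norm_ge_zero that(1)] by (intro mult_mono) auto
  finally show ?thesis by (simp add: power2_eq_square mult_ac)
 qed
 have "area (M *v w) (M' *v w) = area (M0 *v w) (M0' *v w) + area ((M - M0) *v w) (M' *v w) + area (M0 *v w) ((M' - M0') *v w)"
  by (simp add: area_def mat2_vec algebra_simps)
 then have "si * area (M *v w) (M' *v w) = si * area (M0 *v w) (M0' *v w) + si * area ((M - M0) *v w) (M' *v w) + si * area (M0 *v w) ((M' - M0') *v w)"
  by (simp add: distrib_left)
 moreover have "\<bar>si * area ((M - M0) *v w) (M' *v w)\<bar> <= d * b * (norm w)\<^sup>2" "\<bar>si * area (M0 *v w) ((M' - M0') *v w)\<bar> <= b * d * (norm w)\<^sup>2"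
  using bd assms si by (simp_all add: abs_mult)
 moreover have "(c - 2 * b * d) * (norm w)\<^sup>2 = c * (norm w)\<^sup>2 - d * b * (norm w)\<^sup>2 - b * d * (norm w)\<^sup>2"
  by (simp add: algebra_simps)
 ultimately show ?thesis using c by linarith
qed

lemma periodic_int:
 fixes g :: "real => 'b"
 assumes per: "!!th. g (th + 1) = g th"
 shows "g (th + of_int n) = g th"
proof (induction n rule: int_induct[where k = 0])
 case (step1 i)
 then show ?case using per[of "th + of_int i"] by (simp add: add.assoc)
next
 case (step2 i)
 then show ?case using per[of "th + of_int (i - 1)"] by (simp add: add.assoc)
qed simp

lemma periodic_frac:
 fixes g :: "real => 'b"
 assumes "!!th. g (th + 1) = g th"
 shows "g th = g (frac th)" "frac th : {0..1}"
 using periodic_int[of g "frac th" "\<lfloor>th\<rfloor>", OF assms] frac_lt_1[of th] frac_ge_0[of th] by (auto simp: frac_def)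

section \<open>Finite differentiability of the averaged exponent\<close>

lemma jet_lipschitz:
 assumes jets: "jets_on K {s0 - de..s0 + de} b" and bd: "!!l th s. \<bar>s - s0\<bar> <= de ==> \<bar>b i (Suc 0) th s\<bar> <= B"
  and i: "i < K" and s: "\<bar>s - s0\<bar> <= de"
 shows "\<bar>b i 0 th s - b i 0 th s0\<bar> <= B * \<bar>s - s0\<bar>"
proof -
 have "norm (b i 0 th s - b i 0 th s0) <= B * norm (s - s0)"
 proof (rule field_differentiable_bound[of "{s0 - de..s0 + de}" "%s. b i 0 th s" "%s. b i (Suc 0) th s"])
  fix z assume z: "z : {s0 - de..s0 + de}"
  show "((%s. b i 0 th s) has_field_derivative b i (Suc 0) th z) (at z within {s0 - de..s0 + de})"
  using jets_onD(3)[OF jets z, of i 0] i by simp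
  show "norm (b i (Suc 0) th z) <= B" using bd[of z th] z by (simp add: abs_le_iff)
 qed (use s in \<open>auto simp: abs_le_iff\<close>)
 then show ?thesis by simp
qed

text \<open>Monotonicity is given for each \<open>s\<close> with its own constant. Uniformity near \<open>s0\<close> comes from the bounds on the mixed derivatives, which make the areas Lipschitz in \<open>s\<close>.\<close>

lemma monotone_strip:
 fixes a :: "'x => 2 => 2 => nat => nat => real => real => real"
 assumes jets: "!!x p q. jets_on K {s0 - de..s0 + de} (a x p q)" and K: "2 <= K" and de: "0 < de" and B: "1 <= B"
  and bd: "!!x p q i l th s. i + l <= 2 ==> \<bar>s - s0\<bar> <= de ==> \<bar>a x p q i l th s\<bar> <= B"
  and det: "!!x th. det ((\<chi> p q. a x p q 0 0 th s0) :: real^2^2) = 1"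
  and mono: "monotonic_family (%th x. (\<chi> p q. a x p q 0 0 th s0) :: real^2^2)"
 shows "EX si c rh. \<bar>si\<bar> = 1 & 0 < c & c <= 1 & 0 < rh & rh <= de & rh <= 1 / 8 & (ALL x th s w. \<bar>s - s0\<bar> <= rh \<longrightarrow>
  c * (norm w)\<^sup>2 <= si * area ((\<chi> p q. a x p q 0 0 th s) *v w) ((\<chi> p q. a x p q 1 0 th s) *v w))"
proof -
 let ?A = "%i th s x. (\<chi> p q. a x p q i 0 th s) :: real^2^2"
 have nA: "norm (?A i th s x) <= 2 * B" if "i <= 1" "\<bar>s - s0\<bar> <= de" for i th s x
  by (rule norm_mat_le) (use bd[of i 0 s] that in simp)
 have "EX si c. \<bar>si\<bar> = 1 & 0 < c & c <= 1 & (ALL th x w. c * (norm w)\<^sup>2 <= si * area (?A 0 th s0 x *v w) (?A 1 th s0 x *v w))"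
 proof (rule monotonic_family_area[OF mono _ det])
  show "((%t. ?A 0 t s0 x $ p $ q) has_real_derivative ?A 1 th s0 x $ p $ q) (at th)" for th x p q
  using jets_onD(2)[OF jets, of s0 0 0 x p q th] K de by simp
  show "norm (?A 0 th s0 x) <= 2 * B" for th x by (rule nA) (use de in auto)
 qed (use B in simp)
 then obtain si c where c: "\<bar>si\<bar> = 1" "0 < c" "c <= 1" "!!th x w. c * (norm w)\<^sup>2 <= si * area (?A 0 th s0 x *v w) (?A 1 th s0 x *v w)" by blast
 define rh where "rh = min (min de (1 / 8)) (c / (16 * B\<^sup>2))"
 have B2: "0 < B\<^sup>2" using B by simp
 have rh: "0 < rh" "rh <= de" "rh <= 1 / 8" "8 * B\<^sup>2 * rh <= c / 2"
 proof -
  have "rh <= c / (16 * B\<^sup>2)" by (simp add: rh_def)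
  then have "rh * (16 * B\<^sup>2) <= c" using B2 by (simp add: le_divide_eq)
  then show "8 * B\<^sup>2 * rh <= c / 2" by (simp add: mult_ac)
 qed (use de c B2 in \<open>auto simp: rh_def\<close>)
 have "c / 2 * (norm w)\<^sup>2 <= si * area (?A 0 th s x *v w) (?A 1 th s x *v w)" if s: "\<bar>s - s0\<bar> <= rh" for x th s w
 proof -
  have s\<delta>: "\<bar>s - s0\<bar> <= de" "\<bar>s0 - s0\<bar> <= de" using s rh de by simp_all
  have df: "norm (?A i th s x - ?A i th s0 x) <= 2 * (B * rh)" if i: "i <= 1" for i
  proof (rule norm_mat_le)
  fix p q
  have "\<bar>a x p q i 0 th s - a x p q i 0 th s0\<bar> <= B * \<bar>s - s0\<bar>"
  by (rule jet_lipschitz[OF jets]) (use bd[of i 1] i K s\<delta> in auto)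
  also have "... <= B * rh" using s B by (intro mult_left_mono) auto
  finally show "norm ((?A i th s x - ?A i th s0 x) $ p $ q) <= B * rh" by simp
  qed
  have "(c - 2 * (2 * B) * (2 * (B * rh))) * (norm w)\<^sup>2 <= si * area (?A 0 th s x *v w) (?A 1 th s x *v w)"
  by (rule area_perturbation[OF nA[OF _ s\<delta>(1)] nA[OF _ s\<delta>(2)] nA[OF _ s\<delta>(1)] nA[OF _ s\<delta>(2)] df df c(1) c(4)]) simp_all
  moreover have "c / 2 <= c - 2 * (2 * B) * (2 * (B * rh))" using rh(4) by (simp add: power2_eq_square)
  then have "c / 2 * (norm w)\<^sup>2 <= (c - 2 * (2 * B) * (2 * (B * rh))) * (norm w)\<^sup>2" by (rule mult_right_mono) simp
  ultimately show ?thesis by linarith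
 qed
 then show ?thesis using c rh by (intro exI[of _ si] exI[of _ "c / 2"] exI[of _ rh]) auto
qed

lemma iter_deriv_bounds_periodic:
 fixes F :: "'x => real \<times> real => real^2^2"
 assumes I: "open I" "s0 : I" and per: "!!th s x. s : I ==> F x (th + 1, s) = F x (th, s)"
 obtains de where "0 < de" "{s0 - de..s0 + de} <= I" "compact ({0..1} \<times> {s0 - de..s0 + de} :: (real \<times> real) set)"
  "!!n x bs th s m. C_nat_on n (UNIV \<times> I) (F x) ==> bs : lists Basis ==> length bs <= n ==> \<bar>s - s0\<bar> <= de ==>
  (!!z. z : {0..1} \<times> {s0 - de..s0 + de} ==> norm (iter_deriv bs (F x) z) <= m) ==> norm (iter_deriv bs (F x) (th, s)) <= m"
proof -
 obtain de where de: "0 < de" "cball s0 de <= I" using I open_contains_cball by blast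
 have cb: "cball s0 de = {s0 - de..s0 + de}" by (auto simp: dist_real_def)
 show ?thesis
 proof (rule that[OF de(1)])
  show "{s0 - de..s0 + de} <= I" using de cb by simp
  show "compact ({0..1} \<times> {s0 - de..s0 + de} :: (real \<times> real) set)" by (intro compact_Times) auto
  fix n x bs th s m
  assume h: "C_nat_on n (UNIV \<times> I) (F x)" "bs : lists Basis" "length bs <= n" "\<bar>s - s0\<bar> <= de"
  "!!z. z : {0..1} \<times> {s0 - de..s0 + de} ==> norm (iter_deriv bs (F x) z) <= m"
  have s: "s : {s0 - de..s0 + de}" using h(4) by (auto simp: abs_le_iff)
  then have sI: "s : I" using de cb by blast
  have "iter_deriv bs (F x) (th + 1, s) = iter_deriv bs (F x) (th, s)" for th
  by (rule iter_deriv_periodic[OF h(1) I(1) per h(2,3) sI])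
  from periodic_frac[of "%th. iter_deriv bs (F x) (th, s)", OF this]
  show "norm (iter_deriv bs (F x) (th, s)) <= m" using h(5)[of "(frac th, s)"] s by (metis SigmaI)
 qed
qed

lemma (in mpt) mean_exponent_C_nat_family:
 fixes A :: "real => real => 'x => real^2^2"
 assumes I: "open I" and cont: "!!th s. s : I ==> continuous_on UNIV (A th s)"
  and det: "!!th s x. s : I ==> det (A th s x) = 1"
  and per: "!!th s x. s : I ==> A (th + 1) s x = A th s x"
  and mono: "!!s. s : I ==> monotonic_family (%th. A th s)"
  and C: "!!x. C_nat_on K (UNIV \<times> I) (%(th, s). A th s x)"
  and bd: "!!bs V. bs : lists Basis ==> length bs <= K ==> compact V ==> V <= UNIV \<times> I ==>
  EX M. ALL x. ALL z:V. norm (iter_deriv bs (%(th, s). A th s x) z) <= M"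
  and K: "K = r + 2"
 shows "C_nat_on r I (%s. LINT th:{0..1}|lborel. lyapunov f \<mu> (A th s))"
proof (rule C_nat_on_local)
 note Kr = K
 fix s0 assume s0: "s0 : I"
 define F where "F x = (%(th, s). A th s x)" for x
 define a where "a x p q i l th s = iter_deriv (word i l) (F x) (th, s) $ p $ q" for x p q i l th s
 have CF: "C_nat_on K (UNIV \<times> I) (F x)" for x using C by (simp add: F_def)
 have perF: "F x (th + 1, s) = F x (th, s)" if "s : I" for x th s using per[OF that] by (simp add: F_def)
 have a0: "(\<chi> p q. a x p q 0 0 th s) = A th s x" for x th s by (simp add: a_def F_def vec_eq_iff)
 show "EX J. open J & s0 : J & C_nat_on r J (%s. LINT th:{0..1}|lborel. lyapunov f \<mu> (A th s))"
 proof (rule iter_deriv_bounds_periodic[OF I s0 perF])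
  fix de assume de: "0 < de" "{s0 - de..s0 + de} <= I" "compact ({0..1} \<times> {s0 - de..s0 + de} :: (real \<times> real) set)"
  and ext: "!!n x bs th s m. C_nat_on n (UNIV \<times> I) (F x) ==> bs : lists Basis ==> length bs <= n ==> \<bar>s - s0\<bar> <= de ==>
  (!!z. z : {0..1} \<times> {s0 - de..s0 + de} ==> norm (iter_deriv bs (F x) z) <= m) ==> norm (iter_deriv bs (F x) (th, s)) <= m"
  have "EX M. ALL x. ALL z:{0..1} \<times> {s0 - de..s0 + de}. norm (iter_deriv (word i l) (F x) z) <= M" if "i + l <= K" for i l
  unfolding F_def by (rule bd) (use that de in auto)
  then obtain M where M: "!!i l x z. i + l <= K ==> z : {0..1} \<times> {s0 - de..s0 + de} ==> norm (iter_deriv (word i l) (F x) z) <= M i l" by metis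
  define B where "B = 1 + (\<Sum>i\<le>K. \<Sum>l\<le>K. \<bar>M i l\<bar>)"
  have B: "1 <= B" unfolding B_def by (simp add: sum_nonneg)
  have MB: "M i l <= B" if "i + l <= K" for i l
  proof -
  have "\<bar>M i l\<bar> <= (\<Sum>l\<le>K. \<bar>M i l\<bar>)" using that by (intro member_le_sum) auto
  also have "... <= (\<Sum>i\<le>K. \<Sum>l\<le>K. \<bar>M i l\<bar>)" using that by (intro member_le_sum[where f = "%i. \<Sum>l\<le>K. \<bar>M i l\<bar>"]) (auto intro: sum_nonneg)
  finally show ?thesis by (simp add: B_def)
  qed
  have aB: "\<bar>a x p q i l th s\<bar> <= B" if "i + l <= K" "\<bar>s - s0\<bar> <= de" for x p q i l th s
  proof -
  have "norm (iter_deriv (word i l) (F x) (th, s)) <= B"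
  by (rule ext[OF CF _ _ that(2)]) (use M[OF that(1)] MB[OF that(1)] that(1) in \<open>auto intro: order_trans\<close>)
  then show ?thesis using entry_le_norm[of "iter_deriv (word i l) (F x) (th, s)" p q] by (simp add: a_def)
  qed
  have jets: "jets_on K {s0 - de..s0 + de} (a x p q)" for x p q
  unfolding a_def[abs_def] by (rule jets_of_C_nat_on[OF CF I perF de(2)])
  have "monotonic_family (%th x. (\<chi> p q. a x p q 0 0 th s0) :: real^2^2)" unfolding a0 by (rule mono[OF s0])
  from monotone_strip[OF jets _ de(1) B aB _ this]
  obtain si c rh where rh: "\<bar>si\<bar> = 1" "0 < c" "c <= 1" "0 < rh" "rh <= de" "rh <= 1 / 8"
  and mn: "!!x th s w. \<bar>s - s0\<bar> <= rh ==> c * (norm w)\<^sup>2 <= si * area ((\<chi> p q. a x p q 0 0 th s) *v w) ((\<chi> p q. a x p q 1 0 th s) *v w)"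
  using K a0 det[OF s0] by auto
  have sI: "s : I" "\<bar>s - s0\<bar> <= de" if "\<bar>s - s0\<bar> <= rh" for s
  proof -
  show 1: "\<bar>s - s0\<bar> <= de" using that rh by simp
  then have "s : {s0 - de..s0 + de}" by (auto simp: abs_le_iff)
  then show "s : I" using de(2) by blast
  qed
  have oU: "open (UNIV \<times> I :: (real \<times> real) set)" using I by (intro open_Times) auto
  have entry: "bounded_linear (%M :: real^2^2. M $ p $ q)" for p q
  using bounded_linear_compose[OF bounded_linear_vec_nth bounded_linear_vec_nth] .
  have "{s0 - rh..s0 + rh} <= {s0 - de..s0 + de}" using rh by auto
  then have jets': "jets_on K {s0 - rh..s0 + rh} (a x p q)" for x p q
  unfolding a_def[abs_def] using de(2) by (intro jets_of_C_nat_on[OF CF I perF]) auto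
  have K1: "1 <= K" "2 <= K" and B0: "0 <= B" using K B by simp_all
  show ?thesis
  proof (rule exists_periodic_coordinate[of K])
  fix ta :: "complex => complex" and C\<tau> :: real
  assume t: "ta holomorphic_on UNIV" "!!z. ta (z + 1) = ta z" "!!x. Im (ta (of_real x)) = 0"
  "C\<tau> > 0" "!!z. norm z <= 1 ==> norm (ta z - z) <= C\<tau> * norm z ^ K"
  show ?thesis
  proof (rule smooth_approximates_jet[OF t(2,5,4) K1(1) B0 rh(4,6)])
  fix CC cc :: real assume c1: "CC > 0" "0 < cc" "cc <= 1/2" and ap:
  "!!N s0 b th s z w. real N * rh \<ge> 2 ==> jets_on K {s0 - rh..s0 + rh} b ==>
  (!!i l th s. i + l <= K ==> s : {s0 - rh..s0 + rh} ==> \<bar>b i l th s\<bar> <= B) ==>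
  \<bar>s - s0\<bar> <= rh / 2 ==> norm (z - of_real th) <= cc / real N ==> norm (w - of_real s) <= cc / real N ==>
  norm (smooth ta K N s0 rh b z w - tpoly K (%i l. b i l th s) (z - of_real th) (w - of_real s)) <= CC / real N ^ K
  & (\<Sum>n\<in>{0..<int N}. ker K N (z - of_real (of_int n / real N))) ~= 0
  & (\<Sum>m\<in>cells N rh. ker K N (w - of_real (s0 + of_int m / real N))) ~= 0
  & (ALL n. 1 / of_nat N ^ 2 + sin (of_real pi * (z - of_real (of_int n / real N))) ^ 2 ~= (0::complex))
  & (ALL m. 1 / of_nat N ^ 2 + sin (of_real pi * (w - of_real (s0 + of_int m / real N))) ^ 2 ~= (0::complex))"
  interpret smooth_family f \<mu> a K B c si rh s0 CC cc ta
  proof (rule smooth_family.intro[OF mpt_axioms], rule smooth_family_axioms.intro, goal_cases)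
  case (14 x p q i l th s) then show ?case using aB sI(2) by blast
  next
  case (15 p q i l th s)
  have "(%x. iter_deriv (word i l) (F x) (th, s)) : borel_measurable \<mu>"
  proof (rule iter_deriv_measurable[OF CF oU])
  show "(%x. F x z) : borel_measurable \<mu>" if "z : UNIV \<times> I" for z
  using that meas_cont[OF cont] by (auto simp: F_def)
  qed (use 15 sI(1) in auto)
  then show ?case unfolding a_def by (rule measurable_compose[OF _ borel_measurable_continuous_onI[OF linear_continuous_on[OF entry]]])
  next
  case (16 th s p q)
  then show ?case unfolding a_def
  using bounded_linear.continuous_on[OF entry cont[OF sI(1)]] by (simp add: F_def)
  next
  case (17 x s p q)
  have "s : {s0 - rh..s0 + rh}" using 17 by (auto simp: abs_le_iff)
  then have "isCont (%th. a x p q 0 0 th s) y" for y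
  by (intro DERIV_isCont[OF jets_onD(2)[OF jets']]) (use K1 in simp_all)
  then show ?case by (intro continuous_at_imp_continuous_on ballI)
  next
  case (18 x th s) then show ?case unfolding a0 using det sI by blast
  next
  case (19 x th s w) then show ?case using mn by blast
  next
  case (20 N x p q th s z w)
  have "\<bar>a x p q i l th s\<bar> <= B" if "i + l <= K" "s : {s0 - rh..s0 + rh}" for i l th s
  using that aB[OF that(1) sI(2)] by (auto simp: abs_le_iff)
  from ap[OF 20(1) jets' this 20(2-4)] show ?case .
  qed (use c1 K1 B rh t in auto)
  have "C_nat_on r {s0 - rh / 4<..<s0 + rh / 4} (%s. LINT th:{0..1}|lborel. lyapunov f \<mu> (A th s))"
  using mean_exponent_C_nat[OF Kr] unfolding MA_def a0 .
  then show ?thesis using rh by (intro exI[of _ "{s0 - rh / 4<..<s0 + rh / 4}"]) auto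
  qed
  qed
 qed
qed

section \<open>Power series in two variables\<close>

text \<open>Homogeneous part of degree \<open>m\<close>. Ordering by degree turns the double series into a sequence to which termwise differentiation applies.\<close>

definition hterm :: "(nat => nat => 'b::banach) => nat => real \<times> real => 'b" where
 "hterm c m z = (\<Sum>i\<le>m. (fst z ^ i * snd z ^ (m - i)) *\<^sub>R c i (m - i))"

definition hs :: "(nat => nat => 'b::banach) => real \<times> real => 'b" where
 "hs c z = (\<Sum>m. hterm c m z)"

definition cb :: "real => real => (nat => nat => 'b::banach) => bool" where
 "cb M q c \<longleftrightarrow> (ALL i j. norm (c i j) <= M * q ^ (i + j))"

definition d1 :: "(nat => nat => 'b::banach) => nat => nat => 'b" where
 "d1 c i j = real (Suc i) *\<^sub>R c (Suc i) j"

definition d2 :: "(nat => nat => 'b::banach) => nat => nat => 'b" where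
 "d2 c i j = real (Suc j) *\<^sub>R c i (Suc j)"

lemma Suc_le_two_power: "real (Suc m) <= 2 ^ m"
 by (induction m) auto

lemma hterm_bound:
 assumes cb: "cb M q c" and z: "\<bar>fst z\<bar> <= d" "\<bar>snd z\<bar> <= d" and q: "0 <= q" "0 <= M" "4 * q * d <= 1"
 shows "norm (hterm c m z) <= M * (1 / 2) ^ m"
proof -
 have d: "0 <= d" using z by linarith
 have "norm (hterm c m z) <= (\<Sum>i\<le>m. M * (q * d) ^ m)"
  unfolding hterm_def
 proof (rule order_trans[OF norm_sum], rule sum_mono)
  fix i assume "i : {..m}"
  then have im: "i + (m - i) = m" by simp
  have "norm ((fst z ^ i * snd z ^ (m - i)) *\<^sub>R c i (m - i)) = (\<bar>fst z\<bar> ^ i * \<bar>snd z\<bar> ^ (m - i)) * norm (c i (m - i))"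
  by (simp add: abs_mult power_abs)
  also have "... <= (d ^ i * d ^ (m - i)) * (M * q ^ (i + (m - i)))"
  using z cb d unfolding cb_def by (intro mult_mono power_mono) auto
  also have "... = M * (q * d) ^ m" unfolding power_add[symmetric] im by (simp add: power_mult_distrib)
  finally show "norm ((fst z ^ i * snd z ^ (m - i)) *\<^sub>R c i (m - i)) <= M * (q * d) ^ m" .
 qed
 also have "... = real (Suc m) * (M * (q * d) ^ m)" by simp
 also have "... <= 2 ^ m * (M * (1 / 4) ^ m)"
  using q d Suc_le_two_power[of m] by (intro mult_mono power_mono) (auto simp: mult_ac)
 also have "... = M * (2 * (1 / 4)) ^ m" by (simp only: power_mult_distrib mult_ac)
 finally show ?thesis by simp
qed

lemma hs_tail:
 assumes cb: "cb M q c" and z: "\<bar>fst z\<bar> <= d" "\<bar>snd z\<bar> <= d" and q: "0 <= q" "0 <= M" "4 * q * d <= 1"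
 shows "summable (%m. hterm c m z)" and "norm ((\<Sum>m<n. hterm c m z) - hs c z) <= 2 * M * (1 / 2) ^ n"
proof -
 have g: "summable (%m. M * (1 / 2 :: real) ^ m)" by (intro summable_mult summable_geometric) simp
 show s: "summable (%m. hterm c m z)"
  by (rule summable_comparison_test'[OF g, of 0]) (rule hterm_bound[OF assms])
 have sn: "(%m. M * (1 / 2) ^ n * (1 / 2 :: real) ^ m) sums (M * (1 / 2) ^ n * 2)"
  using sums_mult[OF geometric_sums[of "1 / 2 :: real"], of "M * (1 / 2) ^ n"] by simp
 have b: "norm (hterm c (m + n) z) <= M * (1 / 2) ^ n * (1 / 2) ^ m" for m
  using hterm_bound[OF assms, of "m + n"] by (simp add: power_add mult_ac)
 have sm: "summable (%m. norm (hterm c (m + n) z))"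
  by (rule summable_comparison_test'[OF sums_summable[OF sn], of 0]) (use b in simp)
 have "hs c z = (\<Sum>m. hterm c (m + n) z) + (\<Sum>m<n. hterm c m z)"
  unfolding hs_def by (rule suminf_split_initial_segment[OF s])
 then have "norm ((\<Sum>m<n. hterm c m z) - hs c z) = norm (\<Sum>m. hterm c (m + n) z)" by simp
 also have "... <= (\<Sum>m. norm (hterm c (m + n) z))" by (rule summable_norm[OF sm])
 also have "... <= (\<Sum>m. M * (1 / 2) ^ n * (1 / 2) ^ m)" by (rule suminf_le[OF b sm sums_summable[OF sn]])
 also have "... = 2 * M * (1 / 2) ^ n" using sums_unique[OF sn] by (simp add: mult_ac)
 finally show "norm ((\<Sum>m<n. hterm c m z) - hs c z) <= 2 * M * (1 / 2) ^ n" .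
qed

lemma hterm_has_derivative:
 "(hterm c (Suc m) has_derivative (%v. fst v *\<^sub>R hterm (d1 c) m z + snd v *\<^sub>R hterm (d2 c) m z)) (at z within S)"
proof -
 have D: "(hterm c (Suc m) has_derivative (%v. \<Sum>i\<le>Suc m. ((real i * fst v * fst z ^ (i - 1)) * snd z ^ (Suc m - i) + fst z ^ i * (real (Suc m - i) * snd v * snd z ^ (Suc m - i - 1))) *\<^sub>R c i (Suc m - i))) (at z within S)"
  unfolding hterm_def[abs_def]
  by (intro has_derivative_sum) (auto intro!: derivative_eq_intros simp: mult_ac add.commute)
 have "(\<Sum>i\<le>Suc m. ((real i * a * fst z ^ (i - 1)) * snd z ^ (Suc m - i) + fst z ^ i * (real (Suc m - i) * b * snd z ^ (Suc m - i - 1))) *\<^sub>R c i (Suc m - i))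
  = a *\<^sub>R hterm (d1 c) m z + b *\<^sub>R hterm (d2 c) m z" for a b
 proof -
  have "(\<Sum>i\<le>Suc m. (real i * a * fst z ^ (i - 1) * snd z ^ (Suc m - i)) *\<^sub>R c i (Suc m - i)) = a *\<^sub>R hterm (d1 c) m z"
  unfolding sum.atMost_Suc_shift by (simp add: hterm_def d1_def scaleR_sum_right mult_ac)
  moreover have "(\<Sum>i\<le>Suc m. (fst z ^ i * (real (Suc m - i) * b * snd z ^ (Suc m - i - 1))) *\<^sub>R c i (Suc m - i)) = b *\<^sub>R hterm (d2 c) m z"
  proof -
  have "(\<Sum>i\<le>m. (fst z ^ i * (real (Suc m - i) * b * snd z ^ (Suc m - i - 1))) *\<^sub>R c i (Suc m - i)) = (\<Sum>i\<le>m. b *\<^sub>R ((fst z ^ i * snd z ^ (m - i)) *\<^sub>R d2 c i (m - i)))"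
  by (rule sum.cong) (auto simp: Suc_diff_le d2_def mult_ac)
  then show ?thesis by (simp add: hterm_def scaleR_sum_right)
  qed
  ultimately show ?thesis by (simp only: scaleR_left_distrib sum.distrib)
 qed
 then show ?thesis using D by simp
qed

lemma hs_has_derivative:
 assumes c: "cb M q c" "cb M1 q (d1 c)" "cb M1 q (d2 c)" and q: "0 <= q" "0 <= M" "0 <= M1" "4 * q * d <= 1"
  and z: "\<bar>fst z\<bar> < d" "\<bar>snd z\<bar> < d"
 shows "(hs c has_derivative (%v. fst v *\<^sub>R hs (d1 c) z + snd v *\<^sub>R hs (d2 c) z)) (at z)"
proof -
 define S where "S = {- d<..<d} \<times> {- d<..<d}"
 have S: "\<bar>fst z\<bar> <= d" "\<bar>snd z\<bar> <= d" if "z : S" for z using that by (auto simp: S_def)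
 have zS: "z : S" using z by (cases z) (auto simp: S_def)
 have oS: "open S" unfolding S_def by (intro open_Times) auto
 have "EX g. ALL x:S. (%n. hterm c (Suc n) x) sums (g x) & (g has_derivative (%v. fst v *\<^sub>R hs (d1 c) x + snd v *\<^sub>R hs (d2 c) x)) (at x within S)"
 proof (rule has_derivative_series[where f' = "%n x v. fst v *\<^sub>R hterm (d1 c) n x + snd v *\<^sub>R hterm (d2 c) n x"])
  show "convex S" unfolding S_def by (intro convex_Times) auto
  show "(%n. hterm c (Suc n) z) sums suminf (%n. hterm c (Suc n) z)"
  using hs_tail(1)[OF c(1) S[OF zS] q(1,2,4)] by (intro summable_sums) (rule iffD2[OF summable_Suc_iff])
  fix e :: real assume e: "e > 0"
  have "(%n. 4 * M1 * (1 / 2 :: real) ^ n) \<longlonglongrightarrow> 4 * M1 * 0" by (intro tendsto_mult tendsto_const LIMSEQ_power_zero) simp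
  then have "\<forall>\<^sub>F n in sequentially. 4 * M1 * (1 / 2) ^ n < e" using e by (intro order_tendstoD(2)) auto
  then show "\<forall>\<^sub>F n in sequentially. ALL x:S. ALL h. norm ((\<Sum>i<n. fst h *\<^sub>R hterm (d1 c) i x + snd h *\<^sub>R hterm (d2 c) i x) - (fst h *\<^sub>R hs (d1 c) x + snd h *\<^sub>R hs (d2 c) x)) <= e * norm h"
  proof (rule eventually_mono, intro ballI allI)
  fix n x and h :: "real \<times> real" assume n: "4 * M1 * (1 / 2) ^ n < e" and x: "x : S"
  let ?t = "2 * M1 * (1 / 2) ^ n :: real"
  have t: "norm ((\<Sum>i<n. hterm (d1 c) i x) - hs (d1 c) x) <= ?t" "norm ((\<Sum>i<n. hterm (d2 c) i x) - hs (d2 c) x) <= ?t"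
  using hs_tail(2)[OF c(2) S[OF x] q(1,3,4)] hs_tail(2)[OF c(3) S[OF x] q(1,3,4)] by auto
  have hh: "\<bar>fst h\<bar> <= norm h" "\<bar>snd h\<bar> <= norm h"
  using norm_fst_le[of "fst h" "snd h"] norm_snd_le[of "snd h" "fst h"] by simp_all
  have eq: "(\<Sum>i<n. fst h *\<^sub>R hterm (d1 c) i x + snd h *\<^sub>R hterm (d2 c) i x) - (fst h *\<^sub>R hs (d1 c) x + snd h *\<^sub>R hs (d2 c) x)
  = fst h *\<^sub>R ((\<Sum>i<n. hterm (d1 c) i x) - hs (d1 c) x) + snd h *\<^sub>R ((\<Sum>i<n. hterm (d2 c) i x) - hs (d2 c) x)"
  by (simp add: sum.distrib scaleR_sum_right scaleR_diff_right)
  have "norm (fst h *\<^sub>R ((\<Sum>i<n. hterm (d1 c) i x) - hs (d1 c) x) + snd h *\<^sub>R ((\<Sum>i<n. hterm (d2 c) i x) - hs (d2 c) x)) <= norm h * ?t + norm h * ?t"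
  proof (rule order_trans[OF norm_triangle_ineq add_mono])
  show "norm (fst h *\<^sub>R ((\<Sum>i<n. hterm (d1 c) i x) - hs (d1 c) x)) <= norm h * ?t"
  unfolding norm_scaleR by (rule mult_mono[OF hh(1) t(1) norm_ge_zero norm_ge_zero])
  show "norm (snd h *\<^sub>R ((\<Sum>i<n. hterm (d2 c) i x) - hs (d2 c) x)) <= norm h * ?t"
  unfolding norm_scaleR by (rule mult_mono[OF hh(2) t(2) norm_ge_zero norm_ge_zero])
  qed
  also have "... = 4 * M1 * (1 / 2) ^ n * norm h" by simp
  also have "... <= e * norm h" using n by (intro mult_right_mono) auto
  finally show "norm ((\<Sum>i<n. fst h *\<^sub>R hterm (d1 c) i x + snd h *\<^sub>R hterm (d2 c) i x) - (fst h *\<^sub>R hs (d1 c) x + snd h *\<^sub>R hs (d2 c) x)) <= e * norm h" unfolding eq .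
  qed
 qed (use zS hterm_has_derivative in auto)
 then obtain g where g: "!!x. x : S ==> (%n. hterm c (Suc n) x) sums (g x)"
  "!!x. x : S ==> (g has_derivative (%v. fst v *\<^sub>R hs (d1 c) x + snd v *\<^sub>R hs (d2 c) x)) (at x within S)" by blast
 have h: "hs c x = g x + c 0 0" if "x : S" for x
 proof -
  have "hs c x = (\<Sum>n. hterm c (Suc n) x) + hterm c 0 x"
  unfolding hs_def using suminf_split_head[OF hs_tail(1)[OF c(1) S[OF that] q(1,2,4)]] by simp
  then show ?thesis using sums_unique[OF g(1)[OF that]] by (simp add: hterm_def)
 qed
 have "((%x. g x + c 0 0) has_derivative (%v. fst v *\<^sub>R hs (d1 c) z + snd v *\<^sub>R hs (d2 c) z)) (at z)"
  using has_derivative_add[OF g(2)[OF zS] has_derivative_const[of "c 0 0"]] unfolding at_within_open[OF zS oS] by simp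
 then show ?thesis
  by (rule has_derivative_transform_within_open[OF _ oS zS]) (simp add: h)
qed

text \<open>The coefficients of the derivative of order \<open>a\<close> in the first and \<open>b\<close> in the second variable. The closed form keeps one radius of convergence for all orders, at the
price of replacing \<open>q\<close> by \<open>2 q\<close> once.\<close>

definition cd :: "nat => nat => (nat => nat => 'b::banach) => nat => nat => 'b" where
 "cd a b c i j = (fact (i + a) / fact i * (fact (j + b) / fact j)) *\<^sub>R c (i + a) (j + b)"

lemma d1_cd: "d1 (cd a b c) = cd (Suc a) b c" and d2_cd: "d2 (cd a b c) = cd a (Suc b) c"
proof -
 have aux: "real (Suc i) * (X / fact (Suc i) * Y) = X / fact i * Y" "real (Suc i) * (Y * (X / fact (Suc i))) = Y * (X / fact i)" for i X Y
  unfolding fact_Suc by (simp_all add: field_simps del: of_nat_Suc)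
 show "d1 (cd a b c) = cd (Suc a) b c"
  by (intro ext) (simp only: d1_def cd_def scaleR_scaleR aux add_Suc add_Suc_right)
 show "d2 (cd a b c) = cd a (Suc b) c"
  by (intro ext) (simp only: d2_def cd_def scaleR_scaleR aux add_Suc add_Suc_right)
qed

lemma fact_ratio: "fact (i + a) / fact i <= (2 ^ (i + a) * fact a :: real)"
proof -
 have "(i + a) choose a <= (\<Sum>k\<le>i + a. (i + a) choose k)" by (rule member_le_sum) auto
 then have "real ((i + a) choose a) <= 2 ^ (i + a)" unfolding choose_row_sum by (metis of_nat_le_iff of_nat_numeral of_nat_power)
 moreover have "real ((i + a) choose a) = fact (i + a) / (fact a * fact i)" by (subst binomial_fact) auto
 ultimately have "fact (i + a) / (fact a * fact i) <= (2 ^ (i + a) :: real)" by simp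
 then show ?thesis by (simp add: divide_le_eq mult_ac)
qed

lemma cb_cd:
 assumes "cb M q c" and q: "0 <= q" "0 <= M"
 shows "cb (M * (2 * q) ^ (a + b) * (fact a * fact b)) (2 * q) (cd a b c)"
 unfolding cb_def
proof (intro allI)
 fix i j
 have "norm (cd a b c i j) = (fact (i + a) / fact i) * (fact (j + b) / fact j) * norm (c (i + a) (j + b))"
  by (simp add: cd_def abs_mult)
 also have "... <= (2 ^ (i + a) * fact a) * (2 ^ (j + b) * fact b) * (M * q ^ (i + a + (j + b)))"
  using assms fact_ratio[of i a] fact_ratio[of j b] unfolding cb_def by (intro mult_mono) auto
 also have "... = M * (2 * q) ^ (a + b) * (fact a * fact b) * (2 * q) ^ (i + j)"
  by (simp add: power_add power_mult_distrib mult_ac)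
 finally show "norm (cd a b c i j) <= M * (2 * q) ^ (a + b) * (fact a * fact b) * (2 * q) ^ (i + j)" .
qed

lemma Basis2_eq: "(Basis :: (real \<times> real) set) = {(1, 0), (0, 1)}"
 by (auto simp: Basis_prod_def)

definition nx :: "(real \<times> real) list => nat" where "nx bs = length (filter (%b. b = (1, 0)) bs)"
definition ny :: "(real \<times> real) list => nat" where "ny bs = length (filter (%b. b ~= (1, 0)) bs)"

lemma nx_ny: "nx bs + ny bs = length bs"
 unfolding nx_def ny_def by (rule sum_length_filter_compl)

lemma iter_deriv_hs:
 fixes F :: "real \<times> real => 'b::banach"
 assumes c: "cb M q c" and q: "0 <= q" "0 <= M" "8 * q * d <= 1"
  and F: "!!z. \<bar>fst (z - z0)\<bar> < d ==> \<bar>snd (z - z0)\<bar> < d ==> F z = hs c (z - z0)"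
  and bs: "bs : lists Basis" and z: "\<bar>fst (z - z0)\<bar> < d" "\<bar>snd (z - z0)\<bar> < d"
 shows "iter_deriv bs F z = hs (cd (nx bs) (ny bs) c) (z - z0)"
  and "iter_deriv bs F differentiable (at z)"
  and "norm (iter_deriv bs F z) <= 2 * M * (2 * q) ^ length bs * fact (length bs)"
proof -
 define U where "U = {z. \<bar>fst (z - z0)\<bar> < d & \<bar>snd (z - z0)\<bar> < d}"
 have oU: "open U" unfolding U_def by (intro open_Collect_conj open_Collect_less continuous_intros)
 define MM where "MM a b = M * (2 * q) ^ (a + b) * (fact a * fact b)" for a b
 have MM: "0 <= MM a b" for a b using q by (simp add: MM_def)
 have cbd: "cb (MM a b) (2 * q) (cd a b c)" for a b unfolding MM_def by (rule cb_cd[OF c q(1,2)])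
 have cbm: "cb (max (MM (Suc a) b) (MM a (Suc b))) (2 * q) (cd (Suc a) b c)" "cb (max (MM (Suc a) b) (MM a (Suc b))) (2 * q) (cd a (Suc b) c)" for a b
 proof -
  have "cb N (2 * q) e" if "cb m (2 * q) e" "m <= N" for m N and e :: "nat => nat => 'b"
  unfolding cb_def
  proof (intro allI)
  fix i j
  have "norm (e i j) <= m * (2 * q) ^ (i + j)" using that(1) unfolding cb_def by blast
  also have "... <= N * (2 * q) ^ (i + j)" using that(2) q by (intro mult_right_mono) auto
  finally show "norm (e i j) <= N * (2 * q) ^ (i + j)" .
  qed
  from this[OF cbd max.cobounded1] this[OF cbd max.cobounded2]
  show "cb (max (MM (Suc a) b) (MM a (Suc b))) (2 * q) (cd (Suc a) b c)" "cb (max (MM (Suc a) b) (MM a (Suc b))) (2 * q) (cd a (Suc b) c)" .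
 qed
 have D: "((%z. hs (cd a b c) (z - z0)) has_derivative (%v. fst v *\<^sub>R hs (cd (Suc a) b c) (z - z0) + snd v *\<^sub>R hs (cd a (Suc b) c) (z - z0))) (at z)" if "z : U" for a b z
 proof -
  have "(hs (cd a b c) has_derivative (%v. fst v *\<^sub>R hs (cd (Suc a) b c) (z - z0) + snd v *\<^sub>R hs (cd a (Suc b) c) (z - z0))) (at (z - z0))"
  using hs_has_derivative[OF cbd, of "max (MM (Suc a) b) (MM a (Suc b))" a b d "z - z0"] cbm[of a b] q MM that
  unfolding d1_cd d2_cd U_def by (auto simp: le_max_iff_disj)
  then show ?thesis
  by (rule has_derivative_compose[rotated, where f = "%z. z - z0" and f' = "%v. v", simplified]) (auto intro!: derivative_eq_intros)
 qed
 have it: "ALL z:U. iter_deriv bs F z = hs (cd (nx bs) (ny bs) c) (z - z0)" using bs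
 proof (induction bs)
  case Nil
  have "cd 0 0 c = c" by (simp add: cd_def fun_eq_iff)
  then show ?case using F by (simp add: U_def nx_def ny_def)
 next
  case (Cons b bs)
  show ?case
  proof
  fix z assume z: "z : U"
  have "(iter_deriv bs F has_derivative (%v. fst v *\<^sub>R hs (cd (Suc (nx bs)) (ny bs) c) (z - z0) + snd v *\<^sub>R hs (cd (nx bs) (Suc (ny bs)) c) (z - z0))) (at z)"
  by (rule has_derivative_transform_within_open[OF D[OF z] oU z]) (use Cons in auto)
  from frechet_derivative_at[OF this]
  have "iter_deriv (b # bs) F z = fst b *\<^sub>R hs (cd (Suc (nx bs)) (ny bs) c) (z - z0) + snd b *\<^sub>R hs (cd (nx bs) (Suc (ny bs)) c) (z - z0)"
  unfolding iter_deriv_Cons by metis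
  moreover have "b = (1, 0) \<or> b = (0, 1)"
  proof -
  have "b : Basis" using Cons by blast
  then show ?thesis unfolding Basis2_eq by blast
  qed
  ultimately show "iter_deriv (b # bs) F z = hs (cd (nx (b # bs)) (ny (b # bs)) c) (z - z0)"
  by (auto simp: nx_def ny_def)
  qed
 qed
 have zU: "z : U" using z by (simp add: U_def)
 show e: "iter_deriv bs F z = hs (cd (nx bs) (ny bs) c) (z - z0)" using it zU by blast
 have "(iter_deriv bs F has_derivative (%v. fst v *\<^sub>R hs (cd (Suc (nx bs)) (ny bs) c) (z - z0) + snd v *\<^sub>R hs (cd (nx bs) (Suc (ny bs)) c) (z - z0))) (at z)"
  by (rule has_derivative_transform_within_open[OF D[OF zU] oU zU]) (use it in auto)
 then show "iter_deriv bs F differentiable (at z)" unfolding differentiable_def by blast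
 have "norm (hs (cd (nx bs) (ny bs) c) (z - z0)) <= 2 * MM (nx bs) (ny bs)"
  using hs_tail(2)[OF cbd, of "z - z0" d "nx bs" "ny bs" 0] z q MM by simp
 also have "MM (nx bs) (ny bs) <= M * (2 * q) ^ length bs * fact (length bs)"
 proof -
  have "(fact (nx bs) * fact (ny bs) :: real) <= fact (nx bs + ny bs)"
  using dvd_imp_le[OF fact_fact_dvd_fact[of "nx bs" "ny bs"]] by (metis fact_gt_zero of_nat_fact of_nat_le_iff of_nat_mult)
  then show ?thesis unfolding MM_def nx_ny using q by (intro mult_left_mono) auto
 qed
 finally show "norm (iter_deriv bs F z) <= 2 * M * (2 * q) ^ length bs * fact (length bs)" unfolding e by (simp add: mult.assoc)
qed

lemma has_sum_terms_bounded:
 fixes g :: "'i => 'b::real_normed_vector"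
 assumes "(g has_sum S) A"
 shows "\<exists>M\<ge>0. ALL i:A. norm (g i) <= M"
proof -
 have "\<forall>\<^sub>F X in finite_subsets_at_top A. dist (sum g X) S < 1"
  using assms unfolding has_sum_def tendsto_iff by simp
 then have "EX X. finite X & X <= A & (ALL Y. finite Y & X <= Y & Y <= A --> dist (sum g Y) S < 1)"
  unfolding eventually_finite_subsets_at_top .
 then obtain X where X0: "finite X & X <= A & (ALL Y. finite Y & X <= Y & Y <= A --> dist (sum g Y) S < 1)" ..
 have X: "finite X" "X <= A" "dist (sum g Y) S < 1" if "finite Y" "X <= Y" "Y <= A" for Y using X0 that by simp_all
 note XX = X0[THEN conjunct1] X0[THEN conjunct2, THEN conjunct1]
 have "norm (g i) <= 2 + (\<Sum>j\<in>X. norm (g j))" if "i : A" for i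
 proof (cases "i : X")
  case True
  then have "norm (g i) <= (\<Sum>j\<in>X. norm (g j))" using XX(1) by (intro member_le_sum) auto
  then show ?thesis by simp
 next
  case False
  have "dist (sum g (insert i X)) S < 1" "dist (sum g X) S < 1" using XX that by (intro X(3); auto)+
  then have "dist (sum g (insert i X)) (sum g X) < 2" using dist_triangle2[of "sum g (insert i X)" "sum g X" S] by simp
  moreover have "dist (sum g (insert i X)) (sum g X) = norm (g i)" using False XX(1) by (simp add: dist_norm)
  moreover have "0 <= (\<Sum>j\<in>X. norm (g j))" by (rule sum_nonneg) simp
  ultimately show ?thesis by linarith
 qed
 moreover have "0 <= 2 + (\<Sum>j\<in>X. norm (g j))" using sum_nonneg[of X "%j. norm (g j)"] by simp
 ultimately show ?thesis by blast
qed

text \<open>Unconditional convergence at one diagonal point bounds the coefficients geometrically, and the series may be regrouped by degree.\<close>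

lemma real_analytic_hs:
 fixes F :: "real \<times> real => 'b::banach"
 assumes "real_analytic_on U F" "z0 : U"
 obtains M q d c where "cb M q c" "0 < q" "0 <= M" "0 < d" "8 * q * d <= 1"
  "!!z. \<bar>fst (z - z0)\<bar> < d ==> \<bar>snd (z - z0)\<bar> < d ==> F z = hs c (z - z0)"
proof -
 obtain rh c0 where rh: "rh > 0" and c0: "!!z. z : ball z0 rh ==>
  ((%al. (\<Prod>b\<in>Basis. ((z - z0) \<bullet> b) ^ al b) *\<^sub>R c0 al) has_sum F z) (Basis \<rightarrow>\<^sub>E (UNIV :: nat set))"
  using assms unfolding real_analytic_on_def by meson
 define e :: "nat \<times> nat => real \<times> real => nat" where "e = (%(i, j). \<lambda>b\<in>Basis. if b = (1, 0) then i else j)"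
 define c where "c i j = c0 (e (i, j))" for i j
 have bij: "bij_betw e UNIV (Basis \<rightarrow>\<^sub>E (UNIV :: nat set))"
 proof (rule bij_betw_byWitness[where f' = "%al. (al (1, 0), al (0, 1))"])
  show "ALL al:Basis \<rightarrow>\<^sub>E UNIV. e (al (1, 0), al (0, 1)) = al"
  by (auto simp: e_def fun_eq_iff PiE_def extensional_def Basis2_eq restrict_def)
 qed (auto simp: e_def)
 have pr: "(\<Prod>b\<in>Basis. (y \<bullet> b) ^ e (i, j) b) = fst y ^ i * snd y ^ j" for y :: "real \<times> real" and i j
  by (simp add: Basis2_eq e_def inner_prod_def)
 have two: "((%(i, j). (fst (z - z0) ^ i * snd (z - z0) ^ j) *\<^sub>R c i j) has_sum F z) UNIV" if "z : ball z0 rh" for z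
 proof -
  have "((%p. (\<Prod>b\<in>Basis. ((z - z0) \<bullet> b) ^ e p b) *\<^sub>R c0 (e p)) has_sum F z) UNIV"
  using has_sum_reindex_bij_betw[OF bij, of "%al. (\<Prod>b\<in>Basis. ((z - z0) \<bullet> b) ^ al b) *\<^sub>R c0 al" "F z"] c0[OF that] by simp
  moreover have "(%p. (\<Prod>b\<in>Basis. ((z - z0) \<bullet> b) ^ e p b) *\<^sub>R c0 (e p)) = (%(i, j). (fst (z - z0) ^ i * snd (z - z0) ^ j) *\<^sub>R c i j)"
  proof (intro ext)
  fix p :: "nat \<times> nat"
  show "(\<Prod>b\<in>Basis. ((z - z0) \<bullet> b) ^ e p b) *\<^sub>R c0 (e p) = (case p of (i, j) => (fst (z - z0) ^ i * snd (z - z0) ^ j) *\<^sub>R c i j)"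
  by (cases p) (simp only: case_prod_conv pr c_def)
  qed
  ultimately show ?thesis by simp
 qed
 define r where "r = rh / 2"
 have r: "0 < r" using rh by (simp add: r_def)
 have nz: "z : ball z0 rh" if "\<bar>fst (z - z0)\<bar> < rh / 2" "\<bar>snd (z - z0)\<bar> < rh / 2" for z
 proof -
  have "norm (z - z0) <= norm (fst (z - z0)) + norm (snd (z - z0))" by (metis norm_Pair_le prod.collapse)
  then show ?thesis using that by (simp add: dist_norm norm_minus_commute)
 qed
 define r' where "r' = rh / 4"
 have r': "0 < r'" using rh by (simp add: r'_def)
 have "z0 + (r', r') : ball z0 rh" by (rule nz) (use rh in \<open>auto simp: r'_def\<close>)
 from has_sum_terms_bounded[OF two[OF this]]
 obtain M where M: "M \<ge> 0" "!!i j. norm ((r' ^ i * r' ^ j) *\<^sub>R c i j) <= M" by auto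
 define q where "q = 1 / r'"
 have q: "0 < q" using r' by (simp add: q_def)
 have cb: "cb M q c" unfolding cb_def
 proof (intro allI)
  fix i j
  have "r' ^ (i + j) * norm (c i j) <= M" using M(2)[of i j] r' by (simp add: power_add)
  then show "norm (c i j) <= M * q ^ (i + j)" using r' by (simp add: q_def power_divide le_divide_eq mult.commute)
 qed
 define d where "d = r' / 8"
 have "F z = hs c (z - z0)" if z: "\<bar>fst (z - z0)\<bar> < d" "\<bar>snd (z - z0)\<bar> < d" for z
 proof -
  have zb: "z : ball z0 rh" by (rule nz) (use z rh in \<open>auto simp: d_def r'_def\<close>)
  define g where "g = (%(i, j). (fst (z - z0) ^ i * snd (z - z0) ^ j) *\<^sub>R c i j)"
  have bij: "bij_betw (%(m, i). (i, m - i)) (Sigma UNIV (%m. {..m})) (UNIV :: (nat \<times> nat) set)"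
  by (rule bij_betw_byWitness[where f' = "%(i, j). (i + j, i)"]) auto
  have "((%p. g (case p of (m, i) => (i, m - i))) has_sum F z) (Sigma UNIV (%m. {..m}))"
  using has_sum_reindex_bij_betw[OF bij, of g "F z"] two[OF zb] unfolding g_def by simp
  then have "((%m. hterm c m (z - z0)) has_sum F z) UNIV"
  proof (rule has_sum_SigmaD)
  fix m :: nat
  have "((%i. g (case (m, i) of (m, i) => (i, m - i))) has_sum (\<Sum>i\<le>m. g (case (m, i) of (m, i) => (i, m - i)))) {..m}"
  by (rule has_sum_finite) simp
  then show "((%i. g (case (m, i) of (m, i) => (i, m - i))) has_sum hterm c m (z - z0)) {..m}"
  by (simp add: hterm_def g_def)
  qed
  then have "(%m. hterm c m (z - z0)) sums F z" by (rule has_sum_imp_sums)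
  then show ?thesis unfolding hs_def by (rule sums_unique)
 qed
 moreover have "0 < d" "8 * q * d <= 1" using r' by (simp_all add: d_def q_def)
 ultimately show ?thesis using that[OF cb q M(1)] by blast
qed

lemma real_analytic_C_nat:
 fixes F :: "real \<times> real => 'b::banach"
 assumes F: "real_analytic_on U F"
 shows "C_nat_on n U F"
proof -
 have "iter_deriv bs F differentiable (at z)" if "z : U" "bs : lists Basis" for z bs
 proof (rule real_analytic_hs[OF F that(1)])
  fix M q d and c :: "nat => nat => 'b"
  assume h: "cb M q c" "0 < q" "0 <= M" "0 < d" "8 * q * d <= 1"
  "!!y. \<bar>fst (y - z)\<bar> < d ==> \<bar>snd (y - z)\<bar> < d ==> F y = hs c (y - z)"
  show ?thesis by (rule iter_deriv_hs(2)[OF h(1) less_imp_le[OF h(2)] h(3,5,6) that(2)]) (use h(4) in auto)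
 qed
 then show ?thesis unfolding C_nat_on_def
  by (intro conjI ballI impI continuous_at_imp_continuous_on differentiable_imp_continuous_within)
qed

lemma real_analytic_factorial_bounds:
 fixes F :: "real \<times> real => 'b::banach"
 assumes F: "real_analytic_on U F" and C: "compact C" "C <= U"
 shows "EX M R. 0 <= M & 1 <= R & (ALL bs:lists Basis. ALL z:C. norm (iter_deriv bs F z) <= M * R ^ length bs * fact (length bs))"
proof -
 define P where "P V M R \<longleftrightarrow> 0 <= M & 1 <= R & (ALL bs:lists Basis. ALL z:V. norm (iter_deriv bs F z) <= M * R ^ length bs * fact (length bs))"
  for V :: "(real \<times> real) set" and M R :: real
 have loc: "EX V. open V & z0 : V & (EX M R. P V M R)" if z0: "z0 : U" for z0
 proof (rule real_analytic_hs[OF F z0])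
  fix M q d and c :: "nat => nat => 'b"
  assume h: "cb M q c" "0 < q" "0 <= M" "0 < d" "8 * q * d <= 1"
  "!!y. \<bar>fst (y - z0)\<bar> < d ==> \<bar>snd (y - z0)\<bar> < d ==> F y = hs c (y - z0)"
  let ?V = "{z. \<bar>fst (z - z0)\<bar> < d & \<bar>snd (z - z0)\<bar> < d}"
  have "open ?V" by (intro open_Collect_conj open_Collect_less continuous_intros)
  moreover have "P ?V (2 * M) (max 1 (2 * q))" unfolding P_def
  proof (intro conjI ballI)
  fix bs :: "(real \<times> real) list" and z :: "real \<times> real" assume bs: "bs : lists Basis" and z: "z : ?V"
  have "norm (iter_deriv bs F z) <= 2 * M * (2 * q) ^ length bs * fact (length bs)"
  by (rule iter_deriv_hs(3)[OF h(1) less_imp_le[OF h(2)] h(3,5,6) bs]) (use z in auto)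
  also have "... <= 2 * M * max 1 (2 * q) ^ length bs * fact (length bs)"
  using h by (intro mult_right_mono mult_left_mono power_mono) auto
  finally show "norm (iter_deriv bs F z) <= 2 * M * max 1 (2 * q) ^ length bs * fact (length bs)" .
  qed (use h in auto)
  ultimately show ?thesis using h(4) by (intro exI[of _ ?V]) auto
 qed
 then obtain V where V: "!!z0. z0 : U ==> open (V z0) & z0 : V z0 & (EX M R. P (V z0) M R)" by metis
 obtain T where T: "T <= C" "finite T" "C <= (\<Union>z\<in>T. V z)"
 proof -
  have o: "open (V z)" if "z : C" for z using V C(2) that by blast
  have cv: "C <= (\<Union>z\<in>C. V z)"
  proof
  fix z assume "z : C"
  then show "z : (\<Union>z\<in>C. V z)" using V C(2) by blast
  qed
  show thesis by (rule compactE_image[OF C(1) o cv]) (assumption, rule that)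
 qed
 have "EX M R. P (\<Union>z\<in>T'. V z) M R" if "finite T'" "T' <= U" for T' using that
 proof (induction T' rule: finite_induct)
  case empty
  show ?case by (intro exI[of _ 0] exI[of _ 1]) (simp add: P_def)
 next
  case (insert z T')
  obtain M R M' R' where p: "P (\<Union>z\<in>T'. V z) M R" "P (V z) M' R'" using insert V by blast
  have mono: "P W (max M M') (max R R')" if "P W m r" "m <= max M M'" "r <= max R R'" for W m r
  unfolding P_def
  proof (intro conjI ballI)
  fix bs :: "(real \<times> real) list" and z :: "real \<times> real" assume z: "bs : lists Basis" "z : W"
  have "norm (iter_deriv bs F z) <= m * r ^ length bs * fact (length bs)" using that(1) z unfolding P_def by blast
  also have "... <= max M M' * max R R' ^ length bs * fact (length bs)"
  using that unfolding P_def by (intro mult_right_mono mult_mono power_mono) auto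
  finally show "norm (iter_deriv bs F z) <= max M M' * max R R' ^ length bs * fact (length bs)" .
  qed (use that in \<open>auto simp: P_def\<close>)
  have "P (\<Union>z\<in>T'. V z) (max M M') (max R R')" "P (V z) (max M M') (max R R')"
  by (rule mono[OF p(1)]; simp) (rule mono[OF p(2)]; simp)
  then have "P (\<Union>z\<in>insert z T'. V z) (max M M') (max R R')" unfolding P_def by auto
  then show ?case by blast
 qed
 from this[OF T(2)] obtain M R where "P (\<Union>z\<in>T. V z) M R" using T(1) C(2) by blast
 then show ?thesis using T(3) unfolding P_def by (intro exI[of _ M] exI[of _ R]) blast
qed

section \<open>Compact sets of analytic functions\<close>

text \<open>Each weight \<open>d\<close> gives a bound. If no pair of constants worked, some \<open>k\<close>-th violation would occur at every \<open>k\<close>; \<open>h n\<close> is the largest \<open>k\<close> violated at order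
at most \<open>n\<close>, it tends to infinity because a single order admits only finitely many violations, and the weight \<open>(1 + h n)^-n\<close> is then
admissible but leads to unbounded values at the orders where \<open>h\<close> increases.\<close>

lemma analytic_seminorm_uniform:
 fixes S :: "(real \<times> real => 'b::banach) set"
 assumes K: "compactin (seminorm_topology P S) \<K>"
  and P: "!!d. (!!n. 0 <= d n) ==> (%n. root n (d n)) \<longlonglongrightarrow> 0 ==> analytic_seminorm d V : P"
  and V: "compact V" "V <= U" "open U" and S: "!!F. F : S ==> real_analytic_on U F"
 shows "EX M R. 0 <= M & 1 <= R & (ALL F:\<K>. ALL bs:lists Basis. ALL z:V. norm (iter_deriv bs F z) <= M * R ^ length bs * fact (length bs))"
proof -
 define Q where "Q F bs z = norm (iter_deriv bs F z) / fact (length bs)" for F :: "real \<times> real => 'b" and bs z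
 have Q0: "0 <= Q F bs z" for F bs z by (simp add: Q_def)
 have bounded: "EX m. ALL F:\<K>. ALL bs:lists Basis. ALL z:V. d (length bs) * Q F bs z <= m"
  if d: "!!n. 0 <= d n" "(%n. root n (d n)) \<longlonglongrightarrow> 0" for d
 proof -
  have "\<exists>M<\<infinity>. ALL F:\<K>. analytic_seminorm d V F <= M"
  proof (rule compactin_seminorm_bounded(2)[OF K P[OF d]])
  fix F assume F: "F : S"
  obtain M R where MR: "0 <= M" "1 <= R" "!!bs z. bs : lists Basis ==> z : V ==> norm (iter_deriv bs F z) <= M * R ^ length bs * fact (length bs)"
  using real_analytic_factorial_bounds[OF S[OF F] V(1,2)] by blast
  have "\<forall>\<^sub>F n in sequentially. root n (d n) < 1 / R" using d(2) MR(2) by (intro order_tendstoD(2)) auto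
  then obtain N where N: "!!n. n \<ge> N ==> root n (d n) < 1 / R" unfolding eventually_sequentially by blast
  define m where "m = 1 + (\<Sum>n\<le>N. d n * R ^ n)"
  have s0: "0 <= (\<Sum>n\<le>N. d n * R ^ n)" using d MR by (intro sum_nonneg) auto
  have dm: "d n * R ^ n <= m" for n
  proof (cases "n <= N")
  case True
  then have "d n * R ^ n <= (\<Sum>n\<le>N. d n * R ^ n)" using d MR by (intro member_le_sum) auto
  then show ?thesis by (simp add: m_def)
  next
  case False
  then have n: "0 < n" "root n (d n) < 1 / R" using N[of n] by auto
  have "d n = root n (d n) ^ n" using n(1) d by simp
  also have "... <= (1 / R) ^ n" using n d by (intro power_mono) (auto intro: real_root_ge_zero)
  finally have "d n * R ^ n <= (1 / R) ^ n * R ^ n" using MR by (intro mult_right_mono) auto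
  also have "... = 1" using MR by (simp add: power_divide)
  finally show ?thesis using s0 by (simp add: m_def)
  qed
  have "analytic_seminorm d V F <= ennreal (M * m)" unfolding analytic_seminorm_def
  proof (intro SUP_least ennreal_leI)
  fix bs :: "(real \<times> real) list" and z assume bz: "bs : lists Basis" "z : V"
  have "norm (iter_deriv bs F z) / fact (length bs) <= M * R ^ length bs"
  using MR(3)[OF bz] by (simp add: divide_le_eq)
  then have "d (length bs) * (norm (iter_deriv bs F z) / fact (length bs)) <= d (length bs) * (M * R ^ length bs)" using d by (intro mult_left_mono) auto
  also have "... = M * (d (length bs) * R ^ length bs)" by simp
  also have "... <= M * m" using dm MR by (intro mult_left_mono) auto
  finally show "d (length bs) * norm (iter_deriv bs F z) / fact (length bs) <= M * m" by simp
  qed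
  also have "... < \<infinity>" by simp
  finally show "analytic_seminorm d V F < \<infinity>" .
  next
  fix F assume F: "F : S"
  have "iter_deriv bs (%z. F z - F z) z = 0" if "bs : lists Basis" "z : V" for bs z
  using iter_deriv_diff[OF real_analytic_C_nat[OF S[OF F]] real_analytic_C_nat[OF S[OF F]] V(3) that(1) order_refl, of z] that(2) V(2) by auto
  then have "analytic_seminorm d V (%z. F z - F z) <= 0" unfolding analytic_seminorm_def by (intro SUP_least) simp
  then show "analytic_seminorm d V (%z. F z - F z) = 0" by simp
  next
  fix F G assume FG: "F : S" "G : S"
  show "analytic_seminorm d V G <= analytic_seminorm d V (%z. G z - F z) + analytic_seminorm d V F"
  unfolding analytic_seminorm_def[of d V G]
  proof (intro SUP_least)
  fix bs z assume bz: "bs : lists (Basis :: (real \<times> real) set)" "z : V"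
  let ?c = "d (length bs) / fact (length bs)"
  have "iter_deriv bs (%z. G z - F z) z = iter_deriv bs G z - iter_deriv bs F z"
  using iter_deriv_diff[OF real_analytic_C_nat[OF S[OF FG(1)]] real_analytic_C_nat[OF S[OF FG(2)]] V(3) bz(1) order_refl, of z] bz(2) V(2) by auto
  then have "norm (iter_deriv bs G z) <= norm (iter_deriv bs (%z. G z - F z) z) + norm (iter_deriv bs F z)"
  using norm_triangle_sub[of "iter_deriv bs G z" "iter_deriv bs F z"] by simp
  then have "?c * norm (iter_deriv bs G z) <= ?c * (norm (iter_deriv bs (%z. G z - F z) z) + norm (iter_deriv bs F z))"
  using d by (intro mult_left_mono) auto
  then have "ennreal (d (length bs) * norm (iter_deriv bs G z) / fact (length bs)) <=
  ennreal (d (length bs) * norm (iter_deriv bs (%z. G z - F z) z) / fact (length bs) + d (length bs) * norm (iter_deriv bs F z) / fact (length bs))"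
  by (intro ennreal_leI) (simp add: distrib_left)
  also have "... = ennreal (d (length bs) * norm (iter_deriv bs (%z. G z - F z) z) / fact (length bs)) + ennreal (d (length bs) * norm (iter_deriv bs F z) / fact (length bs))"
  using d by (intro ennreal_plus) auto
  also have "... <= analytic_seminorm d V (%z. G z - F z) + analytic_seminorm d V F"
  unfolding analytic_seminorm_def by (intro add_mono SUP_upper2[OF bz(1)] SUP_upper2[OF bz(2)] order_refl)
  finally show "ennreal (d (length bs) * norm (iter_deriv bs G z) / fact (length bs)) <= analytic_seminorm d V (%z. G z - F z) + analytic_seminorm d V F" .
  qed
  qed
  then obtain M where M: "M < \<infinity>" "!!F. F : \<K> ==> analytic_seminorm d V F <= M" by blast
  have "d (length bs) * Q F bs z <= enn2real M" if "F : \<K>" "bs : lists Basis" "z : V" for F bs z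
  proof -
  have "ennreal (d (length bs) * norm (iter_deriv bs F z) / fact (length bs)) <= analytic_seminorm d V F"
  unfolding analytic_seminorm_def by (intro SUP_upper2[OF that(2)] SUP_upper2[OF that(3)] order_refl)
  also have "... <= ennreal (enn2real M)" using M(2)[OF that(1)] M(1) by simp
  finally show ?thesis by (simp add: Q_def ennreal_le_iff)
  qed
  then show ?thesis by blast
 qed
 have "EX G. ALL F:\<K>. ALL bs:lists Basis. ALL z:V. length bs = n --> Q F bs z <= G" for n
 proof -
  define d :: "nat => real" where "d k = (if k = n then 1 else 0)" for k
  have "EX m. ALL F:\<K>. ALL bs:lists Basis. ALL z:V. d (length bs) * Q F bs z <= m"
  proof (rule bounded)
  have "\<forall>\<^sub>F k in sequentially. root k (d k) = 0" using eventually_gt_at_top[of n] by eventually_elim (simp add: d_def)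
  then show "(%k. root k (d k)) \<longlonglongrightarrow> 0" by (rule tendsto_eventually)
  qed (simp add: d_def)
  then obtain m where m: "!!F bs z. F : \<K> ==> bs : lists Basis ==> z : V ==> d (length bs) * Q F bs z <= m" by blast
  have "Q F bs z <= m" if "F : \<K>" "bs : lists Basis" "z : V" "length bs = n" for F bs z
  using m[OF that(1-3)] that(4) by (simp add: d_def)
  then show ?thesis by blast
 qed
 then have "EX G. ALL n. ALL F:\<K>. ALL bs:lists Basis. ALL z:V. length bs = n --> Q F bs z <= G n" by (intro choice allI)
 then obtain G where G: "!!F bs z. F : \<K> ==> bs : lists Basis ==> z : V ==> Q F bs z <= G (length bs)" by blast
 define W where "W n = {k. EX F:\<K>. EX bs:lists Basis. EX z:V. length bs = n & real (Suc k) * (real (Suc k) ^ 2) ^ n < Q F bs z}" for n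
 have "finite (W n)" for n
 proof (rule finite_subset)
  show "W n <= {k. real k <= G n}"
  proof
  fix k assume "k : W n"
  then obtain F bs z where h: "F : \<K>" "bs : lists Basis" "z : V" "length bs = n" "real (Suc k) * (real (Suc k) ^ 2) ^ n < Q F bs z"
  unfolding W_def by blast
  have "real (Suc k) * 1 <= real (Suc k) * (real (Suc k) ^ 2) ^ n" by (intro mult_left_mono one_le_power) auto
  also have "... < Q F bs z" by (rule h(5))
  also have "... <= G n" using G[OF h(1-3)] h(4) by simp
  finally show "k : {k. real k <= G n}" by simp
  qed
  have "{k. real k <= G n} <= {..nat \<lfloor>G n\<rfloor>}" by (auto simp: le_nat_floor)
  then show "finite {k. real k <= G n}" by (rule finite_subset) simp
 qed
 then have finW: "finite (insert 0 (\<Union>m\<le>n. W m))" for n by simp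
 define h where "h n = Max (insert 0 (\<Union>m\<le>n. W m))" for n
 have "EX k. ALL n. k \<notin> W n"
 proof (rule ccontr)
  assume "\<nexists>k. ALL n. k \<notin> W n"
  then have all: "EX n. k : W n" for k by blast
  have hge: "k <= h n" if "k : W m" "m <= n" for k m n
  unfolding h_def by (rule Max_ge[OF finW]) (use that in auto)
  define d :: "nat => real" where "d n = 1 / real (Suc (h n)) ^ n" for n
  have "EX m. ALL F:\<K>. ALL bs:lists Basis. ALL z:V. d (length bs) * Q F bs z <= m"
  proof (rule bounded)
  have "filterlim h at_top sequentially" unfolding filterlim_at_top
  proof
  fix k obtain n where "k : W n" using all by blast
  then show "\<forall>\<^sub>F m in sequentially. k <= h m" unfolding eventually_sequentially using hge by blast
  qed
  then have "(%n. 1 / real (Suc (h n))) \<longlonglongrightarrow> 0"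
  using filterlim_compose[OF LIMSEQ_inverse_real_of_nat, of h sequentially] by (simp add: inverse_eq_divide)
  moreover have "\<forall>\<^sub>F n in sequentially. 1 / real (Suc (h n)) = root n (d n)"
  using eventually_gt_at_top[of 0]
  proof eventually_elim
  fix n :: nat assume "0 < n"
  then show "1 / real (Suc (h n)) = root n (d n)" unfolding d_def power_one_over[symmetric] by (subst real_root_power_cancel) auto
  qed
  ultimately show "(%n. root n (d n)) \<longlonglongrightarrow> 0" by (rule Lim_transform_eventually)
  qed (simp add: d_def)
  then obtain m where m: "!!F bs z. F : \<K> ==> bs : lists Basis ==> z : V ==> d (length bs) * Q F bs z <= m" by blast
  obtain k :: nat where k: "m < real k" using reals_Archimedean2 by blast
  define n where "n = (LEAST n. Suc k <= h n)"
  have ex: "EX n. Suc k <= h n" using all[of "Suc k"] hge by blast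
  then have hn: "Suc k <= h n" unfolding n_def by (rule LeastI_ex)
  have "h n : insert 0 (\<Union>m\<le>n. W m)" unfolding h_def by (rule Max_in[OF finW]) simp
  then obtain m' where m': "m' <= n" "h n : W m'" using hn by auto
  have "Suc k <= h m'" using hge[OF m'(2) order_refl] hn by linarith
  then have "n <= m'" unfolding n_def by (rule Least_le)
  then have "h n : W n" using m' by simp
  then obtain F bs z where w: "F : \<K>" "bs : lists Basis" "z : V" "length bs = n" "real (Suc (h n)) * (real (Suc (h n)) ^ 2) ^ n < Q F bs z"
  unfolding W_def by blast
  define H where "H = real (Suc (h n))"
  have H: "1 <= H" "real k <= H" using hn by (simp_all add: H_def)
  have "H * 1 <= H * H ^ n" using H by (intro mult_left_mono one_le_power) auto
  also have "H * H ^ n = 1 / H ^ n * (H * (H ^ 2) ^ n)" using H by (simp add: power2_eq_square power_mult_distrib)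
  also have "... <= 1 / H ^ n * Q F bs z" using w(5) H unfolding H_def[symmetric] by (intro mult_left_mono) auto
  also have "... = d (length bs) * Q F bs z" by (simp add: d_def w(4) H_def)
  also have "... <= m" by (rule m[OF w(1-3)])
  finally show False using k H by simp
 qed
 then obtain k where k: "!!n. k \<notin> W n" by blast
 have "norm (iter_deriv bs F z) <= real (Suc k) * (real (Suc k) ^ 2) ^ length bs * fact (length bs)" if "F : \<K>" "bs : lists Basis" "z : V" for F bs z
 proof -
  have "Q F bs z <= real (Suc k) * (real (Suc k) ^ 2) ^ length bs" using k[of "length bs"] that unfolding W_def by force
  then show ?thesis by (simp add: Q_def divide_le_eq del: of_nat_Suc)
 qed
 then show ?thesis by (intro exI[of _ "real (Suc k)"] exI[of _ "real (Suc k) ^ 2"]) (auto simp del: of_nat_Suc intro: one_le_power)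
qed

section \<open>Holomorphic extension of analytic jets\<close>

lemma geometric_limit:
 fixes X :: "nat => complex"
 assumes X: "!!k. norm (X (Suc k) - X k) <= C * q ^ k" and q: "0 <= q" "q <= 1 / 2"
 shows "X \<longlonglongrightarrow> lim X" and "norm (lim X - X n) <= 2 * C * q ^ n"
proof -
 define g where "g k = X (Suc k) - X k" for k
 have C: "0 <= C" using X[of 0] order_trans[OF norm_ge_zero X[of 0]] by simp
 have sq: "summable (%k. C * q ^ k)" using q by (intro summable_mult summable_geometric) simp
 have sg: "summable g" by (rule summable_comparison_test'[OF sq, of 0]) (use X in \<open>simp add: g_def\<close>)
 have tel: "X n = X 0 + (\<Sum>k<n. g k)" for n unfolding g_def by (simp add: sum_lessThan_telescope)
 have "(%n. X 0 + (\<Sum>k<n. g k)) \<longlonglongrightarrow> X 0 + suminf g" by (intro tendsto_add tendsto_const summable_LIMSEQ[OF sg])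
 then have l: "X \<longlonglongrightarrow> X 0 + suminf g" unfolding tel[symmetric] .
 then have e: "lim X = X 0 + suminf g" by (rule limI)
 show "X \<longlonglongrightarrow> lim X" unfolding e by (rule l)
 have b: "norm (g (k + n)) <= C * q ^ n * q ^ k" for k using X[of "k + n"] by (simp add: g_def power_add mult_ac)
 have s2: "summable (%k. C * q ^ n * q ^ k)" using q by (intro summable_mult summable_geometric) simp
 have sm: "summable (%k. norm (g (k + n)))" by (rule summable_comparison_test'[OF s2, of 0]) (use b in simp)
 have "lim X - X n = (\<Sum>k. g (k + n))" unfolding e tel[of n] using suminf_split_initial_segment[OF sg, of n] by simp
 also have "norm ... <= (\<Sum>k. norm (g (k + n)))" by (rule summable_norm[OF sm])
 also have "... <= (\<Sum>k. C * q ^ n * q ^ k)" by (rule suminf_le[OF b sm s2])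
 also have "... = C * q ^ n * (1 / (1 - q))" using q by (subst suminf_mult) (auto simp: suminf_geometric intro!: summable_geometric)
 also have "... <= C * q ^ n * 2" using q C by (intro mult_left_mono) (auto simp: divide_le_eq)
 finally show "norm (lim X - X n) <= 2 * C * q ^ n" by (simp add: mult_ac)
qed

text \<open>One further order contributes homogeneous terms only, whose factorials are summed by the binomial theorem.\<close>

lemma tpoly_increment:
 assumes b: "!!i l. \<bar>b i l\<bar> <= M * R ^ (i + l) * fact (i + l)" and r: "norm al <= r" "norm \<beta> <= r" and R: "0 <= R"
 shows "norm (tpoly (Suc K) b al \<beta> - tpoly K b al \<beta>) <= M * (2 * R * r) ^ K"
proof -
 define T where "T i l = of_real (b i l) * al ^ i * \<beta> ^ l / (fact i * fact l)" for i l
 have r0: "0 <= r" using r(1) norm_ge_zero order_trans by blast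
 have "tpoly (Suc K) b al \<beta> = (\<Sum>l<K. (\<Sum>i<K - l. T i l) + T (K - l) l) + T 0 K"
  unfolding tpoly_def T_def[symmetric] by (simp add: Suc_diff_le)
 then have "tpoly (Suc K) b al \<beta> - tpoly K b al \<beta> = (\<Sum>l<Suc K. T (K - l) l)"
  unfolding tpoly_def T_def[symmetric] by (simp add: sum.distrib)
 also have "norm ... <= (\<Sum>l<Suc K. M * (R * r) ^ K * fact K * (1 / (fact (K - l) * fact l)))"
 proof (rule order_trans[OF norm_sum], rule sum_mono)
  fix l assume "l : {..<Suc K}"
  then have e: "K - l + l = K" by simp
  have "norm (T (K - l) l) = \<bar>b (K - l) l\<bar> * (norm al ^ (K - l) * norm \<beta> ^ l) / (fact (K - l) * fact l)"
  by (simp add: T_def norm_mult norm_divide norm_power)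
  also have "... <= (M * R ^ (K - l + l) * fact (K - l + l)) * (r ^ (K - l) * r ^ l) / (fact (K - l) * fact l)"
  using b[of "K - l" l] r r0 order_trans[OF abs_ge_zero b[of "K - l" l]] by (intro divide_right_mono mult_mono power_mono) auto
  also have "... = M * (R * r) ^ K * fact K * (1 / (fact (K - l) * fact l))"
  unfolding power_add[symmetric] e by (simp add: power_mult_distrib)
  finally show "norm (T (K - l) l) <= M * (R * r) ^ K * fact K * (1 / (fact (K - l) * fact l))" .
 qed
 also have "... = M * (R * r) ^ K * fact K * (2 ^ K / fact K)" unfolding sum_distrib_left[symmetric] sum_inverse_fact_product ..
 also have "... = M * (2 * R * r) ^ K" by (simp add: power_mult_distrib)
 finally show ?thesis .
qed

locale analytic_jets =
 fixes b :: "nat => nat => real => real => real" and M R s0 r0 :: real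
 assumes jets: "!!K. jets_on K {s0 - r0..s0 + r0} b"
  and bd: "!!i l th s. \<bar>s - s0\<bar> <= r0 ==> \<bar>b i l th s\<bar> <= M * R ^ (i + l) * fact (i + l)"
  and M: "0 <= M" and R: "1 <= R" and r0: "0 < r0" "8 * R * r0 <= 1"
begin

definition ext :: "real => real => complex => complex => complex" where
 "ext u v z w = lim (%K. tpoly K (%i l. b i l u v) (z - of_real u) (w - of_real v))"

lemma ext_limit:
 assumes v: "\<bar>v - s0\<bar> <= r0" and r: "norm (z - of_real u) <= r" "norm (w - of_real v) <= r" "r <= r0"
 shows "(%K. tpoly K (%i l. b i l u v) (z - of_real u) (w - of_real v)) \<longlonglongrightarrow> ext u v z w"
  and "norm (ext u v z w - tpoly K (%i l. b i l u v) (z - of_real u) (w - of_real v)) <= 2 * M * (2 * R * r) ^ K"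
proof -
 have rr: "0 <= r" using r(1) norm_ge_zero order_trans by blast
 have "2 * R * r <= 2 * R * r0" using r R by (intro mult_left_mono) auto
 then have q: "2 * R * r <= 1 / 2" using r0(2) by linarith
 have q0: "0 <= 2 * R * r" using rr R by simp
 have "norm (tpoly (Suc k) (%i l. b i l u v) (z - of_real u) (w - of_real v) - tpoly k (%i l. b i l u v) (z - of_real u) (w - of_real v)) <= M * (2 * R * r) ^ k" for k
  by (rule tpoly_increment) (use bd[OF v] r R in auto)
 from geometric_limit[of "%K. tpoly K (%i l. b i l u v) (z - of_real u) (w - of_real v)", OF this q0 q]
 show "(%K. tpoly K (%i l. b i l u v) (z - of_real u) (w - of_real v)) \<longlonglongrightarrow> ext u v z w"
  "norm (ext u v z w - tpoly K (%i l. b i l u v) (z - of_real u) (w - of_real v)) <= 2 * M * (2 * R * r) ^ K"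
  unfolding ext_def by auto
qed

text \<open>The sums at two base points agree where both converge, since the difference of the Taylor polynomials is of order \<open>k (2 R r0)^k\<close> by \<open>taylor_rebase\<close>. Thus the local
extensions fit together.\<close>

lemma ext_rebase:
 assumes v: "\<bar>v - s0\<bar> <= r0" "\<bar>v' - s0\<bar> <= r0"
  and r: "norm (z - of_real u) <= r0" "norm (w - of_real v) <= r0" "norm (z - of_real u') <= r0" "norm (w - of_real v') <= r0"
 shows "ext u' v' z w = ext u v z w"
proof -
 let ?P = "%u v K. tpoly K (%i l. b i l u v) (z - of_real u) (w - of_real v)"
 define D where "D = \<bar>u' - u\<bar> + \<bar>v' - v\<bar>"
 have D: "0 <= D" by (simp add: D_def)
 have nb: "norm (?P u' v' (Suc k) - ?P u v (Suc k)) <= D * M * R * (2 * (1 / 2) ^ k)" for k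
 proof -
  have "norm (?P u' v' (Suc k) - ?P u v (Suc k)) <= D * (M * R ^ Suc k * fact (Suc k)) * (2 * r0) ^ (Suc k - 1) / fact (Suc k - 1)"
  unfolding D_def
  proof (rule taylor_rebase[OF jets])
  show "\<bar>b i l th s\<bar> <= M * R ^ Suc k * fact (Suc k)" if "i + l = Suc k" "s : {s0 - r0..s0 + r0}" for i l th s
  using bd[of s i l th] that by (auto simp: abs_le_iff)
  qed (use v r in \<open>auto simp: abs_le_iff\<close>)
  also have "... = D * M * R * (real (Suc k) * (2 * R * r0) ^ k)" by (simp add: power_mult_distrib field_simps)
  also have "... <= D * M * R * (2 ^ k * (1 / 4) ^ k)"
  using D M R r0 Suc_le_two_power[of k] by (intro mult_left_mono mult_mono power_mono) auto
  also have "... = D * M * R * ((2 * (1 / 4)) ^ k)" by (simp only: power_mult_distrib)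
  also have "... <= D * M * R * (2 * (1 / 2) ^ k)" using D M R by (intro mult_left_mono) auto
  finally show ?thesis .
 qed
 have "(%k. D * M * R * (2 * (1 / 2 :: real) ^ k)) \<longlonglongrightarrow> D * M * R * (2 * 0)" by (intro tendsto_mult tendsto_const LIMSEQ_power_zero) simp
 then have lm: "(%k. D * M * R * (2 * (1 / 2 :: real) ^ k)) \<longlonglongrightarrow> 0" by (simp only: mult_zero_right)
 have z: "(%k. ?P u' v' (Suc k) - ?P u v (Suc k)) \<longlonglongrightarrow> 0"
  by (rule Lim_null_comparison[OF _ lm]) (intro always_eventually allI nb)
 have "(%k. ?P u' v' (Suc k) - ?P u v (Suc k)) \<longlonglongrightarrow> ext u' v' z w - ext u v z w"
  by (intro tendsto_diff LIMSEQ_Suc ext_limit(1)[OF v(2) r(3,4) order_refl] ext_limit(1)[OF v(1) r(1,2) order_refl])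
 from LIMSEQ_unique[OF this z] show ?thesis by simp
qed

lemma ext_holomorphic:
 assumes v: "\<bar>v - s0\<bar> <= r0"
 shows "norm (w - of_real v) <= r0 ==> (%z. ext u v z w) holomorphic_on ball (of_real u) r0"
  and "norm (z - of_real u) <= r0 ==> (%w. ext u v z w) holomorphic_on ball (of_real v) r0"
proof -
 have gen: "g holomorphic_on ball c r0" if hol: "!!K. f K holomorphic_on ball c r0" and b: "!!x K. x : ball c r0 ==> norm (g x - f K x) <= 2 * M * (1 / 4) ^ K"
  for f :: "nat => complex => complex" and g c
 proof (rule holomorphic_uniform_sequence[OF open_ball hol])
  fix x assume x: "x : ball c r0"
  obtain d where d: "0 < d" "cball x d <= ball c r0" using open_contains_cball[of "ball c r0"] x open_ball by blast
  have "uniform_limit (cball x d) f g sequentially"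
  proof (rule uniform_limitI)
  fix e :: real assume "e > 0"
  have "(%K. 2 * M * (1 / 4 :: real) ^ K) \<longlonglongrightarrow> 2 * M * 0" by (intro tendsto_mult tendsto_const LIMSEQ_power_zero) simp
  then have "\<forall>\<^sub>F K in sequentially. 2 * M * (1 / 4) ^ K < e" using \<open>e > 0\<close> by (intro order_tendstoD(2)) auto
  then show "\<forall>\<^sub>F K in sequentially. ALL x:cball x d. dist (f K x) (g x) < e"
  proof eventually_elim
  fix K assume K: "2 * M * (1 / 4) ^ K < e"
  show "ALL x:cball x d. dist (f K x) (g x) < e"
  proof
  fix y assume "y : cball x d"
  then have "norm (g y - f K y) <= 2 * M * (1 / 4) ^ K" using d by (intro b) blast
  then show "dist (f K y) (g y) < e" using K by (simp add: dist_norm norm_minus_commute)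
  qed
  qed
  qed
  then show "\<exists>d>0. cball x d <= ball c r0 & uniform_limit (cball x d) f g sequentially" using d by blast
 qed
 have bound: "norm (ext u v z w - tpoly K (%i l. b i l u v) (z - of_real u) (w - of_real v)) <= 2 * M * (1 / 4) ^ K"
  if "norm (z - of_real u) <= r0" "norm (w - of_real v) <= r0" for z w K
 proof -
  have "norm (ext u v z w - tpoly K (%i l. b i l u v) (z - of_real u) (w - of_real v)) <= 2 * M * (2 * R * r0) ^ K"
  by (rule ext_limit(2)[OF v that order_refl])
  also have "... <= 2 * M * (1 / 4) ^ K" using M R r0 by (intro mult_left_mono power_mono) auto
  finally show ?thesis .
 qed
 show "(%z. ext u v z w) holomorphic_on ball (of_real u) r0" if "norm (w - of_real v) <= r0"
 proof (rule gen[where f = "%K z. tpoly K (%i l. b i l u v) (z - of_real u) (w - of_real v)"])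
  show "norm (ext u v x w - tpoly K (%i l. b i l u v) (x - of_real u) (w - of_real v)) <= 2 * M * (1 / 4) ^ K" if x: "x : ball (of_real u) r0" for x K
  proof (rule bound)
  show "norm (x - of_real u) <= r0" using x by (simp add: dist_norm norm_minus_commute)
  qed (rule \<open>norm (w - of_real v) <= r0\<close>)
  show "(%z. tpoly K (%i l. b i l u v) (z - of_real u) (w - of_real v)) holomorphic_on ball (of_real u) r0" for K
  unfolding tpoly_def by (intro holomorphic_on_divide holomorphic_on_sum holomorphic_on_mult holomorphic_on_power holomorphic_on_diff holomorphic_on_const holomorphic_on_ident) auto
 qed
 show "(%w. ext u v z w) holomorphic_on ball (of_real v) r0" if "norm (z - of_real u) <= r0"
 proof (rule gen[where f = "%K w. tpoly K (%i l. b i l u v) (z - of_real u) (w - of_real v)"])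
  show "norm (ext u v z x - tpoly K (%i l. b i l u v) (z - of_real u) (x - of_real v)) <= 2 * M * (1 / 4) ^ K" if x: "x : ball (of_real v) r0" for x K
  proof (rule bound[OF \<open>norm (z - of_real u) <= r0\<close>])
  show "norm (x - of_real v) <= r0" using x by (simp add: dist_norm norm_minus_commute)
  qed
  show "(%w. tpoly K (%i l. b i l u v) (z - of_real u) (w - of_real v)) holomorphic_on ball (of_real v) r0" for K
  unfolding tpoly_def by (intro holomorphic_on_divide holomorphic_on_sum holomorphic_on_mult holomorphic_on_power holomorphic_on_diff holomorphic_on_const holomorphic_on_ident) auto
 qed
qed

definition strip_ext :: "complex => complex => complex" where
 "strip_ext z w = ext (Re z) s0 z w"

lemma Im_part: "z - of_real (Re z) = \<i> * of_real (Im z)"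
 by (simp add: complex_eq_iff)

lemma strip_ext_eq:
 assumes s: "\<bar>s - s0\<bar> <= r0" and z: "norm (z - of_real u) <= r0" and w: "norm (w - of_real s) <= r0" "norm (w - of_real s0) <= r0"
 shows "strip_ext z w = ext u s z w"
proof -
 have "norm (z - of_real (Re z)) <= r0" unfolding Im_part using z abs_Im_le_cmod[of "z - of_real u"] by (simp add: norm_mult)
 moreover have "\<bar>s0 - s0\<bar> <= r0" using r0 by simp
 ultimately show ?thesis unfolding strip_ext_def by (intro ext_rebase[OF s _ z w(1) _ w(2)])
qed

lemma strip_ext_holomorphic:
 "norm (w - of_real s0) <= r0 ==> (%z. strip_ext z w) holomorphic_on {z. \<bar>Im z\<bar> < r0}"
 "\<bar>y\<bar> <= r0 ==> (%w. strip_ext (Complex th y) w) holomorphic_on ball (of_real s0) r0"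
proof -
 have s0: "\<bar>s0 - s0\<bar> <= r0" using r0 by simp
 show "(%z. strip_ext z w) holomorphic_on {z. \<bar>Im z\<bar> < r0}" if w: "norm (w - of_real s0) <= r0"
  unfolding holomorphic_on_def
 proof
  fix z assume z: "z : {z. \<bar>Im z\<bar> < r0}"
  let ?B = "ball (of_real (Re z)) r0 :: complex set"
  have "norm (z - of_real (Re z)) < r0" unfolding Im_part using z by (simp add: norm_mult)
  then have zB: "z : ?B" by (simp add: dist_norm norm_minus_commute)
  have "(%z. strip_ext z w) holomorphic_on ?B"
  proof (rule holomorphic_transform[OF ext_holomorphic(1)[OF s0 w]])
  fix y assume "y : ?B"
  then have ny: "norm (y - of_real (Re z)) <= r0" by (simp add: dist_norm norm_minus_commute)
  show "ext (Re z) s0 y w = strip_ext y w" by (rule strip_ext_eq[OF s0 ny w w, symmetric])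
  qed
  then have "(%z. strip_ext z w) field_differentiable at z" by (rule holomorphic_on_imp_differentiable_at[OF _ open_ball zB])
  then show "(%z. strip_ext z w) field_differentiable at z within {z. \<bar>Im z\<bar> < r0}" by (rule field_differentiable_at_within)
 qed
 show "(%w. strip_ext (Complex th y) w) holomorphic_on ball (of_real s0) r0" if "\<bar>y\<bar> <= r0"
 proof -
  have "norm (Complex th y - of_real th) <= r0" using that Im_part[of "Complex th y"] by (simp add: norm_mult)
  then show ?thesis unfolding strip_ext_def using ext_holomorphic(2)[OF s0, of "Complex th y" th] by simp
 qed
qed

lemma strip_ext_periodic: "strip_ext (z + 1) w = strip_ext z w"
proof -
 have "b i l (Re z + 1) s0 = b i l (Re z) s0" for i l
  using jets_onD(1)[OF jets[of "i + l"], of s0 i l "Re z"] r0 by simp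
 then show ?thesis by (simp add: strip_ext_def ext_def)
qed

text \<open>Quadratic in the height and linear in \<open>w - s\<close>; taking \<open>w = s\<close> gives the precise first-order behaviour near the real axis, taking \<open>s = s0\<close> the room for complex \<open>w\<close>.\<close>

lemma strip_ext_estimate:
 assumes s: "\<bar>s - s0\<bar> <= r0" and y: "\<bar>y\<bar> <= r0" and w: "norm (w - of_real s) <= r0" "norm (w - of_real s0) <= r0"
 shows "norm (strip_ext (Complex th y) w - (of_real (b 0 0 th s) + \<i> * of_real (y * b 1 0 th s))) <= (8 * M * R\<^sup>2 + M * R) * (y\<^sup>2 + norm (w - of_real s))"
proof -
 define r where "r = max \<bar>y\<bar> (norm (w - of_real s))"
 have h: "Complex th y - of_real th = \<i> * of_real y" by (simp add: complex_eq_iff)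
 have zr: "norm (Complex th y - of_real th) <= r" unfolding h by (simp add: norm_mult r_def)
 have r: "r <= r0" using y w by (simp add: r_def)
 have "1 * r0 <= 8 * R * r0" using R r0 by (intro mult_right_mono) auto
 then have r1: "r0 <= 1" using r0 by linarith
 have e: "strip_ext (Complex th y) w = ext th s (Complex th y) w" by (rule strip_ext_eq[OF s _ w]) (use zr r in linarith)
 have 1: "norm (ext th s (Complex th y) w - tpoly 2 (%i l. b i l th s) (Complex th y - of_real th) (w - of_real s)) <= 2 * M * (2 * R * r) ^ 2"
  by (rule ext_limit(2)[OF s zr _ r]) (simp add: r_def)
 have 2: "tpoly 2 (%i l. b i l th s) (Complex th y - of_real th) (w - of_real s) - (of_real (b 0 0 th s) + \<i> * of_real (y * b 1 0 th s)) = of_real (b 0 1 th s) * (w - of_real s)"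
  unfolding h tpoly_def by (simp add: numeral_2_eq_2)
 have 3: "norm (of_real (b 0 1 th s) * (w - of_real s)) <= M * R * norm (w - of_real s)"
  unfolding norm_mult using bd[OF s, of 0 1 th] by (intro mult_right_mono) auto
 have "r\<^sup>2 <= y\<^sup>2 + norm (w - of_real s)"
 proof (cases "\<bar>y\<bar> <= norm (w - of_real s)")
  case True
  then have "r\<^sup>2 = norm (w - of_real s) * norm (w - of_real s)" by (simp add: r_def power2_eq_square)
  also have "... <= 1 * norm (w - of_real s)" using w r1 by (intro mult_right_mono) auto
  finally show ?thesis by (simp add: add_increasing)
 qed (simp add: r_def)
 then have "8 * M * R\<^sup>2 * r\<^sup>2 <= 8 * M * R\<^sup>2 * (y\<^sup>2 + norm (w - of_real s))" using M by (intro mult_left_mono) auto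
 moreover have "2 * M * (2 * R * r) ^ 2 = 8 * M * R\<^sup>2 * r\<^sup>2" by (simp add: power_mult_distrib)
 moreover have "M * R * norm (w - of_real s) <= M * R * (y\<^sup>2 + norm (w - of_real s))" using M R by (intro mult_left_mono) auto
 ultimately have f: "2 * M * (2 * R * r) ^ 2 + M * R * norm (w - of_real s) <= (8 * M * R\<^sup>2 + M * R) * (y\<^sup>2 + norm (w - of_real s))"
  unfolding distrib_right by linarith
 have "strip_ext (Complex th y) w - (of_real (b 0 0 th s) + \<i> * of_real (y * b 1 0 th s)) =
  (ext th s (Complex th y) w - tpoly 2 (%i l. b i l th s) (Complex th y - of_real th) (w - of_real s)) + of_real (b 0 1 th s) * (w - of_real s)"
  unfolding e 2[symmetric] by simp
 also have "norm ... <= 2 * M * (2 * R * r) ^ 2 + M * R * norm (w - of_real s)" by (rule order_trans[OF norm_triangle_ineq add_mono[OF 1 3]])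
 finally show ?thesis using f by linarith
qed

end

section \<open>Analyticity of the averaged exponent\<close>

text \<open>A monotone family near \<open>s0\<close> together with a periodic holomorphic extension \<open>\<Phi>\<close> of its entries and the first-order estimate that controls it.\<close>

locale analytic_family = mpt f \<mu> for f :: "'x::metric_space => 'x" and \<mu> +
 fixes a :: "'x => 2 => 2 => nat => nat => real => real => real" and B c si s0 r L :: real
  and \<Phi> :: "'x => 2 => 2 => complex => complex => complex"
 assumes B: "1 <= B" and c: "0 < c" "c <= 1" and si: "\<bar>si\<bar> = 1" and r: "0 < r" and L: "0 < L"
  and bd: "!!x p q i th s. i <= 1 ==> \<bar>s - s0\<bar> < r ==> \<bar>a x p q i 0 th s\<bar> <= B"
  and cont_x: "!!th s p q. \<bar>s - s0\<bar> < r ==> continuous_on UNIV (%x. a x p q 0 0 th s)"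
  and cont_\<theta>: "!!x s p q. \<bar>s - s0\<bar> < r ==> continuous_on UNIV (%th. a x p q 0 0 th s)"
  and det_jet: "!!x th s. \<bar>s - s0\<bar> < r ==> det ((\<chi> p q. a x p q 0 0 th s) :: real^2^2) = 1"
  and mono_jet: "!!x th s w. \<bar>s - s0\<bar> < r ==>
  si * area ((\<chi> p q. a x p q 0 0 th s) *v w) ((\<chi> p q. a x p q 1 0 th s) *v w) \<ge> c * (norm w)\<^sup>2"
  and hz: "!!x p q v. \<bar>v - s0\<bar> < r ==> (%z. \<Phi> x p q z (of_real v)) holomorphic_on {z. \<bar>Im z\<bar> < r}"
  and hw: "!!x p q th y. \<bar>y\<bar> < r ==> (%w. \<Phi> x p q (Complex th y) w) holomorphic_on ball (of_real s0) r"
  and per: "!!x p q z w. \<Phi> x p q (z + 1) w = \<Phi> x p q z w"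
  and meas: "!!p q th y v. \<bar>y\<bar> < r ==> \<bar>v - s0\<bar> < r ==> (%x. \<Phi> x p q (Complex th y) (of_real v)) : borel_measurable \<mu>"
  and est: "!!x p q th y s w. \<bar>s - s0\<bar> < r ==> \<bar>y\<bar> < r ==> w : ball (of_real s0) r ==>
  norm (\<Phi> x p q (Complex th y) w - (of_real (a x p q 0 0 th s) + \<i> * of_real (y * a x p q 1 0 th s))) <= L * (y\<^sup>2 + norm (w - of_real s))"
begin

definition AM :: "nat => real => real => 'x => real^2^2" where
 "AM i th s x = (\<chi> p q. a x p q i 0 th s)"

definition Ps :: "complex => complex => 'x => complex^2^2" where
 "Ps z w x = (\<chi> p q. \<Phi> x p q z w)"

definition ka where "ka = c / (16 * (2 * B))"

lemma ka: "0 < ka" using c B by (simp add: ka_def)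

lemma C8: "1 <= 4 * (2 * B)" using B by simp

lemma AM:
 assumes "\<bar>s - s0\<bar> < r"
 shows "norm (AM 0 th s x) <= 2 * B" "norm (AM 1 th s x) <= 2 * B" "det (AM 0 th s x) = 1"
  "si * area (AM 0 th s x *v w) (AM 1 th s x *v w) \<ge> c * (norm w)\<^sup>2"
 using bd[OF _ assms] det_jet[OF assms] mono_jet[OF assms]
 by (auto simp: AM_def intro!: norm_mat_le)

lemma Ps_good:
 assumes s: "\<bar>s - s0\<bar> < r" and y: "0 <= y" "y < r" "y <= c / (32 * (2 * B)\<^sup>2)" and w: "w : ball (of_real s0) r"
  and small: "2 * (L * (y\<^sup>2 + norm (w - of_real s))) <= ka * y"
 shows "good (4 * (2 * B)) (Ps (Complex th (si * y)) w x)"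
proof -
 have ay: "\<bar>si * y\<bar> = y" using si y by (simp add: abs_mult)
 have sy: "(si * y)\<^sup>2 = y\<^sup>2" using ay y by (metis power2_abs)
 define E where "E = Ps (Complex th (si * y)) w x - tilt (AM 0 th s x) (si * y) (AM 1 th s x)"
 have "norm (E $ p $ q) <= L * (y\<^sup>2 + norm (w - of_real s))" for p q
  using est[OF s _ w, of "si * y" x p q th] ay y sy by (simp add: E_def Ps_def tilt_def AM_def)
 from norm_mat_le[OF this] have nE: "norm E <= c / (16 * (2 * B)) * y" using small unfolding ka_def by linarith
 have B1: "1 <= 2 * B" using B by simp
 have z: "norm (0 :: real^2^2) <= c / (32 * (2 * B)\<^sup>2)" using c by simp
 have "good (4 * (2 * B)) (tilt (AM 0 th s x + 0) (si * y) (AM 1 th s x) + E)"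
  by (rule good_perturbation[OF AM(1,2)[OF s] B1 AM(3)[OF s] si AM(4)[OF s] c z y(1,3) nE])
 then show ?thesis unfolding E_def by (simp only: add_0_right add_diff_eq add_diff_cancel_left')
qed

lemma Ps_level:
 assumes v: "\<bar>v - s0\<bar> < r" and y: "0 <= y" "y < r" "y <= c / (32 * (2 * B)\<^sup>2)" and small: "2 * (L * y) <= ka"
 shows "level Ps (4 * (2 * B)) (si * y) v"
 unfolding level_def
proof (intro conjI allI)
 have ay: "\<bar>si * y\<bar> < r" using si y by (simp add: abs_mult)
 have vb: "of_real v : ball (complex_of_real s0) r"
  using v by (simp add: dist_norm norm_minus_commute flip: of_real_diff)
 have "2 * (L * y) * y <= ka * y" using small y by (intro mult_right_mono) auto
 then have "2 * (L * (y\<^sup>2 + norm (of_real v - complex_of_real v))) <= ka * y" by (simp add: power2_eq_square mult_ac)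
 then show "good (4 * (2 * B)) (Ps (Complex th (si * y)) (of_real v) x)" for th x by (rule Ps_good[OF v y vb])
 show "(%x. Ps (Complex th (si * y)) (of_real v) x $ p $ q) : borel_measurable \<mu>" for th p q
  unfolding Ps_def vec_lambda_beta by (rule meas[OF ay v])
 fix x p q
 have c2: "continuous_on UNIV (%th. Complex th (si * y))" unfolding complex_eq by (intro continuous_intros)
 have "continuous_on UNIV (%th. \<Phi> x p q (Complex th (si * y)) (of_real v))"
  by (rule continuous_on_compose2[OF holomorphic_on_imp_continuous_on[OF hz[OF v]] c2]) (use ay in auto)
 then show "continuous_on UNIV (%th. Ps (Complex th (si * y)) (of_real v) x $ p $ q)" unfolding Ps_def vec_lambda_beta .
qed

text \<open>The height \<open>t\<close> and the radius \<open>R\<close> are chosen so that the first-order error stays below the cone gain: \<open>L y \<le> ka / 4\<close> for \<open>y \<le> 2 t\<close>, and \<open>L R \<le> ka t / 4\<close>.\<close>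

theorem mean_exponent_anl: "\<exists>rh>0. EX M. anl rh M (%s. LINT th:{0..1}|lborel. lyapunov f \<mu> (AM 0 th s)) s0"
proof -
 define t where "t = min (r / 4) (min (ka / (8 * L)) (c / (64 * (2 * B)\<^sup>2)))"
 define R where "R = min (r / 2) (ka * t / (4 * L))"
 have B2: "0 < (2 * B)\<^sup>2" using B by simp
 have t: "0 < t" using r ka L c B2 by (simp add: t_def)
 have tr: "2 * t < r" using r by (simp add: t_def min_def)
 have "t <= ka / (8 * L)" by (simp add: t_def)
 then have tL: "8 * L * t <= ka" using L by (simp add: le_divide_eq mult_ac)
 have "t <= c / (64 * (2 * B)\<^sup>2)" by (simp add: t_def)
 then have tc: "2 * t <= c / (32 * (2 * B)\<^sup>2)" by simp
 have "R <= r / 2" by (simp add: R_def)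
 then have R: "0 < R" "R < r" using r ka L t by (simp_all add: R_def)
 have "R <= ka * t / (4 * L)" by (simp add: R_def)
 then have RL: "4 * L * R <= ka * t" using L by (simp add: le_divide_eq mult_ac)
 have Ly: "L * y <= L * (2 * t)" if "y <= 2 * t" for y using that L by (intro mult_left_mono) auto
 have lev: "level Ps (4 * (2 * B)) (si * y) v" if "0 <= y" "y <= 2 * t" "\<bar>v - s0\<bar> < r" for y v
  by (rule Ps_level[OF that(3,1)]) (use that tr tc tL Ly[OF that(2)] ka in linarith)+
 have disc: "good (4 * (2 * B)) (Ps (Complex th (si * y)) w x)" if y: "t <= y" "y <= 2 * t" and w: "w : ball (of_real s0) R" for th y w x
 proof (rule Ps_good[where s = s0])
  have nw: "norm (w - of_real s0) <= R" using w by (simp add: dist_norm norm_minus_commute)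
  have "4 * L * y <= ka" using Ly[OF y(2)] tL by linarith
  then have 1: "4 * L * y * y <= ka * y" using y t by (intro mult_right_mono) auto
  have "L * norm (w - of_real s0) <= L * R" using nw L by (intro mult_left_mono) auto
  moreover have "ka * t <= ka * y" using y ka by (intro mult_left_mono) auto
  ultimately have "4 * (L * norm (w - of_real s0)) <= ka * y" using RL by linarith
  with 1 show "2 * (L * (y\<^sup>2 + norm (w - of_real s0))) <= ka * y"
  by (simp add: distrib_left power2_eq_square mult.assoc)
 qed (use r y t tr tc w R in auto)
 have hol: "(%w. Ps (Complex th (si * y)) w x $ i $ j) holomorphic_on ball (of_real s0) R" if "t <= y" "y <= 2 * t" for th y x i j
 proof -
  have "\<bar>si * y\<bar> < r" using si that t tr by (simp add: abs_mult)
  from hw[OF this] show ?thesis unfolding Ps_def vec_lambda_beta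
  using R by (rule_tac holomorphic_on_subset) auto
 qed
 define Lam where "Lam = ln (4 * (2 * B)) + ln 4"
 have d: "anl (R / 2) (9 * Lam) (HH Ps n (si * y)) s0" if y: "t <= y" "y <= 2 * t" for n y
  unfolding Lam_def
 proof (rule HH_anl[where \<Phi> = Ps, OF hol[OF y] disc[OF y] C8 R(1)])
  show "level Ps (4 * (2 * B)) (si * y) v" if "\<bar>v - s0\<bar> < R" for v by (rule lev) (use that y t R in auto)
 qed
 have refl: "HH Ps n 0 v = 2 * HH Ps n (si * t) v - HH Ps n (si * (2 * t)) v" if v: "\<bar>v - s0\<bar> < r" for n v
 proof (rule HH_reflection[where de = r and C = "4 * (2 * B)"])
  show "(%z. Ps z (of_real v) x $ i $ j) holomorphic_on {z. \<bar>Im z\<bar> < r}" for x i j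
  unfolding Ps_def vec_lambda_beta by (rule hz[OF v])
  show "Ps (z + 1) (of_real v) x = Ps z (of_real v) x" for z x unfolding Ps_def per ..
  show "level Ps (4 * (2 * B)) (si * y) v" if "0 <= y" "y <= 2 * t" for y by (rule lev[OF that v])
 qed (use C8 si t tr in auto)
 have tt: "t <= t" "t <= 2 * t" "2 * t <= 2 * t" using t by simp_all
 have an: "anl (R / 2) (27 * Lam) (HH Ps n 0) s0" for n
 proof -
  have "anl (R / 2) (\<bar>2\<bar> * (9 * Lam) + \<bar>- 1\<bar> * (9 * Lam)) (%v. 2 * HH Ps n (si * t) v + (- 1) * HH Ps n (si * (2 * t)) v) s0"
  by (rule anl_lincomb[OF d[OF tt(1,2)] d[OF tt(2,3)]])
  then have "anl (R / 2) (27 * Lam) (%v. 2 * HH Ps n (si * t) v + (- 1) * HH Ps n (si * (2 * t)) v) s0" by simp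
  then show ?thesis
  proof (rule anl_cong)
  fix v assume "\<bar>v - s0\<bar> < R / 2"
  then have "\<bar>v - s0\<bar> < r" using R by linarith
  from refl[OF this] show "2 * HH Ps n (si * t) v + (- 1) * HH Ps n (si * (2 * t)) v = HH Ps n 0 v" by simp
  qed
 qed
 have "anl (R / 2) (27 * Lam) (%s. LINT th:{0..1}|lborel. lyapunov f \<mu> (AM 0 th s)) s0"
 proof (rule anl_limit[OF an])
  fix v assume "\<bar>v - s0\<bar> < R / 2"
  then have v: "\<bar>v - s0\<bar> < r" using R by linarith
  have "Ps (Complex th 0) (of_real v) x = cmat (AM 0 th v x)" for th x
  proof -
  have vb: "of_real v : ball (complex_of_real s0) r"
  using v by (simp add: dist_norm norm_minus_commute flip: of_real_diff)
  have "norm (\<Phi> x p q (Complex th 0) (of_real v) - of_real (a x p q 0 0 th v)) <= 0" for p q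
  using est[OF v _ vb, of 0 x p q th] r by simp
  then show ?thesis by (simp add: vec_eq_iff Ps_def cmat_def AM_def)
  qed
  then have "HH Ps n 0 v = (\<integral>p. (1 / real n) * ln (norm (Dn (%k. cmat (AM 0 (fst p) v ((f ^^ k) (snd p)))) n)) \<partial>(circ \<Otimes>\<^sub>M \<mu>))" for n
  unfolding HH_def LL_def by simp
  moreover have "(%n. \<integral>p. (1 / real n) * ln (norm (Dn (%k. cmat (AM 0 (fst p) v ((f ^^ k) (snd p)))) n)) \<partial>(circ \<Otimes>\<^sub>M \<mu>)) \<longlonglongrightarrow> (LINT th:{0..1}|lborel. lyapunov f \<mu> (AM 0 th v))"
  by (rule mean_lyapunov_as_limit[where B = "2 * B"])
  (use AM[OF v] B in \<open>auto simp: AM_def[abs_def] intro!: continuous_on_vec_lambda cont_x[OF v] cont_\<theta>[OF v]\<close>)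
  ultimately show "(%n. HH Ps n 0 v) \<longlonglongrightarrow> (LINT th:{0..1}|lborel. lyapunov f \<mu> (AM 0 th v))" by simp
 qed (use R in simp)
 then show ?thesis using R(1) by (intro exI[of _ "R / 2"]) auto
qed

end

lemma (in mpt) mean_exponent_analytic_family:
 fixes A :: "real => real => 'x => real^2^2"
 assumes I: "open I" and cont: "!!th s. s : I ==> continuous_on UNIV (A th s)"
  and det: "!!th s x. s : I ==> det (A th s x) = 1"
  and per: "!!th s x. s : I ==> A (th + 1) s x = A th s x"
  and mono: "!!s. s : I ==> monotonic_family (%th. A th s)"
  and C: "!!n x. C_nat_on n (UNIV \<times> I) (%(th, s). A th s x)"
  and bd: "!!V. compact V ==> V <= UNIV \<times> I ==> EX M R. 0 <= M & 1 <= R \<and>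
  (ALL x. ALL bs:lists Basis. ALL z:V. norm (iter_deriv bs (%(th, s). A th s x) z) <= M * R ^ length bs * fact (length bs))"
 shows "real_analytic_on I (%s. LINT th:{0..1}|lborel. lyapunov f \<mu> (A th s))"
proof (rule anl_imp_real_analytic)
 fix s0 assume s0: "s0 : I"
 define F where "F x = (%(th, s). A th s x)" for x
 define a where "a x p q i l th s = iter_deriv (word i l) (F x) (th, s) $ p $ q" for x p q i l th s
 have CF: "C_nat_on n (UNIV \<times> I) (F x)" for n x using C by (simp add: F_def)
 have perF: "F x (th + 1, s) = F x (th, s)" if "s : I" for x th s using per[OF that] by (simp add: F_def)
 have a0: "(\<chi> p q. a x p q 0 0 th s) = A th s x" for x th s by (simp add: a_def F_def vec_eq_iff)
 show "\<exists>rh>0. EX M. anl rh M (%s. LINT th:{0..1}|lborel. lyapunov f \<mu> (A th s)) s0"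
 proof (rule iter_deriv_bounds_periodic[OF I s0 perF])
  fix de assume de: "0 < de" "{s0 - de..s0 + de} <= I" "compact ({0..1} \<times> {s0 - de..s0 + de} :: (real \<times> real) set)"
  and ext: "!!n x bs th s m. C_nat_on n (UNIV \<times> I) (F x) ==> bs : lists Basis ==> length bs <= n ==> \<bar>s - s0\<bar> <= de ==>
  (!!z. z : {0..1} \<times> {s0 - de..s0 + de} ==> norm (iter_deriv bs (F x) z) <= m) ==> norm (iter_deriv bs (F x) (th, s)) <= m"
  have "{0..1} \<times> {s0 - de..s0 + de} <= UNIV \<times> I" using de(2) by blast
  from bd[OF de(3) this] obtain M R where MR: "0 <= M" "1 <= R" "!!x bs z. bs : lists Basis ==> z : {0..1} \<times> {s0 - de..s0 + de} ==>
  norm (iter_deriv bs (F x) z) <= M * R ^ length bs * fact (length bs)" unfolding F_def by blast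
  have aB: "\<bar>a x p q i l th s\<bar> <= M * R ^ (i + l) * fact (i + l)" if "\<bar>s - s0\<bar> <= de" for x p q i l th s
  proof -
  have "norm (iter_deriv (word i l) (F x) (th, s)) <= M * R ^ (i + l) * fact (i + l)"
  by (rule ext[OF CF _ order_refl that]) (use MR(3)[of "word i l"] in simp_all)
  then show ?thesis using entry_le_norm[of "iter_deriv (word i l) (F x) (th, s)" p q] by (simp add: a_def)
  qed
  define B where "B = 1 + M * R ^ 2 * 2"
  have B: "1 <= B" using MR by (simp add: B_def)
  have aB2: "\<bar>a x p q i l th s\<bar> <= B" if "i + l <= 2" "\<bar>s - s0\<bar> <= de" for x p q i l th s
  proof -
  have "fact (i + l) <= (fact 2 :: real)" by (rule fact_mono[OF that(1)])
  then have "M * R ^ (i + l) * fact (i + l) <= M * R ^ 2 * 2" using MR that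
  by (intro mult_mono mult_left_mono power_increasing) auto
  then show ?thesis using aB[OF that(2), of x p q i l th] by (simp add: B_def)
  qed
  have jets: "jets_on K {s0 - de..s0 + de} (a x p q)" for K x p q
  unfolding a_def[abs_def] by (rule jets_of_C_nat_on[OF CF I perF de(2)])
  have "monotonic_family (%th x. (\<chi> p q. a x p q 0 0 th s0) :: real^2^2)" unfolding a0 by (rule mono[OF s0])
  from monotone_strip[OF jets[of 2] order_refl de(1) B aB2 _ this]
  obtain si c rh where rh: "\<bar>si\<bar> = 1" "0 < c" "c <= 1" "0 < rh" "rh <= de"
  and mn: "!!x th s w. \<bar>s - s0\<bar> <= rh ==> c * (norm w)\<^sup>2 <= si * area ((\<chi> p q. a x p q 0 0 th s) *v w) ((\<chi> p q. a x p q 1 0 th s) *v w)"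
  using a0 det[OF s0] by auto
  define r0 where "r0 = min rh (1 / (8 * R))"
  have r0: "0 < r0" "r0 <= rh" "8 * R * r0 <= 1"
  proof -
  have "r0 <= 1 / (8 * R)" by (simp add: r0_def)
  then show "8 * R * r0 <= 1" using MR by (simp add: le_divide_eq mult_ac)
  qed (use rh MR in \<open>auto simp: r0_def\<close>)
  have sI: "\<bar>s - s0\<bar> <= rh" "\<bar>s - s0\<bar> <= de" "s : I" if "\<bar>s - s0\<bar> <= r0" for s
  proof -
  show "\<bar>s - s0\<bar> <= rh" using that r0 by simp
  then show 1: "\<bar>s - s0\<bar> <= de" using rh by simp
  then have "s : {s0 - de..s0 + de}" by (auto simp: abs_le_iff)
  then show "s : I" using de(2) by blast
  qed
  have sub: "{s0 - r0..s0 + r0} <= I"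
  proof
  fix s assume "s : {s0 - r0..s0 + r0}"
  then have "\<bar>s - s0\<bar> <= r0" by (auto simp: abs_le_iff)
  then show "s : I" by (rule sI(3))
  qed
  have jets': "jets_on K {s0 - r0..s0 + r0} (a x p q)" for K x p q
  unfolding a_def[abs_def] by (rule jets_of_C_nat_on[OF CF I perF sub])
  have aj: "analytic_jets (a x p q) M R s0 r0" for x p q
  by unfold_locales (use jets' aB sI MR r0 in auto)
  have oU: "open (UNIV \<times> I :: (real \<times> real) set)" using I by (intro open_Times) auto
  have entry: "bounded_linear (%M :: real^2^2. M $ p $ q)" for p q
  using bounded_linear_compose[OF bounded_linear_vec_nth bounded_linear_vec_nth] .
  have am: "(%x. complex_of_real (a x p q i l th s0)) : borel_measurable \<mu>" for p q i l th
  proof -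
  have "(%x. iter_deriv (word i l) (F x) (th, s0)) : borel_measurable \<mu>"
  proof (rule iter_deriv_measurable[OF CF[of "i + l"] oU])
  show "(%x. F x z) : borel_measurable \<mu>" if "z : UNIV \<times> I" for z
  using that meas_cont[OF cont] by (auto simp: F_def)
  qed (use s0 in auto)
  then show ?thesis unfolding a_def
  by (rule measurable_compose[OF _ borel_measurable_continuous_onI[OF continuous_on_of_real[OF linear_continuous_on[OF entry]]]])
  qed
  define \<Phi> where "\<Phi> x p q = analytic_jets.strip_ext (a x p q) s0" for x p q
  define r where "r = r0 / 2"
  have r: "0 < r" "r <= r0" using r0 by (simp_all add: r_def)
  have L: "0 < 8 * M * R\<^sup>2 + M * R + 1" using MR by (intro add_nonneg_pos) auto
  interpret analytic_family f \<mu> a B c si s0 r "8 * M * R\<^sup>2 + M * R + 1" \<Phi>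
  proof (rule analytic_family.intro[OF mpt_axioms], rule analytic_family_axioms.intro)
  show "1 <= B" "0 < c" "c <= 1" "\<bar>si\<bar> = 1" "0 < r" "0 < 8 * M * R\<^sup>2 + M * R + 1" using B rh r L by auto
  fix s assume s: "\<bar>s - s0\<bar> < r"
  then have s': "\<bar>s - s0\<bar> <= r0" using r by linarith
  show "\<bar>a x p q i 0 th s\<bar> <= B" if "i <= 1" for x p q i th using aB2[of i 0 s] that sI[OF s'] by simp
  show "continuous_on UNIV (%x. a x p q 0 0 th s)" for th p q
  unfolding a_def using bounded_linear.continuous_on[OF entry cont[OF sI(3)[OF s']]] by (simp add: F_def)
  show "continuous_on UNIV (%th. a x p q 0 0 th s)" for x p q
  proof -
  have "s : {s0 - r0..s0 + r0}" using s' by (auto simp: abs_le_iff)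
  then have "isCont (%th. a x p q 0 0 th s) y" for y
  by (intro DERIV_isCont[OF jets_onD(2)[OF jets'[of 1]]]) simp_all
  then show ?thesis by (intro continuous_at_imp_continuous_on ballI)
  qed
  show "det ((\<chi> p q. a x p q 0 0 th s) :: real^2^2) = 1" for x th unfolding a0 by (rule det[OF sI(3)[OF s']])
  show "c * (norm w)\<^sup>2 <= si * area ((\<chi> p q. a x p q 0 0 th s) *v w) ((\<chi> p q. a x p q 1 0 th s) *v w)" for x th w
  by (rule mn[OF sI(1)[OF s']])
  have ns: "norm (of_real s - complex_of_real s0) <= r0" using s' by (simp flip: of_real_diff)
  show "(%z. \<Phi> x p q z (of_real s)) holomorphic_on {z. \<bar>Im z\<bar> < r}" for x p q
  unfolding \<Phi>_def by (rule holomorphic_on_subset[OF analytic_jets.strip_ext_holomorphic(1)[OF aj ns]]) (use r in auto)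
  show "(%x. \<Phi> x p q (Complex th y) (of_real s)) : borel_measurable \<mu>" if y: "\<bar>y\<bar> < r" for p q th y
  proof (rule borel_measurable_LIMSEQ_metric)
  show "(%x. tpoly K (%i l. a x p q i l th s0) (Complex th y - of_real th) (of_real s - of_real s0)) : borel_measurable \<mu>" for K
  unfolding tpoly_def by (intro borel_measurable_divide borel_measurable_sum borel_measurable_times borel_measurable_const am)
  have "Complex th y - of_real th = \<i> * of_real y" by (simp add: complex_eq_iff)
  then have "norm (Complex th y - of_real th) <= r0" using y r by (simp add: norm_mult)
  then show "(%K. tpoly K (%i l. a x p q i l th s0) (Complex th y - of_real th) (of_real s - of_real s0)) \<longlonglongrightarrow> \<Phi> x p q (Complex th y) (of_real s)" for x
  using analytic_jets.ext_limit(1)[OF aj _ _ ns order_refl, of "Complex th y" th] r0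
  by (simp add: \<Phi>_def analytic_jets.strip_ext_def[OF aj])
  qed
  show "norm (\<Phi> x p q (Complex th y) w - (of_real (a x p q 0 0 th s) + \<i> * of_real (y * a x p q 1 0 th s))) <= (8 * M * R\<^sup>2 + M * R + 1) * (y\<^sup>2 + norm (w - of_real s))"
  if y: "\<bar>y\<bar> < r" and w: "w : ball (of_real s0) r" for x p q th y w
  proof -
  have w0: "norm (w - of_real s0) < r" using w by (simp add: dist_norm norm_minus_commute)
  have "norm (of_real s0 - complex_of_real s) < r" using s by (simp add: abs_minus_commute flip: of_real_diff)
  then have "norm (w - of_real s) <= r0" using norm_triangle_ineq[of "w - of_real s0" "of_real s0 - of_real s"] w0 by (simp add: r_def)
  moreover have "\<bar>y\<bar> <= r0" "norm (w - of_real s0) <= r0" using y w0 r by linarith+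
  ultimately have "norm (\<Phi> x p q (Complex th y) w - (of_real (a x p q 0 0 th s) + \<i> * of_real (y * a x p q 1 0 th s))) <= (8 * M * R\<^sup>2 + M * R) * (y\<^sup>2 + norm (w - of_real s))"
  unfolding \<Phi>_def using analytic_jets.strip_ext_estimate[OF aj s'] by blast
  also have "... <= (8 * M * R\<^sup>2 + M * R + 1) * (y\<^sup>2 + norm (w - of_real s))" by (intro mult_right_mono) auto
  finally show ?thesis .
  qed
  next
  show "(%w. \<Phi> x p q (Complex th y) w) holomorphic_on ball (of_real s0) r" if "\<bar>y\<bar> < r" for x p q th y
  unfolding \<Phi>_def by (rule holomorphic_on_subset[OF analytic_jets.strip_ext_holomorphic(2)[OF aj]]) (use r that in auto)
  show "\<Phi> x p q (z + 1) w = \<Phi> x p q z w" for x p q z w unfolding \<Phi>_def by (rule analytic_jets.strip_ext_periodic[OF aj])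
  qed
  show ?thesis using mean_exponent_anl unfolding AM_def a0 .
 qed
qed

section \<open>The three regularity classes\<close>

lemma seminorm_topology_topspace: "topspace (seminorm_topology P S) <= S"
 unfolding seminorm_topology_def topology_generated_by_topspace by auto

theorem theorem2p2:
  fixes f :: "'x::metric_space \<Rightarrow> 'x"
    and \<mu> :: "'x measure"
    and A :: "real \<Rightarrow> real \<Rightarrow> 'x \<Rightarrow> real^2^2"
    and I :: "real set"
  assumes "compact (UNIV :: 'x set)"
    and "\<exists>g. homeomorphism UNIV UNIV f g"
    and "prob_space \<mu>" and "sets \<mu> = sets borel"
    and "distr \<mu> \<mu> f = \<mu>"
    and "\<And>U. open U \<Longrightarrow> U \<noteq> {} \<Longrightarrow> emeasure \<mu> U > 0"
    and "open I" and "is_interval I"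
    and "\<And>\<theta> s. s \<in> I \<Longrightarrow> continuous_on UNIV (A \<theta> s)"
    and "\<And>\<theta> s x. s \<in> I \<Longrightarrow> A \<theta> s x \<in> SL2"
    and "\<And>\<theta> s x. s \<in> I \<Longrightarrow> A (\<theta> + 1) s x = A \<theta> s x"
    and "\<And>s. s \<in> I \<Longrightarrow> monotonic_family (\<lambda>\<theta>. A \<theta> s)"
  shows "(\<forall>(r::nat) (\<epsilon>::real). r \<ge> 1 \<longrightarrow> \<epsilon> > 0 \<longrightarrow>
            regular_family (C_real (2 * real r + 1 + \<epsilon>)) I A \<longrightarrow>
            C_nat_on r I (\<lambda>s. LINT \<theta>:{0..1}|lborel. lyapunov f \<mu> (A \<theta> s))) \<and>
         (regular_family C_inf I A \<longrightarrow>
            class_on C_inf I (\<lambda>s. LINT \<theta>:{0..1}|lborel. lyapunov f \<mu> (A \<theta> s))) \<and>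
         (regular_family C_omega I A \<longrightarrow>
            class_on C_omega I (\<lambda>s. LINT \<theta>:{0..1}|lborel. lyapunov f \<mu> (A \<theta> s)))"
proof -
  obtain g where "homeomorphism UNIV UNIV f g" using assms(2) by blast
  then have cf: "continuous_on UNIV f" by (rule homeomorphism_cont1)
  interpret mpt f \<mu> by (rule mpt.intro[OF assms(3,4,5) cf])
  let ?F = "\<lambda>x. (\<lambda>(\<theta>, s). A \<theta> s x)"
  let ?U = "UNIV \<times> I :: (real \<times> real) set"
  let ?G = "\<lambda>s. LINT \<theta>:{0..1}|lborel. lyapunov f \<mu> (A \<theta> s)"
  have oU: "open ?U" using assms(7) by (intro open_Times) auto
  have det: "det (A \<theta> s x) = 1" if "s \<in> I" for \<theta> s x using assms(10)[OF that] by (simp add: SL2_def)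
  have finite_order: "C_nat_on r I ?G"
    if fam: "regular_family cl I A" and cls: "\<And>F. F \<in> SL2_functions cl I \<Longrightarrow> C_nat_on (r + 2) ?U F"
      and sn: "\<And>bs V. bs \<in> lists Basis \<Longrightarrow> length bs \<le> r + 2 \<Longrightarrow> compact V \<Longrightarrow> V \<subseteq> ?U \<Longrightarrow> (sup_seminorm bs V :: (real \<times> real \<Rightarrow> real^2^2) \<Rightarrow> ennreal) \<in> class_seminorms cl ?U" for cl r
  proof -
    obtain \<K> where K: "compactin (seminorm_topology (class_seminorms cl ?U) (SL2_functions cl I)) \<K>" "\<And>x. ?F x \<in> \<K>"
      using fam unfolding regular_family_def by blast
    have sub: "\<K> \<subseteq> SL2_functions cl I"
      using compactin_subset_topspace[OF K(1)] seminorm_topology_topspace by blast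
    show ?thesis
    proof (rule mean_exponent_C_nat_family[OF assms(7,9) det assms(11,12) _ _ refl])
      show "C_nat_on (r + 2) ?U (?F x)" for x by (rule cls) (use sub K(2) in blast)
      fix bs :: "(real \<times> real) list" and V
      assume h: "bs \<in> lists Basis" "length bs \<le> r + 2" "compact V" "V \<subseteq> ?U"
      show "\<exists>M. \<forall>x. \<forall>z\<in>V. norm (iter_deriv bs (?F x) z) \<le> M"
      proof (rule sup_seminorm_bounded[OF K(1) sn[OF h] h(3,4) oU h(1,2) cls])
        fix M assume "\<And>F z. F \<in> \<K> \<Longrightarrow> z \<in> V \<Longrightarrow> norm (iter_deriv bs F z) \<le> M"
        then show ?thesis using K(2) by blast
      qed
    qed
  qed
  show ?thesis
  proof (intro conjI allI impI)
    fix r :: nat and \<epsilon> :: real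
    assume r: "1 \<le> r" "0 < \<epsilon>" and fam: "regular_family (C_real (2 * real r + 1 + \<epsilon>)) I A"
    let ?k = "2 * real r + 1 + \<epsilon>"
    have "real_of_int (int (2 * r + 1)) \<le> ?k" using r(2) by simp
    then have "int (2 * r + 1) \<le> \<lfloor>?k\<rfloor>" by (simp only: le_floor_iff)
    from nat_mono[OF this] have "2 * r + 1 \<le> nat \<lfloor>?k\<rfloor>" by (simp only: nat_int)
    moreover have "r + 2 \<le> 2 * r + 1" using r(1) by simp
    ultimately have k: "r + 2 \<le> nat \<lfloor>?k\<rfloor>" by (rule order_trans[rotated])
    show "C_nat_on r I ?G"
    proof (rule finite_order[OF fam])
      show "C_nat_on (r + 2) ?U F" if "F \<in> SL2_functions (C_real ?k) I" for F
      proof -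
        have "class_on (C_real ?k) ?U F" using that unfolding SL2_functions_def mem_Collect_eq by (rule conjunct1)
        then have "C_nat_on (nat \<lfloor>?k\<rfloor>) ?U F" unfolding class_on.simps by (rule conjunct1)
        then show ?thesis by (rule C_nat_on_mono[OF _ k])
      qed
      show "(sup_seminorm bs V :: (real \<times> real \<Rightarrow> real^2^2) \<Rightarrow> ennreal) \<in> class_seminorms (C_real ?k) ?U"
        if "bs \<in> lists Basis" "length bs \<le> r + 2" "compact V" "V \<subseteq> ?U" for bs V
        unfolding class_seminorms.simps by (intro UnI1 CollectI exI[of _ bs] exI[of _ V] conjI refl that(1,3,4) order_trans[OF that(2) k])
    qed
  next
    assume fam: "regular_family C_inf I A"
    have "C_nat_on r I ?G" for r
    proof (rule finite_order[OF fam])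
      show "C_nat_on (r + 2) ?U F" if "F \<in> SL2_functions C_inf I" for F
        using that by (auto simp: SL2_functions_def)
      show "(sup_seminorm bs V :: (real \<times> real \<Rightarrow> real^2^2) \<Rightarrow> ennreal) \<in> class_seminorms C_inf ?U"
        if "bs \<in> lists Basis" "length bs \<le> r + 2" "compact V" "V \<subseteq> ?U" for bs V
        unfolding class_seminorms.simps using that by (intro CollectI exI[of _ bs] exI[of _ V]) simp
    qed
    then show "class_on C_inf I ?G" by simp
  next
    assume fam: "regular_family C_omega I A"
    obtain \<K> where K: "compactin (seminorm_topology (class_seminorms C_omega ?U) (SL2_functions C_omega I)) \<K>" "\<And>x. ?F x \<in> \<K>"
      using fam unfolding regular_family_def by blast
    have an: "real_analytic_on ?U F" if "F \<in> SL2_functions C_omega I" for F using that by (simp add: SL2_functions_def)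
    have sub: "\<K> \<subseteq> SL2_functions C_omega I"
      using compactin_subset_topspace[OF K(1)] seminorm_topology_topspace by blast
    have "real_analytic_on I ?G"
    proof (rule mean_exponent_analytic_family[OF assms(7,9) det assms(11,12)])
      show "C_nat_on n ?U (?F x)" for n x by (rule real_analytic_C_nat[OF an]) (use sub K(2) in blast)
      fix V assume V: "compact V" "V \<subseteq> ?U"
      have "\<exists>M R. 0 \<le> M \<and> 1 \<le> R \<and> (\<forall>F\<in>\<K>. \<forall>bs\<in>lists Basis. \<forall>z\<in>V. norm (iter_deriv bs F z) \<le> M * R ^ length bs * fact (length bs))"
      proof (rule analytic_seminorm_uniform[OF K(1) _ V oU an])
        show "(analytic_seminorm d V :: (real \<times> real \<Rightarrow> real^2^2) \<Rightarrow> ennreal) \<in> class_seminorms C_omega ?U" if "\<And>n. 0 \<le> d n" "(\<lambda>n. root n (d n)) \<longlonglongrightarrow> 0" for d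
          unfolding class_seminorms.simps using that V by (intro CollectI exI[of _ d] exI[of _ V]) simp
      qed
      then show "\<exists>M R. 0 \<le> M \<and> 1 \<le> R \<and> (\<forall>x. \<forall>bs\<in>lists Basis. \<forall>z\<in>V. norm (iter_deriv bs (?F x) z) \<le> M * R ^ length bs * fact (length bs))"
        using K(2) by blast
    qed
    then show "class_on C_omega I ?G" by simp
  qed
qed

end
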